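(* Let $U,V$ be real Banach spaces and let $\mathfrak{F}\in\mathcal{C}^{\omega}(\mathbb{R}\times U,V)$ be an analytic map such that: (F1) $\mathfrak{F}(\lambda,0)=0$ for all $\lambda\in\mathbb{R}$; (F2) $D_u\mathfrak{F}(\lambda,u)\in\Phi_0(U,V)$ for all $(\lambda,u)\in\mathbb{R}\times U$; (F3) with $\mathfrak{L}(\lambda):=D_u\mathfrak{F}(\lambda,0)$, $0\in\Sigma(\mathfrak{L})$ is an isolated eigenvalue with $N[\mathfrak{L}(0)]=\mathrm{span}[\varphi_0]$ for some $\varphi_0\in U\setminus\{0\}$; (F4) $\mathfrak{F}$ is proper on closed and bounded subsets of $\mathbb{R}\times U$. Suppose that there exists an analytic injective curve $\gamma:(0,1)\to\mathbb{R}\times U$ such that $\gamma((0,1))\subset\mathfrak{F}^{-1}(0)\setminus\mathcal{T}$, $\lim_{t\downarrow0}\gamma(t)=(0,0)$, and $\gamma((0,1))\subset\mathcal{R}(\mathfrak{F})$. Then there exists a locally injective continuous path $\Gamma:[0,\infty)\to\mathbb{R}\times U$ with $\Gamma([0,\infty))\subset\mathfrak{F}^{-1}(0)$, for which there exists $0<\delta<1$ with $\Gamma(t)=\gamma(t)$ for all $t\in(0,\delta)$. Moreover, $\Gamma$ satisfies one of the following non-excluding alternatives: (a) $\lim_{t\uparrow\infty}\|\Gamma(t)\|_{\mathbb{R}\times U}=+\infty$. (b) $\Gamma$ is a closed loop, i.e. there exists $T>0$ such that $\Gamma(T)=(0,0)$. In particular, when the associated Weierstrass polynomial $p(\lambda,z)$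 is irreducible, every analytic curve of $\mathfrak{F}^{-1}(0)$ emanating from $(0,0)$ can be extended to a locally injective continuous path $\Gamma:[0,+\infty)\to\mathbb{R}\times U$ in $\mathfrak{F}^{-1}(0)$ satisfying one of these alternatives.
   Context: $\Phi_0(U,V)$: bounded linear Fredholm operators of index zero; $\Sigma(\mathfrak{L})=\{\lambda:\mathfrak{L}(\lambda)\notin GL(U,V)\}$. $\mathcal{T}=\{(\lambda,0):\lambda\in\mathbb{R}\}$. $\mathcal{R}(\mathfrak{F})$ is the set of regular points: $(\lambda,u)\in\mathfrak{F}^{-1}(0)$ with $D_u\mathfrak{F}(\lambda,u)\in GL(U,V)$. Weierstrass polynomial: choose $\varphi_0^*\in U^*$ with $\langle\varphi_0,\varphi_0^*\rangle=1$, $P(u)=\langle u,\varphi_0^*\rangle\varphi_0$, a continuous projection $Q$ of $V$ onto $R[\mathfrak{L}(0)]$, $Y=N[P]$, and a linear isomorphism $S:N[Q]\to\mathbb{R}$. By the implicit function theorem there is an analytic $\mathcal{Y}$, defined near $(0,0)$ in $\mathbb{R}\times N[\mathfrak{L}(0)]$ with values in $Y$, $\mathcal{Y}(0,0)=0$, solving $Q\mathfrak{F}(\lambda,x+\mathcal{Y}(\lambda,x))=0$. Put $\mathfrak{G}(\lambda,z):=S(I_V-Q)\mathfrak{F}(\lambda,z\varphi_0+\mathcal{Y}(\lambda,z\varphi_0))=zg(\lambda,z)$, with $g$ analytic and $\chi:=\mathrm{ord}_{\lambda=0}g(\lambda,0)\in[1,\infty)$. By the Weierstrass preparation theorem, on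 a neighbourhood $\mathscr{U}=\mathscr{U}_\lambda\times\mathscr{U}_z$ of $(0,0)$ in $\mathbb{R}^2$, $g=c\cdot p$ with $c$ analytic, $c(0,0)\neq0$, and $p(\lambda,z)=\lambda^\chi+c_{\chi-1}(z)\lambda^{\chi-1}+\cdots+c_0(z)$, $c_j$ analytic on $\mathscr{U}_z$, $c_j(0)=0$; $p$ is the Weierstrass polynomial. Irreducible means irreducible in $\mathcal{M}(\mathscr{U}_z)[\lambda]$, the polynomials in $\lambda$ with meromorphic coefficients in $z$. *)

theory Defs
  imports
    "HOL-Analysis.Analysis"
    "HOL-Algebra.UnivPoly"
    "HOL-Algebra.Divisibility"
begin

section \<open>Real analytic maps between normed spaces\<close>

text \<open>An \<open>n\<close>-linear map is a function on families \<open>v :: nat \<Rightarrow> 'a\<close> that only reads the entries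
  \<open>v 0, \<dots>, v (n - 1)\<close>; \<open>C\<close> is an upper bound of its norm.\<close>

definition sym_multilinear ::
    "nat \<Rightarrow> real \<Rightarrow> ((nat \<Rightarrow> 'a::real_normed_vector) \<Rightarrow> 'b::real_normed_vector) \<Rightarrow> bool" where
  "sym_multilinear n C m \<longleftrightarrow>
     (\<forall>v w. (\<forall>i<n. v i = w i) \<longrightarrow> m v = m w) \<and>
     (\<forall>v. \<forall>i<n. linear (\<lambda>x. m (v(i := x)))) \<and>
     (\<forall>v \<pi>. \<pi> permutes {..<n} \<longrightarrow> m (v \<circ> \<pi>) = m v) \<and>
     (\<forall>v. norm (m v) \<le> C * (\<Prod>i<n. norm (v i)))"

definition analytic_map_at ::
    "('a::real_normed_vector \<Rightarrow> 'b::real_normed_vector) \<Rightarrow> 'a \<Rightarrow> bool" where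
  "analytic_map_at f x \<longleftrightarrow>
     (\<exists>m C r. r > 0 \<and> (\<forall>n. sym_multilinear n (C n) (m n)) \<and>
        (\<exists>K. \<forall>n. C n * r ^ n \<le> K) \<and>
        (\<forall>h. norm h < r \<longrightarrow> (\<lambda>n. m n (\<lambda>_. h)) sums f (x + h)))"

definition analytic_map_on ::
    "('a::real_normed_vector \<Rightarrow> 'b::real_normed_vector) \<Rightarrow> 'a set \<Rightarrow> bool" where
  "analytic_map_on f A \<longleftrightarrow> (\<forall>x\<in>A. analytic_map_at f x)"


section \<open>Fredholm operators of index zero, spectrum\<close>

definition null_space :: "('a::real_vector \<Rightarrow> 'b::real_vector) \<Rightarrow> 'a set" where
  "null_space T = {x. T x = 0}"

text \<open>The dimension of the quotient by \<open>A\<close>: the least number of vectors that span the space modulo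
  \<open>A\<close>. Only meaningful if \<open>A\<close> has finite codimension.\<close>

definition codim :: "'a::real_vector set \<Rightarrow> nat" where
  "codim A = (LEAST n. \<exists>B. finite B \<and> card B = n \<and> span (A \<union> B) = UNIV)"

definition fredholm :: "('a::real_normed_vector \<Rightarrow> 'b::real_normed_vector) \<Rightarrow> bool" where
  "fredholm T \<longleftrightarrow> bounded_linear T \<and> (\<exists>B. finite B \<and> null_space T = span B) \<and>
     closed (range T) \<and> (\<exists>B. finite B \<and> span (range T \<union> B) = UNIV)"

definition fredholm_index :: "('a::real_normed_vector \<Rightarrow> 'b::real_normed_vector) \<Rightarrow> int" where
  "fredholm_index T = int (dim (null_space T)) - int (codim (range T))"

definition Phi0 :: "('a::real_normed_vector \<Rightarrow> 'b::real_normed_vector) set" where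
  "Phi0 = {T. fredholm T \<and> fredholm_index T = 0}"

definition GL :: "('a::real_normed_vector \<Rightarrow> 'b::real_normed_vector) set" where
  "GL = {T. bounded_linear T \<and> bij T \<and> bounded_linear (inv_into UNIV T)}"

definition spectrum_family ::
    "(real \<Rightarrow> 'a::real_normed_vector \<Rightarrow> 'b::real_normed_vector) \<Rightarrow> real set" where
  "spectrum_family L = {l. L l \<notin> GL}"


section \<open>The nonlinear problem\<close>

definition Du :: "(real \<times> 'u::real_normed_vector \<Rightarrow> 'v::real_normed_vector) \<Rightarrow>
    real \<Rightarrow> 'u \<Rightarrow> 'u \<Rightarrow> 'v" where
  "Du F l u = frechet_derivative (\<lambda>w. F (l, w)) (at u)"

definition linearization :: "(real \<times> 'u::real_normed_vector \<Rightarrow> 'v::real_normed_vector) \<Rightarrow>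
    real \<Rightarrow> 'u \<Rightarrow> 'v" where
  "linearization F l = Du F l 0"

definition zero_set :: "(real \<times> 'u \<Rightarrow> 'v::zero) \<Rightarrow> (real \<times> 'u) set" where
  "zero_set F = {x. F x = 0}"

definition trivial_line :: "(real \<times> 'u::zero) set" where
  "trivial_line = {(l, 0) |l. True}"

definition regular_points ::
    "(real \<times> 'u::real_normed_vector \<Rightarrow> 'v::real_normed_vector) \<Rightarrow> (real \<times> 'u) set" where
  "regular_points F = {(l, u). (l, u) \<in> zero_set F \<and> Du F l u \<in> GL}"

definition proper_on_closed_bounded :: "('a::metric_space \<Rightarrow> 'b::topological_space) \<Rightarrow> bool" where
  "proper_on_closed_bounded F \<longleftrightarrow>
     (\<forall>B K. closed B \<and> bounded B \<and> compact K \<longrightarrow> compact {x\<in>B. F x \<in> K})"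

definition locally_injective_on :: "('a::topological_space \<Rightarrow> 'b) \<Rightarrow> 'a set \<Rightarrow> bool" where
  "locally_injective_on f A \<longleftrightarrow> (\<forall>x\<in>A. \<exists>N. open N \<and> x \<in> N \<and> inj_on f (A \<inter> N))"

definition analytic_curve_from_origin ::
    "(real \<times> 'u::real_normed_vector \<Rightarrow> 'v::zero) \<Rightarrow> (real \<Rightarrow> real \<times> 'u) \<Rightarrow> bool" where
  "analytic_curve_from_origin F \<gamma> \<longleftrightarrow>
     analytic_map_on \<gamma> {0<..<1} \<and> inj_on \<gamma> {0<..<1} \<and>
     \<gamma> ` {0<..<1} \<subseteq> zero_set F \<and> (\<gamma> \<longlongrightarrow> (0, 0)) (at_right 0)"

definition global_extension :: "(real \<times> 'u::real_normed_vector \<Rightarrow> 'v::zero) \<Rightarrow>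
    (real \<Rightarrow> real \<times> 'u) \<Rightarrow> (real \<Rightarrow> real \<times> 'u) \<Rightarrow> bool" where
  "global_extension F \<gamma> \<Gamma> \<longleftrightarrow>
     continuous_on {0..} \<Gamma> \<and> locally_injective_on \<Gamma> {0..} \<and> \<Gamma> ` {0..} \<subseteq> zero_set F \<and>
     (\<exists>\<delta>. 0 < \<delta> \<and> \<delta> < 1 \<and> (\<forall>t\<in>{0<..<\<delta>}. \<Gamma> t = \<gamma> t)) \<and>
     (filterlim (\<lambda>t. norm (\<Gamma> t)) at_top at_top \<or> (\<exists>T>0. \<Gamma> T = (0, 0)))"


section \<open>Meromorphic functions of one real variable\<close>

definition real_meromorphic_on :: "(real \<Rightarrow> real) \<Rightarrow> real set \<Rightarrow> bool" where
  "real_meromorphic_on f J \<longleftrightarrow>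
     (\<forall>z\<in>J. \<exists>r>0. \<exists>a b. analytic_map_on a (ball z r) \<and> analytic_map_on b (ball z r) \<and>
        (\<forall>w\<in>ball z r - {z}. b w \<noteq> 0 \<and> f w = a w / b w))"

text \<open>Meromorphic functions on an open set \<open>J\<close> are identified when they agree off a discrete set. The
  normal form of a class is continuous where possible, and \<open>0\<close> at the poles and outside \<open>J\<close>.\<close>

definition mero_normal :: "real set \<Rightarrow> (real \<Rightarrow> real) \<Rightarrow> real \<Rightarrow> real" where
  "mero_normal J f z = (if z \<in> J \<and> (\<exists>l. (f \<longlongrightarrow> l) (at z)) then Lim (at z) f else 0)"

definition mero_ring :: "real set \<Rightarrow> (real \<Rightarrow> real) ring" where
  "mero_ring J =
     \<lparr> carrier = {f. real_meromorphic_on f J \<and> mero_normal J f = f},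
       mult = (\<lambda>f g. mero_normal J (\<lambda>z. f z * g z)),
       one = mero_normal J (\<lambda>z. 1),
       zero = (\<lambda>z. 0),
       add = (\<lambda>f g. mero_normal J (\<lambda>z. f z + g z)) \<rparr>"


section \<open>The Weierstrass polynomial\<close>

text \<open>The subspace \<open>N[L(0)] = span {\<phi>\<^sub>0}\<close> is given the coordinate \<open>z\<close> of \<open>x = z \<phi>\<^sub>0\<close>, and \<open>W\<close> is the
  domain of \<open>Y\<close> in the coordinates \<open>(\<lambda>, z)\<close>. Only the values of \<open>S\<close> on \<open>null_space Q\<close> matter, so that
  \<open>S\<close> can be taken linear on the whole space.\<close>

definition lyapunov_schmidt ::
    "(real \<times> 'u::real_normed_vector \<Rightarrow> 'v::real_normed_vector) \<Rightarrow> 'u \<Rightarrow>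
     ('u \<Rightarrow> real) \<Rightarrow> ('v \<Rightarrow> 'v) \<Rightarrow> ('v \<Rightarrow> real) \<Rightarrow> (real \<times> real) set \<Rightarrow> (real \<times> 'u \<Rightarrow> 'u) \<Rightarrow> bool" where
  "lyapunov_schmidt F \<phi>0 \<phi>s Q S W Y \<longleftrightarrow>
     bounded_linear \<phi>s \<and> \<phi>s \<phi>0 = 1 \<and>
     bounded_linear Q \<and> Q \<circ> Q = Q \<and> range Q = range (linearization F 0) \<and>
     linear S \<and> bij_betw S (null_space Q) UNIV \<and>
     open W \<and> (0, 0) \<in> W \<and>
     analytic_map_on (\<lambda>(l, z). Y (l, z *\<^sub>R \<phi>0)) W \<and>
     Y (0, 0) = 0 \<and>
     (\<forall>(l, z)\<in>W. Y (l, z *\<^sub>R \<phi>0) \<in> null_space (\<lambda>u. \<phi>s u *\<^sub>R \<phi>0) \<and>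
        Q (F (l, z *\<^sub>R \<phi>0 + Y (l, z *\<^sub>R \<phi>0))) = 0)"

definition reduced_map ::
    "(real \<times> 'u::real_normed_vector \<Rightarrow> 'v::real_normed_vector) \<Rightarrow> 'u \<Rightarrow>
     ('v \<Rightarrow> 'v) \<Rightarrow> ('v \<Rightarrow> real) \<Rightarrow> (real \<times> 'u \<Rightarrow> 'u) \<Rightarrow> real \<times> real \<Rightarrow> real" where
  "reduced_map F \<phi>0 Q S Y =
     (\<lambda>(l, z). let v = F (l, z *\<^sub>R \<phi>0 + Y (l, z *\<^sub>R \<phi>0)) in S (v - Q v))"

definition order_at_zero :: "(real \<Rightarrow> real) \<Rightarrow> nat \<Rightarrow> bool" where
  "order_at_zero f n \<longleftrightarrow> (\<forall>j<n. (deriv ^^ j) f 0 = 0) \<and> (deriv ^^ n) f 0 \<noteq> 0"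

text \<open>The Weierstrass polynomial is given by its degree \<open>d\<close> and its lower coefficients
  \<open>a 0, \<dots>, a (d - 1)\<close>, functions of \<open>z\<close>.\<close>

definition weierstrass_poly_fun :: "nat \<Rightarrow> (nat \<Rightarrow> real \<Rightarrow> real) \<Rightarrow> real \<Rightarrow> real \<Rightarrow> real" where
  "weierstrass_poly_fun d a l z = l ^ d + (\<Sum>j<d. a j z * l ^ j)"

definition weierstrass_polynomial ::
    "(real \<times> 'u::real_normed_vector \<Rightarrow> 'v::real_normed_vector) \<Rightarrow> 'u \<Rightarrow>
     real set \<Rightarrow> nat \<Rightarrow> (nat \<Rightarrow> real \<Rightarrow> real) \<Rightarrow> bool" where
  "weierstrass_polynomial F \<phi>0 Uz d a \<longleftrightarrow>
     (\<exists>\<phi>s Q S W Y g Ul c.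
        lyapunov_schmidt F \<phi>0 \<phi>s Q S W Y \<and>
        analytic_map_on g W \<and> (\<forall>(l, z)\<in>W. reduced_map F \<phi>0 Q S Y (l, z) = z * g (l, z)) \<and>
        order_at_zero (\<lambda>l. g (l, 0)) d \<and> d \<ge> 1 \<and>
        open Ul \<and> connected Ul \<and> 0 \<in> Ul \<and> open Uz \<and> connected Uz \<and> 0 \<in> Uz \<and> Ul \<times> Uz \<subseteq> W \<and>
        analytic_map_on c (Ul \<times> Uz) \<and> c (0, 0) \<noteq> 0 \<and>
        (\<forall>j<d. analytic_map_on (a j) Uz \<and> a j 0 = 0) \<and>
        (\<forall>l\<in>Ul. \<forall>z\<in>Uz. g (l, z) = c (l, z) * weierstrass_poly_fun d a l z))"

definition weierstrass_irreducible :: "real set \<Rightarrow> nat \<Rightarrow> (nat \<Rightarrow> real \<Rightarrow> real) \<Rightarrow> bool" where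
  "weierstrass_irreducible Uz d a \<longleftrightarrow>
     Divisibility.irreducible (UP (mero_ring Uz))
       (\<lambda>n. if n < d then mero_normal Uz (a n)
            else if n = d then \<one>\<^bsub>mero_ring Uz\<^esub> else \<zero>\<^bsub>mero_ring Uz\<^esub>)"

end

theory Submission
 imports Defs "HOL-Complex_Analysis.Complex_Analysis" "HOL-Library.FuncSet"
begin

text \<open>Every zero of \<open>F\<close> has a neighbourhood in which, by Lyapunov--Schmidt reduction, the zero set is
 homeomorphic to a real analytic set in some \<open>\<real>\<^sup>m\<close>: adding a finite rank operator to the Fredholm derivative
 makes it invertible, and the inverse function theorem is applied in the complexification, so that
 the reduced equations are holomorphic. A real analytic set has the following property at each of its
 points \<open>y\<close>: every point near \<open>y\<close> can be joined, inside the set and without meeting \<open>y\<close>, to an arc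
 that passes through \<open>y\<close> from one side to the other. It is proved by induction on the dimension,
 following the real roots of a discriminant along Puiseux parametrisations.

 In a set with this property whose bounded parts are compact, an arc never gets stuck: it can be
 prolonged past its end point unless the set contains a loop through which a locally injective closed
 path can be built. Prolonging greedily gives a path that leaves every bounded set, because at a finite
 limit point it could be prolonged by a definite amount. A second branch at the starting point is
 needed in order to turn around; here it is one half of the trivial line, and near the origin a curve
 of zeros either avoids that line or is contained in one half of it, because zeros near a point
 \<open>(\<lambda>, 0)\<close> with invertible linearization are trivial.\<close>

section \<open>Curve selection for real analytic sets\<close>

text \<open>Real roots alone are not governed by analytic equations. The number of distinct complex
  roots in a disc is: it is read off from the vanishing of holomorphic discriminants. Where it is
  constant the roots form a covering, and real paths lift by unique lifting and complex conjugation.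
  Hence the inductive statement speaks of a finite set of functions and asks that the zero pattern
  of all of them stay constant along path and arc: applied to discriminants, it supplies a base path
  over which roots can be followed. That the arc crosses from one side to the other comes from
  taking the ramification index \<open>N\<close> of a root minimal: \<open>\<sigma> ^ N\<close> is
  injective on the reals for odd \<open>N\<close>, and for even \<open>N\<close> the root takes
  different values at \<open>\<sigma>\<close> and \<open>- \<sigma>\<close>. In the global part only
  arcs that are injective as a whole are prolonged. Every return to such an arc, through a closing
  arc, a shortcut or a loop, is turned at once into a path that revisits the starting point, so that
  in the remaining case all of these are excluded.\<close>

lemma continuous_on_contour_integral_circlepath:
 fixes F :: "'a::topological_space \<Rightarrow> complex \<Rightarrow> complex"
 assumes "continuous_on (T \<times> sphere c r) (\<lambda>(t,z). F t z)" "0 < r"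
 shows "continuous_on T (\<lambda>t. contour_integral (circlepath c r) (F t))"
proof -
 have "continuous_on (T \<times> cbox 0 1)
   (\<lambda>(t,x). F t (circlepath c r x) * vector_derivative (circlepath c r) (at x))"
  unfolding split_beta vector_derivative_circlepath
  unfolding circlepath
  by (intro continuous_intros continuous_on_compose2[OF assms(1)[unfolded split_beta], of _ "\<lambda>x. (fst x, f (snd x))" for f, simplified])
   (use assms(2) in \<open>auto simp: dist_norm norm_mult\<close>)
 from integral_continuous_on_param[OF this]
 show ?thesis by (simp add: contour_integral_integral)
qed

text \<open>Morera's theorem: the integral over a triangle may be exchanged with the one over the
  circle, and for each fixed \<open>z\<close> on the circle the triangle integral of
  \<open>F w z\<close> vanishes by Cauchy's theorem.\<close>

lemma holomorphic_on_contour_integral_circlepath: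
 assumes cont: "continuous_on (T \<times> sphere c r) (\<lambda>(w,z). F w z)" and "0 < r" "open T"
  and hol: "\<And>z. z \<in> sphere c r ==> (\<lambda>w. F w z) holomorphic_on T"
 shows "(\<lambda>w. contour_integral (circlepath c r) (F w)) holomorphic_on T"
proof -
 let ?I = "\<lambda>w. contour_integral (circlepath c r) (F w)"
 have I: "continuous_on T ?I"
  by (rule continuous_on_contour_integral_circlepath[OF cont \<open>0 < r\<close>])
 have "?I analytic_on T"
 proof (rule Morera_triangle[OF I \<open>open T\<close>], intro impI)
  fix a b d assume abd: "convex hull {a,b,d} \<subseteq> T"
  have swap: "contour_integral (linepath p q) ?I =
    contour_integral (circlepath c r) (\<lambda>z. contour_integral (linepath p q) (\<lambda>w. F w z))"
   if "closed_segment p q \<subseteq> T" for p q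
  proof (rule contour_integral_swap)
   show "continuous_on (path_image (linepath p q) \<times> path_image (circlepath c r)) (\<lambda>(y1, y2). F y1 y2)"
    using that \<open>0 < r\<close> by (intro continuous_on_subset[OF cont]) auto
  qed (auto simp: vector_derivative_circlepath intro!: continuous_intros)
  have seg: "closed_segment a b \<subseteq> T" "closed_segment b d \<subseteq> T" "closed_segment d a \<subseteq> T"
   using abd by (auto simp: segment_convex_hull dest!: subsetD elim!: subsetD[OF hull_mono, rotated])
  have ci: "(\<lambda>z. contour_integral (linepath p q) (\<lambda>w. F w z)) contour_integrable_on circlepath c r"
   if "closed_segment p q \<subseteq> T" for p q
  proof -
   have c1: "continuous_on (sphere c r \<times> cbox 0 1) (\<lambda>(z,x). F (linepath p q x) z * (q - p))"
   proof -
    have "continuous_on (sphere c r \<times> {0..1}) (\<lambda>x. (linepath p q (snd x), fst x))"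
     unfolding linepath_def by (intro continuous_intros)
    moreover have "(\<lambda>x. (linepath p q (snd x), fst x)) ` (sphere c r \<times> {0..1}) \<subseteq> T \<times> sphere c r"
     using that linepath_in_path by fastforce
    ultimately have "continuous_on (sphere c r \<times> {0..1}) (\<lambda>x. F (linepath p q (snd x)) (fst x))"
     using continuous_on_compose2[OF cont[unfolded split_beta], of _ "\<lambda>x. (linepath p q (snd x), fst x)"] by simp
    then show ?thesis
     by (auto simp: split_beta intro!: continuous_intros)
   qed
   have "continuous_on (sphere c r) (\<lambda>z. contour_integral (linepath p q) (\<lambda>w. F w z))"
    using integral_continuous_on_param[OF c1] by (simp add: contour_integral_integral)
   then show ?thesis
    using \<open>0 < r\<close> by (intro contour_integrable_continuous_circlepath) auto
  qed
  have "contour_integral (linepath a b) ?I + contour_integral (linepath b d) ?I + contour_integral (linepath d a) ?I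
   = contour_integral (circlepath c r) (\<lambda>z. contour_integral (linepath a b) (\<lambda>w. F w z) +
     contour_integral (linepath b d) (\<lambda>w. F w z) + contour_integral (linepath d a) (\<lambda>w. F w z))"
   by (simp add: swap seg ci contour_integral_add contour_integrable_add)
  also have "\<dots> = contour_integral (circlepath c r) (\<lambda>z. 0)"
  proof (rule contour_integral_eq)
   fix z assume "z \<in> path_image (circlepath c r)"
   then have z: "z \<in> sphere c r" using \<open>0 < r\<close> by auto
   have h: "(\<lambda>w. F w z) holomorphic_on convex hull {a,b,d}"
    using hol[OF z] abd holomorphic_on_subset by blast
   show "contour_integral (linepath a b) (\<lambda>w. F w z) +
     contour_integral (linepath b d) (\<lambda>w. F w z) + contour_integral (linepath d a) (\<lambda>w. F w z) = 0"
    using Cauchy_theorem_triangle[OF h] has_chain_integral_chain_integral3 by blast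
  qed
  finally show "contour_integral (linepath a b) ?I + contour_integral (linepath b d) ?I + contour_integral (linepath d a) ?I = 0"
   by simp
 qed
 then show ?thesis by (rule analytic_imp_holomorphic)
qed

section \<open>Zeros of a family of holomorphic functions in a disc\<close>

text \<open>The roots that matter lie in the disc of radius \<open>\<rho>\<close>; \<open>nz\<close>
  keeps them from crossing its boundary as \<open>t\<close> varies, and the larger radius
  \<open>R\<close> leaves room for Cauchy's formula on a circle further out. The parameter space is
  merely metric, because it will be a complex disc, a half-plane, a real interval or a
  polydisc.\<close>

locale root_family =
 fixes T :: "'a::metric_space set" and f :: "'a \<Rightarrow> complex \<Rightarrow> complex" and \<rho> R :: real
 assumes \<rho>: "0 < \<rho>" "\<rho> < R"
  and cont: "continuous_on (T \<times> ball 0 R) (\<lambda>(t,z). f t z)"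
  and hol: "\<And>t. t \<in> T ==> f t holomorphic_on ball 0 R"
  and nz: "\<And>t z. t \<in> T ==> cmod z = \<rho> ==> f t z \<noteq> 0"
begin

definition rts :: "'a \<Rightarrow> complex set" where "rts t = {z. cmod z < \<rho> \<and> f t z = 0}"

text \<open>Symmetric in the roots counted with multiplicity, hence a contour integral that depends
  regularly on \<open>t\<close>, which neither a single root nor the number of distinct roots need
  do.\<close>

definition psum :: "nat \<Rightarrow> 'a \<Rightarrow> complex" where
 "psum a t = (\<Sum>p\<in>rts t. of_int (zorder (f t) p) * p ^ a)"

lemma not_const: "t \<in> T ==> \<exists>w\<in>ball 0 R. f t w \<noteq> 0"
 using nz[of t "of_real \<rho>"] \<rho> by (intro bexI[of _ "of_real \<rho>"]) auto

lemma finite_zeros: assumes "t \<in> T" "r < R" shows "finite {z\<in>cball 0 r. f t z = 0}"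
proof (cases "f t constant_on ball 0 R")
 case True
 then have "{z\<in>cball 0 r. f t z = 0} = {}"
  using not_const[OF assms(1)] assms(2) by (fastforce simp: constant_on_def)
 then show ?thesis by (metis finite.emptyI)
next
 case False
 then show ?thesis
  using assms by (intro holomorphic_compact_finite_zeros[OF hol]) auto
qed

lemma finite_rts: "t \<in> T ==> finite (rts t)"
 using finite_zeros[of t \<rho>] \<rho> by (auto simp: rts_def intro: finite_subset[rotated])

lemma zorder_pos: "t \<in> T ==> p \<in> rts t ==> zorder (f t) p > 0"
 using zorder_exist_zero[OF hol _ _ _ not_const, of t p] \<rho> by (auto simp: rts_def split: if_splits)

text \<open>The argument principle with the weight \<open>z ^ a\<close>. Zeros between the circle
  and the auxiliary radius \<open>r\<close> have winding number 0 and drop out.\<close>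

lemma psum_integral:
 assumes t: "t \<in> T"
 shows "contour_integral (circlepath 0 \<rho>) (\<lambda>z. deriv (f t) z * z ^ a / f t z) = 2 * pi * \<i> * psum a t"
proof -
 define r where "r = (\<rho> + R) / 2"
 have r: "\<rho> < r" "r < R" using \<rho> by (auto simp: r_def)
 let ?pz = "{w \<in> ball 0 r. f t w = 0 \<or> w \<in> {}}"
 have fin: "finite ?pz" using finite_zeros[OF t r(2)] by (rule finite_subset[rotated]) auto
 have "contour_integral (circlepath 0 \<rho>) (\<lambda>z. deriv (f t) z * z ^ a / f t z) =
   2 * pi * \<i> * (\<Sum>p\<in>?pz. winding_number (circlepath 0 \<rho>) p * p ^ a * of_int (zorder (f t) p))"
 proof (rule argument_principle)
  show "f t holomorphic_on ball 0 r - {}"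
   using hol[OF t] r by (auto intro: holomorphic_on_subset)
  show "path_image (circlepath 0 \<rho>) \<subseteq> ball 0 r - ?pz"
   using r \<rho> nz[OF t] by auto
  show "\<forall>z. z \<notin> ball 0 r --> winding_number (circlepath 0 \<rho>) z = 0"
   using r \<rho> by (auto intro!: winding_number_zero_outside[of _ "cball 0 \<rho>"] simp: dist_norm)
 qed (use fin in \<open>auto intro!: holomorphic_intros\<close>)
 also have "(\<Sum>p\<in>?pz. winding_number (circlepath 0 \<rho>) p * p ^ a * of_int (zorder (f t) p)) =
   (\<Sum>p\<in>rts t. winding_number (circlepath 0 \<rho>) p * p ^ a * of_int (zorder (f t) p))"
 proof (rule sum.mono_neutral_right[OF fin])
  show "rts t \<subseteq> ?pz" using r by (auto simp: rts_def)
  show "\<forall>p\<in>?pz - rts t. winding_number (circlepath 0 \<rho>) p * p ^ a * of_int (zorder (f t) p) = 0"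
  proof
   fix p assume p: "p \<in> ?pz - rts t"
   then have "cmod p \<noteq> \<rho>" using nz[OF t] by auto
   then have "p \<notin> cball 0 \<rho>" using p by (auto simp: rts_def)
   then have "winding_number (circlepath 0 \<rho>) p = 0"
    using \<rho> by (intro winding_number_zero_outside[of _ "cball 0 \<rho>"]) auto
   then show "winding_number (circlepath 0 \<rho>) p * p ^ a * of_int (zorder (f t) p) = 0" by simp
  qed
 qed
 also have "\<dots> = psum a t"
  unfolding psum_def by (intro sum.cong) (auto simp: rts_def winding_number_circlepath)
 finally show ?thesis .
qed

lemma deriv_formula:
 assumes t: "t \<in> T" and "0 < r" "r < R" "cmod z < r"
 shows "deriv (f t) z = contour_integral (circlepath 0 r) (\<lambda>u. f t u / (u - z)^2) / (2 * pi * \<i>)"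
proof -
 have "continuous_on (cball 0 r) (f t)"
  using hol[OF t] assms by (intro holomorphic_on_imp_continuous_on) (auto intro: holomorphic_on_subset)
 moreover have "f t holomorphic_on ball 0 r"
  using hol[OF t] assms by (auto intro: holomorphic_on_subset)
 ultimately show ?thesis
  using Cauchy_has_contour_integral_higher_derivative_circlepath[of 0 r "f t" z 1] assms
  by (auto dest!: contour_integral_unique simp: numeral_2_eq_2)
qed

text \<open>\<open>cont\<close> says nothing about derivatives; their joint continuity is read off
  from Cauchy's formula on an intermediate circle.\<close>

lemma deriv_cont: "continuous_on (T \<times> cball 0 \<rho>) (\<lambda>(t,z). deriv (f t) z)"
proof -
 define r where "r = (\<rho> + R) / 2"
 have r: "\<rho> < r" "r < R" "0 < r" using \<rho> by (auto simp: r_def)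
 have "continuous_on (T \<times> cball 0 \<rho>) (\<lambda>x. contour_integral (circlepath 0 r) (\<lambda>u. f (fst x) u / (u - snd x)^2))"
 proof (rule continuous_on_contour_integral_circlepath)
  show "continuous_on ((T \<times> cball 0 \<rho>) \<times> sphere 0 r) (\<lambda>(x, u). f (fst x) u / (u - snd x)\<^sup>2)"
   unfolding split_beta
   by (intro continuous_intros continuous_on_compose2[OF cont[unfolded split_beta], of _ "\<lambda>x. (fst (fst x), snd x)", simplified])
    (use r in auto)
 qed (use r in auto)
 then have "continuous_on (T \<times> cball 0 \<rho>) (\<lambda>x. contour_integral (circlepath 0 r) (\<lambda>u. f (fst x) u / (u - snd x)^2) / (2 * pi * \<i>))"
  by (intro continuous_intros) auto
 then show ?thesis
  by (rule continuous_on_eq) (use r in \<open>auto simp: deriv_formula\<close>)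
qed

lemma psum_cont: "continuous_on T (psum a)"
proof -
 have "continuous_on (T \<times> sphere 0 \<rho>) (\<lambda>(t,z). deriv (f t) z * z ^ a / f t z)"
  unfolding split_beta
  by (intro continuous_intros continuous_on_subset[OF deriv_cont[unfolded split_beta]]
    continuous_on_subset[OF cont[unfolded split_beta]])
   (use nz \<rho> in auto)
 from continuous_on_contour_integral_circlepath[OF this \<rho>(1)]
 have "continuous_on T (\<lambda>t. contour_integral (circlepath 0 \<rho>) (\<lambda>z. deriv (f t) z * z ^ a / f t z) / (2 * pi * \<i>))"
  by (intro continuous_intros) auto
 then show ?thesis by (rule continuous_on_eq) (simp add: psum_integral)
qed

text \<open>Multiplicities are at least 1. Since \<open>psum 0\<close> is continuous, this will
  bound the number of distinct roots uniformly near a parameter.\<close>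

lemma card_le_psum: assumes "t \<in> T" shows "real (card (rts t)) \<le> Re (psum 0 t)"
proof -
 have "real (card (rts t)) = (\<Sum>p\<in>rts t. 1)" by simp
 also have "\<dots> \<le> (\<Sum>p\<in>rts t. real_of_int (zorder (f t) p))"
  using zorder_pos[OF assms] by (intro sum_mono) force
 finally show ?thesis by (simp add: psum_def)
qed

end

text \<open>The parameter space carries no complex structure of its own, so holomorphy is tested
  along a map \<open>\<psi>\<close> from an open set of complex numbers.\<close>

lemma (in root_family) psum_holomorphic:
 fixes \<psi> :: "complex \<Rightarrow> 'a"
 assumes S: "open S" "\<psi> ` S \<subseteq> T" "continuous_on S \<psi>"
  and h: "\<And>z. z \<in> ball 0 R ==> (\<lambda>w. f (\<psi> w) z) holomorphic_on S"
 shows "(\<lambda>w. psum a (\<psi> w)) holomorphic_on S"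
proof -
 define r where "r = (\<rho> + R) / 2"
 have r: "\<rho> < r" "r < R" "0 < r" using \<rho> by (auto simp: r_def)
 have c: "continuous_on (S \<times> ball 0 R) (\<lambda>(w,z). f (\<psi> w) z)"
  unfolding split_beta
  by (intro continuous_on_compose2[OF cont[unfolded split_beta], of _ "\<lambda>x. (\<psi> (fst x), snd x)", simplified]
     continuous_intros continuous_on_compose2[OF S(3)]) (use S in auto)
 have dh: "(\<lambda>w. deriv (f (\<psi> w)) z) holomorphic_on S" if "z \<in> cball 0 \<rho>" for z
 proof -
  have "(\<lambda>w. contour_integral (circlepath 0 r) (\<lambda>u. f (\<psi> w) u / (u - z)^2) / (2 * pi * \<i>)) holomorphic_on S"
  proof (intro holomorphic_intros holomorphic_on_contour_integral_circlepath)
   show "continuous_on (S \<times> sphere 0 r) (\<lambda>(w, u). f (\<psi> w) u / (u - z)\<^sup>2)"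
    unfolding split_beta
    by (intro continuous_intros continuous_on_subset[OF c[unfolded split_beta]]) (use r that in auto)
  qed (use r S that h in \<open>auto intro!: holomorphic_intros\<close>)
  then show ?thesis
   by (rule holomorphic_transform) (use that r S in \<open>auto simp: deriv_formula image_subset_iff\<close>)
 qed
 have "(\<lambda>w. contour_integral (circlepath 0 \<rho>) (\<lambda>z. deriv (f (\<psi> w)) z * z ^ a / f (\<psi> w) z)) holomorphic_on S"
 proof (rule holomorphic_on_contour_integral_circlepath)
  have "continuous_on (S \<times> cball 0 \<rho>) (\<lambda>x. deriv (f (\<psi> (fst x))) (snd x))"
   by (intro continuous_on_compose2[OF deriv_cont[unfolded split_beta], of _ "\<lambda>x. (\<psi> (fst x), snd x)", simplified]
     continuous_intros continuous_on_compose2[OF S(3)]) (use S in auto)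
  then show "continuous_on (S \<times> sphere 0 \<rho>) (\<lambda>(w, z). deriv (f (\<psi> w)) z * z ^ a / f (\<psi> w) z)"
   unfolding split_beta
   by (intro continuous_intros continuous_on_subset[OF c[unfolded split_beta]])
    (use \<rho> nz S in \<open>auto elim: continuous_on_subset simp: image_subset_iff\<close>)
  show "(\<lambda>w. deriv (f (\<psi> w)) z * z ^ a / f (\<psi> w) z) holomorphic_on S" if "z \<in> sphere 0 \<rho>" for z
   using that \<rho> nz S(2) by (intro holomorphic_intros dh h) auto
 qed (use \<rho> S in auto)
 then have "(\<lambda>w. contour_integral (circlepath 0 \<rho>) (\<lambda>z. deriv (f (\<psi> w)) z * z ^ a / f (\<psi> w) z) / (2 * pi * \<i>)) holomorphic_on S"
  by (intro holomorphic_intros) auto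
 then show ?thesis
  by (rule holomorphic_transform) (use S in \<open>auto simp: psum_integral image_subset_iff\<close>)
qed

section \<open>Discriminants that count distinct roots\<close>

text \<open>Polynomials in \<open>k\<close> variables as lists of coefficients and exponents, the
  form in which a sum over tuples of roots splits term by term.\<close>

definition is_poly_fun :: "nat \<Rightarrow> ((nat \<Rightarrow> complex) \<Rightarrow> complex) \<Rightarrow> bool" where
 "is_poly_fun k q \<longleftrightarrow> (\<exists>L. \<forall>\<tau>. q \<tau> = (\<Sum>(c,\<alpha>)\<leftarrow>L. c * (\<Prod>i<k. \<tau> i ^ \<alpha> i)))"

lemma is_poly_fun_const: "is_poly_fun k (\<lambda>_. c)"
 unfolding is_poly_fun_def by (rule exI[of _ "[(c, \<lambda>_. 0)]"]) simp

lemma is_poly_fun_coord: assumes "i < k" shows "is_poly_fun k (\<lambda>\<tau>. \<tau> i)"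
proof -
 have "(\<Prod>j<k. \<tau> j ^ (if j = i then 1 else 0)) = \<tau> i" for \<tau> :: "nat \<Rightarrow> complex"
  using assms by (subst prod.mono_neutral_right[of _ "{i}"]) auto
 then show ?thesis
  unfolding is_poly_fun_def by (intro exI[of _ "[(1, \<lambda>j. if j = i then 1 else 0)]"]) simp
qed

lemma is_poly_fun_add: assumes "is_poly_fun k p" "is_poly_fun k q" shows "is_poly_fun k (\<lambda>\<tau>. p \<tau> + q \<tau>)"
proof -
 from assms obtain L M where "\<forall>\<tau>. p \<tau> = (\<Sum>(c,\<alpha>)\<leftarrow>L. c * (\<Prod>i<k. \<tau> i ^ \<alpha> i))"
  "\<forall>\<tau>. q \<tau> = (\<Sum>(c,\<alpha>)\<leftarrow>M. c * (\<Prod>i<k. \<tau> i ^ \<alpha> i))" unfolding is_poly_fun_def by auto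
 then show ?thesis unfolding is_poly_fun_def by (intro exI[of _ "L @ M"]) simp
qed

lemma is_poly_fun_mult_monom:
 assumes "is_poly_fun k q" shows "is_poly_fun k (\<lambda>\<tau>. c * (\<Prod>i<k. \<tau> i ^ \<alpha> i) * q \<tau>)"
proof -
 from assms obtain M where M: "\<forall>\<tau>. q \<tau> = (\<Sum>(c,\<alpha>)\<leftarrow>M. c * (\<Prod>i<k. \<tau> i ^ \<alpha> i))"
  unfolding is_poly_fun_def by auto
 have "c * (\<Prod>i<k. \<tau> i ^ \<alpha> i) * (\<Sum>(c,\<alpha>)\<leftarrow>M. c * (\<Prod>i<k. \<tau> i ^ \<alpha> i)) =
   (\<Sum>(c,\<alpha>)\<leftarrow>map (\<lambda>(d,\<beta>). (c * d, \<lambda>i. \<alpha> i + \<beta> i)) M. c * (\<Prod>i<k. \<tau> i ^ \<alpha> i))" for \<tau> :: "nat \<Rightarrow> complex"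
  by (induction M) (auto simp: algebra_simps power_add prod.distrib)
 then show ?thesis using M unfolding is_poly_fun_def
  by (intro exI[of _ "map (\<lambda>(d,\<beta>). (c * d, \<lambda>i. \<alpha> i + \<beta> i)) M"]) (simp only: simp_thms)
qed

lemma is_poly_fun_mult: assumes "is_poly_fun k p" "is_poly_fun k q" shows "is_poly_fun k (\<lambda>\<tau>. p \<tau> * q \<tau>)"
proof -
 from assms obtain L where L: "\<forall>\<tau>. p \<tau> = (\<Sum>(c,\<alpha>)\<leftarrow>L. c * (\<Prod>i<k. \<tau> i ^ \<alpha> i))"
  unfolding is_poly_fun_def by auto
 have "is_poly_fun k (\<lambda>\<tau>. (\<Sum>(c,\<alpha>)\<leftarrow>L. c * (\<Prod>i<k. \<tau> i ^ \<alpha> i)) * q \<tau>)"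
 proof (induction L)
  case Nil then show ?case using is_poly_fun_const[of k 0] by simp
 next
  case (Cons x L)
  obtain c \<alpha> where x: "x = (c,\<alpha>)" by (cases x)
  show ?case
   using is_poly_fun_add[OF is_poly_fun_mult_monom[OF assms(2), of c \<alpha>] Cons.IH]
   by (simp add: x algebra_simps)
 qed
 then show ?thesis using L by simp
qed

lemma is_poly_fun_prod:
 assumes "finite I" "\<And>i. i \<in> I ==> is_poly_fun k (q i)" shows "is_poly_fun k (\<lambda>\<tau>. \<Prod>i\<in>I. q i \<tau>)"
 using assms by (induction I rule: finite_induct) (auto simp: is_poly_fun_const intro!: is_poly_fun_mult)

lemma is_poly_fun_diff_prod: "is_poly_fun k (\<lambda>\<tau>. \<Prod>i<k. \<Prod>j\<in>{..<k}-{i}. \<tau> i - \<tau> j)"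
proof (intro is_poly_fun_prod)
 fix i j assume "i \<in> {..<k}" "j \<in> {..<k} - {i}"
 then have "is_poly_fun k (\<lambda>\<tau>. \<tau> i + (-1) * \<tau> j)"
  by (intro is_poly_fun_add is_poly_fun_mult is_poly_fun_const is_poly_fun_coord) auto
 then show "is_poly_fun k (\<lambda>\<tau>. \<tau> i - \<tau> j)" by simp
qed auto

context root_family begin

text \<open>Up to sign and a factor \<open>k!\<close> this is the Hankel determinant of the power
  sums. The product over ordered pairs is a squared Vandermonde product up to sign, so all orderings
  of a tuple contribute the same value and cannot cancel.\<close>

definition disc :: "nat \<Rightarrow> 'a \<Rightarrow> complex" where
 "disc k t = (\<Sum>\<tau>\<in>PiE {..<k} (\<lambda>_. rts t).
   (\<Prod>i<k. of_int (zorder (f t) (\<tau> i))) * (\<Prod>i<k. \<Prod>j\<in>{..<k}-{i}. \<tau> i - \<tau> j))"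

text \<open>The product of differences is expanded into monomials, and the weighted sum of a
  monomial over all tuples factorises into one power sum per slot. Thus discriminants inherit
  continuity and holomorphy from power sums.\<close>

lemma disc_eq_psum: "\<exists>L. \<forall>t\<in>T. disc k t = (\<Sum>(c,\<alpha>)\<leftarrow>L. c * (\<Prod>i<k. psum (\<alpha> i) t))"
proof -
 obtain L where L: "\<And>\<tau> :: nat \<Rightarrow> complex. (\<Prod>i<k. \<Prod>j\<in>{..<k}-{i}. \<tau> i - \<tau> j) = (\<Sum>(c,\<alpha>)\<leftarrow>L. c * (\<Prod>i<k. \<tau> i ^ \<alpha> i))"
  using is_poly_fun_diff_prod[of k] unfolding is_poly_fun_def by blast
 have "disc k t = (\<Sum>(c,\<alpha>)\<leftarrow>L. c * (\<Prod>i<k. psum (\<alpha> i) t))" if t: "t \<in> T" for t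
 proof -
  have "disc k t = (\<Sum>\<tau>\<in>PiE {..<k} (\<lambda>_. rts t). (\<Sum>(c,\<alpha>)\<leftarrow>L. c * (\<Prod>i<k. of_int (zorder (f t) (\<tau> i)) * \<tau> i ^ \<alpha> i)))"
   unfolding disc_def L
   by (intro sum.cong refl, induction L) (auto simp: algebra_simps prod.distrib)
  also have "\<dots> = (\<Sum>(c,\<alpha>)\<leftarrow>L. \<Sum>\<tau>\<in>PiE {..<k} (\<lambda>_. rts t). c * (\<Prod>i<k. of_int (zorder (f t) (\<tau> i)) * \<tau> i ^ \<alpha> i))"
   by (induction L) (auto simp: sum.distrib)
  also have "\<dots> = (\<Sum>(c,\<alpha>)\<leftarrow>L. c * (\<Prod>i<k. psum (\<alpha> i) t))"
   unfolding psum_def using finite_rts[OF t]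
   by (intro arg_cong[where f = sum_list] map_cong refl) (auto simp: prod_sum_PiE sum_distrib_left)
  finally show ?thesis .
 qed
 then show ?thesis by blast
qed

lemma disc_eq_0: assumes t: "t \<in> T" and "card (rts t) < k" shows "disc k t = 0"
 unfolding disc_def
proof (rule sum.neutral, intro ballI)
 fix \<tau> assume \<tau>: "\<tau> \<in> PiE {..<k} (\<lambda>_. rts t)"
 have "\<not> inj_on \<tau> {..<k}"
 proof
  assume "inj_on \<tau> {..<k}"
  then have "card {..<k} \<le> card (rts t)"
   using \<tau> finite_rts[OF t] by (intro card_inj_on_le[of \<tau>]) auto
  then show False using assms(2) by simp
 qed
 then obtain i j where "i < k" "j < k" "i \<noteq> j" "\<tau> i = \<tau> j" by (auto simp: inj_on_def)
 then have "(\<Prod>j\<in>{..<k}-{i}. \<tau> i - \<tau> j) = 0" by (intro prod_zero bexI[of _ j]) auto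
 with \<open>i < k\<close> have "(\<Prod>i<k. \<Prod>j\<in>{..<k}-{i}. \<tau> i - \<tau> j) = 0"
  by - (rule prod_zero[OF finite_lessThan], rule bexI[of _ i], simp_all only: lessThan_iff)
 then show "(\<Prod>i<k. of_int (zorder (f t) (\<tau> i))) * (\<Prod>i<k. \<Prod>j\<in>{..<k}-{i}. \<tau> i - \<tau> j) = 0" by simp
qed

text \<open>Only injective tuples contribute. Each of them enumerates all roots and contributes the
  same nonzero number \<open>W\<close>.\<close>

lemma disc_card: assumes t: "t \<in> T" shows "disc (card (rts t)) t \<noteq> 0"
proof -
 let ?R = "rts t" and ?e = "card (rts t)"
 define W :: complex where "W = (\<Prod>a\<in>?R. of_int (zorder (f t) a)) * (\<Prod>a\<in>?R. \<Prod>b\<in>?R-{a}. a - b)"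
 have fin: "finite ?R" by (rule finite_rts[OF t])
 have W: "W \<noteq> 0"
  unfolding W_def using fin zorder_pos[OF t] by fastforce
 let ?I = "{\<tau> \<in> PiE {..<?e} (\<lambda>_. ?R). inj_on \<tau> {..<?e}}"
 have finP: "finite (PiE {..<?e} (\<lambda>_. ?R))" using fin by (intro finite_PiE) auto
 have "disc ?e t = (\<Sum>\<tau>\<in>?I. (\<Prod>i<?e. of_int (zorder (f t) (\<tau> i))) * (\<Prod>i<?e. \<Prod>j\<in>{..<?e}-{i}. \<tau> i - \<tau> j))"
  unfolding disc_def
 proof (rule sum.mono_neutral_right[OF finP], blast, intro ballI)
  fix \<tau> assume \<tau>: "\<tau> \<in> PiE {..<?e} (\<lambda>_. rts t) - ?I"
  then obtain i j where "i < ?e" "j < ?e" "i \<noteq> j" "\<tau> i = \<tau> j" by (auto simp: inj_on_def)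
  then have "(\<Prod>j\<in>{..<?e}-{i}. \<tau> i - \<tau> j) = 0" by (intro prod_zero bexI[of _ j]) auto
 with \<open>i < ?e\<close> have "(\<Prod>i<?e. \<Prod>j\<in>{..<?e}-{i}. \<tau> i - \<tau> j) = 0"
  by - (rule prod_zero[OF finite_lessThan], rule bexI[of _ i], simp_all only: lessThan_iff)
  then show "(\<Prod>i<?e. of_int (zorder (f t) (\<tau> i))) * (\<Prod>i<?e. \<Prod>j\<in>{..<?e}-{i}. \<tau> i - \<tau> j) = 0" by simp
 qed
 also have "\<dots> = (\<Sum>\<tau>\<in>?I. W)"
 proof (rule sum.cong[OF refl])
  fix \<tau> assume \<tau>: "\<tau> \<in> ?I"
  then have inj: "inj_on \<tau> {..<?e}" and sub: "\<tau> ` {..<?e} \<subseteq> ?R" by auto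
  then have im: "\<tau> ` {..<?e} = ?R"
   using fin by (intro card_subset_eq) (auto simp: card_image)
  have 1: "(\<Prod>j\<in>{..<?e}-{i}. \<tau> i - \<tau> j) = (\<Prod>b\<in>?R-{\<tau> i}. \<tau> i - b)" if "i < ?e" for i
  proof -
   have "\<tau> ` ({..<?e}-{i}) = ?R - {\<tau> i}"
    using im inj that by (auto simp: inj_on_def)
   moreover have "inj_on \<tau> ({..<?e}-{i})" using inj by (rule inj_on_subset) auto
   ultimately show ?thesis
    using prod.reindex_bij_betw[of \<tau> "{..<?e}-{i}" "?R - {\<tau> i}" "\<lambda>b. \<tau> i - b"] by (simp add: bij_betw_def)
  qed
  have bij: "bij_betw \<tau> {..<?e} ?R" using inj im by (simp add: bij_betw_def)
  show "(\<Prod>i<?e. of_int (zorder (f t) (\<tau> i))) * (\<Prod>i<?e. \<Prod>j\<in>{..<?e}-{i}. \<tau> i - \<tau> j) = W"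
   unfolding W_def
   using prod.reindex_bij_betw[OF bij, of "\<lambda>a. of_int (zorder (f t) a) :: complex"]
    prod.reindex_bij_betw[OF bij, of "\<lambda>a. \<Prod>b\<in>?R-{a}. a - b"] by (simp add: 1)
 qed
 also have "\<dots> = of_nat (card ?I) * W" by simp
 finally have eq: "disc ?e t = of_nat (card ?I) * W" .
 obtain h where h: "bij_betw h {..<?e} ?R" using ex_bij_betw_nat_finite[OF fin] by (auto simp: atLeast0LessThan)
 have "restrict h {..<?e} \<in> PiE {..<?e} (\<lambda>_. ?R)"
  using bij_betwE[OF h] by (simp add: restrict_PiE_iff)
 moreover have "inj_on (restrict h {..<?e}) {..<?e}"
  using bij_betw_imp_inj_on[OF h] by (simp only: inj_on_restrict_eq)
 ultimately have "?I \<noteq> {}" by blast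
 moreover have "finite ?I" by (rule finite_subset[OF _ finP]) blast
 ultimately have "card ?I \<noteq> 0" by (simp only: card_0_eq not_False_eq_True)
 then show ?thesis using eq W by simp
qed

text \<open>The number of distinct roots is the largest index with a nonvanishing
  discriminant.\<close>

lemma card_rts_eqI:
 assumes "t \<in> T" and "\<And>k. k > e ==> disc k t = 0" "disc e t \<noteq> 0" shows "card (rts t) = e"
 using disc_card[OF assms(1)] disc_eq_0[OF assms(1)] assms(2,3) by (metis linorder_neqE_nat)

text \<open>A Hurwitz argument by the maximum principle: without a zero near \<open>z0\<close>,
  \<open>1 / f t\<close> would be holomorphic on a small disc, at most \<open>3/(2*\<mu>)\<close> on
  its boundary and at least \<open>3/\<mu>\<close> at the centre.\<close>

lemma roots_persist:
 assumes t0: "t0 \<in> T" and z0: "z0 \<in> rts t0" and \<epsilon>: "0 < \<epsilon>"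
 shows "\<exists>d>0. \<forall>t\<in>T. dist t t0 < d --> (\<exists>u\<in>rts t. dist u z0 < \<epsilon>)"
proof -
 let ?Z = "{z\<in>cball 0 \<rho>. f t0 z = 0}"
 have finZ: "finite ?Z" using finite_zeros[OF t0] \<rho> by auto
 obtain \<kappa>0 where \<kappa>0: "\<kappa>0 > 0" "\<forall>z\<in>?Z - {z0}. \<kappa>0 \<le> dist z0 z"
  using finite_set_avoid[OF finZ] by blast
 have "cmod z0 < \<rho>" "f t0 z0 = 0" using z0 by (auto simp: rts_def)
 \<comment> \<open>Small enough that the closed disc around \<open>z0\<close> contains no further
   zero of \<open>f t0\<close>, lies inside the disc of radius \<open>\<rho>\<close> and stays
   within \<open>\<epsilon>\<close> of \<open>z0\<close>.\<close>
 define \<kappa> where "\<kappa> = min (min (\<kappa>0/2) (\<epsilon>/2)) ((\<rho> - cmod z0)/2)"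
 have \<kappa>: "0 < \<kappa>" "\<kappa> < \<kappa>0" "\<kappa> < \<epsilon>" "cmod z0 + \<kappa> < \<rho>"
  using \<kappa>0 \<epsilon> \<open>cmod z0 < \<rho>\<close> by (auto simp: \<kappa>_def min_def field_simps)
 have sub: "cball z0 \<kappa> \<subseteq> ball 0 \<rho>"
 proof
  fix u assume "u \<in> cball z0 \<kappa>"
  then show "u \<in> ball 0 \<rho>" using \<kappa>(4) norm_triangle_ineq2[of u z0] by (auto simp: dist_norm norm_minus_commute)
 qed
 have nzs: "f t0 u \<noteq> 0" if "u \<in> sphere z0 \<kappa>" for u
 proof
  assume "f t0 u = 0"
  moreover have "u \<in> cball 0 \<rho>" using that sub by force
  moreover have "u \<noteq> z0" using that \<kappa> by auto
  ultimately have "\<kappa>0 \<le> dist z0 u" using \<kappa>0 by auto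
  then show False using that \<kappa> by auto
 qed
 have conts: "continuous_on (sphere z0 \<kappa>) (f t0)"
  using hol[OF t0] sub \<rho> by (intro holomorphic_on_imp_continuous_on) (auto intro!: holomorphic_on_subset[of _ "ball 0 R"])
 have "\<exists>\<mu>>0. \<forall>u\<in>sphere z0 \<kappa>. \<mu> \<le> cmod (f t0 u)"
 proof -
  have "sphere z0 \<kappa> \<noteq> {}" using \<kappa> by simp
  then obtain u where "u \<in> sphere z0 \<kappa>" "\<forall>v\<in>sphere z0 \<kappa>. cmod (f t0 u) \<le> cmod (f t0 v)"
   using continuous_attains_inf[of "sphere z0 \<kappa>" "\<lambda>u. cmod (f t0 u)"] continuous_on_norm[OF conts] by auto
  then show ?thesis using nzs by (intro exI[of _ "cmod (f t0 u)"]) auto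
 qed
 then obtain \<mu> where \<mu>: "0 < \<mu>" "\<And>u. u \<in> sphere z0 \<kappa> ==> \<mu> \<le> cmod (f t0 u)" by blast
 have "continuous_on (T \<times> cball z0 \<kappa>) (\<lambda>(t,z). f t z)"
  using sub \<rho> by (intro continuous_on_subset[OF cont]) auto
 from continuous_on_prod_compactE[OF this compact_cball t0, of "\<mu>/3"]
 obtain X where X: "t0 \<in> X" "open X" "\<forall>t\<in>X\<inter>T. \<forall>u\<in>cball z0 \<kappa>. dist (f t u) (f t0 u) \<le> \<mu>/3"
  using \<mu> by auto
 from X(1,2) obtain d where d: "0 < d" "ball t0 d \<subseteq> X" by (auto simp: open_contains_ball)
 show ?thesis
 proof (intro exI[of _ d] conjI ballI impI)
  fix t assume t: "t \<in> T" "dist t t0 < d"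
  then have tX: "t \<in> X \<inter> T" using d by (auto simp: dist_commute)
  show "\<exists>u\<in>rts t. dist u z0 < \<epsilon>"
  proof (rule ccontr)
   assume no: "\<not> (\<exists>u\<in>rts t. dist u z0 < \<epsilon>)"
   have nzt: "f t u \<noteq> 0" if "u \<in> cball z0 \<kappa>" for u
    using no that sub \<kappa> by (force simp: rts_def dist_commute)
   have "cmod (1 / f t z0) \<le> 3/(2*\<mu>)"
   proof (rule maximum_modulus_frontier[where S = "cball z0 \<kappa>" and f = "\<lambda>u. 1 / f t u"])
    have ht: "f t holomorphic_on cball z0 \<kappa>"
     using hol[OF t(1)] sub \<rho> by (auto intro!: holomorphic_on_subset[of _ "ball 0 R"])
    show "(\<lambda>u. 1 / f t u) holomorphic_on interior (cball z0 \<kappa>)"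
     using nzt by (intro holomorphic_intros holomorphic_on_subset[OF ht]) auto
    show "continuous_on (closure (cball z0 \<kappa>)) (\<lambda>u. 1 / f t u)"
     using nzt holomorphic_on_imp_continuous_on[OF ht] by (intro continuous_intros) auto
    fix u assume "u \<in> frontier (cball z0 \<kappa>)"
    then have u: "u \<in> sphere z0 \<kappa>" using \<kappa> by (simp add: frontier_cball)
    then have "cmod (f t u - f t0 u) \<le> \<mu>/3" using X(3) tX by (auto simp: dist_norm)
    then have "cmod (f t u) \<ge> 2*\<mu>/3" using \<mu>(2)[OF u] norm_triangle_ineq2[of "f t0 u" "f t u"]
     by (simp add: norm_minus_commute)
    then have "1 / cmod (f t u) \<le> 1 / (2*\<mu>/3)" using \<mu> by (intro divide_left_mono mult_pos_pos) auto
    then show "cmod (1 / f t u) \<le> 3/(2*\<mu>)" by (simp add: norm_divide)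
   qed (use \<kappa> in auto)
   moreover have "cmod (f t z0) \<le> \<mu>/3"
    using X(3)[rule_format, OF tX, of z0] \<kappa> \<open>f t0 z0 = 0\<close> by (simp add: dist_norm)
   moreover have "f t z0 \<noteq> 0" using nzt \<kappa> by auto
   ultimately show False using \<mu> by (simp add: norm_divide field_simps)
  qed
 qed (use d in auto)
qed

text \<open>What remains of the closed disc after the \<open>\<epsilon>\<close>-discs around the
  roots are removed is compact, so \<open>f t0\<close> is bounded away from 0 there, and nearby
  functions differ from it by at most a third of that bound.\<close>

lemma roots_stay:
 assumes t0: "t0 \<in> T" and \<epsilon>: "0 < \<epsilon>"
 shows "\<exists>d>0. \<forall>t\<in>T. dist t t0 < d --> (\<forall>u\<in>rts t. \<exists>z\<in>rts t0. dist u z < \<epsilon>)"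
proof -
 let ?K = "cball 0 \<rho> - (\<Union>z\<in>rts t0. ball z \<epsilon>)"
 have K: "compact ?K" by (intro compact_diff compact_cball open_UN) auto
 have nzK: "f t0 u \<noteq> 0" if "u \<in> ?K" for u
  using that nz[OF t0, of u] \<epsilon> by (force simp: rts_def)
 have "\<exists>\<mu>>0. \<forall>u\<in>?K. \<mu> \<le> cmod (f t0 u)"
 proof (cases "?K = {}")
  case True then show ?thesis by (intro exI[of _ 1]) (metis empty_iff zero_less_one)
 next
  case False
  have "continuous_on ?K (f t0)"
   using hol[OF t0] \<rho> by (intro holomorphic_on_imp_continuous_on) (auto intro!: holomorphic_on_subset[of _ "ball 0 R"])
  then obtain u where "u \<in> ?K" "\<forall>v\<in>?K. cmod (f t0 u) \<le> cmod (f t0 v)"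
   using continuous_attains_inf[OF K False continuous_on_norm] by blast
  then show ?thesis using nzK[of u] by (intro exI[of _ "cmod (f t0 u)"]) auto
 qed
 then obtain \<mu> where \<mu>: "0 < \<mu>" "\<And>u. u \<in> ?K ==> \<mu> \<le> cmod (f t0 u)" by blast
 have "continuous_on (T \<times> ?K) (\<lambda>(t,z). f t z)"
  using \<rho> by (intro continuous_on_subset[OF cont]) auto
 from continuous_on_prod_compactE[OF this K t0, of "\<mu>/3"]
 obtain X where X: "t0 \<in> X" "open X" "\<forall>t\<in>X\<inter>T. \<forall>u\<in>?K. dist (f t u) (f t0 u) \<le> \<mu>/3"
  using \<mu> by auto
 from X(1,2) obtain d where d: "0 < d" "ball t0 d \<subseteq> X" by (auto simp: open_contains_ball)
 show ?thesis
 proof (intro exI[of _ d] conjI ballI impI)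
  fix t u assume t: "t \<in> T" "dist t t0 < d" and u: "u \<in> rts t"
  then have tX: "t \<in> X \<inter> T" using d by (auto simp: dist_commute)
  have "u \<notin> ?K"
  proof
   assume uK: "u \<in> ?K"
   then have "cmod (f t0 u) \<le> \<mu>/3" using X(3) tX u by (force simp: rts_def dist_norm)
   then show False using \<mu>(2)[OF uK] \<mu>(1) by simp
  qed
  then show "\<exists>z\<in>rts t0. dist u z < \<epsilon>" using u by (auto simp: rts_def dist_commute)
 qed (use d in auto)
qed

text \<open>Both sums carry the multiplicity as a factor, which cancels. This is how an isolated
  root is seen to be holomorphic.\<close>

lemma root_of_psum_ratio:
 assumes "t \<in> T" "rts t = {z}" shows "psum 1 t / psum 0 t = z"
 using zorder_pos[OF assms(1), of z] by (simp add: psum_def assms(2))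

end

section \<open>Coverings by roots when their number is constant\<close>

locale root_family_const = root_family T f \<rho> R
 for T :: "'a::real_normed_vector set" and f \<rho> R +
 fixes e :: nat
 assumes card_rts: "\<And>t. t \<in> T ==> card (rts t) = e"
begin

lemma isolating_radius:
 assumes "t0 \<in> T"
 shows "\<exists>\<kappa>>0. \<forall>z\<in>rts t0. \<forall>z'\<in>rts t0. z \<noteq> z' --> 2 * \<kappa> < dist z z'"
proof -
 let ?D = "(\<lambda>(z,z'). dist z z') ` (rts t0 \<times> rts t0 - Id)"
 have fin: "finite ?D" using finite_rts[OF assms] by auto
 show ?thesis
 proof (cases "?D = {}")
  case True then show ?thesis by (intro exI[of _ 1]) auto
 next
  case False
  have "Min ?D > 0" using fin False by (subst Min_gr_iff) auto
  moreover have "Min ?D \<le> dist z z'" if "z \<in> rts t0" "z' \<in> rts t0" "z \<noteq> z'" for z z'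
   using that by (intro Min_le[OF fin]) force
  ultimately show ?thesis by (intro exI[of _ "Min ?D / 3"]) force
 qed
qed

text \<open>Each root disc contains at least one root for nearby parameters, and there are exactly as many
 roots as discs; hence exactly one.\<close>

lemma unique_root_nearby:
 assumes t0: "t0 \<in> T" and \<epsilon>: "0 < \<epsilon>"
 obtains d \<kappa> where "0 < d" "0 < \<kappa>" "\<kappa> < \<epsilon>"
  "\<forall>z\<in>rts t0. \<forall>z'\<in>rts t0. z \<noteq> z' --> 2 * \<kappa> < dist z z'"
  "\<And>t u. t \<in> T ==> dist t t0 < d ==> u \<in> rts t ==> \<exists>z\<in>rts t0. u \<in> ball z \<kappa>"
  "\<And>t z. t \<in> T ==> dist t t0 < d ==> z \<in> rts t0 ==> \<exists>!u. u \<in> rts t \<and> u \<in> ball z \<kappa>"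
proof -
 obtain \<kappa>0 where \<kappa>0: "\<kappa>0 > 0" "\<forall>z\<in>rts t0. \<forall>z'\<in>rts t0. z \<noteq> z' --> 2 * \<kappa>0 < dist z z'"
  using isolating_radius[OF t0] by blast
 define \<kappa> where "\<kappa> = min \<kappa>0 (\<epsilon>/2)"
 have \<kappa>: "0 < \<kappa>" "\<kappa> < \<epsilon>" "2 * \<kappa> \<le> 2 * \<kappa>0" using \<kappa>0(1) \<epsilon> by (auto simp: \<kappa>_def)
 have \<kappa>3: "\<forall>z\<in>rts t0. \<forall>z'\<in>rts t0. z \<noteq> z' --> 2 * \<kappa> < dist z z'"
  using \<kappa>0(2) order.strict_trans1[OF \<kappa>(3)] by blast
 have fin: "finite (rts t0)" by (rule finite_rts[OF t0])
 obtain d1 where d1: "d1 > 0" "\<forall>t\<in>T. dist t t0 < d1 --> (\<forall>u\<in>rts t. \<exists>z\<in>rts t0. dist u z < \<kappa>)"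
  using roots_stay[OF t0 \<kappa>(1)] by blast
 have "\<forall>z\<in>rts t0. \<exists>d>0. \<forall>t\<in>T. dist t t0 < d --> (\<exists>u\<in>rts t. dist u z < \<kappa>)"
  using roots_persist[OF t0 _ \<kappa>(1)] by blast
 then obtain D where D: "\<And>z. z \<in> rts t0 ==> D z > 0"
   "\<And>z t. z \<in> rts t0 ==> t \<in> T ==> dist t t0 < D z ==> \<exists>u\<in>rts t. dist u z < \<kappa>" by metis
 define d where "d = Min (insert d1 (D ` rts t0))"
 have d: "0 < d" "d \<le> d1" "\<And>z. z \<in> rts t0 ==> d \<le> D z"
  using fin d1(1) D(1) by (auto simp: d_def)
 have "(\<forall>u\<in>rts t. \<exists>z\<in>rts t0. u \<in> ball z \<kappa>) \<and> (\<forall>z\<in>rts t0. \<exists>!u. u \<in> rts t \<and> u \<in> ball z \<kappa>)"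
  if t: "t \<in> T" "dist t t0 < d" for t
 proof
  show near: "\<forall>u\<in>rts t. \<exists>z\<in>rts t0. u \<in> ball z \<kappa>"
   using d1(2) t d(2) by (auto simp: dist_commute dest!: bspec[of _ _ t])
  have "\<forall>z\<in>rts t0. \<exists>u. u \<in> rts t \<and> u \<in> ball z \<kappa>"
   using D(2) t d(3) by (force simp: dist_commute)
  then obtain r where r: "\<And>z. z \<in> rts t0 ==> r z \<in> rts t \<and> r z \<in> ball z \<kappa>" by metis
  have sep: "z = z'" if "z \<in> rts t0" "z' \<in> rts t0" "u \<in> ball z \<kappa>" "u \<in> ball z' \<kappa>" for z z' u
  proof (rule ccontr)
   assume "z \<noteq> z'"
   then have "2 * \<kappa> < dist z z'" using \<kappa>3 that by blast
   moreover have "dist z z' \<le> dist z u + dist z' u" by (metis dist_commute dist_triangle)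
   ultimately show False using that by simp
  qed
  have "inj_on r (rts t0)" using r sep by (metis inj_onI)
  then have im: "r ` rts t0 = rts t"
   using r finite_rts[OF t(1)] card_rts[OF t(1)] card_rts[OF t0]
   by (intro card_subset_eq) (auto simp: card_image)
  show "\<forall>z\<in>rts t0. \<exists>!u. u \<in> rts t \<and> u \<in> ball z \<kappa>"
  proof
   fix z assume z: "z \<in> rts t0"
   show "\<exists>!u. u \<in> rts t \<and> u \<in> ball z \<kappa>"
   proof (rule ex1I[of _ "r z"])
    fix u assume u: "u \<in> rts t \<and> u \<in> ball z \<kappa>"
    then obtain z' where z': "z' \<in> rts t0" "u = r z'" using im by blast
    then have "z' = z" using r[OF z'(1)] u z sep by blast
    then show "u = r z" using z' by simp
   qed (use r z in blast)
  qed
 qed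
 then show ?thesis using that[OF d(1) \<kappa>(1,2) \<kappa>3] by blast
qed

definition total :: "('a \<times> complex) set" where "total = {(t,z). t \<in> T \<and> z \<in> rts t}"

text \<open>Over a small ball around \<open>t0\<close> each root of \<open>f t0\<close> has exactly
  one root near it, which gives disjoint sheets; continuity of a sheet is persistence of roots.
  \<open>0 < e\<close> makes the projection onto.\<close>

lemma covering: assumes "0 < e" shows "covering_space total fst T"
 unfolding covering_space_def
proof (intro conjI ballI)
 show "continuous_on total fst" by (intro continuous_intros)
 show "fst ` total = T"
 proof
  show "T \<subseteq> fst ` total"
  proof
   fix t assume t: "t \<in> T"
   then have "rts t \<noteq> {}" using card_rts[OF t] assms by auto
   then obtain z where "z \<in> rts t" by blast
   then have "(t,z) \<in> total" using t by (simp add: total_def)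
   then show "t \<in> fst ` total" by force
  qed
 qed (auto simp: total_def)
 fix t0 assume t0: "t0 \<in> T"
 obtain d \<kappa> where d\<kappa>: "0 < d" "0 < \<kappa>" "\<forall>z\<in>rts t0. \<forall>z'\<in>rts t0. z \<noteq> z' --> 2 * \<kappa> < dist z z'"
   and near: "\<And>t u. t \<in> T ==> dist t t0 < d ==> u \<in> rts t ==> \<exists>z\<in>rts t0. u \<in> ball z \<kappa>"
   and uniq: "\<And>t z. t \<in> T ==> dist t t0 < d ==> z \<in> rts t0 ==> \<exists>!u. u \<in> rts t \<and> u \<in> ball z \<kappa>"
  by (rule unique_root_nearby[OF t0, of 1]) (auto simp only: zero_less_one)
 define V where "V = T \<inter> ball t0 d"
 have V: "t \<in> V \<longleftrightarrow> t \<in> T \<and> dist t t0 < d" for t by (auto simp: V_def dist_commute)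
 define sheet where "sheet z = {(t,u). t \<in> V \<and> u \<in> rts t \<and> u \<in> ball z \<kappa>}" for z
 define r where "r z t = (THE u. u \<in> rts t \<and> u \<in> ball z \<kappa>)" for z t
 have r: "r z t \<in> rts t" "r z t \<in> ball z \<kappa>" if "z \<in> rts t0" "t \<in> V" for z t
  using theI'[OF uniq, of t z] that by (auto simp: r_def V)
 have r_eq: "u = r z t" if "z \<in> rts t0" "t \<in> V" "u \<in> rts t" "u \<in> ball z \<kappa>" for z t u
  using uniq[of t z] that r[OF that(1,2)] V by blast
 have cont_r: "continuous_on V (r z)" if z: "z \<in> rts t0" for z
 proof -
  have "\<exists>d'>0. \<forall>t\<in>V. dist t t1 < d' --> dist (r z t) (r z t1) < \<epsilon>" if t1: "t1 \<in> V" and "0 < \<epsilon>" for t1 \<epsilon>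
  proof -
   \<comment> \<open>Also at most the distance from \<open>r z t1\<close> to the boundary of its
     ball, so that the root found by persistence lies in the same ball and must be
     \<open>r z t\<close>.\<close>
   define \<eta> where "\<eta> = min \<epsilon> (\<kappa> - dist z (r z t1))"
   have \<eta>: "0 < \<eta>" using r[OF z t1] \<open>0 < \<epsilon>\<close> by (auto simp: \<eta>_def)
   obtain d' where d': "d' > 0" "\<forall>t\<in>T. dist t t1 < d' --> (\<exists>u\<in>rts t. dist u (r z t1) < \<eta>)"
    using roots_persist[OF _ r(1)[OF z t1] \<eta>] t1 by (auto simp: V)
   have "dist (r z t) (r z t1) < \<epsilon>" if t: "t \<in> V" "dist t t1 < d'" for t
   proof -
    obtain u where u: "u \<in> rts t" "dist u (r z t1) < \<eta>" using d' t V by blast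
    have "dist z u \<le> dist z (r z t1) + dist u (r z t1)" by (metis dist_commute dist_triangle)
    then have "u \<in> ball z \<kappa>" using u(2) by (simp add: \<eta>_def)
    then have "u = r z t" using r_eq[OF z t(1) u(1)] by blast
    then show ?thesis using u(2) by (simp add: \<eta>_def)
   qed
   then show ?thesis using d'(1) by blast
  qed
  then show ?thesis by (auto simp: continuous_on_iff)
 qed
 show "\<exists>V. t0 \<in> V \<and> openin (top_of_set T) V \<and>
   (\<exists>v. \<Union> v = total \<inter> fst -` V \<and> (\<forall>u\<in>v. openin (top_of_set total) u) \<and> pairwise disjnt v \<and>
     (\<forall>u\<in>v. \<exists>q. homeomorphism u V fst q))"
 proof (intro exI[of _ V] conjI exI[of _ "sheet ` rts t0"] ballI)
  show "t0 \<in> V" using t0 d\<kappa> by (simp add: V)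
  show "openin (top_of_set T) V" unfolding V_def by (intro openin_open_Int) auto
  show "\<Union> (sheet ` rts t0) = total \<inter> fst -` V"
   using near by (auto simp: sheet_def total_def V)
  show "pairwise disjnt (sheet ` rts t0)"
  proof (clarsimp simp: pairwise_def disjnt_iff)
   fix z z' t u assume *: "z \<in> rts t0" "z' \<in> rts t0" "sheet z \<noteq> sheet z'" "(t,u) \<in> sheet z" "(t,u) \<in> sheet z'"
   then have "z \<noteq> z'" by auto
   then have "2 * \<kappa> < dist z z'" using d\<kappa>(3) * by blast
   moreover have "dist z z' \<le> dist z u + dist z' u" by (metis dist_commute dist_triangle)
   ultimately show False using * by (simp add: sheet_def)
  qed
  fix s assume "s \<in> sheet ` rts t0"
  then obtain z where z: "z \<in> rts t0" "s = sheet z" by auto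
  have "sheet z = total \<inter> (ball t0 d \<times> ball z \<kappa>)"
   by (auto simp: sheet_def total_def V_def)
  then show "openin (top_of_set total) s"
   unfolding z by (metis openin_open_Int open_Times open_ball)
  show "\<exists>q. homeomorphism s V fst q"
  proof (intro exI[of _ "\<lambda>t. (t, r z t)"] homeomorphismI)
   show "continuous_on s fst" by (intro continuous_intros)
   show "continuous_on V (\<lambda>t. (t, r z t))" by (intro continuous_intros cont_r z)
  qed (use z r r_eq in \<open>auto simp: sheet_def\<close>)
 qed
qed

text \<open>A convex base is simply connected, so the identity of \<open>T\<close> lifts to the
  covering.\<close>

lemma section_exists:
 assumes "convex T" "t0 \<in> T" "z0 \<in> rts t0"
 shows "\<exists>g. continuous_on T g \<and> g t0 = z0 \<and> (\<forall>t\<in>T. g t \<in> rts t)"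
proof -
 have e: "0 < e" using card_rts[OF assms(2)] assms(3) finite_rts[OF assms(2)] by (metis card_gt_0_iff empty_iff)
 obtain g where g: "continuous_on T g" "g \<in> T \<rightarrow> total" "g t0 = (t0,z0)" "\<And>y. y \<in> T ==> fst (g y) = y"
 proof (rule covering_space_lift_strong[OF covering[OF e], of "(t0,z0)" t0 T "\<lambda>t. t"])
  show "simply_connected T" using assms(1) by (rule convex_imp_simply_connected)
  show "locally path_connected T" using assms(1) by (rule convex_imp_locally_path_connected)
 qed (use assms in \<open>auto simp: total_def\<close>)
 have "continuous_on T (\<lambda>t. snd (g t))" using g(1) by (intro continuous_intros)
 moreover have "snd (g t) \<in> rts t" if "t \<in> T" for t
  using g(2,4) that by (auto simp: total_def Pi_iff split_beta)
 ultimately show ?thesis using g(3) by (intro exI[of _ "\<lambda>t. snd (g t)"]) auto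
qed

lemma section_unique:
 assumes "connected T" and g: "continuous_on T g" "\<And>t. t \<in> T ==> g t \<in> rts t"
  and h: "continuous_on T h" "\<And>t. t \<in> T ==> h t \<in> rts t" and "a \<in> T" "g a = h a" "t \<in> T"
 shows "g t = h t"
proof -
 have e: "0 < e" using card_rts[OF \<open>a \<in> T\<close>] g(2)[OF \<open>a \<in> T\<close>] finite_rts[OF \<open>a \<in> T\<close>] by (metis card_gt_0_iff empty_iff)
 have "(t, g t) = (t, h t)"
  by (rule covering_space_lift_unique[OF covering[OF e], of "\<lambda>t. (t, g t)" a "\<lambda>t. (t, h t)" T "\<lambda>t. t"])
   (use assms in \<open>auto simp: total_def intro!: continuous_intros\<close>)
 then show ?thesis by simp
qed

end

text \<open>A section of the smaller family through \<open>y a\<close> is also a section of the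
  larger one, where unique lifting identifies it with \<open>y\<close>. Applied to a factor of a
  product, it says that along a root of the product the vanishing of the factor cannot
  change.\<close>

lemma section_subfamily:
 assumes F: "root_family_const T f \<rho> R e" and G: "root_family_const T g \<rho> R e'"
  and sub: "\<And>t z. t \<in> T ==> g t z = 0 ==> f t z = 0" and "convex T"
  and y: "continuous_on T y" "\<And>t. t \<in> T ==> cmod (y t) < \<rho> \<and> f t (y t) = 0"
  and a: "a \<in> T" "g a (y a) = 0" and t: "t \<in> T"
 shows "g t (y t) = 0"
proof -
 interpret F: root_family_const T f \<rho> R e by fact
 interpret G: root_family_const T g \<rho> R e' by fact
 have "y a \<in> G.rts a" using a y by (auto simp: G.rts_def)
 from G.section_exists[OF \<open>convex T\<close> a(1) this] obtain k where
  k: "continuous_on T k" "k a = y a" "\<forall>t\<in>T. k t \<in> G.rts t" by blast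
 have "k t = y t"
  by (rule F.section_unique[OF convex_connected[OF \<open>convex T\<close>] k(1) _ y(1) _ a(1) k(2) t])
   (use k y sub in \<open>auto simp: G.rts_def F.rts_def\<close>)
 then show ?thesis using k(3) t by (auto simp: G.rts_def)
qed

text \<open>Recentred at \<open>g t0\<close> and restricted to a small disc, the family has the
  single root \<open>g t - g t0\<close>, which is the quotient of two holomorphic power
  sums.\<close>

lemma section_holomorphic:
 assumes "root_family_const T f \<rho> R e" "open T"
  and h: "\<And>z. z \<in> ball 0 R ==> (\<lambda>w. f w z) holomorphic_on T"
  and g: "continuous_on T g" "\<And>t. t \<in> T ==> cmod (g t) < \<rho> \<and> f t (g t) = 0"
 shows "g holomorphic_on T"
proof -
 interpret root_family_const T f \<rho> R e by fact
 have "\<exists>S. open S \<and> t0 \<in> S \<and> g holomorphic_on S" if t0: "t0 \<in> T" for t0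
 proof -
  have g0: "g t0 \<in> rts t0" and g0': "cmod (g t0) < \<rho>" using g t0 by (auto simp: rts_def)
  obtain d \<kappa> where d\<kappa>: "0 < d" "0 < \<kappa>" "\<kappa> < \<rho> - cmod (g t0)"
    and sep: "\<forall>z\<in>rts t0. \<forall>z'\<in>rts t0. z \<noteq> z' --> 2 * \<kappa> < dist z z'"
    and near: "\<And>t u. t \<in> T ==> dist t t0 < d ==> u \<in> rts t ==> \<exists>z\<in>rts t0. u \<in> ball z \<kappa>"
    and uniq: "\<And>t z. t \<in> T ==> dist t t0 < d ==> z \<in> rts t0 ==> \<exists>!u. u \<in> rts t \<and> u \<in> ball z \<kappa>"
   by (rule unique_root_nearby[OF t0, of "\<rho> - cmod (g t0)"]) (use g0' in \<open>auto simp only: diff_gt_0_iff_gt\<close>)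
  define S where "S = {t \<in> T. g t \<in> ball (g t0) \<kappa>} \<inter> ball t0 d"
  have S: "open S" "t0 \<in> S" "S \<subseteq> T"
  proof -
   have "S = (T \<inter> g -` ball (g t0) \<kappa>) \<inter> ball t0 d" by (auto simp: S_def)
   then show "open S" using continuous_open_preimage[OF g(1) \<open>open T\<close>, of "ball (g t0) \<kappa>"] by (simp add: open_Int)
  qed (use t0 d\<kappa> in \<open>auto simp: S_def\<close>)
  let ?f = "\<lambda>t z. f t (g t0 + z)" and ?R = "R - cmod (g t0)"
  have inb: "g t0 + z \<in> ball 0 R" if "z \<in> ball 0 ?R" for z
   using that norm_triangle_ineq[of "g t0" z] by auto
  interpret L: root_family S ?f \<kappa> ?R
  proof
   show "0 < \<kappa>" "\<kappa> < ?R" using d\<kappa> \<rho> by auto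
   show "continuous_on (S \<times> ball 0 ?R) (\<lambda>(t, z). f t (g t0 + z))"
    unfolding split_beta
    by (intro continuous_on_compose2[OF cont[unfolded split_beta], of _ "\<lambda>x. (fst x, g t0 + snd x)", simplified]
     continuous_intros) (use S inb in auto)
   show "(\<lambda>z. f t (g t0 + z)) holomorphic_on ball 0 ?R" if "t \<in> S" for t
   proof -
    have "(\<lambda>z. g t0 + z) ` ball 0 ?R \<subseteq> ball 0 R" using inb by blast
    moreover have "f t holomorphic_on ball 0 R" using hol that S(3) by blast
    moreover have "(\<lambda>z. g t0 + z) holomorphic_on ball 0 ?R" by (intro holomorphic_intros)
    ultimately show ?thesis using holomorphic_on_compose_gen by (fastforce simp: o_def)
   qed
   show "f t (g t0 + z) \<noteq> 0" if t: "t \<in> S" and z: "cmod z = \<kappa>" for t z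
   proof
    assume "f t (g t0 + z) = 0"
    moreover have "cmod (g t0 + z) < \<rho>" using norm_triangle_ineq[of "g t0" z] z d\<kappa> by linarith
    ultimately have "g t0 + z \<in> rts t" by (simp add: rts_def)
    then obtain z' where z': "z' \<in> rts t0" "g t0 + z \<in> ball z' \<kappa>"
     using near[of t "g t0 + z"] t by (auto simp: S_def dist_commute)
    have "z' \<noteq> g t0" using z' z by (auto simp: dist_norm)
    then have "2 * \<kappa> < dist z' (g t0)" using sep g0 z' by blast
    moreover have "dist z' (g t0) \<le> dist z' (g t0 + z) + dist (g t0 + z) (g t0)" by (rule dist_triangle)
    moreover have "dist z' (g t0 + z) < \<kappa>" "dist (g t0 + z) (g t0) = \<kappa>" using z' z by (simp_all add: dist_norm)
    ultimately show False by linarith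
   qed
  qed
  have eq: "L.rts t = {g t - g t0}" if t: "t \<in> S" for t
  proof -
   have t': "t \<in> T" "dist t t0 < d" "g t \<in> rts t" "g t \<in> ball (g t0) \<kappa>"
    using t g by (auto simp: S_def rts_def dist_commute)
   have "z = g t - g t0" if "cmod z < \<kappa>" "f t (g t0 + z) = 0" for z
   proof -
    have "cmod (g t0 + z) < \<rho>" using norm_triangle_ineq[of "g t0" z] that d\<kappa> by linarith
    then have "g t0 + z \<in> rts t" "g t0 + z \<in> ball (g t0) \<kappa>" using that by (auto simp: rts_def dist_norm)
    then have "g t0 + z = g t" using uniq[OF t'(1,2) g0] t'(3,4) by blast
    then show ?thesis by (simp add: algebra_simps)
   qed
   then show ?thesis using t' by (auto simp: L.rts_def rts_def dist_norm norm_minus_commute)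
  qed
  have hp: "L.psum a holomorphic_on S" for a
  proof (rule L.psum_holomorphic[of S "\<lambda>w. w" a])
   show "(\<lambda>w. f w (g t0 + z)) holomorphic_on S" if "z \<in> ball 0 ?R" for z
    using h[OF inb[OF that]] S(3) by (rule holomorphic_on_subset)
  qed (use S in auto)
  have nz0: "L.psum 0 t \<noteq> 0" if "t \<in> S" for t
   using L.zorder_pos[OF that] eq[OF that] by (simp add: L.psum_def)
  have "(\<lambda>t. g t0 + L.psum 1 t / L.psum 0 t) holomorphic_on S"
   by (intro holomorphic_intros hp nz0)
  then have "g holomorphic_on S"
   by (rule holomorphic_transform) (simp add: L.root_of_psum_ratio[OF _ eq] del: One_nat_def)
  then show ?thesis using S by blast
 qed
 then show ?thesis
  by (metis (no_types) field_differentiable_at_within holomorphic_onI holomorphic_on_imp_differentiable_at)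
qed

section \<open>Puiseux parametrisations\<close>

text \<open>Pulled back by \<open>exp\<close>, the punctured disc becomes a half-plane, over which
  the root through \<open>z0\<close> continues to a section \<open>g\<close>. Translates of
  \<open>g\<close> by multiples of \<open>2*pi*\<i>\<close> are again sections and at most
  \<open>e\<close> of them differ, so \<open>g\<close> has a least period \<open>2*pi*\<i>*N\<close>
  and is a function of the \<open>N\<close>-th root of \<open>s\<close>. Minimality gives the last
  conclusion: for even \<open>N\<close>, equal values at \<open>\<sigma>\<close> and
  \<open>- \<sigma>\<close> would make \<open>N / 2\<close> a period.\<close>

theorem puiseux_root:
 assumes "root_family (ball 0 s1) G \<rho> R" and s1: "0 < s1"
  and card: "\<And>s. s \<in> ball 0 s1 - {0} ==> card {z. cmod z < \<rho> \<and> G s z = 0} = e"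
  and zero: "\<And>z. cmod z < \<rho> ==> G 0 z = 0 ==> z = 0"
  and h: "\<And>z. z \<in> ball 0 R ==> (\<lambda>s. G s z) holomorphic_on ball 0 s1"
  and s0: "0 < s0" "s0 < s1" and z0: "cmod z0 < \<rho>" "G (of_real s0) z0 = 0"
 shows "\<exists>N Y. 0 < N \<and> N \<le> e \<and> Y holomorphic_on ball 0 (root N s1) \<and> Y 0 = 0 \<and>
   (\<forall>\<sigma>\<in>ball 0 (root N s1) - {0}. cmod (Y \<sigma>) < \<rho> \<and> G (\<sigma>^N) (Y \<sigma>) = 0) \<and>
   Y (of_real (root N s0)) = z0 \<and>
   (\<forall>\<sigma>\<in>ball 0 (root N s1) - {0}. even N --> Y (-\<sigma>) \<noteq> Y \<sigma>)"
proof -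
 interpret G: root_family "ball 0 s1" G \<rho> R by fact
 define T where "T = {w. Re w < ln s1}"
 have openT: "open T" by (auto simp: T_def open_halfspace_Re_lt)
 have convT: "convex T" unfolding T_def by (rule convex_halfspace_Re_lt)
 have expT: "exp w \<in> ball 0 s1 - {0}" if "w \<in> T" for w
  using that s1 by (simp add: T_def) (metis exp_less_mono exp_ln)
 let ?f = "\<lambda>w. G (exp w)"
 interpret F: root_family_const T ?f \<rho> R e
 proof
  show "0 < \<rho>" "\<rho> < R" by (fact G.\<rho>)+
  show "continuous_on (T \<times> ball 0 R) (\<lambda>(t, z). G (exp t) z)"
   unfolding split_beta
   by (intro continuous_on_compose2[OF G.cont[unfolded split_beta], of _ "\<lambda>x. (exp (fst x), snd x)", simplified]
     continuous_intros) (use expT in auto)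
  show "G (exp t) holomorphic_on ball 0 R" if "t \<in> T" for t using G.hol expT[OF that] by auto
  show "G (exp t) z \<noteq> 0" if "t \<in> T" "cmod z = \<rho>" for t z using G.nz expT[OF that(1)] that by auto
  show "card (root_family.rts (\<lambda>w. G (exp w)) \<rho> t) = e" if "t \<in> T" for t
  proof -
   have "root_family T (\<lambda>w. G (exp w)) \<rho> R" by unfold_locales fact+
   then show ?thesis using card[OF expT[OF that]] by (simp add: root_family.rts_def)
  qed
 qed
 define w0 :: complex where "w0 = of_real (ln s0)"
 have w0: "w0 \<in> T" "exp w0 = of_real s0" using s0 s1 by (auto simp: w0_def T_def exp_of_real)
 have "z0 \<in> F.rts w0" using z0 w0 by (simp add: F.rts_def)
 from F.section_exists[OF convT w0(1) this] obtain g where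
  g: "continuous_on T g" "g w0 = z0" "\<And>t. t \<in> T ==> g t \<in> F.rts t" by blast
 have holg: "g holomorphic_on T"
 proof (rule section_holomorphic[OF F.root_family_const_axioms openT _ g(1)])
  show "(\<lambda>w. G (exp w) z) holomorphic_on T" if "z \<in> ball 0 R" for z
  proof -
   have "exp ` T \<subseteq> ball 0 s1" using expT by blast
   then show ?thesis
    using holomorphic_on_compose_gen[OF holomorphic_on_exp h[OF that]] by (simp add: o_def)
  qed
 qed (use g in \<open>auto simp: F.rts_def\<close>)
 define p :: "int \<Rightarrow> complex" where "p k = 2 * pi * of_int k * \<i>" for k
 have pT: "w + p k \<in> T \<longleftrightarrow> w \<in> T" for w k by (simp add: T_def p_def)
 have expp: "exp (w + p k) = exp w" for w k
  by (simp add: p_def exp_add exp_eq_1)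
 have gp: "continuous_on T (\<lambda>w. g (w + p k))" "\<And>w. w \<in> T ==> g (w + p k) \<in> F.rts w" for k
 proof -
  show "continuous_on T (\<lambda>w. g (w + p k))"
   by (intro continuous_on_compose2[OF g(1)] continuous_intros) (auto simp: pT)
  show "g (w + p k) \<in> F.rts w" if "w \<in> T" for w
   using g(3)[of "w + p k"] that by (simp add: pT F.rts_def expp)
 qed
 have glob: "g (w + p j) = g (w + p k)" if "a \<in> T" "g (a + p j) = g (a + p k)" "w \<in> T" for a w j k
  using F.section_unique[OF convex_connected[OF convT] gp gp that(1,2,3)] .
 have padd: "p (j + k) = p j + p k" "p 0 = 0" for j k by (simp_all add: p_def algebra_simps)
 \<comment> \<open>Pigeonhole: the \<open>e + 1\<close> translates have only \<open>e\<close>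
   possible values at \<open>w0\<close>, and two sections that agree at one point agree
   everywhere.\<close>
 have "\<exists>j k. j < k \<and> k \<le> e \<and> g (w0 + p (int j)) = g (w0 + p (int k))"
 proof (rule ccontr)
  assume "\<not> ?thesis"
  then have inj: "inj_on (\<lambda>j. g (w0 + p (int j))) {..e}"
   by (auto simp: inj_on_def) (metis linorder_neqE_nat)
  have "card {..e} \<le> card (F.rts w0)"
   using inj gp(2)[OF w0(1)] F.finite_rts[OF w0(1)] by (intro card_inj_on_le) auto
  then show False using F.card_rts[OF w0(1)] by simp
 qed
 then obtain j k where jk: "j < k" "k \<le> e" "g (w0 + p (int j)) = g (w0 + p (int k))" by blast
 define P where "P n \<longleftrightarrow> 0 < n \<and> g (w0 + p (int n)) = g w0" for n
 have "g (w0 + p (- int j) + p (int j)) = g (w0 + p (- int j) + p (int k))"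
  by (rule glob[OF w0(1) jk(3)]) (simp add: pT w0)
 moreover have "w0 + p (- int j) + p (int j) = w0" "w0 + p (- int j) + p (int k) = w0 + p (int (k - j))"
  using jk(1) by (simp_all add: p_def algebra_simps of_nat_diff)
 ultimately have Pkj: "P (k - j)" using jk(1) by (simp add: P_def)
 define N where "N = (LEAST n. P n)"
 have PN: "P N" unfolding N_def using Pkj by (rule LeastI)
 have Nle: "N \<le> k - j" unfolding N_def using Pkj by (rule Least_le)
 have Nmin: "\<not> P n" if "n < N" for n using that unfolding N_def by (rule not_less_Least)
 have N: "0 < N" "N \<le> e" using PN Nle jk by (auto simp: P_def)
 have per1: "g (w + p (int N)) = g w" if "w \<in> T" for w
  using glob[OF w0(1), of "int N" 0 w] PN that by (simp add: padd P_def)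
 have pern: "g (w + p (int (N * n))) = g w" if "w \<in> T" for w n
 proof (induction n)
  case (Suc n)
  have "w + p (int (N * Suc n)) = (w + p (int (N * n))) + p (int N)" by (simp add: p_def algebra_simps)
  then show ?case using per1[of "w + p (int (N * n))"] Suc that by (simp only: pT)
 qed (simp add: padd)
 have per: "g (w + p (int N * k)) = g w" if "w \<in> T" for w k
 proof (cases "k \<ge> 0")
  case True then show ?thesis using pern[OF that, of "nat k"] by simp
 next
  case False
  have "g ((w + p (int N * k)) + p (int (N * nat (-k)))) = g (w + p (int N * k))"
   by (rule pern) (simp add: pT that)
  moreover have "(w + p (int N * k)) + p (int (N * nat (-k))) = w"
   using False by (simp add: p_def algebra_simps)
  ultimately show ?thesis by (simp only:)
 qed
 define r where "r = root N s1"
 have r: "0 < r" "r ^ N = s1" using N s1 by (simp_all add: r_def)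
 have lnr: "N * ln r = ln s1" using r by (metis ln_realpow)
 \<comment> \<open>The value at 0 is fixed in advance; \<open>lim\<close> below shows that it is the
   one that removes the singularity.\<close>
 define Y where "Y \<sigma> = (if \<sigma> = 0 then 0 else g (of_nat N * Ln \<sigma>))" for \<sigma>
 have inT: "of_nat N * w \<in> T" if "Re w < ln r" for w
 proof -
  have "N * Re w < N * ln r" using that N by simp
  then show ?thesis by (simp add: T_def lnr)
 qed
 \<comment> \<open>By periodicity any logarithm of \<open>\<sigma>\<close> may replace
   \<open>Ln \<sigma>\<close>, which frees \<open>Y\<close> from the branch cut.\<close>
 have Yexp: "Y (exp w) = g (of_nat N * w)" if "Re w < ln r" for w
 proof -
  obtain k where k: "Ln (exp w) = w + of_int (2 * k) * pi * \<i>"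
   using Ln_exp[of w] exp_eq[of "Ln (exp w)" w] by auto
  have "of_nat N * Ln (exp w) = of_nat N * w + p (int N * k)" by (simp add: k p_def algebra_simps)
  then show ?thesis using per[OF inT[OF that]] by (simp add: Y_def)
 qed
 have ReLn: "Re (Ln \<sigma>) < ln r" if "\<sigma> \<noteq> 0" "cmod \<sigma> < r" for \<sigma>
  using that by (metis Re_Ln ln_less_cancel_iff r(1) zero_less_norm_iff)
 have Yrt: "Y \<sigma> \<in> F.rts (of_nat N * Ln \<sigma>)" if "\<sigma> \<noteq> 0" "cmod \<sigma> < r" for \<sigma>
  using g(3)[OF inT[OF ReLn[OF that]]] that by (simp add: Y_def)
 have Yrt': "cmod (Y \<sigma>) < \<rho> \<and> G (\<sigma>^N) (Y \<sigma>) = 0" if "\<sigma> \<noteq> 0" "cmod \<sigma> < r" for \<sigma>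
  using Yrt[OF that] that by (simp add: F.rts_def exp_of_nat_mult)
 have hol1: "Y holomorphic_on ball 0 r - \<real>\<^sub>\<le>\<^sub>0"
 proof (rule holomorphic_transform[where f = "\<lambda>\<sigma>. g (of_nat N * Ln \<sigma>)"])
  have "(\<lambda>\<sigma>. of_nat N * Ln \<sigma>) holomorphic_on ball 0 r - \<real>\<^sub>\<le>\<^sub>0" by (intro holomorphic_intros) auto
  moreover have "(\<lambda>\<sigma>. of_nat N * Ln \<sigma>) ` (ball 0 r - \<real>\<^sub>\<le>\<^sub>0) \<subseteq> T"
  proof clarify
   fix \<sigma> :: complex assume "\<sigma> \<in> ball 0 r" "\<sigma> \<notin> \<real>\<^sub>\<le>\<^sub>0"
   moreover from this have "\<sigma> \<noteq> 0" by auto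
   ultimately show "of_nat N * Ln \<sigma> \<in> T" using inT[OF ReLn[of \<sigma>]] by simp
  qed
  ultimately show "(\<lambda>\<sigma>. g (of_nat N * Ln \<sigma>)) holomorphic_on ball 0 r - \<real>\<^sub>\<le>\<^sub>0"
   using holomorphic_on_compose_gen[OF _ holg] by (simp add: o_def)
 qed (auto simp: Y_def)
 \<comment> \<open>\<open>Ln\<close> is holomorphic only off the negative axis. Off the positive
   axis a second branch of the logarithm is used, and the two slit discs cover the punctured
   disc.\<close>
 have hol2: "Y holomorphic_on ball 0 r - \<real>\<^sub>\<ge>\<^sub>0"
 proof (rule holomorphic_transform[where f = "\<lambda>\<sigma>. g (of_nat N * (Ln (-\<sigma>) + \<i> * pi))"])
  have "(\<lambda>\<sigma>. of_nat N * (Ln (-\<sigma>) + \<i> * pi)) holomorphic_on ball 0 r - \<real>\<^sub>\<ge>\<^sub>0"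
   by (intro holomorphic_intros) (auto simp: complex_nonpos_Reals_iff complex_nonneg_Reals_iff)
  moreover have "(\<lambda>\<sigma>. of_nat N * (Ln (-\<sigma>) + \<i> * pi)) ` (ball 0 r - \<real>\<^sub>\<ge>\<^sub>0) \<subseteq> T"
  proof clarify
   fix \<sigma> :: complex assume "\<sigma> \<in> ball 0 r" "\<sigma> \<notin> \<real>\<^sub>\<ge>\<^sub>0"
   moreover from this have "\<sigma> \<noteq> 0" by auto
   ultimately have "Re (Ln (-\<sigma>) + \<i> * pi) < ln r" using ReLn[of "-\<sigma>"] by simp
   then show "of_nat N * (Ln (-\<sigma>) + \<i> * pi) \<in> T" by (rule inT)
  qed
  ultimately show "(\<lambda>\<sigma>. g (of_nat N * (Ln (-\<sigma>) + \<i> * pi))) holomorphic_on ball 0 r - \<real>\<^sub>\<ge>\<^sub>0"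
   using holomorphic_on_compose_gen[OF _ holg] by (simp add: o_def)
  fix \<sigma> :: complex assume \<sigma>: "\<sigma> \<in> ball 0 r - \<real>\<^sub>\<ge>\<^sub>0"
  then have "\<sigma> \<noteq> 0" by auto
  then have "exp (Ln (-\<sigma>) + \<i> * pi) = \<sigma>" by (simp add: exp_add)
  moreover have "Re (Ln (-\<sigma>) + \<i> * pi) < ln r" using ReLn[of "-\<sigma>"] \<sigma> \<open>\<sigma> \<noteq> 0\<close> by simp
  ultimately show "g (of_nat N * (Ln (-\<sigma>) + \<i> * pi)) = Y \<sigma>" using Yexp by metis
 qed
 have "Y holomorphic_on (ball 0 r - \<real>\<^sub>\<le>\<^sub>0) \<union> (ball 0 r - \<real>\<^sub>\<ge>\<^sub>0)"
  using hol1 hol2 by (intro holomorphic_on_Un) (auto intro!: open_Diff closed_nonpos_Reals_complex closed_nonneg_Reals_complex)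
 moreover have "(ball 0 r - \<real>\<^sub>\<le>\<^sub>0) \<union> (ball 0 r - \<real>\<^sub>\<ge>\<^sub>0) = ball 0 r - {0::complex}"
  by (auto simp: complex_nonpos_Reals_iff complex_nonneg_Reals_iff complex_eq_iff)
 ultimately have hol0: "Y holomorphic_on ball 0 r - {0}" by simp
 \<comment> \<open>Over \<open>s = 0\<close> the only root is 0, so all roots over small
   \<open>s\<close> are small.\<close>
 have lim: "\<exists>d>0. \<forall>\<sigma>. cmod \<sigma> < d --> cmod (Y \<sigma>) < \<epsilon>" if "0 < \<epsilon>" for \<epsilon>
 proof -
  obtain d where d: "d > 0" "\<forall>t\<in>ball 0 s1. dist t 0 < d --> (\<forall>u\<in>G.rts t. \<exists>z\<in>G.rts 0. dist u z < \<epsilon>)"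
   using G.roots_stay[OF _ \<open>0 < \<epsilon>\<close>, of 0] s1 by auto
  define d' where "d' = min (min r 1) d"
  have "cmod (Y \<sigma>) < \<epsilon>" if "cmod \<sigma> < d'" for \<sigma>
  proof (cases "\<sigma> = 0")
   case False
   have "cmod (\<sigma> ^ N) \<le> cmod \<sigma>"
    using that N power_decreasing[of 1 N "cmod \<sigma>"] by (auto simp: d'_def norm_power)
   then have "cmod (\<sigma>^N) < d" using that by (simp add: d'_def)
   moreover have "cmod (\<sigma>^N) < s1"
    using that N r by (metis d'_def min_less_iff_conj norm_ge_zero norm_power power_strict_mono)
   moreover have "Y \<sigma> \<in> G.rts (\<sigma>^N)" using Yrt'[OF False] that by (simp add: G.rts_def d'_def)
   ultimately obtain z where "z \<in> G.rts 0" "dist (Y \<sigma>) z < \<epsilon>" using d(2) by fastforce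
   then show ?thesis using zero[of z] by (auto simp: G.rts_def)
  qed (use \<open>0 < \<epsilon>\<close> in \<open>simp add: Y_def\<close>)
  then show ?thesis using d(1) r by (intro exI[of _ d']) (auto simp: d'_def)
 qed
 have "continuous_on (ball 0 r) Y"
 proof -
  have "isCont Y \<sigma>" if "\<sigma> \<in> ball 0 r" for \<sigma>
  proof (cases "\<sigma> = 0")
   case True
   have "Y 0 = 0" by (simp add: Y_def)
   then show ?thesis unfolding True continuous_at_eps_delta using lim by simp
  next
   case False
   then have "\<sigma> \<in> ball 0 r - {0}" using that by auto
   then show ?thesis
    using holomorphic_on_imp_continuous_on[OF hol0] continuous_on_eq_continuous_at[of "ball 0 r - {0}" Y]
    by (auto simp: open_delete)
  qed
  then show ?thesis by (simp add: continuous_at_imp_continuous_on)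
 qed
 then have holY: "Y holomorphic_on ball 0 r"
  by (rule no_isolated_singularity[OF _ hol0]) auto
 have odd: "Y (-\<sigma>) \<noteq> Y \<sigma>" if \<sigma>: "\<sigma> \<noteq> 0" "cmod \<sigma> < r" and "even N" for \<sigma>
 proof
  assume eq: "Y (-\<sigma>) = Y \<sigma>"
  obtain M where M: "N = 2 * M" using \<open>even N\<close> by (auto elim: evenE)
  let ?w = "Ln \<sigma>"
  have w: "Re ?w < ln r" "exp ?w = \<sigma>" using ReLn[OF \<sigma>] \<sigma> by auto
  have "exp (?w + \<i> * pi) = -\<sigma>" using \<sigma> by (simp add: exp_add)
  then have "Y (-\<sigma>) = g (of_nat N * (?w + \<i> * pi))" using Yexp[of "?w + \<i> * pi"] w by simp
  also have "of_nat N * (?w + \<i> * pi) = of_nat N * ?w + p (int M)" by (simp add: M p_def algebra_simps)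
  finally have "g (of_nat N * ?w + p (int M)) = g (of_nat N * ?w + p 0)"
   using eq Yexp[OF w(1)] w(2) by (simp add: padd)
  from glob[OF inT[OF w(1)] this w0(1)] have "P M" using N M by (simp add: P_def padd)
  then show False using Nmin[of M] M N by simp
 qed
 have "Y (of_real (root N s0)) = z0"
 proof -
  have "exp (of_real (ln (root N s0))) = complex_of_real (root N s0)"
   using s0 N by (metis exp_ln exp_of_real real_root_gt_zero)
  moreover have "ln (root N s0) < ln r" using s0 s1 N by (simp add: r_def real_root_less_iff)
  moreover have "of_nat N * complex_of_real (ln (root N s0)) = w0"
  proof -
   have "real N * ln (root N s0) = ln s0" using N s0 by (simp add: ln_root)
   then show ?thesis by (metis of_real_mult of_real_of_nat_eq w0_def)
  qed
  ultimately show ?thesis using Yexp[of "of_real (ln (root N s0))"] g(2) by (metis Re_complex_of_real)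
 qed
 moreover have "Y 0 = 0" by (simp add: Y_def)
 ultimately show ?thesis
  using N holY odd Yrt' unfolding r_def
  by (intro exI[of _ N] exI[of _ Y]) auto
qed

section \<open>Real roots and the gaps between them\<close>

lemma holomorphic_comp:
 assumes "g holomorphic_on T" "f holomorphic_on S" "f ` S \<subseteq> T"
 shows "(\<lambda>x. g (f x)) holomorphic_on S"
 using holomorphic_on_compose_gen[OF assms(2,1,3)] by (simp add: o_def)

text \<open>The conjugate of a section is a section and agrees with it at \<open>t0\<close>, where
  the value is real; hence both coincide.\<close>

lemma real_section:
 assumes "root_family_const T f \<rho> R e" and T: "convex (T :: real set)"
  and conj: "\<And>t z. t \<in> T ==> cmod z < \<rho> ==> f t (cnj z) = cnj (f t z)"
  and t0: "t0 \<in> T" and y: "\<bar>y\<bar> < \<rho>" "f t0 (complex_of_real y) = 0"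
 shows "\<exists>g. continuous_on T g \<and> g t0 = y \<and> (\<forall>t\<in>T. \<bar>g t\<bar> < \<rho> \<and> f t (complex_of_real (g t)) = 0)"
proof -
 interpret root_family_const T f \<rho> R e by fact
 have "complex_of_real y \<in> rts t0" using y by (simp add: rts_def)
 from section_exists[OF T t0 this] obtain g where
  g: "continuous_on T g" "g t0 = complex_of_real y" "\<forall>t\<in>T. g t \<in> rts t" by blast
 have "cnj (g t) = g t" if "t \<in> T" for t
  using section_unique[OF convex_connected[OF T], of "\<lambda>t. cnj (g t)" g t0 t] g t0 that conj
  by (auto intro!: continuous_intros simp: rts_def)
 then have "g t = complex_of_real (Re (g t))" if "t \<in> T" for t
  using that by (metis Reals_cnj_iff of_real_Re)
 then have *: "cmod (g t) = \<bar>Re (g t)\<bar>" "f t (of_real (Re (g t))) = f t (g t)" if "t \<in> T" for t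
  using that by (metis norm_of_real, metis)
 show ?thesis
  by (intro exI[of _ "\<lambda>t. Re (g t)"]) (use g * in \<open>auto intro!: continuous_intros simp: rts_def\<close>)
qed

text \<open>Different sections never meet, so by the intermediate value theorem real ones cannot
  change their order.\<close>

lemma real_sections_ordered:
 assumes "root_family_const T f \<rho> R e" and T: "convex (T :: real set)"
  and g: "continuous_on T g" "\<And>t. t \<in> T ==> \<bar>g t\<bar> < \<rho> \<and> f t (complex_of_real (g t)) = 0"
  and h: "continuous_on T h" "\<And>t. t \<in> T ==> \<bar>h t\<bar> < \<rho> \<and> f t (complex_of_real (h t)) = 0"
  and t0: "t0 \<in> T" "g t0 < h t0" and t: "t \<in> T"
 shows "g t < h t"
proof (rule ccontr)
 interpret root_family_const T f \<rho> R e by fact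
 assume "\<not> g t < h t"
 have "connected ((\<lambda>t. h t - g t) ` T)"
  using convex_connected[OF T] g h by (intro connected_continuous_image continuous_intros)
 moreover have "h t - g t \<in> (\<lambda>t. h t - g t) ` T" "h t0 - g t0 \<in> (\<lambda>t. h t - g t) ` T"
  using t t0 by auto
 ultimately have "0 \<in> (\<lambda>t. h t - g t) ` T"
  using \<open>\<not> g t < h t\<close> t0 connected_contains_Icc[of "(\<lambda>t. h t - g t) ` T" "h t - g t" "h t0 - g t0"]
  by (auto dest!: subsetD[of _ _ 0])
 then obtain a where a: "a \<in> T" "g a = h a" by auto
 have "complex_of_real (g t0) = complex_of_real (h t0)"
  by (rule section_unique[OF convex_connected[OF T], of "\<lambda>t. of_real (g t)" "\<lambda>t. of_real (h t)" a t0])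
   (use g h a t0 in \<open>auto intro!: continuous_intros simp: rts_def\<close>)
 then show False using t0 by simp
qed

text \<open>A value that is no root lies between two neighbouring real roots at \<open>t0\<close>,
  with \<open>-\<rho>\<close> and \<open>\<rho>\<close> standing in for missing ones. Their sections
  bound a strip over all of \<open>T\<close>; a root inside the strip would continue to a section
  that lies between the two at \<open>t0\<close>, where there is none.\<close>

lemma real_root_gap:
 assumes F: "root_family_const T f \<rho> R e" and T: "convex (T :: real set)"
  and conj: "\<And>t z. t \<in> T ==> cmod z < \<rho> ==> f t (cnj z) = cnj (f t z)"
  and t0: "t0 \<in> T" and y: "\<bar>y\<bar> < \<rho>" "f t0 (complex_of_real y) \<noteq> 0"
 shows "\<exists>lo hi. continuous_on T lo \<and> continuous_on T hi \<and> lo t0 < y \<and> y < hi t0 \<and>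
   (lo = (\<lambda>_. -\<rho>) \<or> (\<forall>t\<in>T. \<bar>lo t\<bar> < \<rho> \<and> f t (complex_of_real (lo t)) = 0)) \<and>
   (hi = (\<lambda>_. \<rho>) \<or> (\<forall>t\<in>T. \<bar>hi t\<bar> < \<rho> \<and> f t (complex_of_real (hi t)) = 0)) \<and>
   (\<forall>t\<in>T. lo t < hi t \<and> -\<rho> \<le> lo t \<and> hi t \<le> \<rho>) \<and>
   (\<forall>t\<in>T. \<forall>v. lo t < v --> v < hi t --> f t (complex_of_real v) \<noteq> 0)"
proof -
 interpret root_family_const T f \<rho> R e by fact
 have sec: "\<exists>g. continuous_on T g \<and> g t = v \<and> (\<forall>t\<in>T. \<bar>g t\<bar> < \<rho> \<and> f t (complex_of_real (g t)) = 0)"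
  if "t \<in> T" "\<bar>v\<bar> < \<rho>" "f t (complex_of_real v) = 0" for t v
  using real_section[OF F T conj that] by blast
 let ?A = "{v. \<bar>v\<bar> < \<rho> \<and> f t0 (complex_of_real v) = 0}"
 have "of_real ` ?A \<subseteq> rts t0" by (auto simp: rts_def)
 then have finA: "finite ?A"
  using finite_rts[OF t0] finite_subset finite_imageD inj_of_real by (metis (no_types, lifting) inj_on_subset subset_UNIV)
 have finA': "finite {v\<in>?A. v < y}" "finite {v\<in>?A. y < v}" by (rule finite_subset[OF _ finA], blast)+
 define S where "S g \<longleftrightarrow> continuous_on T g \<and> (\<forall>t\<in>T. \<bar>g t\<bar> < \<rho> \<and> f t (complex_of_real (g t)) = 0)" for g
 have ord: "g t < h t" if "S g" "S h" "a \<in> T" "g a < h a" "t \<in> T" for g h a t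
  using real_sections_ordered[OF F T] that unfolding S_def by blast
 have "\<exists>lo. continuous_on T lo \<and> lo t0 < y \<and> (lo = (\<lambda>_. -\<rho>) \<or> S lo) \<and>
   (\<forall>g. S g --> g t0 < y --> g t0 \<le> lo t0)"
 proof (cases "{v\<in>?A. v < y} = {}")
  case True
  then show ?thesis using y t0 by (intro exI[of _ "\<lambda>_. -\<rho>"]) (auto simp: S_def)
 next
  case False
  define a where "a = Max {v\<in>?A. v < y}"
  have "a \<in> {v\<in>?A. v < y}" unfolding a_def using finA' False by (intro Max_in)
  moreover from this obtain lo where "continuous_on T lo" "lo t0 = a" "S lo"
   using sec[OF t0] unfolding S_def by blast
  moreover have "g t0 \<le> a" if "S g" "g t0 < y" for g
   unfolding a_def using finA' that t0 by (intro Max_ge) (auto simp: S_def)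
  ultimately show ?thesis by (intro exI[of _ lo]) auto
 qed
 then obtain lo where lo: "continuous_on T lo" "lo t0 < y" "lo = (\<lambda>_. -\<rho>) \<or> S lo"
   "\<And>g. S g ==> g t0 < y ==> g t0 \<le> lo t0" by blast
 have "\<exists>hi. continuous_on T hi \<and> y < hi t0 \<and> (hi = (\<lambda>_. \<rho>) \<or> S hi) \<and>
   (\<forall>g. S g --> y < g t0 --> hi t0 \<le> g t0)"
 proof (cases "{v\<in>?A. y < v} = {}")
  case True
  then show ?thesis using y t0 by (intro exI[of _ "\<lambda>_. \<rho>"]) (auto simp: S_def)
 next
  case False
  define a where "a = Min {v\<in>?A. y < v}"
  have "a \<in> {v\<in>?A. y < v}" unfolding a_def using finA' False by (intro Min_in)
  moreover from this obtain hi where "continuous_on T hi" "hi t0 = a" "S hi"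
   using sec[OF t0] unfolding S_def by blast
  moreover have "a \<le> g t0" if "S g" "y < g t0" for g
   unfolding a_def using finA' that t0 by (intro Min_le) (auto simp: S_def)
  ultimately show ?thesis by (intro exI[of _ hi]) auto
 qed
 then obtain hi where hi: "continuous_on T hi" "y < hi t0" "hi = (\<lambda>_. \<rho>) \<or> S hi"
   "\<And>g. S g ==> y < g t0 ==> hi t0 \<le> g t0" by blast
 have bnd: "-\<rho> \<le> lo t" "hi t \<le> \<rho>" if "t \<in> T" for t
 proof -
  show "-\<rho> \<le> lo t" using lo(3) that unfolding S_def by (auto dest!: bspec[of _ _ t])
  show "hi t \<le> \<rho>" using hi(3) that unfolding S_def by (auto dest!: bspec[of _ _ t])
 qed
 have lohi: "lo t < hi t" if "t \<in> T" for t
 proof -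
  consider "S lo" "S hi" | "lo = (\<lambda>_. -\<rho>)" "S hi" | "hi = (\<lambda>_. \<rho>)" "S lo" | "lo = (\<lambda>_. -\<rho>)" "hi = (\<lambda>_. \<rho>)"
   using lo(3) hi(3) by blast
  then show ?thesis
  proof cases
   case 1 then show ?thesis using ord[OF 1 t0 _ that] lo(2) hi(2) by simp
  next
   case 2 then show ?thesis using that unfolding S_def by (auto dest!: bspec[of _ _ t])
  next
   case 3 then show ?thesis using that unfolding S_def by (auto dest!: bspec[of _ _ t])
  next
   case 4 then show ?thesis using y by auto
  qed
 qed
 have gap: "f t (complex_of_real v) \<noteq> 0" if t: "t \<in> T" and v: "lo t < v" "v < hi t" for t v
 proof
  assume "f t (complex_of_real v) = 0"
  moreover have "\<bar>v\<bar> < \<rho>" using v bnd[OF t] by auto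
  ultimately obtain g where g: "S g" "g t = v" using sec[OF t] unfolding S_def by blast
  have "lo t0 < g t0"
  proof (cases "S lo")
   case True then show ?thesis using ord[OF True g(1) t _ t0] v g(2) by simp
  next
   case False
   then have "lo t0 = -\<rho>" using lo(3) by auto
   then show ?thesis using g(1) t0 unfolding S_def by auto
  qed
  moreover have "g t0 < hi t0"
  proof (cases "S hi")
   case True then show ?thesis using ord[OF g(1) True t _ t0] v g(2) by simp
  next
   case False
   then have "hi t0 = \<rho>" using hi(3) by auto
   then show ?thesis using g(1) t0 unfolding S_def by auto
  qed
  moreover have "g t0 \<noteq> y" using g(1) y(2) t0 unfolding S_def by auto
  ultimately show False using lo(4)[OF g(1)] hi(4)[OF g(1)] by linarith
 qed
 show ?thesis
  using lo(1-3) hi(1-3) bnd lohi gap unfolding S_def by (intro exI[of _ lo] exI[of _ hi]) blast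
qed

text \<open>An arc that separates the two given ones for positive parameters; the odd monomial
 makes it take different values at opposite parameters.\<close>

lemma holomorphic_between:
 assumes hol: "L holomorphic_on ball 0 r" "U holomorphic_on ball 0 r" and "0 < r"
  and real: "\<And>s. s \<in> \<real> ==> s \<in> ball 0 r ==> L s \<in> \<real> \<and> U s \<in> \<real>"
  and lt: "\<And>s::real. 0 < s ==> s < r ==> Re (L (of_real s)) < Re (U (of_real s))"
  and zero: "L 0 = 0" "U 0 = 0"
 shows "\<exists>Y s1. 0 < s1 \<and> s1 \<le> r \<and> Y holomorphic_on ball 0 s1 \<and> Y 0 = 0 \<and>
  (\<forall>s. s \<in> \<real> --> s \<in> ball 0 s1 --> Y s \<in> \<real>) \<and>
  (\<forall>s::real. 0 < s --> s < s1 --> Re (L (of_real s)) < Re (Y (of_real s)) \<and> Re (Y (of_real s)) < Re (U (of_real s))) \<and>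
  (\<forall>s. s \<noteq> 0 --> s \<in> ball 0 s1 --> Y (-s) \<noteq> Y s)"
proof -
 define d where "d s = U s - L s" for s
 have hd: "d holomorphic_on ball 0 r" unfolding d_def by (intro holomorphic_intros hol)
 have "d (of_real (r/2)) \<noteq> 0" using lt[of "r/2"] \<open>0 < r\<close> by (auto simp: d_def complex_eq_iff)
 then have "\<exists>w\<in>ball 0 r. d w \<noteq> 0" using \<open>0 < r\<close> by (intro bexI[of _ "of_real (r/2)"]) auto
 define n where "n = nat (zorder d 0)"
 define g where "g = zor_poly d 0"
 obtain q where
  q: "0 < q" "cball 0 q \<subseteq> ball (0::complex) r" "g holomorphic_on cball 0 q" "\<forall>w\<in>cball 0 q. d w = g w * w ^ n \<and> g w \<noteq> 0"
 proof -
  have "0 \<in> ball (0::complex) r" using \<open>0 < r\<close> by simp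
  from conjunct2[OF zorder_exist_zero[OF hd open_ball connected_ball this \<open>\<exists>w\<in>ball 0 r. d w \<noteq> 0\<close>]]
  show thesis using that
   unfolding n_def[symmetric] g_def[symmetric] diff_zero by auto
 qed
 have "\<exists>c>0. \<exists>q'>0. q' \<le> q \<and> (\<forall>w\<in>ball 0 q'. c \<le> cmod (g w))"
 proof -
  have "isCont g 0"
   using holomorphic_on_imp_continuous_on[OF q(3)] q(1)
   by (intro continuous_on_interior[of "cball 0 q"]) auto
  moreover have "g 0 \<noteq> 0" using q by auto
  ultimately obtain q' where q': "q' > 0" "\<And>w. dist w 0 < q' ==> dist (g w) (g 0) < cmod (g 0) / 2"
   unfolding continuous_at_eps_delta by (metis half_gt_zero zero_less_norm_iff)
  have "cmod (g 0) / 2 \<le> cmod (g w)" if "w \<in> ball 0 (min q q')" for w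
   using q'(2)[of w] that norm_triangle_ineq2[of "g 0" "g w"] by (auto simp: dist_norm norm_minus_commute)
  then show ?thesis using q' q(1) \<open>g 0 \<noteq> 0\<close> by (intro exI[of _ "cmod (g 0) / 2"]) (auto intro!: exI[of _ "min q q'"])
 qed
 then obtain c q' where c: "0 < c" "0 < q'" "q' \<le> q" "\<And>w. w \<in> ball 0 q' ==> c \<le> cmod (g w)" by blast
 define W where "W s = (L s + U s) / 2" for s
 \<comment> \<open>Odd, so that the monomial changes sign with \<open>s\<close>, and larger than the
   order \<open>n\<close> at which the gap closes, so that for small positive \<open>s\<close> the
   monomial is less than half of the gap.\<close>
 define M where "M = 2 * n + 1"
 define Y where "Y \<theta> s = W s + complex_of_real \<theta> * s ^ M" for \<theta> s
 define D where "D \<theta> s = Y \<theta> s - Y \<theta> (-s)" for \<theta> s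
 define s0 where "s0 = Min {q', 1, c/2}"
 have s0: "0 < s0" "s0 \<le> q'" "s0 \<le> 1" "s0 \<le> c/2" "s0 \<le> r"
 proof -
  show "0 < s0" "s0 \<le> q'" "s0 \<le> 1" "s0 \<le> c/2" using c by (auto simp: s0_def)
  have "complex_of_real q \<in> ball 0 r" using q(1,2) by (intro subsetD[OF q(2)]) auto
  then have "q \<le> r" using q(1) by simp
  then show "s0 \<le> r" using c \<open>s0 \<le> q'\<close> by linarith
 qed
 have holW: "W holomorphic_on ball 0 r" unfolding W_def by (intro holomorphic_intros hol) auto
 have holY: "Y \<theta> holomorphic_on ball 0 r" for \<theta> unfolding Y_def by (intro holomorphic_intros holW)
 have holD: "D \<theta> holomorphic_on ball 0 r" for \<theta>
 proof -
  have "(\<lambda>s. Y \<theta> (-s)) holomorphic_on ball 0 r"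
   by (rule holomorphic_comp[OF holY]) (auto intro!: holomorphic_intros)
  then show ?thesis unfolding D_def by (intro holomorphic_intros holY)
 qed
 \<comment> \<open>At \<open>s0/2\<close> the values of \<open>D\<close> for the two choices of
   \<open>\<theta>\<close> differ by the nonzero number \<open>(s0/2) ^ M\<close>, so at least one
   of them is nonzero.\<close>
 have "\<exists>\<theta>\<in>{1/2,1}. D \<theta> (of_real (s0/2)) \<noteq> 0"
 proof (rule ccontr)
  assume *: "\<not> ?thesis"
  have odd: "(- x) ^ M = - (x ^ M)" for x :: complex by (simp add: M_def)
  have "D 1 (of_real (s0/2)) - D (1/2) (of_real (s0/2)) = complex_of_real (s0/2) ^ M"
   by (simp add: D_def Y_def odd algebra_simps)
  then show False using * s0 by simp
 qed
 then obtain \<theta> where \<theta>: "\<theta> \<in> {1/2,1::real}" "D \<theta> (of_real (s0/2)) \<noteq> 0" by blast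
 have "\<exists>s1>0. s1 \<le> s0 \<and> (\<forall>s\<in>ball 0 s1 - {0}. D \<theta> s \<noteq> 0)"
 proof -
  have "of_real (s0/2) \<in> ball (0::complex) r" using s0 by auto
  from non_zero_neighbour_alt[OF holD _ _ _ this \<theta>(2), of 0] have "eventually (\<lambda>w. D \<theta> w \<noteq> 0 \<and> w \<in> ball 0 r) (at 0)"
   using \<open>0 < r\<close> by auto
  then obtain s' where "s' > 0" "\<forall>w. w \<noteq> 0 \<and> dist w 0 < s' --> D \<theta> w \<noteq> 0" by (auto simp: eventually_at)
  then show ?thesis using s0 by (intro exI[of _ "min s' s0"]) auto
 qed
 then obtain s1 where s1: "0 < s1" "s1 \<le> s0" "\<And>s. s \<in> ball 0 s1 - {0} ==> D \<theta> s \<noteq> 0" by blast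
 show ?thesis
 proof (intro exI[of _ "Y \<theta>"] exI[of _ s1] conjI allI impI)
  show "Y \<theta> holomorphic_on ball 0 s1" using holY by (rule holomorphic_on_subset) (use s0 s1 in auto)
  show "Y \<theta> 0 = 0" by (simp add: Y_def W_def zero M_def)
  show "Y \<theta> s \<in> \<real>" if "s \<in> \<real>" "s \<in> ball 0 s1" for s
   using real[OF that(1)] that s1 s0 by (auto simp: Y_def W_def intro!: Reals_add Reals_mult Reals_power Reals_divide)
  show "Y \<theta> (- s) \<noteq> Y \<theta> s" if "s \<noteq> 0" "s \<in> ball 0 s1" for s using s1(3)[of s] that by (auto simp: D_def)
  fix s :: real assume s: "0 < s" "s < s1"
  then have sr: "complex_of_real s \<in> ball 0 r" "complex_of_real s \<in> ball 0 q'" "complex_of_real s \<in> cball 0 q" "complex_of_real s \<in> \<real>"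
   using s1 s0 c by auto
  have LU: "L (of_real s) \<in> \<real>" "U (of_real s) \<in> \<real>" using real sr by auto
  let ?dd = "Re (U (of_real s)) - Re (L (of_real s))"
  have "?dd = cmod (d (of_real s))"
   using LU lt[of s] s s1 s0 by (auto simp: d_def elim!: Reals_cases simp flip: of_real_diff)
  also have "\<dots> = cmod (g (of_real s)) * s ^ n" using bspec[OF q(4) sr(3)] s by (simp add: norm_mult norm_power)
  also have "\<dots> \<ge> c * s ^ n" using c(4)[OF sr(2)] s by (intro mult_right_mono) auto
  finally have dd: "?dd \<ge> c * s ^ n" .
  have "s ^ M = s * (s ^ n * s ^ n)" by (simp add: M_def power_add mult_2)
  also have "\<dots> \<le> s * (s ^ n * 1)"
   using s s1 s0 by (intro mult_left_mono mult_left_mono power_le_one) auto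
  also have "\<dots> < (c/2) * s ^ n" using s s1 s0 by simp
  finally have sM: "s ^ M < ?dd / 2" using dd by simp
  have "0 < s ^ M" using s by simp
  have "Re (Y \<theta> (of_real s)) = (Re (L (of_real s)) + Re (U (of_real s))) / 2 + \<theta> * s ^ M"
   by (simp add: Y_def W_def)
  moreover have "\<theta> * s ^ M \<le> s ^ M" "0 < \<theta> * s ^ M" using \<theta>(1) \<open>0 < s ^ M\<close> by auto
  ultimately show "Re (L (of_real s)) < Re (Y \<theta> (of_real s))" "Re (Y \<theta> (of_real s)) < Re (U (of_real s))"
   using sM by (auto simp: field_simps)
 qed (use s1 s0 in auto)
qed

text \<open>Schwarz reflection: \<open>Y\<close> and its conjugate by \<open>cnj\<close> agree on
  the positive reals and hence, by the identity theorem, on the whole disc.\<close>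

lemma holomorphic_real_on_reals:
 assumes hol: "Y holomorphic_on ball 0 r" and r: "0 < r"
  and real: "\<And>s::real. 0 < s ==> s < r ==> Y (of_real s) \<in> \<real>"
  and s: "s \<in> \<real>" "s \<in> ball 0 r"
 shows "Y s \<in> \<real>"
proof -
 have h2: "(cnj \<circ> Y \<circ> cnj) holomorphic_on ball 0 r"
  by (rule holomorphic_on_compose_cnj_cnj) (auto intro!: holomorphic_on_subset[OF hol])
 let ?d = "\<lambda>w. Y w - cnj (Y (cnj w))"
 have hd: "?d holomorphic_on ball 0 r" using h2 by (intro holomorphic_intros hol) (simp add: o_def)
 have "?d s = 0"
 proof (rule analytic_continuation[OF hd open_ball connected_ball, of "of_real ` {0<..<r}" "of_real (r/2)"])
  show "complex_of_real (r / 2) islimpt of_real ` {0<..<r}"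
  proof (rule islimpt_isCont_image)
   show "r / 2 islimpt {0<..<r}" using r by (intro interior_limit_point) simp
   show "\<forall>\<^sub>F y in at (r / 2). complex_of_real y \<noteq> complex_of_real (r / 2)"
    unfolding of_real_eq_iff by (simp add: eventually_at_filter)
  qed auto
  fix z :: complex assume "z \<in> of_real ` {0<..<r}"
  then obtain x where "z = of_real x" "0 < x" "x < r" by auto
  then show "Y z - cnj (Y (cnj z)) = 0" using real[of x] by (simp add: Reals_cnj_iff)
 qed (use r s in auto)
 then show ?thesis using s(1) by (simp add: Reals_cnj_iff)
qed

section \<open>Arcs over a base of one parameter\<close>

lemma root_family_compose:
 fixes u :: "'b::metric_space \<Rightarrow> 'a::metric_space"
 assumes "root_family T f \<rho> R" "continuous_on S u" "u ` S \<subseteq> T"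
 shows "root_family S (\<lambda>s. f (u s)) \<rho> R"
proof -
 interpret root_family T f \<rho> R by fact
 show ?thesis
 proof
  show "continuous_on (S \<times> ball 0 R) (\<lambda>(t, z). f (u t) z)"
   unfolding split_beta
   by (intro continuous_on_compose2[OF cont[unfolded split_beta], of _ "\<lambda>x. (u (fst x), snd x)", simplified]
     continuous_intros continuous_on_compose2[OF assms(2)]) (use assms(3) in auto)
 qed (use \<rho> hol nz assms(3) in auto)
qed

lemma root_family_const_compose:
 assumes "root_family T f \<rho> R" "continuous_on S u" "u ` S \<subseteq> T"
  and "\<And>s. s \<in> S ==> card {z. cmod z < \<rho> \<and> f (u s) z = 0} = e"
 shows "root_family_const S (\<lambda>s. f (u s)) \<rho> R e"
proof -
 interpret root_family S "\<lambda>s. f (u s)" \<rho> R using root_family_compose[OF assms(1-3)] .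
 show ?thesis by unfold_locales (use assms(4) in \<open>simp add: rts_def\<close>)
qed

text \<open>What is left when the base is restricted to an arc: \<open>s\<close> is the parameter of
  the arc, \<open>z\<close> the coordinate that was eliminated. \<open>zero\<close> says that all
  roots come together at the origin, and \<open>conj\<close> that the coefficients are real.\<close>

locale plane_family =
 fixes G :: "complex \<Rightarrow> complex \<Rightarrow> complex" and \<rho> R s1 :: real and e :: nat
 assumes fam: "root_family (ball 0 s1) G \<rho> R" and s1: "0 < s1"
  and card: "\<And>s. s \<in> ball 0 s1 - {0} ==> card {z. cmod z < \<rho> \<and> G s z = 0} = e"
  and zero: "\<And>z. cmod z < \<rho> ==> G 0 z = 0 ==> z = 0"
  and holG: "\<And>z. z \<in> ball 0 R ==> (\<lambda>s. G s z) holomorphic_on ball 0 s1"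
  and conj: "\<And>s z. s \<in> ball 0 s1 ==> z \<in> ball 0 R ==> G (cnj s) (cnj z) = cnj (G s z)"
begin

lemma root_pow_in:
 assumes "0 < N" "\<sigma> \<in> {0<..<root N s1}" shows "\<sigma> ^ N \<in> {0<..<s1}" "of_real \<sigma> ^ N \<in> ball (0::complex) s1 - {0}"
proof -
 have "\<sigma> ^ N < root N s1 ^ N" using assms by (intro power_strict_mono) auto
 then show "\<sigma> ^ N \<in> {0<..<s1}" using assms s1 by simp
 then show "of_real \<sigma> ^ N \<in> ball (0::complex) s1 - {0}" using assms by (auto simp: norm_power)
qed

lemma real_family_pow:
 assumes "0 < N"
 shows "root_family_const {0<..<root N s1} (\<lambda>\<sigma>. G (of_real \<sigma> ^ N)) \<rho> R e"
 by (rule root_family_const_compose[OF fam]) (use root_pow_in[OF assms] card in \<open>auto intro!: continuous_intros\<close>)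

lemma real_family: "root_family_const {0<..<s1} (\<lambda>\<sigma>. G (of_real \<sigma>)) \<rho> R e"
 using real_family_pow[of 1] s1 by simp

lemma real_conj: "s \<in> {0<..<s1} ==> cmod z < \<rho> ==> G (of_real s) (cnj z) = cnj (G (of_real s) z)"
 using conj[of "of_real s" z] root_family.\<rho>[OF fam] by auto

text \<open>The Puiseux root is started at the value \<open>lo (s1/2)\<close>. Over positive
  parameters unique lifting identifies it with \<open>lo\<close>; so it is real there and, by
  reflection, on the whole real diameter.\<close>

lemma puiseux_real_section:
 assumes lo: "continuous_on {0<..<s1} lo" "\<And>s. s \<in> {0<..<s1} ==> \<bar>lo s\<bar> < \<rho> \<and> G (of_real s) (of_real (lo s)) = 0"
 obtains N Y where "0 < N" "Y holomorphic_on ball 0 (root N s1)" "Y 0 = 0"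
  "\<And>\<sigma>. \<sigma> \<in> ball 0 (root N s1) ==> cmod (Y \<sigma>) < \<rho>"
  "\<And>\<sigma>. \<sigma> \<in> ball 0 (root N s1) ==> \<sigma> \<in> \<real> ==> Y \<sigma> \<in> \<real>"
  "\<And>\<sigma>. \<sigma> \<in> {0<..<root N s1} ==> Y (of_real \<sigma>) = of_real (lo (\<sigma> ^ N))"
  "\<And>\<sigma>. even N ==> \<sigma> \<in> ball 0 (root N s1) - {0} ==> Y (-\<sigma>) \<noteq> Y \<sigma>"
proof -
 have s2: "s1/2 \<in> {0<..<s1}" using s1 by simp
 obtain N Y where N: "0 < N" "Y holomorphic_on ball 0 (root N s1)" "Y 0 = 0"
   "\<forall>\<sigma>\<in>ball 0 (root N s1) - {0}. cmod (Y \<sigma>) < \<rho> \<and> G (\<sigma>^N) (Y \<sigma>) = 0"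
   "Y (of_real (root N (s1/2))) = of_real (lo (s1/2))"
   "\<forall>\<sigma>\<in>ball 0 (root N s1) - {0}. even N --> Y (-\<sigma>) \<noteq> Y \<sigma>"
 proof -
  have "0 < s1/2" "s1/2 < s1" "cmod (of_real (lo (s1/2))) < \<rho>" "G (of_real (s1/2)) (of_real (lo (s1/2))) = 0"
   using s1 lo(2)[OF s2] by auto
  note P = puiseux_root[OF fam s1 card zero holG this]
  have "\<exists>N Y. 0 < N \<and> N \<le> e \<and> Y holomorphic_on ball 0 (root N s1) \<and> Y 0 = 0 \<and>
    (\<forall>\<sigma>\<in>ball 0 (root N s1) - {0}. cmod (Y \<sigma>) < \<rho> \<and> G (\<sigma>^N) (Y \<sigma>) = 0) \<and>
    Y (of_real (root N (s1/2))) = of_real (lo (s1/2)) \<and>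
    (\<forall>\<sigma>\<in>ball 0 (root N s1) - {0}. even N --> Y (-\<sigma>) \<noteq> Y \<sigma>)"
   by (rule P) assumption+
  then show thesis by (elim exE conjE) (rule that; assumption)
 qed
 interpret F: root_family_const "{0<..<root N s1}" "\<lambda>\<sigma>. G (of_real \<sigma> ^ N)" \<rho> R e
  by (rule real_family_pow[OF N(1)])
 have \<rho>: "0 < \<rho>" by (rule F.\<rho>)
 have bnd: "cmod (Y \<sigma>) < \<rho>" if "\<sigma> \<in> ball 0 (root N s1)" for \<sigma> using N(3,4) \<rho> that by (cases "\<sigma> = 0") auto
 have eq: "Y (of_real \<sigma>) = of_real (lo (\<sigma> ^ N))" if "\<sigma> \<in> {0<..<root N s1}" for \<sigma>
 proof (rule F.section_unique[of "\<lambda>\<sigma>. Y (of_real \<sigma>)" "\<lambda>\<sigma>. of_real (lo (\<sigma> ^ N))" "root N (s1/2)" \<sigma>])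
  show "continuous_on {0<..<root N s1} (\<lambda>\<sigma>. Y (of_real \<sigma>))"
   by (intro continuous_on_compose2[OF holomorphic_on_imp_continuous_on[OF N(2)]] continuous_intros) auto
  show "continuous_on {0<..<root N s1} (\<lambda>\<sigma>. complex_of_real (lo (\<sigma> ^ N)))"
   using root_pow_in(1)[OF N(1)] by (intro continuous_intros continuous_on_compose2[OF lo(1)]) auto
  show "Y (of_real t) \<in> F.rts t" if "t \<in> {0<..<root N s1}" for t
   using N(4) that by (auto simp: F.rts_def)
  show "complex_of_real (lo (t ^ N)) \<in> F.rts t" if "t \<in> {0<..<root N s1}" for t
   using lo(2)[OF root_pow_in(1)[OF N(1) that]] by (auto simp: F.rts_def)
  show "root N (s1/2) \<in> {0<..<root N s1}" using s1 N(1) by simp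
  show "Y (of_real (root N (s1/2))) = of_real (lo (root N (s1/2) ^ N))" using N(1,5) s1 by simp
 qed (use that in auto)
 have re: "Y \<sigma> \<in> \<real>" if "\<sigma> \<in> ball 0 (root N s1)" "\<sigma> \<in> \<real>" for \<sigma>
  by (rule holomorphic_real_on_reals[OF N(2) _ _ that(2,1)]) (use eq s1 N(1) in auto)
 show thesis using that[OF N(1,2,3) bnd re eq] N(6) by blast
qed

text \<open>A bound that is a root section is replaced by its Puiseux parametrisation; two of them
  are brought to the common exponent \<open>N1 * N2\<close>. The constant bounds
  \<open>-\<rho>\<close> and \<open>\<rho>\<close> do not tend to 0, so in their place the other arc
  is displaced by \<open>\<sigma>\<close>, or \<open>-\<sigma>\<close> and \<open>\<sigma>\<close>
  are used when both bounds are constant.\<close>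

lemma gap_arcs:
 assumes lo: "continuous_on {0<..<s1} lo" "lo = (\<lambda>_. -\<rho>) \<or> (\<forall>s\<in>{0<..<s1}. \<bar>lo s\<bar> < \<rho> \<and> G (of_real s) (of_real (lo s)) = 0)"
  and hi: "continuous_on {0<..<s1} hi" "hi = (\<lambda>_. \<rho>) \<or> (\<forall>s\<in>{0<..<s1}. \<bar>hi s\<bar> < \<rho> \<and> G (of_real s) (of_real (hi s)) = 0)"
  and lohi: "\<forall>s\<in>{0<..<s1}. lo s < hi s"
 shows "\<exists>N L U r. 0 < N \<and> 0 < r \<and> r \<le> root N s1 \<and> L holomorphic_on ball 0 r \<and> U holomorphic_on ball 0 r \<and> L 0 = 0 \<and> U 0 = 0 \<and>
   (\<forall>\<sigma>. \<sigma> \<in> \<real> --> \<sigma> \<in> ball 0 r --> L \<sigma> \<in> \<real> \<and> U \<sigma> \<in> \<real>) \<and>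
   (\<forall>\<sigma>::real. 0 < \<sigma> --> \<sigma> < r --> Re (L (of_real \<sigma>)) < Re (U (of_real \<sigma>)) \<and>
    lo (\<sigma> ^ N) \<le> Re (L (of_real \<sigma>)) \<and> Re (U (of_real \<sigma>)) \<le> hi (\<sigma> ^ N))"
proof -
 interpret F: root_family_const "{0<..<s1}" "\<lambda>\<sigma>. G (of_real \<sigma>)" \<rho> R e by (rule real_family)
 have \<rho>: "0 < \<rho>" by (rule F.\<rho>)
 have small: "\<exists>r. 0 < r \<and> r \<le> r0 \<and> r \<le> \<rho>/2 \<and> (\<forall>\<sigma>\<in>ball 0 r. cmod (Y \<sigma>) < \<rho>/2)"
  if "Y holomorphic_on ball 0 r0" "0 < r0" "Y 0 = 0" for Y r0
 proof -
  have "isCont Y 0" using holomorphic_on_imp_continuous_on[OF that(1)] that(2)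
   by (intro continuous_on_interior[of "ball 0 r0"]) auto
  then obtain d where "d > 0" "\<forall>w. dist w 0 < d --> dist (Y w) (Y 0) < \<rho>/2"
   unfolding continuous_at_eps_delta using \<rho> by (metis half_gt_zero)
  then show ?thesis using that \<rho> by (intro exI[of _ "min (min d r0) (\<rho>/2)"]) auto
 qed
 consider (1) "lo = (\<lambda>_. -\<rho>)" "hi = (\<lambda>_. \<rho>)"
  | (2) "\<forall>s\<in>{0<..<s1}. \<bar>lo s\<bar> < \<rho> \<and> G (of_real s) (of_real (lo s)) = 0" "hi = (\<lambda>_. \<rho>)"
  | (3) "lo = (\<lambda>_. -\<rho>)" "\<forall>s\<in>{0<..<s1}. \<bar>hi s\<bar> < \<rho> \<and> G (of_real s) (of_real (hi s)) = 0"
  | (4) "\<forall>s\<in>{0<..<s1}. \<bar>lo s\<bar> < \<rho> \<and> G (of_real s) (of_real (lo s)) = 0"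
     "\<forall>s\<in>{0<..<s1}. \<bar>hi s\<bar> < \<rho> \<and> G (of_real s) (of_real (hi s)) = 0"
  using lo(2) hi(2) by blast
 then show ?thesis
 proof cases
  case 1
  then show ?thesis using \<rho> s1
   by - (rule exI[of _ 1], rule exI[of _ "\<lambda>\<sigma>. -\<sigma>"], rule exI[of _ "\<lambda>\<sigma>. \<sigma>"], rule exI[of _ "min \<rho> s1"],
    auto intro!: holomorphic_intros)
 next
  case 2
  obtain N Y where N: "0 < N" "Y holomorphic_on ball 0 (root N s1)" "Y 0 = 0"
   "\<And>\<sigma>. \<sigma> \<in> ball 0 (root N s1) ==> \<sigma> \<in> \<real> ==> Y \<sigma> \<in> \<real>"
   "\<And>\<sigma>. \<sigma> \<in> {0<..<root N s1} ==> Y (of_real \<sigma>) = of_real (lo (\<sigma> ^ N))"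
  proof (rule puiseux_real_section[OF lo(1)])
   show "\<bar>lo s\<bar> < \<rho> \<and> G (of_real s) (of_real (lo s)) = 0" if "s \<in> {0<..<s1}" for s using 2(1) that by blast
  qed (rule that; assumption)
  obtain r where r: "0 < r" "r \<le> root N s1" "r \<le> \<rho>/2" "\<forall>\<sigma>\<in>ball 0 r. cmod (Y \<sigma>) < \<rho>/2"
   using small[OF N(2) _ N(3)] s1 N(1) by auto
  have "Re (Y (of_real \<sigma>)) + \<sigma> \<le> \<rho>" if "0 < \<sigma>" "\<sigma> < r" for \<sigma>
   using r(3) bspec[OF r(4), of "of_real \<sigma>"] that abs_Re_le_cmod[of "Y (of_real \<sigma>)"] by auto
  then show ?thesis using N r 2(2)
   by - (rule exI[of _ N], rule exI[of _ Y], rule exI[of _ "\<lambda>\<sigma>. Y \<sigma> + \<sigma>"], rule exI[of _ r],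
    auto intro!: holomorphic_intros Reals_add elim: holomorphic_on_subset)
 next
  case 3
  obtain N Y where N: "0 < N" "Y holomorphic_on ball 0 (root N s1)" "Y 0 = 0"
   "\<And>\<sigma>. \<sigma> \<in> ball 0 (root N s1) ==> \<sigma> \<in> \<real> ==> Y \<sigma> \<in> \<real>"
   "\<And>\<sigma>. \<sigma> \<in> {0<..<root N s1} ==> Y (of_real \<sigma>) = of_real (hi (\<sigma> ^ N))"
  proof (rule puiseux_real_section[OF hi(1)])
   show "\<bar>hi s\<bar> < \<rho> \<and> G (of_real s) (of_real (hi s)) = 0" if "s \<in> {0<..<s1}" for s using 3(2) that by blast
  qed (rule that; assumption)
  obtain r where r: "0 < r" "r \<le> root N s1" "r \<le> \<rho>/2" "\<forall>\<sigma>\<in>ball 0 r. cmod (Y \<sigma>) < \<rho>/2"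
   using small[OF N(2) _ N(3)] s1 N(1) by auto
  have "-\<rho> \<le> Re (Y (of_real \<sigma>)) - \<sigma>" if "0 < \<sigma>" "\<sigma> < r" for \<sigma>
   using r(3) bspec[OF r(4), of "of_real \<sigma>"] that abs_Re_le_cmod[of "Y (of_real \<sigma>)"] by auto
  then show ?thesis using N r 3(1)
   by - (rule exI[of _ N], rule exI[of _ "\<lambda>\<sigma>. Y \<sigma> - \<sigma>"], rule exI[of _ Y], rule exI[of _ r],
    auto intro!: holomorphic_intros Reals_diff elim: holomorphic_on_subset)
 next
  case 4
  obtain N1 Y1 where N1: "0 < N1" "Y1 holomorphic_on ball 0 (root N1 s1)" "Y1 0 = 0"
   "\<And>\<sigma>. \<sigma> \<in> ball 0 (root N1 s1) ==> \<sigma> \<in> \<real> ==> Y1 \<sigma> \<in> \<real>"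
   "\<And>\<sigma>. \<sigma> \<in> {0<..<root N1 s1} ==> Y1 (of_real \<sigma>) = of_real (lo (\<sigma> ^ N1))"
  proof (rule puiseux_real_section[OF lo(1)])
   show "\<bar>lo s\<bar> < \<rho> \<and> G (of_real s) (of_real (lo s)) = 0" if "s \<in> {0<..<s1}" for s using 4(1) that by blast
  qed (rule that; assumption)
  obtain N2 Y2 where N2: "0 < N2" "Y2 holomorphic_on ball 0 (root N2 s1)" "Y2 0 = 0"
   "\<And>\<sigma>. \<sigma> \<in> ball 0 (root N2 s1) ==> \<sigma> \<in> \<real> ==> Y2 \<sigma> \<in> \<real>"
   "\<And>\<sigma>. \<sigma> \<in> {0<..<root N2 s1} ==> Y2 (of_real \<sigma>) = of_real (hi (\<sigma> ^ N2))"
  proof (rule puiseux_real_section[OF hi(1)])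
   show "\<bar>hi s\<bar> < \<rho> \<and> G (of_real s) (of_real (hi s)) = 0" if "s \<in> {0<..<s1}" for s using 4(2) that by blast
  qed (rule that; assumption)
  have pw: "x ^ b < root a s1" if "0 \<le> x" "x < root (a * b) s1" "0 < a" "0 < b" for x a b
  proof -
   have "x ^ (a * b) < root (a * b) s1 ^ (a * b)" using that by (intro power_strict_mono) auto
   also have "\<dots> = root a s1 ^ a" using that s1 by simp
   finally have "(x ^ b) ^ a < root a s1 ^ a" by (simp add: power_mult[symmetric] mult.commute)
   then show ?thesis using s1 that by (intro power_less_imp_less_base[of "x ^ b" a]) auto
  qed
  let ?N = "N1 * N2"
  have a: "\<sigma> ^ N2 \<in> ball 0 (root N1 s1)" "\<sigma> ^ N1 \<in> ball 0 (root N2 s1)" if "\<sigma> \<in> ball 0 (root ?N s1)" for \<sigma> :: complex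
   using pw[of "cmod \<sigma>" N1 N2] pw[of "cmod \<sigma>" N2 N1] that N1(1) N2(1) by (auto simp: norm_power mult.commute)
  have b: "\<sigma> ^ N2 \<in> {0<..<root N1 s1}" "\<sigma> ^ N1 \<in> {0<..<root N2 s1}" if "0 < \<sigma>" "\<sigma> < root ?N s1" for \<sigma> :: real
   using pw[of \<sigma> N1 N2] pw[of \<sigma> N2 N1] that N1(1) N2(1) by (auto simp: mult.commute)
  show ?thesis
  proof (rule exI[of _ ?N], rule exI[of _ "\<lambda>\<sigma>. Y1 (\<sigma> ^ N2)"], rule exI[of _ "\<lambda>\<sigma>. Y2 (\<sigma> ^ N1)"], rule exI[of _ "root ?N s1"],
    intro conjI allI impI)
   have "(\<lambda>\<sigma>. \<sigma> ^ N2) ` ball (0::complex) (root ?N s1) \<subseteq> ball 0 (root N1 s1)" using a(1) by blast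
   then show "(\<lambda>\<sigma>. Y1 (\<sigma> ^ N2)) holomorphic_on ball 0 (root ?N s1)"
    by (intro holomorphic_comp[OF N1(2)] holomorphic_intros)
   have "(\<lambda>\<sigma>. \<sigma> ^ N1) ` ball (0::complex) (root ?N s1) \<subseteq> ball 0 (root N2 s1)" using a(2) by blast
   then show "(\<lambda>\<sigma>. Y2 (\<sigma> ^ N1)) holomorphic_on ball 0 (root ?N s1)"
    by (intro holomorphic_comp[OF N2(2)] holomorphic_intros)
   show "Y1 (\<sigma> ^ N2) \<in> \<real>" "Y2 (\<sigma> ^ N1) \<in> \<real>" if "\<sigma> \<in> \<real>" "\<sigma> \<in> ball 0 (root ?N s1)" for \<sigma>
    using N1(4)[OF a(1)[OF that(2)]] N2(4)[OF a(2)[OF that(2)]] that(1) by (auto intro: Reals_power)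
   fix \<sigma> :: real assume \<sigma>: "0 < \<sigma>" "\<sigma> < root ?N s1"
   have e1: "Y1 (of_real \<sigma> ^ N2) = of_real (lo (\<sigma> ^ ?N))"
    using N1(5)[OF b(1)[OF \<sigma>]] by (simp add: power_mult[symmetric] mult.commute)
   have e2: "Y2 (of_real \<sigma> ^ N1) = of_real (hi (\<sigma> ^ ?N))"
    using N2(5)[OF b(2)[OF \<sigma>]] by (simp add: power_mult[symmetric])
   have "\<sigma> ^ ?N \<in> {0<..<s1}" using root_pow_in(1)[of ?N \<sigma>] \<sigma> N1(1) N2(1) by simp
   then show "Re (Y1 (of_real \<sigma> ^ N2)) < Re (Y2 (of_real \<sigma> ^ N1))" using lohi by (simp add: e1 e2)
   show "lo (\<sigma> ^ ?N) \<le> Re (Y1 (of_real \<sigma> ^ N2))" "Re (Y2 (of_real \<sigma> ^ N1)) \<le> hi (\<sigma> ^ ?N)" by (simp_all add: e1 e2)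
  qed (use N1(1,3) N2(1,3) s1 in \<open>auto simp: zero_power\<close>)
 qed
qed

end

context plane_family begin

text \<open>The zeros of a factor form a subfamily of the zeros of the product, so
  \<open>section_subfamily\<close> applies.\<close>

lemma product_pattern:
 fixes f :: "'k \<Rightarrow> complex \<Rightarrow> complex \<Rightarrow> complex"
 assumes I: "finite I" and G: "\<And>s z. G s z = (\<Prod>i\<in>I. f i s z)"
  and famf: "\<And>i. i \<in> I ==> root_family (ball 0 s1) (f i) \<rho> R"
  and cardf: "\<And>i s. i \<in> I ==> s \<in> ball 0 s1 - {0} ==> card {z. cmod z < \<rho> \<and> f i s z = 0} = ef i"
  and N: "0 < N" and Y: "continuous_on {0<..<root N s1} Y"
   "\<And>\<sigma>. \<sigma> \<in> {0<..<root N s1} ==> cmod (Y \<sigma>) < \<rho> \<and> G (of_real \<sigma> ^ N) (Y \<sigma>) = 0"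
  and i: "i \<in> I" and \<sigma>: "\<sigma> \<in> {0<..<root N s1}" "\<tau> \<in> {0<..<root N s1}"
  and 0: "f i (of_real \<sigma> ^ N) (Y \<sigma>) = 0"
 shows "f i (of_real \<tau> ^ N) (Y \<tau>) = 0"
proof (rule section_subfamily[OF real_family_pow[OF N] _ _ _ Y \<sigma>(1) _ \<sigma>(2),
   of "\<lambda>\<sigma>. f i (of_real \<sigma> ^ N)" "ef i"])
 show "root_family_const {0<..<root N s1} (\<lambda>\<sigma>. f i (of_real \<sigma> ^ N)) \<rho> R (ef i)"
  by (rule root_family_const_compose[OF famf[OF i]]) (use root_pow_in[OF N] cardf[OF i] in \<open>auto intro!: continuous_intros\<close>)
 show "G (of_real t ^ N) z = 0" if "f i (of_real t ^ N) z = 0" for t z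
  unfolding G using I i that by (intro prod_zero bexI[of _ i])
qed (use 0 in auto)

text \<open>If the starting point is a zero of \<open>G\<close>, the Puiseux arc of its root runs
  through it and the path is constant. Otherwise the point lies in a gap between real roots; an arc
  is put into the gap by \<open>holomorphic_between\<close>, and the path \<open>(S, V)\<close>
  reaches it without leaving the gap, where no factor vanishes.\<close>

theorem two_var_arc:
 fixes f :: "'k \<Rightarrow> complex \<Rightarrow> complex \<Rightarrow> complex"
 assumes I: "finite I" and G: "\<And>s z. G s z = (\<Prod>i\<in>I. f i s z)"
  and famf: "\<And>i. i \<in> I ==> root_family (ball 0 s1) (f i) \<rho> R"
  and cardf: "\<And>i s. i \<in> I ==> s \<in> ball 0 s1 - {0} ==> card {z. cmod z < \<rho> \<and> f i s z = 0} = ef i"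
  and s2: "0 < s2" "s2 < s1" and y: "\<bar>y\<bar> < \<rho>"
 shows "\<exists>N Y r. \<exists>(S :: real \<Rightarrow> real) (V :: real \<Rightarrow> real). 0 < N \<and> 0 < r \<and> r \<le> root N s1 \<and> Y holomorphic_on ball 0 r \<and> Y 0 = 0 \<and>
  (\<forall>\<sigma>\<in>ball 0 r. cmod (Y \<sigma>) < \<rho>) \<and> (\<forall>\<sigma>\<in>ball 0 r. \<sigma> \<in> \<real> --> Y \<sigma> \<in> \<real>) \<and>
  (even N --> (\<forall>\<sigma>\<in>ball 0 r - {0}. Y (-\<sigma>) \<noteq> Y \<sigma>)) \<and>
  continuous_on {0..1} S \<and> continuous_on {0..1} V \<and> S 0 = s2 \<and> V 0 = y \<and>
  (\<forall>t\<in>{0..1}. 0 < S t \<and> S t < s1 \<and> \<bar>V t\<bar> < \<rho>) \<and>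
  (\<exists>\<sigma>. 0 < \<sigma> \<and> \<sigma> < r \<and> S 1 = \<sigma> ^ N \<and> of_real (V 1) = Y (of_real \<sigma>)) \<and>
  (\<forall>i\<in>I. (\<forall>t\<in>{0..1}. (f i (of_real (S t)) (of_real (V t)) = 0) = (f i (of_real s2) (of_real y) = 0)) \<and>
    (\<forall>\<sigma>. 0 < \<sigma> --> \<sigma> < r --> (f i (of_real \<sigma> ^ N) (Y (of_real \<sigma>)) = 0) = (f i (of_real s2) (of_real y) = 0)))"
proof -
 have \<rho>: "0 < \<rho>" using root_family.\<rho>[OF fam] by simp
 let ?T = "{0<..<s1}"
 have s2T: "s2 \<in> ?T" using s2 by simp
 show ?thesis
 proof (cases "G (of_real s2) (of_real y) = 0")
  case True
  obtain g where g: "continuous_on ?T g" "g s2 = y" "\<forall>t\<in>?T. \<bar>g t\<bar> < \<rho> \<and> G (of_real t) (complex_of_real (g t)) = 0"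
   using real_section[OF real_family _ real_conj s2T y True] by (auto simp: is_interval_convex_1[symmetric] is_interval_oo)
  obtain N Y where N: "0 < N" "Y holomorphic_on ball 0 (root N s1)" "Y 0 = 0"
    "\<And>\<sigma>. \<sigma> \<in> ball 0 (root N s1) ==> cmod (Y \<sigma>) < \<rho>"
    "\<And>\<sigma>. \<sigma> \<in> ball 0 (root N s1) ==> \<sigma> \<in> \<real> ==> Y \<sigma> \<in> \<real>"
    "\<And>\<sigma>. \<sigma> \<in> {0<..<root N s1} ==> Y (of_real \<sigma>) = of_real (g (\<sigma> ^ N))"
    "\<And>\<sigma>. even N ==> \<sigma> \<in> ball 0 (root N s1) - {0} ==> Y (-\<sigma>) \<noteq> Y \<sigma>"
  proof (rule puiseux_real_section[OF g(1)])
   show "\<bar>g s\<bar> < \<rho> \<and> G (of_real s) (of_real (g s)) = 0" if "s \<in> ?T" for s using g(3) that by blast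
  qed (rule that; assumption)
  define \<sigma>0 where "\<sigma>0 = root N s2"
  have \<sigma>0: "\<sigma>0 \<in> {0<..<root N s1}" "\<sigma>0 ^ N = s2" using s2 N(1) by (auto simp: \<sigma>0_def)
  have Y0: "Y (of_real \<sigma>0) = of_real y" using N(6)[OF \<sigma>0(1)] \<sigma>0(2) g(2) by simp
  have cY: "continuous_on {0<..<root N s1} (\<lambda>\<sigma>. Y (of_real \<sigma>))"
   by (intro continuous_on_compose2[OF holomorphic_on_imp_continuous_on[OF N(2)]] continuous_intros) auto
  have sY: "cmod (Y (of_real \<sigma>)) < \<rho> \<and> G (of_real \<sigma> ^ N) (Y (of_real \<sigma>)) = 0" if "\<sigma> \<in> {0<..<root N s1}" for \<sigma>
   using N(6)[OF that] bspec[OF g(3) root_pow_in(1)[OF N(1) that]] by simp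
  have pat: "f i (of_real \<tau> ^ N) (Y (of_real \<tau>)) = 0"
   if "i \<in> I" "\<sigma> \<in> {0<..<root N s1}" "\<tau> \<in> {0<..<root N s1}" "f i (of_real \<sigma> ^ N) (Y (of_real \<sigma>)) = 0" for i \<sigma> \<tau>
   using product_pattern[OF I G famf cardf N(1) cY sY that] by blast
  have s2': "complex_of_real \<sigma>0 ^ N = of_real s2" using \<sigma>0(2) by (metis of_real_power)
  have P: "(f i (of_real \<sigma> ^ N) (Y (of_real \<sigma>)) = 0) = (f i (of_real s2) (of_real y) = 0)" if "i \<in> I" "0 < \<sigma>" "\<sigma> < root N s1" for i \<sigma>
   using pat[OF that(1) \<sigma>0(1), of \<sigma>] pat[OF that(1) _ \<sigma>0(1), of \<sigma>] that unfolding s2' Y0 by auto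
  show ?thesis
  proof (rule exI[of _ N], rule exI[of _ Y], rule exI[of _ "root N s1"], rule exI[of _ "\<lambda>_. s2"], rule exI[of _ "\<lambda>_. y"], intro conjI)
   show "\<exists>\<sigma>>0. \<sigma> < root N s1 \<and> s2 = \<sigma> ^ N \<and> complex_of_real y = Y (of_real \<sigma>)"
    using \<sigma>0 Y0 by (intro exI[of _ \<sigma>0]) auto
  qed (use N P s1 s2 y in auto)
 next
  case False
  obtain lo hi where lh: "continuous_on ?T lo" "continuous_on ?T hi" "lo s2 < y" "y < hi s2"
   "lo = (\<lambda>_. -\<rho>) \<or> (\<forall>t\<in>?T. \<bar>lo t\<bar> < \<rho> \<and> G (of_real t) (complex_of_real (lo t)) = 0)"
   "hi = (\<lambda>_. \<rho>) \<or> (\<forall>t\<in>?T. \<bar>hi t\<bar> < \<rho> \<and> G (of_real t) (complex_of_real (hi t)) = 0)"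
   "\<forall>t\<in>?T. lo t < hi t \<and> -\<rho> \<le> lo t \<and> hi t \<le> \<rho>"
   "\<forall>t\<in>?T. \<forall>v. lo t < v --> v < hi t --> G (of_real t) (complex_of_real v) \<noteq> 0"
   using real_root_gap[OF real_family _ real_conj s2T y False] by (auto simp: is_interval_convex_1[symmetric] is_interval_oo)
  have lohi: "\<forall>s\<in>?T. lo s < hi s" using lh(7) by blast
  obtain N L U r0 where LU': "0 < N \<and> 0 < r0 \<and> r0 \<le> root N s1 \<and> L holomorphic_on ball 0 r0 \<and> U holomorphic_on ball 0 r0 \<and> L 0 = 0 \<and> U 0 = 0 \<and>
   (\<forall>\<sigma>. \<sigma> \<in> \<real> --> \<sigma> \<in> ball 0 r0 --> L \<sigma> \<in> \<real> \<and> U \<sigma> \<in> \<real>) \<and>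
   (\<forall>\<sigma>::real. 0 < \<sigma> --> \<sigma> < r0 --> Re (L (of_real \<sigma>)) < Re (U (of_real \<sigma>)) \<and>
    lo (\<sigma> ^ N) \<le> Re (L (of_real \<sigma>)) \<and> Re (U (of_real \<sigma>)) \<le> hi (\<sigma> ^ N))"
   using gap_arcs[OF lh(1,5,2,6) lohi] by (elim exE) (rule that)
  then have LU: "0 < N" "0 < r0" "r0 \<le> root N s1" "L holomorphic_on ball 0 r0" "U holomorphic_on ball 0 r0"
   "L 0 = 0" "U 0 = 0" "\<And>\<sigma>. \<sigma> \<in> \<real> ==> \<sigma> \<in> ball 0 r0 ==> L \<sigma> \<in> \<real> \<and> U \<sigma> \<in> \<real>"
   "\<And>\<sigma>::real. 0 < \<sigma> ==> \<sigma> < r0 ==> Re (L (of_real \<sigma>)) < Re (U (of_real \<sigma>))"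
   "\<And>\<sigma>::real. 0 < \<sigma> ==> \<sigma> < r0 ==> lo (\<sigma> ^ N) \<le> Re (L (of_real \<sigma>)) \<and> Re (U (of_real \<sigma>)) \<le> hi (\<sigma> ^ N)"
   by blast+
  obtain Y r1 where Y': "0 < r1 \<and> r1 \<le> r0 \<and> Y holomorphic_on ball 0 r1 \<and> Y 0 = 0 \<and>
   (\<forall>s. s \<in> \<real> --> s \<in> ball 0 r1 --> Y s \<in> \<real>) \<and>
   (\<forall>s::real. 0 < s --> s < r1 --> Re (L (of_real s)) < Re (Y (of_real s)) \<and> Re (Y (of_real s)) < Re (U (of_real s))) \<and>
   (\<forall>s. s \<noteq> 0 --> s \<in> ball 0 r1 --> Y (-s) \<noteq> Y s)"
  proof -
   assume *: "\<And>r1 Y. 0 < r1 \<and> r1 \<le> r0 \<and> Y holomorphic_on ball 0 r1 \<and> Y 0 = 0 \<and>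
   (\<forall>s. s \<in> \<real> --> s \<in> ball 0 r1 --> Y s \<in> \<real>) \<and>
   (\<forall>s::real. 0 < s --> s < r1 --> Re (L (of_real s)) < Re (Y (of_real s)) \<and> Re (Y (of_real s)) < Re (U (of_real s))) \<and>
   (\<forall>s. s \<noteq> 0 --> s \<in> ball 0 r1 --> Y (-s) \<noteq> Y s) ==> thesis"
   show thesis
    by (rule exE[OF holomorphic_between[OF LU(4,5,2) LU(8) LU(9) LU(6,7)]], assumption+, elim exE, rule *)
  qed
  then have Y: "0 < r1" "r1 \<le> r0" "Y holomorphic_on ball 0 r1" "Y 0 = 0"
    "\<And>s. s \<in> \<real> ==> s \<in> ball 0 r1 ==> Y s \<in> \<real>"
    "\<And>s::real. 0 < s ==> s < r1 ==> Re (L (of_real s)) < Re (Y (of_real s)) \<and> Re (Y (of_real s)) < Re (U (of_real s))"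
    "\<And>s. s \<noteq> 0 ==> s \<in> ball 0 r1 ==> Y (-s) \<noteq> Y s"
   by blast+
  have "\<exists>r>0. r \<le> r1 \<and> (\<forall>\<sigma>\<in>ball 0 r. cmod (Y \<sigma>) < \<rho>)"
  proof -
   have "isCont Y 0" using holomorphic_on_imp_continuous_on[OF Y(3)] Y(1)
    by (intro continuous_on_interior[of "ball 0 r1"]) auto
   then obtain d where "d > 0" "\<forall>w. dist w 0 < d --> dist (Y w) (Y 0) < \<rho>"
    unfolding continuous_at_eps_delta using \<rho> by metis
   then show ?thesis using Y(1,4) by (intro exI[of _ "min d r1"]) auto
  qed
  then obtain r where r: "0 < r" "r \<le> r1" "\<forall>\<sigma>\<in>ball 0 r. cmod (Y \<sigma>) < \<rho>" by blast
  have rN: "r \<le> root N s1" using r Y LU by linarith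
  have YT: "\<sigma> ^ N \<in> ?T" "lo (\<sigma> ^ N) < Re (Y (of_real \<sigma>))" "Re (Y (of_real \<sigma>)) < hi (\<sigma> ^ N)"
    "Y (of_real \<sigma>) = of_real (Re (Y (of_real \<sigma>)))" if "0 < \<sigma>" "\<sigma> < r" for \<sigma>
  proof -
   show "\<sigma> ^ N \<in> ?T" using root_pow_in(1)[OF LU(1), of \<sigma>] that rN by auto
   show "lo (\<sigma> ^ N) < Re (Y (of_real \<sigma>))" "Re (Y (of_real \<sigma>)) < hi (\<sigma> ^ N)"
    using Y(6)[of \<sigma>] LU(10)[of \<sigma>] that r Y(2) by auto
   have "Y (of_real \<sigma>) \<in> \<real>" using Y(5)[of "of_real \<sigma>"] that r by auto
   then show "Y (of_real \<sigma>) = of_real (Re (Y (of_real \<sigma>)))" by (simp add: of_real_Re)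
  qed
  define \<sigma>3 where "\<sigma>3 = r/2"
  have \<sigma>3: "0 < \<sigma>3" "\<sigma>3 < r" using r by (auto simp: \<sigma>3_def)
  define s3 where "s3 = \<sigma>3 ^ N"
  have s3: "s3 \<in> ?T" using YT(1)[OF \<sigma>3] by (simp add: s3_def)
  \<comment> \<open>Relative height in the gap. Interpolating it linearly along with the parameter
    keeps the path strictly between \<open>lo\<close> and \<open>hi\<close>.\<close>
  define \<theta> where "\<theta> s v = (v - lo s) / (hi s - lo s)" for s v
  define S where "S t = (1 - t) * s2 + t * s3" for t
  define \<Theta> where "\<Theta> t = (1 - t) * \<theta> s2 y + t * \<theta> s3 (Re (Y (of_real \<sigma>3)))" for t
  define V where "V t = lo (S t) + \<Theta> t * (hi (S t) - lo (S t))" for t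
  have \<theta>: "0 < \<theta> s v \<and> \<theta> s v < 1 \<and> lo s + \<theta> s v * (hi s - lo s) = v" if "s \<in> ?T" "lo s < v" "v < hi s" for s v
   using that by (auto simp: \<theta>_def field_simps)
  note \<theta>2 = \<theta>[OF s2T lh(3,4)]
  note \<theta>3 = \<theta>[OF s3, of "Re (Y (of_real \<sigma>3))", unfolded s3_def, OF YT(2,3)[OF \<sigma>3], folded s3_def]
  have St: "S t \<in> ?T" if "t \<in> {0..1}" for t
  proof -
   have "(1 - t) *\<^sub>R s2 + t *\<^sub>R s3 \<in> ?T" using that s2T s3 by (intro convexD) (auto simp: is_interval_convex_1[symmetric] is_interval_oo)
   then show ?thesis by (simp add: S_def)
  qed
  have \<Theta>t: "0 < \<Theta> t \<and> \<Theta> t < 1" if "t \<in> {0..1}" for t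
  proof -
   have "(1 - t) *\<^sub>R \<theta> s2 y + t *\<^sub>R \<theta> s3 (Re (Y (of_real \<sigma>3))) \<in> {0<..<1}"
    using that \<theta>2 \<theta>3 by (intro convexD) (auto simp: is_interval_convex_1[symmetric] is_interval_oo)
   then show ?thesis by (simp add: \<Theta>_def)
  qed
  have Vt: "lo (S t) < V t" "V t < hi (S t)" "\<bar>V t\<bar> < \<rho>" if "t \<in> {0..1}" for t
  proof -
   have d: "0 < hi (S t) - lo (S t)" and b: "-\<rho> \<le> lo (S t)" "hi (S t) \<le> \<rho>" using lh(7) St[OF that] by auto
   show 1: "lo (S t) < V t" using \<Theta>t[OF that] d by (simp add: V_def)
   have "\<Theta> t * (hi (S t) - lo (S t)) < 1 * (hi (S t) - lo (S t))" using \<Theta>t[OF that] d by (intro mult_strict_right_mono) auto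
   then show 2: "V t < hi (S t)" by (simp add: V_def)
   show "\<bar>V t\<bar> < \<rho>" using 1 2 b by auto
  qed
  have nz: "f i (of_real s) (of_real v) \<noteq> 0" if "i \<in> I" "s \<in> ?T" "lo s < v" "v < hi s" for i s v
  proof
   assume "f i (of_real s) (of_real v) = 0"
   then have "G (of_real s) (of_real v) = 0" unfolding G using I that(1) by (intro prod_zero bexI[of _ i])
   then show False using lh(8) that by blast
  qed
  have cS: "continuous_on {0..1} S" unfolding S_def by (intro continuous_intros)
  have cl: "continuous_on {0..1} (\<lambda>t. lo (S t))" "continuous_on {0..1} (\<lambda>t. hi (S t))"
   using St by (auto intro!: continuous_on_compose2[OF lh(1) cS] continuous_on_compose2[OF lh(2) cS])
  show ?thesis
  proof (rule exI[of _ N], rule exI[of _ Y], rule exI[of _ r], rule exI[of _ S], rule exI[of _ V], intro conjI)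
   show "Y holomorphic_on ball 0 r" using Y(3) r by (auto elim: holomorphic_on_subset)
   show "\<forall>\<sigma>\<in>ball 0 r. \<sigma> \<in> \<real> --> Y \<sigma> \<in> \<real>" using Y(5) r by auto
   show "even N --> (\<forall>\<sigma>\<in>ball 0 r - {0}. Y (- \<sigma>) \<noteq> Y \<sigma>)" using Y(7) r by auto
   show "continuous_on {0..1} V" unfolding V_def \<Theta>_def by (intro continuous_intros cl)
   show "V 0 = y" using \<theta>2 by (simp add: V_def S_def \<Theta>_def)
   show "\<forall>t\<in>{0..1}. 0 < S t \<and> S t < s1 \<and> \<bar>V t\<bar> < \<rho>" using St Vt by auto
   show "\<exists>\<sigma>>0. \<sigma> < r \<and> S 1 = \<sigma> ^ N \<and> of_real (V 1) = Y (of_real \<sigma>)"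
    using \<sigma>3 \<theta>3 YT(4)[OF \<sigma>3] by (intro exI[of _ \<sigma>3]) (auto simp: V_def S_def \<Theta>_def s3_def)
   show "\<forall>i\<in>I. (\<forall>t\<in>{0..1}. (f i (of_real (S t)) (of_real (V t)) = 0) = (f i (of_real s2) (of_real y) = 0)) \<and>
    (\<forall>\<sigma>. 0 < \<sigma> --> \<sigma> < r --> (f i (of_real \<sigma> ^ N) (Y (of_real \<sigma>)) = 0) = (f i (of_real s2) (of_real y) = 0))"
   proof (intro ballI conjI allI impI)
    fix i assume i: "i \<in> I"
    have n0: "f i (of_real s2) (of_real y) \<noteq> 0" using nz[OF i s2T lh(3,4)] .
    show "(f i (of_real (S t)) (of_real (V t)) = 0) = (f i (of_real s2) (of_real y) = 0)" if "t \<in> {0..1}" for t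
     using nz[OF i St Vt(1,2)] that n0 by simp
    show "(f i (of_real \<sigma> ^ N) (Y (of_real \<sigma>)) = 0) = (f i (of_real s2) (of_real y) = 0)" if "0 < \<sigma>" "\<sigma> < r" for \<sigma>
     using nz[OF i YT(1-3)[OF that]] n0 YT(4)[OF that] by (simp flip: of_real_power)
   qed
  qed (use LU(1) r rN Y(4) cS in \<open>auto simp: S_def\<close>)
 qed
qed

end

text \<open>A real root is followed as a section; a point in a gap moves along at constant relative
  height. In both cases no factor changes between zero and nonzero.\<close>

lemma real_path_lift:
 fixes f :: "'k \<Rightarrow> real \<Rightarrow> complex \<Rightarrow> complex"
 assumes I: "finite I" and G: "\<And>s z. G s z = (\<Prod>i\<in>I. f i s z)"
  and famG: "root_family_const T G \<rho> R e"
  and famf: "\<And>i. i \<in> I ==> root_family_const T (f i) \<rho> R (ef i)"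
  and T: "convex T" and conj: "\<And>t z. t \<in> T ==> cmod z < \<rho> ==> G t (cnj z) = cnj (G t z)"
  and t0: "t0 \<in> T" and y: "\<bar>y\<bar> < \<rho>"
 shows "\<exists>V :: real \<Rightarrow> real. continuous_on T V \<and> V t0 = y \<and> (\<forall>t\<in>T. \<bar>V t\<bar> < \<rho>) \<and>
  (\<forall>i\<in>I. \<forall>t\<in>T. (f i t (of_real (V t)) = 0) = (f i t0 (of_real y) = 0))"
proof (cases "G t0 (of_real y) = 0")
 case True
 obtain g where g: "continuous_on T g" "g t0 = y" "\<forall>t\<in>T. \<bar>g t\<bar> < \<rho> \<and> G t (complex_of_real (g t)) = 0"
  using real_section[OF famG T conj t0 y True] by blast
 have sub: "G t z = 0" if "i \<in> I" "f i t z = 0" for i t z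
  unfolding G using I that by (intro prod_zero bexI[of _ i])
 have *: "f i b (of_real (g b)) = 0" if "i \<in> I" "a \<in> T" "b \<in> T" "f i a (of_real (g a)) = 0" for i a b
  by (rule section_subfamily[OF famG famf[OF that(1)] _ T, of "\<lambda>t. of_real (g t)" a b])
   (use g that sub in \<open>auto intro!: continuous_intros\<close>)
 have "(f i t (of_real (g t)) = 0) = (f i t0 (of_real y) = 0)" if "i \<in> I" "t \<in> T" for i t
  using *[OF that(1) t0 that(2)] *[OF that t0] unfolding g(2) by blast
 then show ?thesis
  by (intro exI[of _ g]) (use g in simp)
next
 case False
 obtain lo hi where lh: "continuous_on T lo" "continuous_on T hi" "lo t0 < y" "y < hi t0"
   "\<forall>t\<in>T. lo t < hi t \<and> -\<rho> \<le> lo t \<and> hi t \<le> \<rho>"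
   "\<forall>t\<in>T. \<forall>v. lo t < v --> v < hi t --> G t (complex_of_real v) \<noteq> 0"
  using real_root_gap[OF famG T conj t0 y False] by blast
 define \<theta> where "\<theta> = (y - lo t0) / (hi t0 - lo t0)"
 define V where "V t = lo t + \<theta> * (hi t - lo t)" for t
 have \<theta>: "0 < \<theta>" "\<theta> < 1" "V t0 = y" using lh(3,4) by (auto simp: \<theta>_def V_def field_simps)
 have Vt: "lo t < V t" "V t < hi t" "\<bar>V t\<bar> < \<rho>" if "t \<in> T" for t
 proof -
  have d: "0 < hi t - lo t" and b: "-\<rho> \<le> lo t" "hi t \<le> \<rho>" using lh(5) that by auto
  show 1: "lo t < V t" using \<theta> d by (simp add: V_def)
  have "\<theta> * (hi t - lo t) < 1 * (hi t - lo t)" using \<theta> d by (intro mult_strict_right_mono) auto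
  then show 2: "V t < hi t" by (simp add: V_def)
  show "\<bar>V t\<bar> < \<rho>" using 1 2 b by auto
 qed
 have nz: "f i t (of_real v) \<noteq> 0" if "i \<in> I" "t \<in> T" "lo t < v" "v < hi t" for i t v
 proof
  assume "f i t (of_real v) = 0"
  then have "G t (of_real v) = 0" unfolding G using I that(1) by (intro prod_zero bexI[of _ i])
  then show False using lh(6) that by blast
 qed
 have "continuous_on T V" unfolding V_def by (intro continuous_intros lh)
 then show ?thesis using \<theta>(3) Vt nz lh(3,4) t0 by (intro exI[of _ V]) auto
qed

lemma holomorphic_cnj_sym:
 assumes hol: "Y holomorphic_on ball 0 r" and r: "0 < r"
  and real: "\<And>s. s \<in> ball 0 r ==> s \<in> \<real> ==> Y s \<in> \<real>"
  and s: "s \<in> ball 0 r"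
 shows "Y (cnj s) = cnj (Y s)"
proof -
 have h2: "(cnj \<circ> Y \<circ> cnj) holomorphic_on ball 0 r"
  by (rule holomorphic_on_compose_cnj_cnj) (auto intro!: holomorphic_on_subset[OF hol])
 let ?d = "\<lambda>w. Y w - cnj (Y (cnj w))"
 have hd: "?d holomorphic_on ball 0 r" using h2 by (intro holomorphic_intros hol) (simp add: o_def)
 have "?d (cnj s) = 0"
 proof (rule analytic_continuation[OF hd open_ball connected_ball, of "of_real ` {0<..<r}" "of_real (r/2)"])
  show "complex_of_real (r / 2) islimpt of_real ` {0<..<r}"
  proof (rule islimpt_isCont_image)
   show "r / 2 islimpt {0<..<r}" using r by (intro interior_limit_point) simp
   show "\<forall>\<^sub>F y in at (r / 2). complex_of_real y \<noteq> complex_of_real (r / 2)"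
    unfolding of_real_eq_iff by (simp add: eventually_at_filter)
  qed auto
  fix z :: complex assume "z \<in> of_real ` {0<..<r}"
  then obtain x where "z = of_real x" "0 < x" "x < r" by auto
  then show "Y z - cnj (Y (cnj z)) = 0" using real[of z] by (simp add: Reals_cnj_iff)
 qed (use r s in auto)
 then show ?thesis by simp
qed

section \<open>Holomorphic functions on polydiscs and elimination of the last variable\<close>

text \<open>Points of complex \<open>m\<close>-space are sequences that vanish from index
  \<open>m\<close> on, so that the dimension can vary in an induction without a change of
  type.\<close>

definition pdisc :: "nat \<Rightarrow> real \<Rightarrow> (nat \<Rightarrow> complex) set" where
 "pdisc m r = {x. (\<forall>i<m. cmod (x i) < r) \<and> (\<forall>i\<ge>m. x i = 0)}"

definition real_pt :: "(nat \<Rightarrow> complex) \<Rightarrow> bool" where "real_pt x \<longleftrightarrow> (\<forall>i. x i \<in> \<real>)"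

text \<open>Functions that are holomorphic along every holomorphic curve; this is all that is needed of
 holomorphy in several variables.\<close>

definition hol_germ :: "nat \<Rightarrow> real \<Rightarrow> ((nat \<Rightarrow> complex) \<Rightarrow> complex) \<Rightarrow> bool" where
 "hol_germ m r h \<longleftrightarrow> continuous_on (pdisc m r) h \<and>
   (\<forall>S \<psi>. open S --> (\<forall>i. (\<lambda>s. \<psi> s i) holomorphic_on S) --> \<psi> ` S \<subseteq> pdisc m r --> (\<lambda>s. h (\<psi> s)) holomorphic_on S)"

lemma hol_germI:
 assumes "continuous_on (pdisc m r) h"
  "\<And>S \<psi>. open S ==> (\<And>i. (\<lambda>s. \<psi> s i) holomorphic_on S) ==> \<psi> ` S \<subseteq> pdisc m r ==> (\<lambda>s. h (\<psi> s)) holomorphic_on S"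
 shows "hol_germ m r h"
 unfolding hol_germ_def by (intro conjI allI impI assms) auto

lemma hol_germ_cont: "hol_germ m r h ==> continuous_on (pdisc m r) h"
 by (simp add: hol_germ_def)

lemma hol_germ_curve:
 "hol_germ m r h ==> open S ==> (\<And>i. (\<lambda>s. \<psi> s i) holomorphic_on S) ==> \<psi> ` S \<subseteq> pdisc m r ==> (\<lambda>s. h (\<psi> s)) holomorphic_on S"
 by (simp add: hol_germ_def)

lemma pdisc_mono: "r \<le> r' ==> pdisc m r \<subseteq> pdisc m r'"
 by (force simp: pdisc_def)

lemma hol_germ_subset: "hol_germ m r h ==> r' \<le> r ==> hol_germ m r' h"
proof (rule hol_germI)
 assume h: "hol_germ m r h" "r' \<le> r"
 note sub = pdisc_mono[OF h(2), of m]
 show "continuous_on (pdisc m r') h" by (rule continuous_on_subset[OF hol_germ_cont[OF h(1)] sub])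
 fix S \<psi> assume \<psi>: "open S" "\<And>i. (\<lambda>s. \<psi> s i) holomorphic_on S" "\<psi> ` S \<subseteq> pdisc m r'"
 show "(\<lambda>s. h (\<psi> s)) holomorphic_on S"
  by (rule hol_germ_curve[OF h(1) \<psi>(1,2) order_trans[OF \<psi>(3) sub]])
qed

lemma hol_germ_const: "hol_germ m r (\<lambda>_. c)"
 by (rule hol_germI) auto

lemma hol_germ_coord: "hol_germ m r (\<lambda>x. x i)"
 by (rule hol_germI) (simp_all add: continuous_on_subset[OF continuous_on_product_coordinates])

lemma hol_germ_add: "hol_germ m r h ==> hol_germ m r k ==> hol_germ m r (\<lambda>x. h x + k x)"
 unfolding hol_germ_def by (simp add: continuous_intros holomorphic_intros)

lemma hol_germ_mult: "hol_germ m r h ==> hol_germ m r k ==> hol_germ m r (\<lambda>x. h x * k x)"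
 unfolding hol_germ_def by (simp add: continuous_intros holomorphic_intros)

lemma hol_germ_prod: "finite I ==> (\<And>i. i \<in> I ==> hol_germ m r (h i)) ==> hol_germ m r (\<lambda>x. \<Prod>i\<in>I. h i x)"
 by (induction I rule: finite_induct) (auto intro: hol_germ_const hol_germ_mult)

lemma hol_germ_cong: "hol_germ m r h ==> (\<And>x. x \<in> pdisc m r ==> h x = k x) ==> hol_germ m r k"
proof (rule hol_germI)
 assume *: "hol_germ m r h" "\<And>x. x \<in> pdisc m r ==> h x = k x"
 show "continuous_on (pdisc m r) k" by (rule continuous_on_eq[OF hol_germ_cont[OF *(1)] *(2)])
 fix S \<psi> assume \<psi>: "open S" "\<And>i. (\<lambda>s. \<psi> s i) holomorphic_on S" "\<psi> ` S \<subseteq> pdisc m r"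
 show "(\<lambda>s. k (\<psi> s)) holomorphic_on S"
  by (rule holomorphic_transform[OF hol_germ_curve[OF *(1) \<psi>]]) (use \<psi>(3) in \<open>intro *(2), blast\<close>)
qed

lemma hol_germ_cnj:
 assumes h: "hol_germ m r h" shows "hol_germ m r (\<lambda>x. cnj (h (\<lambda>i. cnj (x i))))"
proof (rule hol_germI)
 have "continuous_on (pdisc m r) (\<lambda>x i. cnj (x i))"
  by (intro continuous_on_coordinatewise_then_product continuous_on_cnj
    continuous_on_subset[OF continuous_on_product_coordinates]) auto
 then show "continuous_on (pdisc m r) (\<lambda>x. cnj (h (\<lambda>i. cnj (x i))))"
  by (intro continuous_on_cnj continuous_on_compose2[OF hol_germ_cont[OF h]]) (auto simp: pdisc_def)
 fix S \<psi> assume \<psi>: "open S" "\<And>i. (\<lambda>s. \<psi> s i) holomorphic_on S" "\<psi> ` S \<subseteq> pdisc m r"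
 have op: "open (cnj ` S)"
 proof -
  have "cnj ` S = cnj -` S" by (auto simp: image_iff) (metis complex_cnj_cnj)
  then show ?thesis using open_vimage[OF \<psi>(1), of cnj] by (simp add: continuous_on_cnj)
 qed
 have "(\<lambda>s. h (\<lambda>i. cnj (\<psi> (cnj s) i))) holomorphic_on cnj ` S"
 proof (rule hol_germ_curve[OF h op])
  show "(\<lambda>s. cnj (\<psi> (cnj s) i)) holomorphic_on cnj ` S" for i
   using holomorphic_on_compose_cnj_cnj[of "\<lambda>s. \<psi> s i" "cnj ` S"] \<psi> op by (simp add: o_def image_image)
  show "(\<lambda>s i. cnj (\<psi> (cnj s) i)) ` cnj ` S \<subseteq> pdisc m r"
   using \<psi>(3) by (auto simp: pdisc_def image_subset_iff)
 qed
 from holomorphic_on_compose_cnj_cnj[OF this \<psi>(1)]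
 show "(\<lambda>s. cnj (h (\<lambda>i. cnj (\<psi> s i)))) holomorphic_on S" by (simp add: o_def)
qed

lemma pdisc_upd: "x \<in> pdisc m r ==> cmod z < r ==> x(m := z) \<in> pdisc (Suc m) r"
 by (auto simp: pdisc_def less_Suc_eq)

lemma pdisc_restrict: "x \<in> pdisc (Suc m) r ==> x(m := 0) \<in> pdisc m r"
 by (auto simp: pdisc_def)

lemma zero_in_pdisc: "0 < r ==> (\<lambda>_. 0) \<in> pdisc m r"
 by (auto simp: pdisc_def)

text \<open>A basic neighbourhood in the product topology prescribes a radius in each coordinate; on
  \<open>pdisc m\<close> only the first \<open>m\<close> of them matter, and their minimum is
  positive.\<close>

lemma pdisc_nhd:
 assumes "open X" "(\<lambda>_. 0) \<in> X" shows "\<exists>\<delta>>0. pdisc m \<delta> \<subseteq> X"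
proof -
 have "openin (product_topology (\<lambda>_. euclidean) UNIV) X" using assms(1) by (simp add: open_fun_def)
 from product_topology_open_contains_basis[OF this assms(2)] obtain B where
  B: "(\<lambda>_. 0) \<in> PiE UNIV B" "\<And>i. open (B i)" "PiE UNIV B \<subseteq> X" by auto
 have "\<forall>i. \<exists>d>0. ball 0 d \<subseteq> B i" using B(1,2) by (auto simp: PiE_def Pi_def open_contains_ball)
 then obtain d where d: "\<And>i. d i > 0" "\<And>i. ball 0 (d i) \<subseteq> B i" by metis
 define \<delta> where "\<delta> = Min (insert 1 (d ` {..<m}))"
 have \<delta>: "0 < \<delta>" "\<And>i. i < m ==> \<delta> \<le> d i" using d(1) by (auto simp: \<delta>_def)
 have "x \<in> X" if x: "x \<in> pdisc m \<delta>" for x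
 proof -
  have "x i \<in> B i" for i
  proof (cases "i < m")
   case True
   then have "x i \<in> ball 0 (d i)" using x \<delta>(2)[OF True] by (force simp: pdisc_def)
   then show ?thesis using d(2) by blast
  next
   case False
   then have "x i = 0" using x by (simp add: pdisc_def)
   then show ?thesis using B(1) by (auto simp: PiE_def Pi_def)
  qed
  then show ?thesis using B(3) by auto
 qed
 then show ?thesis using \<delta>(1) by blast
qed

lemma continuous_on_upd: "continuous_on S f ==> continuous_on S g ==> continuous_on S (\<lambda>x. (f x)(m := g x :: complex))"
 for f :: "'a::topological_space \<Rightarrow> nat \<Rightarrow> complex"
proof (rule continuous_on_coordinatewise_then_product)
 fix i assume "continuous_on S f" "continuous_on S g"
 then show "continuous_on S (\<lambda>x. ((f x)(m := g x)) i)"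
  by (cases "i = m") (auto intro: continuous_on_product_then_coordinatewise)
qed

lemma continuous_on_holomorphic_coords:
 "(\<And>i. (\<lambda>s. \<psi> s i) holomorphic_on S) ==> continuous_on S (\<psi> :: complex \<Rightarrow> nat \<Rightarrow> complex)"
 by (intro continuous_on_coordinatewise_then_product holomorphic_on_imp_continuous_on)

context
 fixes m :: nat and \<epsilon> \<rho> \<delta> :: real and k :: "(nat \<Rightarrow> complex) \<Rightarrow> complex"
 assumes k: "hol_germ (Suc m) \<epsilon> k" and \<rho>: "0 < \<rho>" "\<rho> < \<epsilon>" and \<delta>: "\<delta> \<le> \<epsilon>"
  and nz: "\<forall>x\<in>pdisc m \<delta>. \<forall>z. cmod z = \<rho> --> k (x(m := z)) \<noteq> 0"
begin

lemma slice_in: "x \<in> pdisc m \<delta> ==> cmod z < \<epsilon> ==> x(m := z) \<in> pdisc (Suc m) \<epsilon>"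
 using pdisc_upd[of x m \<epsilon> z] pdisc_mono[OF \<delta>, of m] by blast

lemma slice_curve:
 assumes "open S" "\<And>i. (\<lambda>s. \<psi> s i) holomorphic_on S" "\<psi> ` S \<subseteq> pdisc m \<delta>" "g holomorphic_on S" "\<And>s. s \<in> S ==> cmod (g s) < \<epsilon>"
 shows "(\<lambda>s. k ((\<psi> s)(m := g s))) holomorphic_on S"
proof (rule hol_germ_curve[OF k assms(1)])
 show "(\<lambda>s. ((\<psi> s)(m := g s)) i) holomorphic_on S" for i
  using assms(2)[of i] assms(4) by (cases "i = m") auto
 show "(\<lambda>s. (\<psi> s)(m := g s)) ` S \<subseteq> pdisc (Suc m) \<epsilon>"
  using assms(3,5) slice_in by blast
qed

text \<open>The point \<open>x\<close> of the base is the parameter and the value \<open>z\<close>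
  inserted at index \<open>m\<close> is the unknown.\<close>

lemma slice_family: "root_family (pdisc m \<delta>) (\<lambda>x z. k (x(m := z))) \<rho> \<epsilon>"
proof
 show "continuous_on (pdisc m \<delta> \<times> ball 0 \<epsilon>) (\<lambda>(x, z). k (x(m := z)))"
  unfolding split_beta
 proof (rule continuous_on_compose2[OF hol_germ_cont[OF k]])
  show "continuous_on (pdisc m \<delta> \<times> ball 0 \<epsilon>) (\<lambda>x. (fst x)(m := snd x))"
   by (intro continuous_on_upd continuous_intros)
  show "(\<lambda>x. (fst x)(m := snd x)) ` (pdisc m \<delta> \<times> ball 0 \<epsilon>) \<subseteq> pdisc (Suc m) \<epsilon>"
   using slice_in by auto
 qed
 show "(\<lambda>z. k (x(m := z))) holomorphic_on ball 0 \<epsilon>" if "x \<in> pdisc m \<delta>" for x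
  by (rule slice_curve[of _ "\<lambda>_. x" "\<lambda>z. z"]) (use that in auto)
qed (use \<rho> nz in auto)

interpretation root_family "pdisc m \<delta>" "\<lambda>x z. k (x(m := z))" \<rho> \<epsilon> by (rule slice_family)

lemma slice_psum: "hol_germ m \<delta> (psum a)"
proof (rule hol_germI)
 show "continuous_on (pdisc m \<delta>) (psum a)" by (rule psum_cont)
 fix S \<psi> assume \<psi>: "open S" "\<And>i. (\<lambda>s. \<psi> s i) holomorphic_on S" "\<psi> ` S \<subseteq> pdisc m \<delta>"
 show "(\<lambda>s. psum a (\<psi> s)) holomorphic_on S"
 proof (rule psum_holomorphic[OF \<psi>(1,3) continuous_on_holomorphic_coords[OF \<psi>(2)]])
  show "(\<lambda>w. k ((\<psi> w)(m := z))) holomorphic_on S" if "z \<in> ball 0 \<epsilon>" for z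
   by (rule slice_curve[OF \<psi>]) (use that in auto)
 qed
qed

text \<open>The discriminants are the functions in one variable less to which the induction
  hypothesis will be applied.\<close>

lemma slice_disc: "hol_germ m \<delta> (disc j)"
proof -
 obtain L where L: "\<And>x. x \<in> pdisc m \<delta> ==> disc j x = (\<Sum>(c,\<alpha>)\<leftarrow>L. c * (\<Prod>i<j. psum (\<alpha> i) x))"
  using disc_eq_psum by blast
 have "hol_germ m \<delta> (\<lambda>x. \<Sum>(c,\<alpha>)\<leftarrow>L. c * (\<Prod>i<j. psum (\<alpha> i) x))"
 proof (induction L)
  case Nil
  show ?case unfolding list.map sum_list.Nil by (rule hol_germ_const)
 next
  case (Cons a L)
  have "hol_germ m \<delta> (\<lambda>x. fst a * (\<Prod>i<j. psum (snd a i) x))"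
   by (intro hol_germ_mult hol_germ_const hol_germ_prod slice_psum finite_lessThan)
  from hol_germ_add[OF this Cons.IH] show ?case unfolding list.map sum_list.Cons split_beta .
 qed
 then show ?thesis by (rule hol_germ_cong) (simp add: L)
qed

text \<open>With a uniform bound on the root count, finitely many discriminants determine it. The
  bound comes from continuity of \<open>psum 0\<close> at the origin.\<close>

lemma slice_card_bound: "0 < \<delta> ==> \<exists>\<delta>'>0. \<delta>' \<le> \<delta> \<and> (\<exists>d. \<forall>x\<in>pdisc m \<delta>'. card {z. cmod z < \<rho> \<and> k (x(m := z)) = 0} \<le> d)"
proof -
 assume "0 < \<delta>"
 have 0: "(\<lambda>_. 0) \<in> pdisc m \<delta>" using zero_in_pdisc[OF \<open>0 < \<delta>\<close>] .
 obtain X where X: "open X" "(\<lambda>_. 0) \<in> X" "\<forall>x\<in>X \<inter> pdisc m \<delta>. dist (psum 0 x) (psum 0 (\<lambda>_. 0)) < 1"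
 proof -
  have "open (ball (psum 0 (\<lambda>_. 0)) 1)" "psum 0 (\<lambda>_. 0) \<in> ball (psum 0 (\<lambda>_. 0)) 1" by auto
  with psum_cont[of 0] 0 have "\<exists>X. open X \<and> (\<lambda>_. 0) \<in> X \<and> (\<forall>y\<in>pdisc m \<delta>. y \<in> X --> psum 0 y \<in> ball (psum 0 (\<lambda>_. 0)) 1)"
   unfolding continuous_on_topological by blast
  then show thesis using that by (auto simp: dist_commute)
 qed
 obtain \<delta>0 where \<delta>0: "\<delta>0 > 0" "pdisc m \<delta>0 \<subseteq> X" using pdisc_nhd[OF X(1,2)] by blast
 define d where "d = nat \<lceil>Re (psum 0 (\<lambda>_. 0)) + 1\<rceil>"
 have "card (rts x) \<le> d" if "x \<in> pdisc m (min \<delta>0 \<delta>)" for x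
 proof -
  have x: "x \<in> X \<inter> pdisc m \<delta>" using that pdisc_mono[of "min \<delta>0 \<delta>" \<delta>0 m] pdisc_mono[of "min \<delta>0 \<delta>" \<delta> m] \<delta>0(2) by auto
  have "Re (psum 0 x) - Re (psum 0 (\<lambda>_. 0)) < 1"
   using bspec[OF X(3) x] abs_Re_le_cmod[of "psum 0 x - psum 0 (\<lambda>_. 0)"] by (simp add: dist_norm)
  then have "real (card (rts x)) < Re (psum 0 (\<lambda>_. 0)) + 1" using card_le_psum[of x] x by auto
  then show ?thesis unfolding d_def by linarith
 qed
 then show ?thesis using \<delta>0(1) \<open>0 < \<delta>\<close> unfolding rts_def
  by (intro exI[of _ "min \<delta>0 \<delta>"]) auto
qed

text \<open>Above \<open>d\<close> all discriminants vanish at both points, so equal zero patterns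
  up to \<open>d\<close> give the same last nonvanishing index.\<close>

lemma slice_card_eq:
 assumes x: "x \<in> pdisc m \<delta>" "x' \<in> pdisc m \<delta>"
  and bd: "card {z. cmod z < \<rho> \<and> k (x(m := z)) = 0} \<le> d" "card {z. cmod z < \<rho> \<and> k (x'(m := z)) = 0} \<le> d"
  and pat: "\<And>j. j \<le> d ==> (disc j x = 0) = (disc j x' = 0)"
 shows "card {z. cmod z < \<rho> \<and> k (x(m := z)) = 0} = card {z. cmod z < \<rho> \<and> k (x'(m := z)) = 0}"
proof -
 have "card (rts x) = card (rts x')"
 proof (rule card_rts_eqI[OF x(1)])
  show "disc (card (rts x')) x \<noteq> 0" using disc_card[OF x(2)] pat[of "card (rts x')"] bd(2) by (simp add: rts_def)
  show "disc j x = 0" if "card (rts x') < j" for j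
  proof (cases "j \<le> d")
   case True then show ?thesis using pat disc_eq_0[OF x(2) that] by simp
  next
   case False then show ?thesis using disc_eq_0[OF x(1), of j] bd(1) by (simp add: rts_def)
  qed
 qed
 then show ?thesis by (simp add: rts_def)
qed

text \<open>Along the curve, discriminants of index above \<open>e\<close> vanish at positive
  parameters and so identically; the one of index \<open>e\<close> is not identically zero, so its
  zeros do not accumulate at 0.\<close>

lemma slice_card_punctured:
 assumes \<psi>: "\<And>i. (\<lambda>s. \<psi> s i) holomorphic_on ball 0 s0" "\<psi> ` ball 0 s0 \<subseteq> pdisc m \<delta>" and s0: "0 < s0"
  and card: "\<And>s. s \<in> {0<..<s0} ==> card {z. cmod z < \<rho> \<and> k ((\<psi> (complex_of_real s))(m := z)) = 0} = e"
 shows "\<exists>s1>0. s1 \<le> s0 \<and> (\<forall>s\<in>ball 0 s1 - {0}. card {z. cmod z < \<rho> \<and> k ((\<psi> s)(m := z)) = 0} = e)"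
proof -
 have hd: "(\<lambda>s. disc j (\<psi> s)) holomorphic_on ball 0 s0" for j
  by (rule hol_germ_curve[OF slice_disc open_ball \<psi>])
 have in_pd: "\<psi> s \<in> pdisc m \<delta>" if "s \<in> ball 0 s0" for s using \<psi>(2) that by blast
 have cr: "card (rts (\<psi> (of_real s))) = e" if "s \<in> {0<..<s0}" for s using card[OF that] by (simp add: rts_def)
 have mid: "s0/2 \<in> {0<..<s0}" "complex_of_real (s0/2) \<in> ball 0 s0" using s0 by auto
 have nz: "disc e (\<psi> (of_real (s0/2))) \<noteq> 0" using disc_card[OF in_pd[OF mid(2)]] cr[OF mid(1)] by simp
 have z0: "disc j (\<psi> s) = 0" if "e < j" "s \<in> ball 0 s0" for j s
 proof (rule analytic_continuation[OF hd open_ball connected_ball, of "of_real ` {0<..<s0}" "of_real (s0/2)" j s])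
  show "complex_of_real (s0 / 2) islimpt of_real ` {0<..<s0}"
  proof (rule islimpt_isCont_image)
   show "s0 / 2 islimpt {0<..<s0}" using s0 by (intro interior_limit_point) simp
   show "\<forall>\<^sub>F y in at (s0 / 2). complex_of_real y \<noteq> complex_of_real (s0 / 2)"
    unfolding of_real_eq_iff by (simp add: eventually_at_filter)
  qed auto
  fix z :: complex assume "z \<in> of_real ` {0<..<s0}"
  then obtain x where "z = of_real x" "x \<in> {0<..<s0}" by auto
  then show "disc j (\<psi> z) = 0" using cr disc_eq_0[OF in_pd[of z], of j] that(1) by auto
 qed (use mid that in auto)
 have "0 \<in> ball (0::complex) s0" using s0 by simp
 from non_zero_neighbour_alt[OF hd open_ball connected_ball this mid(2) nz]
 have "eventually (\<lambda>s. disc e (\<psi> s) \<noteq> 0) (at 0)" by (rule eventually_mono) blast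
 then obtain d where d: "d > 0" "\<And>s. s \<noteq> 0 ==> dist s 0 < d ==> disc e (\<psi> s) \<noteq> 0"
  unfolding eventually_at by blast
 have "card (rts (\<psi> s)) = e" if "s \<in> ball 0 (min d s0) - {0}" for s
  by (rule card_rts_eqI[OF in_pd]) (use that d z0 in auto)
 then show ?thesis using d s0 by (intro exI[of _ "min d s0"]) (auto simp: rts_def)
qed

end

section \<open>Curve selection by induction on the dimension\<close>

definition arc_prop :: "nat \<Rightarrow> ((nat \<Rightarrow> complex) \<Rightarrow> complex) set \<Rightarrow> real \<Rightarrow> (nat \<Rightarrow> complex) \<Rightarrow> bool" where
 "arc_prop m H \<epsilon> x \<longleftrightarrow> (\<exists>\<psi> s0 p s. 0 < s0 \<and> (\<forall>i. (\<lambda>s. \<psi> s i) holomorphic_on ball 0 s0) \<and>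
   \<psi> ` ball 0 s0 \<subseteq> pdisc m \<epsilon> \<and> \<psi> 0 = (\<lambda>_. 0) \<and> (\<forall>s\<in>ball 0 s0. \<forall>i. \<psi> (cnj s) i = cnj (\<psi> s i)) \<and>
   (inj_on (\<lambda>s. \<psi> (complex_of_real s)) {-s0<..<s0} \<or> (\<forall>s\<in>ball 0 s0. \<psi> s = (\<lambda>_. 0))) \<and>
   path p \<and> (\<forall>t\<in>{0..1}. p t \<in> pdisc m \<epsilon> \<and> real_pt (p t)) \<and> pathstart p = x \<and>
   0 < s \<and> s < s0 \<and> pathfinish p = \<psi> (complex_of_real s) \<and>
   (\<forall>h\<in>H. (\<forall>t\<in>{0..1}. (h (p t) = 0) = (h x = 0)) \<and>
    (\<forall>s\<in>{0<..<s0}. (h (\<psi> (complex_of_real s)) = 0) = (h x = 0))))"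

text \<open>A finite set \<open>H\<close> and its zero pattern, instead of one zero set, since the
  step needs all the vanishing and nonvanishing discriminants to keep their status.\<close>

definition curve_selection :: "nat \<Rightarrow> bool" where
 "curve_selection m \<longleftrightarrow> (\<forall>H r. finite H --> 0 < r --> (\<forall>h\<in>H. hol_germ m r h) -->
   (\<exists>\<delta>>0. \<delta> \<le> r \<and> (\<forall>x\<in>pdisc m \<delta>. real_pt x --> arc_prop m H r x)))"

lemma real_pt_curve: "(\<forall>s\<in>ball 0 s0. \<forall>i. \<psi> (cnj s) i = cnj (\<psi> s i)) ==> \<bar>s\<bar> < s0 ==> real_pt (\<psi> (complex_of_real s))"
 by (auto simp: real_pt_def Reals_cnj_iff dest: bspec[of _ _ "complex_of_real s"])

lemma slice_nonzero_nhd: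
 assumes k: "hol_germ (Suc m) \<epsilon> k" and \<rho>: "0 < \<rho>" "\<rho> < \<epsilon>"
  and nz: "\<And>z. cmod z = \<rho> ==> k ((\<lambda>_. 0)(m := z)) \<noteq> 0"
 shows "\<exists>\<delta>>0. \<delta> \<le> \<epsilon> \<and> (\<forall>x\<in>pdisc m \<delta>. \<forall>z. cmod z = \<rho> --> k (x(m := z)) \<noteq> 0)"
proof -
 have \<epsilon>: "0 < \<epsilon>" using \<rho> by simp
 have ne: "sphere (0::complex) \<rho> \<noteq> {}" using \<rho> by simp
 have c: "continuous_on (pdisc m \<epsilon> \<times> sphere 0 \<rho>) (\<lambda>x. k ((fst x)(m := snd x)))"
 proof (rule continuous_on_compose2[OF hol_germ_cont[OF k]])
  show "continuous_on (pdisc m \<epsilon> \<times> sphere 0 \<rho>) (\<lambda>x. (fst x)(m := snd x))"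
   by (intro continuous_on_upd continuous_intros)
  show "(\<lambda>x. (fst x)(m := snd x)) ` (pdisc m \<epsilon> \<times> sphere 0 \<rho>) \<subseteq> pdisc (Suc m) \<epsilon>"
   using pdisc_upd \<rho> by auto
 qed
 have c0: "continuous_on (sphere 0 \<rho>) (\<lambda>z. cmod (k ((\<lambda>_. 0)(m := z))))"
 proof (rule continuous_on_norm)
  have "continuous_on (sphere 0 \<rho>) (\<lambda>z. (\<lambda>_::nat. 0::complex, z))" by (intro continuous_intros)
  moreover have "(\<lambda>z. (\<lambda>_. 0, z)) ` sphere 0 \<rho> \<subseteq> pdisc m \<epsilon> \<times> sphere 0 \<rho>" using zero_in_pdisc[OF \<epsilon>, of m] by auto
  ultimately show "continuous_on (sphere 0 \<rho>) (\<lambda>z. k ((\<lambda>_. 0)(m := z)))"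
   using continuous_on_compose2[OF c] by fastforce
 qed
 obtain z1 where z1: "z1 \<in> sphere 0 \<rho>" "\<forall>z\<in>sphere 0 \<rho>. cmod (k ((\<lambda>_. 0)(m := z1))) \<le> cmod (k ((\<lambda>_. 0)(m := z)))"
  using continuous_attains_inf[OF compact_sphere ne c0] by blast
 define \<mu> where "\<mu> = cmod (k ((\<lambda>_. 0)(m := z1)))"
 have \<mu>: "0 < \<mu>" "\<And>z. cmod z = \<rho> ==> \<mu> \<le> cmod (k ((\<lambda>_. 0)(m := z)))" using z1 nz[of z1] by (auto simp: \<mu>_def)
 obtain X where X: "(\<lambda>_. 0) \<in> X" "open X"
  "\<forall>x\<in>X \<inter> pdisc m \<epsilon>. \<forall>z\<in>sphere 0 \<rho>. dist (k (x(m := z))) (k ((\<lambda>_. 0)(m := z))) \<le> \<mu>/2"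
 proof (rule continuous_on_prod_compactE[OF c compact_sphere zero_in_pdisc[OF \<epsilon>]])
  show "0 < \<mu>/2" using \<mu>(1) by simp
 qed (rule that, simp_all only: fst_conv snd_conv)
 obtain \<delta>0 where \<delta>0: "\<delta>0 > 0" "pdisc m \<delta>0 \<subseteq> X" using pdisc_nhd[OF X(2,1)] by blast
 have "k (x(m := z)) \<noteq> 0" if x: "x \<in> pdisc m (min \<delta>0 \<epsilon>)" and z: "cmod z = \<rho>" for x z
 proof
  assume 0: "k (x(m := z)) = 0"
  have "x \<in> X \<inter> pdisc m \<epsilon>" using x \<delta>0(2) pdisc_mono[of "min \<delta>0 \<epsilon>" \<delta>0 m] pdisc_mono[of "min \<delta>0 \<epsilon>" \<epsilon> m] by auto
  then have "dist (k (x(m := z))) (k ((\<lambda>_. 0)(m := z))) \<le> \<mu>/2" using X(3) z by auto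
  then have "cmod (k ((\<lambda>_. 0)(m := z))) \<le> \<mu>/2" unfolding 0 by simp
  then show False using \<mu>(2)[OF z] \<mu>(1) by linarith
 qed
 then show ?thesis using \<delta>0(1) \<epsilon> by (intro exI[of _ "min \<delta>0 \<epsilon>"]) auto
qed

lemma Min_pos_choice:
 fixes P :: "'a \<Rightarrow> real \<Rightarrow> bool"
 assumes "finite A" "\<And>a. a \<in> A ==> \<exists>d>0. P a d" "\<And>a d d'. P a d ==> 0 < d' ==> d' \<le> d ==> P a d'" and "0 < c"
 shows "\<exists>d>0. d \<le> c \<and> (\<forall>a\<in>A. P a d)"
 using assms(1,2)
proof (induction A rule: finite_induct)
 case empty then show ?case using \<open>0 < c\<close> by auto
next
 case (insert a A)
 then obtain d where d: "d > 0" "d \<le> c" "\<forall>a\<in>A. P a d" by auto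
 obtain d' where d': "d' > 0" "P a d'" using insert.prems by auto
 show ?case using d d' assms(3) by (intro exI[of _ "min d d'"]) (auto simp: min_def)
qed

text \<open>When the arc in the base is constant, the last coordinate axis takes its place: no
  member of \<open>H\<close> vanishes on it near the origin except possibly at the origin.\<close>

lemma arc_prop_axis:
 assumes \<rho>: "0 < \<rho>" "\<rho> < \<epsilon>" and nz: "\<And>h z. h \<in> H ==> z \<noteq> 0 ==> cmod z < \<rho> ==> h ((\<lambda>_. 0)(m := z)) \<noteq> 0"
  and p: "path p" "\<And>t. t \<in> {0..1} ==> p t \<in> pdisc (Suc m) \<epsilon> \<and> real_pt (p t)" "pathstart p = x"
  and fin: "pathfinish p = (\<lambda>_. 0)(m := complex_of_real y)" "\<bar>y\<bar> < \<rho>"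
  and pat: "\<And>h t. h \<in> H ==> t \<in> {0..1} ==> (h (p t) = 0) = (h x = 0)"
 shows "arc_prop (Suc m) H \<epsilon> x"
proof (cases "y = 0")
 case True
 have p1: "p 1 = (\<lambda>_. 0)" using fin True by (auto simp: pathfinish_def)
 show ?thesis unfolding arc_prop_def
 proof (rule exI[of _ "\<lambda>_ _. 0"], rule exI[of _ 1], rule exI[of _ p], rule exI[of _ "1/2"], intro conjI ballI)
  show "pathfinish p = (\<lambda>_. 0)" using p1 by (simp add: pathfinish_def)
  show "(h (\<lambda>_. 0) = 0) = (h x = 0)" if "h \<in> H" for h using pat[OF that, of 1] p1 by simp
 qed (use p pat \<rho> in \<open>auto simp: pdisc_def\<close>)
next
 case False
 \<comment> \<open>The direction of the axis is chosen so that the end of \<open>p\<close> has the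
   positive parameter \<open>\<bar>y\<bar>\<close>.\<close>
 define c where "c = complex_of_real (sgn y)"
 have c: "cmod c = 1" "c \<noteq> 0" "c \<in> \<real>" using False by (auto simp: c_def sgn_real_def)
 have e: "c * of_real \<bar>y\<bar> = of_real y" by (simp add: c_def sgn_mult_abs flip: of_real_mult)
 have p1: "p 1 = (\<lambda>_. 0)(m := of_real y)" using fin by (simp add: pathfinish_def)
 have hx: "h x \<noteq> 0" if "h \<in> H" for h
  using pat[OF that, of 1] nz[OF that, of "of_real y"] p1 fin(2) False by auto
 show ?thesis unfolding arc_prop_def
 proof (rule exI[of _ "\<lambda>s. (\<lambda>_. 0)(m := c * s)"], rule exI[of _ \<rho>], rule exI[of _ p], rule exI[of _ "\<bar>y\<bar>"], intro conjI ballI)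
  show "\<forall>i. (\<lambda>s. ((\<lambda>_. 0)(m := c * s)) i) holomorphic_on ball 0 \<rho>"
  proof
   show "(\<lambda>s. ((\<lambda>_. 0)(m := c * s)) i) holomorphic_on ball 0 \<rho>" for i
    by (cases "i = m") (auto intro!: holomorphic_intros)
  qed
  show "(\<lambda>s. (\<lambda>_. 0)(m := c * s)) ` ball 0 \<rho> \<subseteq> pdisc (Suc m) \<epsilon>"
   using \<rho> c by (auto simp: pdisc_def norm_mult)
  show "\<forall>i. ((\<lambda>_. 0)(m := c * cnj s)) i = cnj (((\<lambda>_. 0)(m := c * s)) i)" for s
   using c(3) by (auto simp: Reals_cnj_iff)
  show "inj_on (\<lambda>s. (\<lambda>_. 0)(m := c * complex_of_real s)) {-\<rho><..<\<rho>} \<or> (\<forall>s\<in>ball 0 \<rho>. (\<lambda>_. 0)(m := c * s) = (\<lambda>_. 0))"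
   using c(2) by (intro disjI1 inj_onI) (auto dest!: fun_cong[of _ _ m])
  show "pathfinish p = (\<lambda>_. 0)(m := c * complex_of_real \<bar>y\<bar>)" using fin e by simp
  show "(h ((\<lambda>_. 0)(m := c * complex_of_real s)) = 0) = (h x = 0)" if "h \<in> H" "s \<in> {0<..<\<rho>}" for h s
   using hx[OF that(1)] nz[OF that(1), of "c * of_real s"] c that(2) by (simp add: norm_mult)
 qed (use p pat \<rho> fin False in \<open>auto simp: fun_eq_iff\<close>)
qed

text \<open>The induction hypothesis, applied to the discriminants, gives a path and an arc in the
  base along which all root counts are constant. The path is lifted by
  \<open>real_path_lift\<close>; over the arc, \<open>two_var_arc\<close> supplies a function
  \<open>Y\<close> and an exponent \<open>N\<close>, and the new arc is \<open>\<sigma>\<close> to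
  \<open>\<psi> (\<sigma> ^ N)\<close> with last coordinate \<open>Y \<sigma>\<close>.
  \<open>reg\<close> makes 0 the only root over the origin of the base.\<close>

theorem regular_step:
 assumes IH: "curve_selection m" and H: "finite H" "0 < \<epsilon>" "\<And>h. h \<in> H ==> hol_germ (Suc m) \<epsilon> h"
  and conj: "\<And>h x. h \<in> H ==> x \<in> pdisc (Suc m) \<epsilon> ==> h (\<lambda>i. cnj (x i)) = cnj (h x)"
  and reg: "\<And>h. h \<in> H ==> \<exists>\<rho>>0. \<forall>z. z \<noteq> 0 --> cmod z < \<rho> --> h ((\<lambda>_. 0)(m := z)) \<noteq> 0"
 shows "\<exists>\<delta>>0. \<delta> \<le> \<epsilon> \<and> (\<forall>x\<in>pdisc (Suc m) \<delta>. real_pt x --> arc_prop (Suc m) H \<epsilon> x)"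
proof -
 \<comment> \<open>The roots of the product are those of all members of \<open>H\<close> together.
   Its constant root count keeps roots of different members from colliding, so that gaps between
   consecutive real roots make sense.\<close>
 define G where "G x = (\<Prod>h\<in>H. h x)" for x
 define K where "K = insert G H"
 have finK: "finite K" using H by (simp add: K_def)
 have holK: "hol_germ (Suc m) \<epsilon> k" if "k \<in> K" for k
  using that H hol_germ_prod[of H "Suc m" \<epsilon> "\<lambda>h. h"] by (auto simp: K_def G_def[abs_def])
 have Gz: "G x = 0 \<longleftrightarrow> (\<exists>h\<in>H. h x = 0)" for x unfolding G_def using H(1) by (rule prod_zero_iff)
 obtain \<rho>0 where \<rho>0: "\<rho>0 > 0" "\<rho>0 \<le> \<epsilon>" "\<forall>h\<in>H. \<forall>z. z \<noteq> 0 --> cmod z < \<rho>0 --> h ((\<lambda>_. 0)(m := z)) \<noteq> 0"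
  using Min_pos_choice[OF H(1), of "\<lambda>h \<rho>. \<forall>z. z \<noteq> 0 --> cmod z < \<rho> --> h ((\<lambda>_. 0)(m := z)) \<noteq> 0" \<epsilon>] reg H(2) by force
 define \<rho> where "\<rho> = \<rho>0 / 2"
 have \<rho>: "0 < \<rho>" "\<rho> < \<epsilon>" "\<rho> < \<rho>0" using \<rho>0 by (auto simp: \<rho>_def)
 have nzH: "h ((\<lambda>_. 0)(m := z)) \<noteq> 0" if "h \<in> H" "z \<noteq> 0" "cmod z \<le> \<rho>" for h z
  using \<rho>0(3) that \<rho>(3) by auto
 have nzK: "k ((\<lambda>_. 0)(m := z)) \<noteq> 0" if "k \<in> K" "z \<noteq> 0" "cmod z \<le> \<rho>" for k z
  using that nzH Gz by (auto simp: K_def)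
 obtain \<delta>1 where \<delta>1: "\<delta>1 > 0" "\<delta>1 \<le> \<epsilon>" "\<forall>k\<in>K. \<forall>x\<in>pdisc m \<delta>1. \<forall>z. cmod z = \<rho> --> k (x(m := z)) \<noteq> 0"
 proof -
  have "\<exists>\<delta>>0. \<delta> \<le> \<epsilon> \<and> (\<forall>k\<in>K. \<forall>x\<in>pdisc m \<delta>. \<forall>z. cmod z = \<rho> --> k (x(m := z)) \<noteq> 0)"
  proof (rule Min_pos_choice[OF finK _ _ H(2)])
   show "\<exists>\<delta>>0. \<forall>x\<in>pdisc m \<delta>. \<forall>z. cmod z = \<rho> --> k (x(m := z)) \<noteq> 0" if "k \<in> K" for k
    using slice_nonzero_nhd[OF holK[OF that] \<rho>(1,2)] nzK[OF that] \<rho>(1) by fastforce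
   show "\<forall>x\<in>pdisc m d'. \<forall>z. cmod z = \<rho> --> k (x(m := z)) \<noteq> 0"
    if "\<forall>x\<in>pdisc m d. \<forall>z. cmod z = \<rho> --> k (x(m := z)) \<noteq> 0" "d' \<le> d" for k d d'
    using that(1) pdisc_mono[OF that(2), of m] by blast
  qed
  then show thesis using that by blast
 qed
 have nz1: "\<forall>x\<in>pdisc m \<delta>1. \<forall>z. cmod z = \<rho> --> k (x(m := z)) \<noteq> 0" if "k \<in> K" for k using \<delta>1(3) that by blast
 let ?cd = "\<lambda>k x. card {z. cmod z < \<rho> \<and> k (x(m := z)) = 0}"
 obtain \<delta>2 where \<delta>2: "\<delta>2 > 0" "\<delta>2 \<le> \<delta>1" "\<forall>k\<in>K. \<exists>d. \<forall>x\<in>pdisc m \<delta>2. ?cd k x \<le> d"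
 proof -
  have "\<exists>\<delta>>0. \<delta> \<le> \<delta>1 \<and> (\<forall>k\<in>K. \<exists>d. \<forall>x\<in>pdisc m \<delta>. ?cd k x \<le> d)"
  proof (rule Min_pos_choice[OF finK _ _ \<delta>1(1)])
   show "\<exists>\<delta>>0. \<exists>d. \<forall>x\<in>pdisc m \<delta>. ?cd k x \<le> d" if "k \<in> K" for k
    using slice_card_bound[OF holK[OF that] \<rho>(1,2) \<delta>1(2) nz1[OF that] \<delta>1(1)] by blast
   show "\<exists>e. \<forall>x\<in>pdisc m d'. ?cd k x \<le> e" if "\<exists>e. \<forall>x\<in>pdisc m d. ?cd k x \<le> e" "d' \<le> d" for k d d'
    using that(1) pdisc_mono[OF that(2), of m] by blast
  qed
  then show thesis using that by blast
 qed
 then obtain db where db: "\<And>k x. k \<in> K ==> x \<in> pdisc m \<delta>2 ==> ?cd k x \<le> db k" by metis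
 have \<delta>2\<epsilon>: "\<delta>2 \<le> \<epsilon>" using \<delta>1 \<delta>2 by linarith
 have sub2: "pdisc m \<delta>2 \<subseteq> pdisc m \<delta>1" by (rule pdisc_mono[OF \<delta>2(2)])
 have nz2: "\<forall>x\<in>pdisc m \<delta>2. \<forall>z. cmod z = \<rho> --> k (x(m := z)) \<noteq> 0" if "k \<in> K" for k using nz1[OF that] sub2 by blast
 let ?disc = "\<lambda>k. root_family.disc (\<lambda>x z. k (x(m := z))) \<rho>"
 \<comment> \<open>By \<open>slice_card_eq\<close> the discriminants up to the bound
   \<open>db k\<close> suffice to fix every root count, which keeps this set finite.\<close>
 define H' where "H' = (\<Union>k\<in>K. ?disc k ` {..db k})"
 have "finite H'" using finK by (simp add: H'_def)
 moreover have "\<forall>h\<in>H'. hol_germ m \<delta>2 h"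
 proof
  fix h assume "h \<in> H'"
  then obtain k j where k: "k \<in> K" and h: "h = ?disc k j" unfolding H'_def by blast
  show "hol_germ m \<delta>2 h" unfolding h by (rule slice_disc[OF holK[OF k] \<rho>(1,2) \<delta>2\<epsilon> nz2[OF k]])
 qed
 ultimately obtain \<delta>3 where \<delta>3: "\<delta>3 > 0" "\<delta>3 \<le> \<delta>2" "\<forall>x\<in>pdisc m \<delta>3. real_pt x --> arc_prop m H' \<delta>2 x"
  using IH \<delta>2(1) unfolding curve_selection_def by blast
 have "arc_prop (Suc m) H \<epsilon> x" if x: "x \<in> pdisc (Suc m) (min \<delta>3 \<rho>)" and rx: "real_pt x" for x
 proof -
  define x' where "x' = x(m := 0)"
  define y where "y = Re (x m)"
  have "cmod (x m) < \<rho>" using x by (auto simp: pdisc_def)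
  moreover have xm: "x m = of_real y" using rx by (simp add: y_def real_pt_def of_real_Re)
  ultimately have y: "\<bar>y\<bar> < \<rho>" by simp
  have xx: "x'(m := of_real y) = x" using xm by (auto simp: x'_def)
  have "x' \<in> pdisc m (min \<delta>3 \<rho>)" unfolding x'_def by (rule pdisc_restrict[OF x])
  then have x'3: "x' \<in> pdisc m \<delta>3" using pdisc_mono[of "min \<delta>3 \<rho>" \<delta>3 m] by auto
  have rx': "real_pt x'" using rx by (auto simp: x'_def real_pt_def)
  from \<delta>3(3) x'3 rx' have "arc_prop m H' \<delta>2 x'" by blast
  then obtain \<psi> s0 p sa where s0: "0 < s0" and \<psi>: "\<forall>i. (\<lambda>s. \<psi> s i) holomorphic_on ball 0 s0"
   "\<psi> ` ball 0 s0 \<subseteq> pdisc m \<delta>2" "\<psi> 0 = (\<lambda>_. 0)" "\<forall>s\<in>ball 0 s0. \<forall>i. \<psi> (cnj s) i = cnj (\<psi> s i)"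
   "inj_on (\<lambda>s. \<psi> (complex_of_real s)) {-s0<..<s0} \<or> (\<forall>s\<in>ball 0 s0. \<psi> s = (\<lambda>_. 0))"
   and p: "path p" "\<forall>t\<in>{0..1}. p t \<in> pdisc m \<delta>2 \<and> real_pt (p t)" "pathstart p = x'"
   and sa: "0 < sa" "sa < s0" "pathfinish p = \<psi> (complex_of_real sa)"
   and pat: "\<forall>h\<in>H'. (\<forall>t\<in>{0..1}. (h (p t) = 0) = (h x' = 0)) \<and>
    (\<forall>s\<in>{0<..<s0}. (h (\<psi> (complex_of_real s)) = 0) = (h x' = 0))"
   unfolding arc_prop_def by (elim exE conjE) (rule that; assumption)
  have x'2: "x' \<in> pdisc m \<delta>2" using x'3 pdisc_mono[OF \<delta>3(2), of m] by blast
  have \<psi>2: "\<psi> s \<in> pdisc m \<delta>2" if "s \<in> ball 0 s0" for s using \<psi>(2) that by blast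
  have H'I: "?disc k j \<in> H'" if "k \<in> K" "j \<le> db k" for k j using that by (auto simp only: H'_def UN_iff image_iff atMost_iff)
  have card_eq: "?cd k w = ?cd k x'" if "k \<in> K" "w \<in> pdisc m \<delta>2" "\<And>h. h \<in> H' ==> (h w = 0) = (h x' = 0)" for k w
   by (rule slice_card_eq[OF holK[OF that(1)] \<rho>(1,2) \<delta>2\<epsilon> nz2[OF that(1)] that(2) x'2 db[OF that(1,2)] db[OF that(1) x'2]])
    (use that(3) H'I[OF that(1)] in blast)
  have cardp: "?cd k (p t) = ?cd k x'" if "k \<in> K" "t \<in> {0..1}" for k t
   by (rule card_eq[OF that(1)]) (use p(2) pat that in blast)+
  have card\<psi>: "?cd k (\<psi> (complex_of_real s)) = ?cd k x'" if "k \<in> K" "s \<in> {0<..<s0}" for k s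
   by (rule card_eq[OF that(1)]) (use \<psi>2[of "of_real s"] pat that in auto)
  \<comment> \<open>The counts are known at positive real parameters, whereas Puiseux
    parametrisation needs them on a complex punctured disc; this costs a smaller radius.\<close>
  obtain s1 where s1: "s1 > 0" "s1 \<le> s0" "\<forall>k\<in>K. \<forall>s\<in>ball 0 s1 - {0}. ?cd k (\<psi> s) = ?cd k x'"
  proof -
   have "\<exists>s1>0. s1 \<le> s0 \<and> (\<forall>k\<in>K. \<forall>s\<in>ball 0 s1 - {0}. ?cd k (\<psi> s) = ?cd k x')"
   proof (rule Min_pos_choice[OF finK _ _ s0])
    show "\<exists>d>0. \<forall>s\<in>ball 0 d - {0}. ?cd k (\<psi> s) = ?cd k x'" if "k \<in> K" for k
     using slice_card_punctured[OF holK[OF that] \<rho>(1,2) \<delta>2\<epsilon> nz2[OF that] _ \<psi>(2) s0 card\<psi>[OF that]] \<psi>(1) by blast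
   qed auto
   then show thesis using that by blast
  qed
  define s2 where "s2 = s1 / 2"
  have s2: "0 < s2" "s2 < s1" "s2 < s0" using s1 by (auto simp: s2_def)
  \<comment> \<open>The base path is continued along the base arc from \<open>sa\<close> to the
    parameter \<open>s2\<close> inside the smaller disc.\<close>
  define q where "q = p +++ (\<lambda>t. \<psi> (complex_of_real (linepath sa s2 t)))"
  have lin: "linepath sa s2 t \<in> {0<..<s0}" if "t \<in> {0..1}" for t
  proof -
   have "linepath sa s2 t \<in> closed_segment sa s2" using that by (intro linepath_in_path) auto
   moreover have "closed_segment sa s2 \<subseteq> {0<..<s0}"
    using sa s2 by (intro closed_segment_subset) (auto simp: is_interval_convex_1[symmetric] is_interval_oo)
   ultimately show ?thesis by blast
  qed
  have c\<psi>: "continuous_on (ball 0 s0) \<psi>" by (rule continuous_on_holomorphic_coords) (use \<psi>(1) in blast)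
  have path2: "path (\<lambda>t. \<psi> (complex_of_real (linepath sa s2 t)))"
   unfolding path_def
  proof (rule continuous_on_compose2[OF c\<psi>])
   show "continuous_on {0..1} (\<lambda>t. complex_of_real (linepath sa s2 t))"
    unfolding linepath_def by (intro continuous_intros)
   show "(\<lambda>t. complex_of_real (linepath sa s2 t)) ` {0..1} \<subseteq> ball 0 s0" using lin by fastforce
  qed
  have pq: "path q" unfolding q_def
   using p(1) path2 sa(3) by (intro path_join_imp) (auto simp: pathstart_def linepath_def)
  have q01: "q 0 = x'" "q 1 = \<psi> (of_real s2)"
   using p(3) by (auto simp: q_def joinpaths_def pathstart_def linepath_def)
  have qt: "q t \<in> pdisc m \<delta>2 \<and> real_pt (q t) \<and> (\<forall>k\<in>K. ?cd k (q t) = ?cd k x')" if t: "t \<in> {0..1}" for t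
  proof (cases "t \<le> 1/2")
   case True
   then have "q t = p (2 * t)" "2 * t \<in> {0..1}" using t by (auto simp: q_def joinpaths_def)
   then show ?thesis using p(2) cardp by auto
  next
   case False
   then have *: "q t = \<psi> (of_real (linepath sa s2 (2*t - 1)))" "2*t - 1 \<in> {0..1}" using t by (auto simp: q_def joinpaths_def)
   define l where "l = linepath sa s2 (2*t - 1)"
   have l: "l \<in> {0<..<s0}" unfolding l_def by (rule lin[OF *(2)])
   have "q t = \<psi> (of_real l)" using * by (simp add: l_def)
   moreover have "\<psi> (of_real l) \<in> pdisc m \<delta>2" using l by (intro \<psi>2) auto
   moreover have "real_pt (\<psi> (of_real l))" using real_pt_curve[OF \<psi>(4), of l] l by auto
   moreover have "\<forall>k\<in>K. ?cd k (\<psi> (of_real l)) = ?cd k x'" using card\<psi> l by blast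
   ultimately show ?thesis by simp
  qed
  have cnjG: "k (\<lambda>i. cnj (w i)) = cnj (k w)" if "k \<in> K" "w \<in> pdisc (Suc m) \<epsilon>" for k w
   using that conj by (auto simp: K_def G_def)
  have cq: "continuous_on {0..1} q" using pq by (simp add: path_def)
  have famq: "root_family_const {0..1} (\<lambda>t z. k ((q t)(m := z))) \<rho> \<epsilon> (?cd k x')" if "k \<in> K" for k
   by (rule root_family_const_compose[OF slice_family[OF holK[OF that] \<rho>(1,2) \<delta>2\<epsilon> nz2[OF that]] cq])
    (use qt that in blast)+
  have upd2: "w(m := z) \<in> pdisc (Suc m) \<epsilon>" if "w \<in> pdisc m \<delta>2" "cmod z < \<epsilon>" for w z
   by (rule slice_in[OF holK[of G] \<rho>(1,2) \<delta>2\<epsilon> nz2[of G] that]) (auto simp: K_def)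
  have "\<exists>V :: real \<Rightarrow> real. continuous_on {0..1} V \<and> V 0 = y \<and> (\<forall>t\<in>{0..1}. \<bar>V t\<bar> < \<rho>) \<and>
   (\<forall>h\<in>H. \<forall>t\<in>{0..1}. (h ((q t)(m := of_real (V t))) = 0) = (h ((q 0)(m := of_real y)) = 0))"
  proof (rule real_path_lift[OF H(1), of "\<lambda>t z. G ((q t)(m := z))" "\<lambda>h t z. h ((q t)(m := z))" "{0..1}" \<rho> \<epsilon> "?cd G x'" "\<lambda>h. ?cd h x'" 0 y])
   show "G ((q s)(m := z)) = (\<Prod>h\<in>H. h ((q s)(m := z)))" for s z by (simp add: G_def)
   show "root_family_const {0..1} (\<lambda>t z. G ((q t)(m := z))) \<rho> \<epsilon> (?cd G x')" by (rule famq) (simp add: K_def)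
   show "root_family_const {0..1} (\<lambda>t z. h ((q t)(m := z))) \<rho> \<epsilon> (?cd h x')" if "h \<in> H" for h
    by (rule famq) (simp add: K_def that)
   fix t :: real and z assume t: "t \<in> {0..1}" and z: "cmod z < \<rho>"
   have "(\<lambda>i. cnj (((q t)(m := z)) i)) = (q t)(m := cnj z)"
    using qt[OF t] by (auto simp: real_pt_def Reals_cnj_iff)
   moreover have "(q t)(m := z) \<in> pdisc (Suc m) \<epsilon>" using qt[OF t] z \<rho> by (intro upd2) auto
   ultimately show "G ((q t)(m := cnj z)) = cnj (G ((q t)(m := z)))"
    using cnjG[of G "(q t)(m := z)"] by (simp add: K_def)
  qed (use y in auto)
  then obtain V where V: "continuous_on {0..1} V" "V 0 = y" "\<forall>t\<in>{0..1}. \<bar>V t\<bar> < \<rho>"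
   "\<forall>h\<in>H. \<forall>t\<in>{0..1}. (h ((q t)(m := of_real (V t))) = 0) = (h x = 0)"
   unfolding q01(1) xx by blast
  define P1 where "P1 t = (q t)(m := complex_of_real (V t))" for t
  have P1: "path P1" "pathstart P1 = x" "pathfinish P1 = (\<psi> (of_real s2))(m := of_real (V 1))"
  proof -
   show "path P1" unfolding path_def P1_def by (intro continuous_on_upd cq continuous_on_of_real V(1))
   show "pathstart P1 = x" unfolding P1_def pathstart_def q01 V(2) by (rule xx)
   show "pathfinish P1 = (\<psi> (of_real s2))(m := of_real (V 1))" unfolding P1_def pathfinish_def q01 ..
  qed
  have P1t: "P1 t \<in> pdisc (Suc m) \<epsilon> \<and> real_pt (P1 t)" "h \<in> H ==> (h (P1 t) = 0) = (h x = 0)" if t: "t \<in> {0..1}" for t h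
  proof -
   have "\<bar>V t\<bar> < \<epsilon>" using V(3) t \<rho> by force
   then show "P1 t \<in> pdisc (Suc m) \<epsilon> \<and> real_pt (P1 t)"
    using qt[OF t] upd2[of "q t" "of_real (V t)"] by (auto simp: P1_def real_pt_def)
   show "(h (P1 t) = 0) = (h x = 0)" if "h \<in> H" using V(4) t that by (simp add: P1_def)
  qed
  have y2: "\<bar>V 1\<bar> < \<rho>" using V(3) by auto
  show ?thesis
  proof (cases "\<forall>s\<in>ball 0 s0. \<psi> s = (\<lambda>_. 0)")
   case True
   then have "\<psi> (of_real s2) = (\<lambda>_. 0)" using s2 by auto
   then show ?thesis
    using arc_prop_axis[OF \<rho>(1,2) _ P1(1) P1t(1) P1(2) _ y2 P1t(2)] P1(3) nzH by auto
  next
   case False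
   then have inj: "inj_on (\<lambda>s. \<psi> (complex_of_real s)) {-s0<..<s0}" using \<psi>(5) by blast
   have sub1: "ball 0 s1 \<subseteq> ball (0::complex) s0" using s1 by auto
   have c\<psi>1: "continuous_on (ball 0 s1) \<psi>" by (rule continuous_on_subset[OF c\<psi> sub1])
   have \<psi>1: "\<psi> ` ball 0 s1 \<subseteq> pdisc m \<delta>2" using \<psi>(2) sub1 by blast
   have fam1: "root_family (ball 0 s1) (\<lambda>s z. k ((\<psi> s)(m := z))) \<rho> \<epsilon>" if "k \<in> K" for k
    by (rule root_family_compose[OF slice_family[OF holK[OF that] \<rho>(1,2) \<delta>2\<epsilon> nz2[OF that]] c\<psi>1 \<psi>1])
   interpret PF: plane_family "\<lambda>s z. G ((\<psi> s)(m := z))" \<rho> \<epsilon> s1 "?cd G x'"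
   proof (rule plane_family.intro)
    show "root_family (ball 0 s1) (\<lambda>s z. G ((\<psi> s)(m := z))) \<rho> \<epsilon>" by (rule fam1) (simp add: K_def)
    show "0 < s1" by fact
    show "?cd G (\<psi> s) = ?cd G x'" if "s \<in> ball 0 s1 - {0}" for s using s1(3) that by (simp add: K_def)
    show "z = 0" if "cmod z < \<rho>" "G ((\<psi> 0)(m := z)) = 0" for z
     using nzK[of G z] that \<psi>(3) by (auto simp: K_def)
    show "(\<lambda>s. G ((\<psi> s)(m := z))) holomorphic_on ball 0 s1" if "z \<in> ball 0 \<epsilon>" for z
    proof (rule slice_curve[OF holK[of G] \<rho>(1,2) \<delta>2\<epsilon> nz2[of G] open_ball _ \<psi>1])
     show "(\<lambda>s. \<psi> s i) holomorphic_on ball 0 s1" for i using \<psi>(1) sub1 holomorphic_on_subset by blast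
    qed (use that in \<open>auto simp: K_def\<close>)
    fix s z :: complex assume s: "s \<in> ball 0 s1" and z: "z \<in> ball 0 \<epsilon>"
    have "(\<lambda>i. cnj (((\<psi> s)(m := z)) i)) = (\<psi> (cnj s))(m := cnj z)"
     using \<psi>(4) s sub1 by (auto simp: fun_eq_iff)
    moreover have "(\<psi> s)(m := z) \<in> pdisc (Suc m) \<epsilon>" using \<psi>1 s z by (intro upd2) auto
    ultimately show "G ((\<psi> (cnj s))(m := cnj z)) = cnj (G ((\<psi> s)(m := z)))"
     using cnjG[of G "(\<psi> s)(m := z)"] by (simp add: K_def)
   qed
   have ta: "\<exists>N Y r. \<exists>(S :: real \<Rightarrow> real) (V' :: real \<Rightarrow> real). 0 < N \<and> 0 < r \<and> r \<le> root N s1 \<and> Y holomorphic_on ball 0 r \<and> Y 0 = 0 \<and>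
    (\<forall>\<sigma>\<in>ball 0 r. cmod (Y \<sigma>) < \<rho>) \<and> (\<forall>\<sigma>\<in>ball 0 r. \<sigma> \<in> \<real> --> Y \<sigma> \<in> \<real>) \<and>
    (even N --> (\<forall>\<sigma>\<in>ball 0 r - {0}. Y (-\<sigma>) \<noteq> Y \<sigma>)) \<and>
    continuous_on {0..1} S \<and> continuous_on {0..1} V' \<and> S 0 = s2 \<and> V' 0 = V 1 \<and>
    (\<forall>t\<in>{0..1}. 0 < S t \<and> S t < s1 \<and> \<bar>V' t\<bar> < \<rho>) \<and>
    (\<exists>\<sigma>. 0 < \<sigma> \<and> \<sigma> < r \<and> S 1 = \<sigma> ^ N \<and> of_real (V' 1) = Y (of_real \<sigma>)) \<and>
    (\<forall>h\<in>H. (\<forall>t\<in>{0..1}. (h ((\<psi> (of_real (S t)))(m := of_real (V' t))) = 0) = (h ((\<psi> (of_real s2))(m := of_real (V 1))) = 0)) \<and>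
      (\<forall>\<sigma>. 0 < \<sigma> --> \<sigma> < r --> (h ((\<psi> (of_real \<sigma> ^ N))(m := Y (of_real \<sigma>))) = 0) = (h ((\<psi> (of_real s2))(m := of_real (V 1))) = 0)))"
   proof (rule PF.two_var_arc[OF H(1), of "\<lambda>h s z. h ((\<psi> s)(m := z))" "\<lambda>h. ?cd h x'" s2 "V 1"])
    show "G ((\<psi> s)(m := z)) = (\<Prod>h\<in>H. h ((\<psi> s)(m := z)))" for s z by (simp add: G_def)
    show "root_family (ball 0 s1) (\<lambda>s z. h ((\<psi> s)(m := z))) \<rho> \<epsilon>" if "h \<in> H" for h
     by (rule fam1) (simp add: K_def that)
    show "?cd h (\<psi> s) = ?cd h x'" if "h \<in> H" "s \<in> ball 0 s1 - {0}" for h s using s1(3) that by (simp add: K_def)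
   qed (use s2 y2 in auto)
   obtain N Y r and S V' :: "real \<Rightarrow> real" and \<sigma>1 where N: "0 < N" and r: "0 < r" "r \<le> root N s1" and Y: "Y holomorphic_on ball 0 r" "Y 0 = 0"
    "\<forall>\<sigma>\<in>ball 0 r. cmod (Y \<sigma>) < \<rho>" "\<forall>\<sigma>\<in>ball 0 r. \<sigma> \<in> \<real> --> Y \<sigma> \<in> \<real>"
    "even N --> (\<forall>\<sigma>\<in>ball 0 r - {0}. Y (-\<sigma>) \<noteq> Y \<sigma>)" and
    S: "continuous_on {0..1} S" "continuous_on {0..1} V'" "S 0 = s2" "V' 0 = V 1"
    "\<forall>t\<in>{0..1}. 0 < S t \<and> S t < s1 \<and> \<bar>V' t\<bar> < \<rho>" and
    \<sigma>1: "0 < \<sigma>1" "\<sigma>1 < r" "S 1 = \<sigma>1 ^ N" "of_real (V' 1) = Y (of_real \<sigma>1)" and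
    patY: "\<forall>h\<in>H. (\<forall>t\<in>{0..1}. (h ((\<psi> (of_real (S t)))(m := of_real (V' t))) = 0) = (h ((\<psi> (of_real s2))(m := of_real (V 1))) = 0)) \<and>
      (\<forall>\<sigma>. 0 < \<sigma> --> \<sigma> < r --> (h ((\<psi> (of_real \<sigma> ^ N))(m := Y (of_real \<sigma>))) = 0) = (h ((\<psi> (of_real s2))(m := of_real (V 1))) = 0))"
    using ta by (elim exE conjE) (rule that; assumption)
   define \<phi> where "\<phi> \<sigma> = (\<psi> (\<sigma> ^ N))(m := Y \<sigma>)" for \<sigma>
   define P2 where "P2 t = (\<psi> (of_real (S t)))(m := complex_of_real (V' t))" for t
   have pw: "\<sigma> ^ N \<in> ball 0 s1" if "\<sigma> \<in> ball 0 r" for \<sigma> :: complex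
   proof -
    have "cmod \<sigma> ^ N < root N s1 ^ N" using that r N by (intro power_strict_mono) auto
    then show ?thesis using N s1(1) by (simp add: norm_power)
   qed
   have Sb: "complex_of_real (S t) \<in> ball 0 s0" if "t \<in> {0..1}" for t using bspec[OF S(5) that] s1(2) by auto
   have cP2: "continuous_on {0..1} (\<lambda>t. \<psi> (complex_of_real (S t)))"
    by (rule continuous_on_compose2[OF c\<psi>]) (use Sb S(1) in \<open>auto intro!: continuous_intros\<close>)
   have P2: "path P2" unfolding path_def P2_def by (intro continuous_on_upd cP2 continuous_intros S)
   have P2s: "pathstart P2 = pathfinish P1" by (simp add: P2_def P1(3) pathstart_def S)
   have P2f: "pathfinish P2 = \<phi> (of_real \<sigma>1)" by (simp add: P2_def \<phi>_def pathfinish_def \<sigma>1)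
   have hend: "(h ((\<psi> (of_real s2))(m := of_real (V 1))) = 0) = (h x = 0)" if "h \<in> H" for h
    using P1t(2)[of 1 h] that P1(3) by (simp add: pathfinish_def)
   have P2t: "P2 t \<in> pdisc (Suc m) \<epsilon> \<and> real_pt (P2 t)" "h \<in> H ==> (h (P2 t) = 0) = (h x = 0)" if t: "t \<in> {0..1}" for t h
   proof -
    have "\<bar>V' t\<bar> < \<epsilon>" using S(5) t \<rho> by force
    moreover have "real_pt (\<psi> (of_real (S t)))" using real_pt_curve[OF \<psi>(4), of "S t"] bspec[OF S(5) t] s1(2) by auto
    ultimately show "P2 t \<in> pdisc (Suc m) \<epsilon> \<and> real_pt (P2 t)"
     using \<psi>2[OF Sb[OF t]] upd2[of "\<psi> (of_real (S t))" "of_real (V' t)"] by (auto simp: P2_def real_pt_def)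
    show "(h (P2 t) = 0) = (h x = 0)" if "h \<in> H" using patY hend that t by (simp add: P2_def)
   qed
   show ?thesis unfolding arc_prop_def
   proof (rule exI[of _ \<phi>], rule exI[of _ r], rule exI[of _ "P1 +++ P2"], rule exI[of _ \<sigma>1], intro conjI)
    show "\<forall>i. (\<lambda>s. \<phi> s i) holomorphic_on ball 0 r"
    proof
     fix i
     have "(\<lambda>s. \<psi> (s ^ N) i) holomorphic_on ball 0 r"
     proof (rule holomorphic_comp[of "\<lambda>s. \<psi> s i" "ball 0 s1" "\<lambda>s. s ^ N"])
      show "(\<lambda>s. \<psi> s i) holomorphic_on ball 0 s1" using \<psi>(1) sub1 holomorphic_on_subset by blast
      show "(\<lambda>s. s ^ N) ` ball 0 r \<subseteq> ball (0::complex) s1" using pw by blast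
     qed (intro holomorphic_intros)
     then show "(\<lambda>s. \<phi> s i) holomorphic_on ball 0 r" using Y(1) by (cases "i = m") (auto simp: \<phi>_def)
    qed
    show "\<phi> ` ball 0 r \<subseteq> pdisc (Suc m) \<epsilon>"
    proof clarify
     fix s :: complex assume s: "s \<in> ball 0 r"
     have "cmod (Y s) < \<epsilon>" using bspec[OF Y(3) s] \<rho>(2) by simp
     moreover have "\<psi> (s ^ N) \<in> pdisc m \<delta>2" using \<psi>1 pw[OF s] by blast
     ultimately show "\<phi> s \<in> pdisc (Suc m) \<epsilon>" unfolding \<phi>_def by (intro upd2)
    qed
    show "\<phi> 0 = (\<lambda>_. 0)" using N \<psi>(3) Y(2) by (auto simp: \<phi>_def zero_power)
    show "\<forall>s\<in>ball 0 r. \<forall>i. \<phi> (cnj s) i = cnj (\<phi> s i)"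
    proof (intro ballI allI)
     fix s :: complex and i assume s: "s \<in> ball 0 r"
     have "Y (cnj s) = cnj (Y s)" by (rule holomorphic_cnj_sym[OF Y(1) r(1) _ s]) (use Y(4) in blast)
     moreover have "\<psi> (cnj (s ^ N)) i = cnj (\<psi> (s ^ N) i)" using \<psi>(4) pw[OF s] sub1 by blast
     ultimately show "\<phi> (cnj s) i = cnj (\<phi> s i)" by (simp add: \<phi>_def)
    qed
    show "inj_on (\<lambda>s. \<phi> (complex_of_real s)) {-r<..<r} \<or> (\<forall>s\<in>ball 0 r. \<phi> s = (\<lambda>_. 0))"
    proof (intro disjI1 inj_onI)
     fix a b assume a: "a \<in> {-r<..<r}" and b: "b \<in> {-r<..<r}" and eq: "\<phi> (of_real a) = \<phi> (of_real b)"
     have mm: "\<psi> w m = 0" if "w \<in> ball 0 s0" for w using \<psi>2[OF that] by (simp add: pdisc_def)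
     have ab: "complex_of_real a ^ N \<in> ball 0 s0" "complex_of_real b ^ N \<in> ball 0 s0"
      using subsetD[OF sub1 pw[of "of_real a"]] subsetD[OF sub1 pw[of "of_real b"]] a b by auto
     have "\<psi> (of_real a ^ N) i = \<psi> (of_real b ^ N) i" for i
     proof (cases "i = m")
      case True then show ?thesis using mm ab by simp
     next
      case False then show ?thesis using fun_cong[OF eq, of i] by (simp add: \<phi>_def)
     qed
     then have "\<psi> (of_real (a ^ N)) = \<psi> (of_real (b ^ N))" by (auto simp: of_real_power)
     moreover have "a ^ N \<in> {-s0<..<s0}" "b ^ N \<in> {-s0<..<s0}"
      using ab by (simp_all add: norm_power abs_less_iff flip: power_abs)
     ultimately have "a ^ N = b ^ N" using inj by (auto simp: inj_on_def)
     then have "\<bar>a\<bar> = \<bar>b\<bar>" using N by (metis abs_ge_zero power_abs power_eq_imp_eq_base)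
     \<comment> \<open>For odd \<open>N\<close> opposite parameters have different powers, hence
       different base points; for even \<open>N\<close> the last coordinate separates them.\<close>
     then consider "a = b" | "a = -b" by linarith
     then show "a = b"
     proof cases
      case 2
      show ?thesis
      proof (cases "b = 0 \<or> odd N")
       case True
       then show ?thesis using 2 \<open>a ^ N = b ^ N\<close> by auto
      next
       case False
       then have "Y (- of_real b) \<noteq> Y (of_real b)" using Y(5) b by auto
       moreover have "Y (of_real a) = Y (of_real b)" using fun_cong[OF eq, of m] by (simp add: \<phi>_def)
       ultimately show ?thesis using 2 by simp
      qed
     qed
    qed
    show "path (P1 +++ P2)" using P1(1) P2 P2s by (intro path_join_imp) auto
    have *: "(P1 +++ P2) t \<in> pdisc (Suc m) \<epsilon> \<and> real_pt ((P1 +++ P2) t) \<and> (\<forall>h\<in>H. (h ((P1 +++ P2) t) = 0) = (h x = 0))"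
     if t: "t \<in> {0..1}" for t
    proof (cases "t \<le> 1/2")
     case True
     then show ?thesis using P1t[of "2 * t"] t by (auto simp: joinpaths_def)
    next
     case False
     then show ?thesis using P2t[of "2 * t - 1"] t by (auto simp: joinpaths_def)
    qed
    then show "\<forall>t\<in>{0..1}. (P1 +++ P2) t \<in> pdisc (Suc m) \<epsilon> \<and> real_pt ((P1 +++ P2) t)" by blast
    show "\<forall>h\<in>H. (\<forall>t\<in>{0..1}. (h ((P1 +++ P2) t) = 0) = (h x = 0)) \<and>
     (\<forall>s\<in>{0<..<r}. (h (\<phi> (complex_of_real s)) = 0) = (h x = 0))"
     using * patY hend by (auto simp: \<phi>_def)
   qed (use r \<sigma>1 P1(2) P2f in auto)
  qed
 qed
 then show ?thesis using \<delta>3 \<delta>2\<epsilon> \<rho> by (intro exI[of _ "min \<delta>3 \<rho>"]) auto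
qed

lemma curve_selection_0: "curve_selection 0"
 unfolding curve_selection_def
proof (intro allI impI)
 fix H and r :: real assume "0 < r"
 have "arc_prop 0 H r x" if "x \<in> pdisc 0 r" for x
 proof -
  have x: "x = (\<lambda>_. 0)" using that by (auto simp: pdisc_def)
  show ?thesis unfolding arc_prop_def x
   by (rule exI[of _ "\<lambda>_ _. 0"], rule exI[of _ 1], rule exI[of _ "\<lambda>_ _. 0"], rule exI[of _ "1/2"])
    (auto simp: pdisc_def real_pt_def path_def pathstart_def pathfinish_def)
 qed
 then show "\<exists>\<delta>>0. \<delta> \<le> r \<and> (\<forall>x\<in>pdisc 0 \<delta>. real_pt x --> arc_prop 0 H r x)" using \<open>0 < r\<close> by blast
qed

text \<open>Joins two points by a complex line with connected parameter domain, to which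
  one-variable identity theorems apply.\<close>

lemma pdisc_line:
 assumes "x \<in> pdisc m r" "y \<in> pdisc m r"
 shows "\<exists>S. open S \<and> convex S \<and> 0 \<in> S \<and> 1 \<in> S \<and> (\<lambda>z i. x i + z * (y i - x i)) ` S \<subseteq> pdisc m r"
proof -
 let ?S = "\<Inter>i\<in>{..<m}. {z. x i + z * (y i - x i) \<in> ball 0 r}"
 have "{z. x i + z * (y i - x i) \<in> ball 0 r} = (\<lambda>z. x i + z * (y i - x i)) -` ball 0 r" for i by auto
 then have "open {z. x i + z * (y i - x i) \<in> ball 0 r}" for i
  using open_vimage[OF open_ball, of "\<lambda>z. x i + z * (y i - x i)" 0 r] by (simp add: continuous_intros)
 then have "open ?S" by (intro open_INT) auto
 moreover have "convex ?S"
 proof (intro convex_INT)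
  fix i
  show "convex {z. x i + z * (y i - x i) \<in> ball 0 r}"
  proof (rule convexI)
   fix a b :: complex and u v :: real
   assume a: "a \<in> {z. x i + z * (y i - x i) \<in> ball 0 r}" "b \<in> {z. x i + z * (y i - x i) \<in> ball 0 r}" and uv: "0 \<le> u" "0 \<le> v" "u + v = 1"
   have "u *\<^sub>R (x i + a * (y i - x i)) + v *\<^sub>R (x i + b * (y i - x i)) \<in> ball 0 r"
    using a uv by (intro convexD[OF convex_ball]) auto
   moreover have "u *\<^sub>R (x i + a * (y i - x i)) + v *\<^sub>R (x i + b * (y i - x i)) = (u + v) *\<^sub>R x i + (u *\<^sub>R a + v *\<^sub>R b) * (y i - x i)"
    by (simp add: algebra_simps scaleR_conv_of_real)
   ultimately show "u *\<^sub>R a + v *\<^sub>R b \<in> {z. x i + z * (y i - x i) \<in> ball 0 r}" using uv by simp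
  qed
 qed
 moreover have "0 \<in> ?S" "1 \<in> ?S" using assms by (auto simp: pdisc_def)
 moreover have "(\<lambda>z i. x i + z * (y i - x i)) ` ?S \<subseteq> pdisc m r"
  using assms by (auto simp: pdisc_def)
 ultimately show ?thesis by blast
qed

text \<open>On the complex line from a point \<open>v\<close> good for \<open>H\<close> to a point
  \<open>w\<close> good for \<open>h\<close>, the function \<open>h\<close> has only isolated zeros,
  while the members of \<open>H\<close> stay nonzero near \<open>v\<close>. A small real parameter
  on this line serves all of them.\<close>

lemma generic_point:
 assumes "finite H" "0 < r" "\<And>h. h \<in> H ==> hol_germ m r h"
  "\<And>h. h \<in> H ==> \<exists>x\<in>pdisc m r. real_pt x \<and> h x \<noteq> 0"
 shows "\<exists>v\<in>pdisc m r. real_pt v \<and> (\<forall>h\<in>H. h v \<noteq> 0)"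
 using assms(1,3,4)
proof (induction H rule: finite_induct)
 case empty
 show ?case using zero_in_pdisc[OF assms(2)] by (intro bexI[of _ "\<lambda>_. 0"]) (auto simp: real_pt_def)
next
 case (insert h H)
 then obtain v where v: "v \<in> pdisc m r" "real_pt v" "\<forall>h\<in>H. h v \<noteq> 0" by auto
 obtain w where w: "w \<in> pdisc m r" "real_pt w" "h w \<noteq> 0" using insert.prems(2)[of h] by auto
 let ?l = "\<lambda>z i. v i + z * (w i - v i)"
 obtain S where S: "open S" "convex S" "0 \<in> S" "1 \<in> S" "?l ` S \<subseteq> pdisc m r"
  using pdisc_line[OF v(1) w(1)] by blast
 have hol: "(\<lambda>z. k (?l z)) holomorphic_on S" if "k \<in> insert h H" for k
  by (rule hol_germ_curve[OF insert.prems(1)[OF that] S(1) _ S(5)]) (intro holomorphic_intros)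
 have "eventually (\<lambda>z. h (?l z) \<noteq> 0 \<and> z \<in> S) (at 0)"
  by (rule non_zero_neighbour_alt[OF hol S(1) convex_connected[OF S(2)] S(3,4)]) (use w in auto)
 moreover have "eventually (\<lambda>z. \<forall>k\<in>H. k (?l z) \<noteq> 0) (at 0)"
 proof (rule eventually_ball_finite[OF insert.hyps(1)], intro ballI)
  fix k assume "k \<in> H"
  then have "isCont (\<lambda>z. k (?l z)) 0"
   using holomorphic_on_imp_continuous_on[OF hol[of k]] S(1,3) by (simp add: continuous_on_eq_continuous_at)
  then have "((\<lambda>z. k (?l z)) \<longlongrightarrow> k v) (at 0)" by (simp add: isCont_def)
  then show "eventually (\<lambda>z. k (?l z) \<noteq> 0) (at 0)"
   using tendsto_imp_eventually_ne v(3) \<open>k \<in> H\<close> by blast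
 qed
 ultimately have "eventually (\<lambda>z. h (?l z) \<noteq> 0 \<and> z \<in> S \<and> (\<forall>k\<in>H. k (?l z) \<noteq> 0)) (at 0)"
  by eventually_elim auto
 then obtain d where d: "d > 0" "\<And>z. z \<noteq> 0 ==> dist z 0 < d ==> h (?l z) \<noteq> 0 \<and> z \<in> S \<and> (\<forall>k\<in>H. k (?l z) \<noteq> 0)"
  unfolding eventually_at by blast
 let ?z = "complex_of_real (d/2)"
 have z: "h (?l ?z) \<noteq> 0" "?z \<in> S" "\<forall>k\<in>H. k (?l ?z) \<noteq> 0" using d(2)[of ?z] d(1) by auto
 have "real_pt (?l ?z)" using v(2) w(2) by (auto simp: real_pt_def intro!: Reals_add Reals_mult Reals_diff)
 then show ?case using z S(5) by (intro bexI[of _ "?l ?z"]) auto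
qed

lemma continuous_on_shear:
 fixes f :: "'a::topological_space \<Rightarrow> nat \<Rightarrow> complex"
 assumes "continuous_on S f" shows "continuous_on S (\<lambda>x i. f x i + c i * f x m)"
proof (rule continuous_on_coordinatewise_then_product)
 fix i
 have c: "continuous_on S (\<lambda>x. f x j)" for j using assms by (rule continuous_on_product_then_coordinatewise)
 show "continuous_on S (\<lambda>x. f x i + c i * f x m)"
  by (intro continuous_on_add continuous_on_mult continuous_on_const c)
qed

text \<open>Prepares \<open>regular_step\<close>: each function is split into parts with real
  coefficients, those that vanish at all real points near the origin are set aside, and a real shear
  makes the last axis regular for the others.\<close>

theorem curve_selection_step:
 assumes IH: "curve_selection m" shows "curve_selection (Suc m)"
 unfolding curve_selection_def
proof (intro allI impI)
 fix H and r :: real assume H: "finite H" "0 < r" "\<forall>h\<in>H. hol_germ (Suc m) r h"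
 define re where "re h x = (h x + cnj (h (\<lambda>i. cnj (x i)))) * (1/2)" for h :: "(nat \<Rightarrow> complex) \<Rightarrow> complex" and x
 define im where "im h x = (h x + (-1) * cnj (h (\<lambda>i. cnj (x i)))) * (1/(2*\<i>))" for h :: "(nat \<Rightarrow> complex) \<Rightarrow> complex" and x
 define Hc where "Hc = re ` H \<union> im ` H"
 have finc: "finite Hc" using H(1) by (simp add: Hc_def)
 have holc: "hol_germ (Suc m) r h" if h: "h \<in> Hc" for h
 proof -
  obtain k where k: "k \<in> H" "h = re k \<or> h = im k" using h by (auto simp: Hc_def)
  have "hol_germ (Suc m) r (re k)" "hol_germ (Suc m) r (im k)"
   unfolding re_def[abs_def] im_def[abs_def] using H(3) k(1)
   by (intro hol_germ_mult hol_germ_add hol_germ_const hol_germ_cnj; simp)+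
  then show ?thesis using k(2) by blast
 qed
 have conjc: "h (\<lambda>i. cnj (x i)) = cnj (h x)" if "h \<in> Hc" for h x
  using that by (auto simp: Hc_def re_def im_def field_simps)
 have split0: "h x = 0 \<longleftrightarrow> re h x = 0 \<and> im h x = 0" if "real_pt x" for h x
 proof -
  have "(\<lambda>i. cnj (x i)) = x" using that by (auto simp: real_pt_def Reals_cnj_iff)
  then have "re h x = of_real (Re (h x))" "im h x = of_real (Im (h x))"
   by (simp_all add: re_def im_def complex_eq_iff)
  then show ?thesis by (simp add: complex_eq_iff)
 qed
 \<comment> \<open>Their pattern is constant on small real points, and no change of axis could make
   them regular.\<close>
 define Hz where "Hz = {h\<in>Hc. \<exists>\<rho>>0. \<forall>x\<in>pdisc (Suc m) \<rho>. real_pt x --> h x = 0}"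
 define Hn where "Hn = Hc - Hz"
 have "\<exists>d>0. d \<le> r \<and> (\<forall>h\<in>Hz. \<forall>x\<in>pdisc (Suc m) d. real_pt x --> h x = 0)"
 proof (rule Min_pos_choice[OF _ _ _ H(2)])
  show "finite Hz" using finc by (simp add: Hz_def)
  show "\<forall>x\<in>pdisc (Suc m) d'. real_pt x --> h x = 0" if "\<forall>x\<in>pdisc (Suc m) d. real_pt x --> h x = 0" "d' \<le> d" for h d d'
   using that(1) pdisc_mono[OF that(2), of "Suc m"] by blast
 qed (auto simp: Hz_def)
 then obtain r1 where r1: "0 < r1" "r1 \<le> r" "\<And>h x. h \<in> Hz ==> x \<in> pdisc (Suc m) r1 ==> real_pt x ==> h x = 0" by blast
 have hol1: "hol_germ (Suc m) r1 h" if "h \<in> Hc" for h by (rule hol_germ_subset[OF holc[OF that] r1(2)])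
 \<comment> \<open>The last coordinate joins the functions in order that
   \<open>v m \<noteq> 0\<close>, by which the shear divides.\<close>
 have "\<exists>v\<in>pdisc (Suc m) r1. real_pt v \<and> (\<forall>h\<in>insert (\<lambda>x. x m) Hn. h v \<noteq> 0)"
 proof (rule generic_point)
  show "finite (insert (\<lambda>x. x m) Hn)" using finc by (simp add: Hn_def)
  show "hol_germ (Suc m) r1 h" if "h \<in> insert (\<lambda>x. x m) Hn" for h
   using that hol1 hol_germ_coord[of "Suc m" r1 m] by (auto simp: Hn_def)
  show "\<exists>x\<in>pdisc (Suc m) r1. real_pt x \<and> h x \<noteq> 0" if "h \<in> insert (\<lambda>x. x m) Hn" for h
  proof (cases "h \<in> Hn")
   case True
   then show ?thesis using r1(1) by (auto simp: Hn_def Hz_def)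
  next
   case False
   then have "h = (\<lambda>x. x m)" using that by auto
   then show ?thesis using r1(1)
    by (intro bexI[of _ "(\<lambda>_. 0)(m := complex_of_real (r1/2))"]) (auto simp: real_pt_def pdisc_def)
  qed
 qed (fact r1(1))
 then obtain v where v: "v \<in> pdisc (Suc m) r1" "real_pt v" "\<And>h. h \<in> Hn ==> h v \<noteq> 0" "v m \<noteq> 0" by auto
 \<comment> \<open>The shear with these entries fixes the last coordinate and carries the last axis
   to the line through \<open>v\<close>, on which no member of \<open>Hn\<close> vanishes
   identically.\<close>
 define c where "c i = (if i < m then v i / v m else 0)" for i
 have creal: "cnj (c i) = c i" for i using v(2) by (auto simp: c_def real_pt_def Reals_cnj_iff)
 have cm: "c i = 0" if "i \<ge> m" for i using that by (simp add: c_def)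
 define sh where "sh y i = y i + c i * y m" for y i
 define ush where "ush x i = x i + - c i * x m" for x :: "nat \<Rightarrow> complex" and i
 have shush: "sh (ush x) = x" for x by (auto simp: sh_def ush_def cm)
 have shinj: "x = y" if "sh x = sh y" for x y
 proof -
  have "x m = y m" using fun_cong[OF that, of m] by (simp add: sh_def cm)
  then show ?thesis using fun_cong[OF that] by (auto simp: sh_def fun_eq_iff)
 qed
 define C where "C = (\<Sum>i<m. cmod (c i))"
 have C: "0 \<le> C" "\<And>i. cmod (c i) \<le> C"
 proof -
  show "0 \<le> C" by (simp add: C_def sum_nonneg)
  show "cmod (c i) \<le> C" for i
   using member_le_sum[of i "{..<m}" "\<lambda>i. cmod (c i)"] \<open>0 \<le> C\<close> by (cases "i < m") (auto simp: C_def cm)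
 qed
 have bound: "(\<lambda>i. y i + d i * y m) \<in> pdisc (Suc m) ((1 + C) * e)"
  if y: "y \<in> pdisc (Suc m) e" and d: "\<And>i. cmod (d i) \<le> C" "\<And>i. i \<ge> m ==> d i = 0" for y d e
 proof -
  have "cmod (y i + d i * y m) < (1 + C) * e" if "i < Suc m" for i
  proof -
   have ym: "cmod (y m) < e" "cmod (y i) < e" using y that by (auto simp: pdisc_def)
   have "cmod (y i + d i * y m) \<le> cmod (y i) + cmod (d i) * cmod (y m)" by (metis norm_mult norm_triangle_ineq)
   also have "cmod (d i) * cmod (y m) \<le> C * e" using d(1)[of i] ym by (intro mult_mono) (auto simp: C(1))
   finally show ?thesis using ym by (simp add: algebra_simps)
  qed
  moreover have "y i + d i * y m = 0" if "i \<ge> Suc m" for i using y d(2)[of i] that by (auto simp: pdisc_def)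
  ultimately show ?thesis by (auto simp: pdisc_def)
 qed
 \<comment> \<open>The shear and its inverse enlarge a polydisc at most by the factor
   \<open>1 + C\<close>.\<close>
 define \<epsilon> where "\<epsilon> = r1 / (1 + C)"
 have \<epsilon>: "0 < \<epsilon>" "(1 + C) * \<epsilon> = r1" using r1(1) C(1) by (auto simp: \<epsilon>_def)
 have sh_in: "sh y \<in> pdisc (Suc m) r1" if "y \<in> pdisc (Suc m) \<epsilon>" for y
  using bound[OF that C(2) cm] \<epsilon>(2) by (simp add: sh_def[abs_def])
 have sh_real: "real_pt (sh y)" if "real_pt y" for y
  using that creal by (auto simp: real_pt_def sh_def Reals_cnj_iff)
 have ush_real: "real_pt (ush y)" if "real_pt y" for y
  using that creal by (auto simp: real_pt_def ush_def Reals_cnj_iff)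
 have hol_sh: "hol_germ (Suc m) \<epsilon> (\<lambda>y. h (sh y))" if h: "h \<in> Hc" for h
 proof (rule hol_germI)
  show "continuous_on (pdisc (Suc m) \<epsilon>) (\<lambda>y. h (sh y))"
   by (rule continuous_on_compose2[OF hol_germ_cont[OF hol1[OF h]]]) (use sh_in in \<open>auto simp: sh_def[abs_def] intro!: continuous_on_shear continuous_on_id\<close>)
  fix S \<psi> assume \<psi>: "open S" "\<And>i. (\<lambda>s. \<psi> s i) holomorphic_on S" "\<psi> ` S \<subseteq> pdisc (Suc m) \<epsilon>"
  show "(\<lambda>s. h (sh (\<psi> s))) holomorphic_on S"
  proof (rule hol_germ_curve[OF hol1[OF h] \<psi>(1)])
   show "(\<lambda>s. sh (\<psi> s) i) holomorphic_on S" for i unfolding sh_def by (intro holomorphic_intros \<psi>(2))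
   show "(\<lambda>s. sh (\<psi> s)) ` S \<subseteq> pdisc (Suc m) r1" using \<psi>(3) sh_in by blast
  qed
 qed
 define H2 where "H2 = (\<lambda>h y. h (sh y)) ` Hn"
 have "\<exists>\<delta>>0. \<delta> \<le> \<epsilon> \<and> (\<forall>x\<in>pdisc (Suc m) \<delta>. real_pt x --> arc_prop (Suc m) H2 \<epsilon> x)"
 proof (rule regular_step[OF IH _ \<epsilon>(1)])
  show "finite H2" using finc by (simp add: H2_def Hn_def)
  show "hol_germ (Suc m) \<epsilon> h" if "h \<in> H2" for h using that hol_sh by (auto simp: H2_def Hn_def)
  show "h (\<lambda>i. cnj (x i)) = cnj (h x)" if hH: "h \<in> H2" for h x
  proof -
   obtain k where k: "k \<in> Hc" "h = (\<lambda>y. k (sh y))" using hH by (auto simp: H2_def Hn_def)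
   have "sh (\<lambda>i. cnj (x i)) = (\<lambda>i. cnj (sh x i))" by (auto simp: sh_def creal)
   then show ?thesis using conjc[OF k(1)] k(2) by simp
  qed
  show "\<exists>\<rho>>0. \<forall>z. z \<noteq> 0 --> cmod z < \<rho> --> h ((\<lambda>_. 0)(m := z)) \<noteq> 0" if hH: "h \<in> H2" for h
  proof -
   obtain k where k: "k \<in> Hn" "h = (\<lambda>y. k (sh y))" using hH by (auto simp: H2_def)
   have zv: "sh ((\<lambda>_. 0)(m := z)) = (\<lambda>i. 0 + (z / v m) * (v i - 0))" for z
    using v(1,4) by (auto simp: sh_def c_def pdisc_def fun_eq_iff not_less le_less_Suc_eq)
   obtain S where S: "open S" "convex S" "0 \<in> S" "1 \<in> S" "(\<lambda>z i. 0 + z * (v i - 0)) ` S \<subseteq> pdisc (Suc m) r1"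
    using pdisc_line[OF zero_in_pdisc[OF r1(1)] v(1)] by blast
   have hol: "(\<lambda>z. k (\<lambda>i. 0 + z * (v i - 0))) holomorphic_on S"
    by (rule hol_germ_curve[OF hol1 S(1) _ S(5)]) (use k(1) in \<open>auto simp: Hn_def intro!: holomorphic_intros\<close>)
   have "eventually (\<lambda>z. k (\<lambda>i. 0 + z * (v i - 0)) \<noteq> 0 \<and> z \<in> S) (at 0)"
    by (rule non_zero_neighbour_alt[OF hol S(1) convex_connected[OF S(2)] S(3,4)]) (use v(3)[OF k(1)] in simp)
   then obtain d where d: "d > 0" "\<And>z. z \<noteq> 0 ==> dist z 0 < d ==> k (\<lambda>i. 0 + z * (v i - 0)) \<noteq> 0"
    unfolding eventually_at by blast
   have "h ((\<lambda>_. 0)(m := z)) \<noteq> 0" if "z \<noteq> 0" "cmod z < d * cmod (v m)" for z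
    unfolding k(2) zv using d(2)[of "z / v m"] that v(4) by (simp add: norm_divide field_simps)
   then show ?thesis using d(1) v(4) by (intro exI[of _ "d * cmod (v m)"]) auto
  qed
 qed
 then obtain \<delta>' where \<delta>': "0 < \<delta>'" "\<delta>' \<le> \<epsilon>" "\<And>x. x \<in> pdisc (Suc m) \<delta>' ==> real_pt x ==> arc_prop (Suc m) H2 \<epsilon> x" by blast
 define \<delta> where "\<delta> = \<delta>' / (1 + C)"
 have \<delta>: "0 < \<delta>" "(1 + C) * \<delta> = \<delta>'" using \<delta>'(1) C(1) by (auto simp: \<delta>_def)
 have "1 * \<delta> \<le> (1 + C) * \<delta>" "1 * \<epsilon> \<le> (1 + C) * \<epsilon>" using \<delta>(1) \<epsilon>(1) C(1) by (intro mult_right_mono; simp)+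
 then have "\<delta> \<le> \<delta>'" and "\<epsilon> \<le> r1" using \<delta>(2) \<epsilon>(2) by simp_all
 then have "\<delta> \<le> r" using \<delta>'(2) r1(2) by linarith
 moreover have "arc_prop (Suc m) H r x" if x: "x \<in> pdisc (Suc m) \<delta>" and rx: "real_pt x" for x
 proof -
  have "(\<lambda>i. x i + - c i * x m) \<in> pdisc (Suc m) ((1 + C) * \<delta>)"
   by (rule bound[OF x]) (simp_all add: C(2) cm)
  then have "ush x \<in> pdisc (Suc m) \<delta>'" unfolding \<delta>(2) ush_def[abs_def] .
  from \<delta>'(3)[OF this ush_real[OF rx]]
  obtain \<psi> s0 p s where s0: "0 < s0" and \<psi>: "\<forall>i. (\<lambda>s. \<psi> s i) holomorphic_on ball 0 s0"
   "\<psi> ` ball 0 s0 \<subseteq> pdisc (Suc m) \<epsilon>" "\<psi> 0 = (\<lambda>_. 0)" "\<forall>s\<in>ball 0 s0. \<forall>i. \<psi> (cnj s) i = cnj (\<psi> s i)"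
   "inj_on (\<lambda>s. \<psi> (complex_of_real s)) {-s0<..<s0} \<or> (\<forall>s\<in>ball 0 s0. \<psi> s = (\<lambda>_. 0))"
   and p: "path p" "\<forall>t\<in>{0..1}. p t \<in> pdisc (Suc m) \<epsilon> \<and> real_pt (p t)" "pathstart p = ush x"
   and s: "0 < s" "s < s0" "pathfinish p = \<psi> (complex_of_real s)"
   and pat: "\<forall>h\<in>H2. (\<forall>t\<in>{0..1}. (h (p t) = 0) = (h (ush x) = 0)) \<and>
    (\<forall>s\<in>{0<..<s0}. (h (\<psi> (complex_of_real s)) = 0) = (h (ush x) = 0))"
   unfolding arc_prop_def by (elim exE conjE) (rule that; assumption)
  have sub: "pdisc (Suc m) r1 \<subseteq> pdisc (Suc m) r" by (rule pdisc_mono[OF r1(2)])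
  have x1: "x \<in> pdisc (Suc m) r1" using x \<open>\<delta> \<le> \<delta>'\<close> \<delta>'(2) \<open>\<epsilon> \<le> r1\<close> pdisc_mono[of \<delta> r1 "Suc m"] by auto
  have patc: "(h (sh y) = 0) = (h x = 0)"
   if "h \<in> Hc" "y \<in> pdisc (Suc m) \<epsilon>" "real_pt y" "\<forall>k\<in>H2. (k y = 0) = (k (ush x) = 0)" for h y
  proof (cases "h \<in> Hz")
   case True
   then show ?thesis using r1(3)[OF True sh_in[OF that(2)] sh_real[OF that(3)]] r1(3)[OF True x1 rx] by simp
  next
   case False
   then have "(\<lambda>y. h (sh y)) \<in> H2" using that(1) by (auto simp: H2_def Hn_def)
   then show ?thesis using that(4) shush by auto
  qed
  have patH: "(h (sh y) = 0) = (h x = 0)"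
   if "h \<in> H" "y \<in> pdisc (Suc m) \<epsilon>" "real_pt y" "\<forall>k\<in>H2. (k y = 0) = (k (ush x) = 0)" for h y
   using patc[of "re h" y] patc[of "im h" y] that split0[OF rx, of h] split0[OF sh_real[OF that(3)], of h]
   by (auto simp: Hc_def)
  have \<psi>s: "\<psi> (of_real a) \<in> pdisc (Suc m) \<epsilon>" "real_pt (\<psi> (of_real a))" if "a \<in> {0<..<s0}" for a
   using \<psi>(2) real_pt_curve[OF \<psi>(4), of a] that by (auto intro: subsetD[OF \<psi>(2)])
  show ?thesis unfolding arc_prop_def
  proof (rule exI[of _ "\<lambda>s. sh (\<psi> s)"], rule exI[of _ s0], rule exI[of _ "\<lambda>t. sh (p t)"], rule exI[of _ s], intro conjI)
   show "\<forall>i. (\<lambda>s. sh (\<psi> s) i) holomorphic_on ball 0 s0" using \<psi>(1) unfolding sh_def by (intro allI holomorphic_intros) auto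
   show "(\<lambda>s. sh (\<psi> s)) ` ball 0 s0 \<subseteq> pdisc (Suc m) r" using \<psi>(2) sh_in sub by blast
   show "sh (\<psi> 0) = (\<lambda>_. 0)" by (auto simp: \<psi>(3) sh_def)
   show "\<forall>s\<in>ball 0 s0. \<forall>i. sh (\<psi> (cnj s)) i = cnj (sh (\<psi> s) i)" using \<psi>(4) by (auto simp: sh_def creal)
   show "inj_on (\<lambda>s. sh (\<psi> (complex_of_real s))) {-s0<..<s0} \<or> (\<forall>s\<in>ball 0 s0. sh (\<psi> s) = (\<lambda>_. 0))"
    using \<psi>(5)
   proof
    assume "inj_on (\<lambda>s. \<psi> (complex_of_real s)) {-s0<..<s0}"
    then show ?thesis using shinj unfolding inj_on_def by blast
   qed (auto simp: sh_def)
   show "path (\<lambda>t. sh (p t))" using p(1) unfolding path_def sh_def[abs_def] by (rule continuous_on_shear)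
   show "\<forall>t\<in>{0..1}. sh (p t) \<in> pdisc (Suc m) r \<and> real_pt (sh (p t))" using p(2) sh_in sub sh_real by blast
   show "pathstart (\<lambda>t. sh (p t)) = x" using p(3) shush by (simp add: pathstart_def)
   show "pathfinish (\<lambda>t. sh (p t)) = sh (\<psi> (complex_of_real s))" using s(3) by (simp add: pathfinish_def)
   show "\<forall>h\<in>H. (\<forall>t\<in>{0..1}. (h (sh (p t)) = 0) = (h x = 0)) \<and>
     (\<forall>s\<in>{0<..<s0}. (h (sh (\<psi> (complex_of_real s))) = 0) = (h x = 0))"
   proof (intro ballI conjI)
    fix h assume h: "h \<in> H"
    show "(h (sh (p t)) = 0) = (h x = 0)" if "t \<in> {0..1}" for t
     by (rule patH[OF h]) (use p(2) pat that in blast)+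
    show "(h (sh (\<psi> (complex_of_real a))) = 0) = (h x = 0)" if "a \<in> {0<..<s0}" for a
     by (rule patH[OF h \<psi>s[OF that]]) (use pat that in blast)
   qed
  qed (use s0 s in auto)
 qed
 ultimately show "\<exists>\<delta>>0. \<delta> \<le> r \<and> (\<forall>x\<in>pdisc (Suc m) \<delta>. real_pt x --> arc_prop (Suc m) H r x)" using \<delta>(1) by blast
qed

theorem curve_selection: "curve_selection m"
 by (induction m) (simp_all add: curve_selection_0 curve_selection_step)

text \<open>The arc is a real analytic curve through the origin, so it also runs in the zero set
 for negative parameters.\<close>

corollary zero_set_arcs:
 assumes H: "finite H" "0 < r" "\<And>h. h \<in> H ==> hol_germ m r h"
 defines "Z \<equiv> {x\<in>pdisc m r. real_pt x \<and> (\<forall>h\<in>H. h x = 0)}"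
 shows "\<exists>\<delta>>0. \<forall>x\<in>Z. x \<in> pdisc m \<delta> --> x \<noteq> (\<lambda>_. 0) -->
  (\<exists>p \<phi>. path p \<and> path_image p \<subseteq> Z - {\<lambda>_. 0} \<and> pathstart p = x \<and> pathfinish p = \<phi> (1::real) \<and>
    continuous_on {-1..1} \<phi> \<and> inj_on \<phi> {-1..1} \<and> \<phi> 0 = (\<lambda>_. 0) \<and> \<phi> ` {-1..1} \<subseteq> Z)"
proof -
 \<comment> \<open>With the coordinates in the set, the pattern records that \<open>x\<close> is not
   the origin: the path cannot meet the origin, and the constant arc is excluded.\<close>
 let ?H = "H \<union> (\<lambda>i x. x i) ` {..<m}"
 have "finite ?H" "\<forall>h\<in>?H. hol_germ m r h" using H(1,3) hol_germ_coord[of m r] by auto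
 then have "\<exists>\<delta>>0. \<delta> \<le> r \<and> (\<forall>x\<in>pdisc m \<delta>. real_pt x --> arc_prop m ?H r x)"
  using curve_selection[of m, unfolded curve_selection_def] H(2) by (simp only: simp_thms)
 then obtain \<delta> where \<delta>: "\<delta> > 0" "\<And>x. x \<in> pdisc m \<delta> ==> real_pt x ==> arc_prop m ?H r x" by blast
 have "\<exists>p \<phi>. path p \<and> path_image p \<subseteq> Z - {\<lambda>_. 0} \<and> pathstart p = x \<and> pathfinish p = \<phi> (1::real) \<and>
    continuous_on {-1..1} \<phi> \<and> inj_on \<phi> {-1..1} \<and> \<phi> 0 = (\<lambda>_. 0) \<and> \<phi> ` {-1..1} \<subseteq> Z"
  if x: "x \<in> Z" "x \<in> pdisc m \<delta>" "x \<noteq> (\<lambda>_. 0)" for x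
 proof -
  have "arc_prop m ?H r x" using \<delta>(2) x by (simp add: Z_def)
  then obtain \<psi> s0 p s where s0: "0 < s0" and \<psi>: "\<forall>i. (\<lambda>s. \<psi> s i) holomorphic_on ball 0 s0"
   "\<psi> ` ball 0 s0 \<subseteq> pdisc m r" "\<psi> 0 = (\<lambda>_. 0)" "\<forall>s\<in>ball 0 s0. \<forall>i. \<psi> (cnj s) i = cnj (\<psi> s i)"
   "inj_on (\<lambda>s. \<psi> (complex_of_real s)) {-s0<..<s0} \<or> (\<forall>s\<in>ball 0 s0. \<psi> s = (\<lambda>_. 0))"
   and p: "path p" "\<forall>t\<in>{0..1}. p t \<in> pdisc m r \<and> real_pt (p t)" "pathstart p = x"
   and s: "0 < s" "s < s0" "pathfinish p = \<psi> (complex_of_real s)"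
   and pat: "\<forall>h\<in>?H. (\<forall>t\<in>{0..1}. (h (p t) = 0) = (h x = 0)) \<and>
    (\<forall>s\<in>{0<..<s0}. (h (\<psi> (complex_of_real s)) = 0) = (h x = 0))"
   unfolding arc_prop_def by (elim exE conjE) (rule that; assumption)
  obtain i where i: "i < m" "x i \<noteq> 0" using x(1,3) by (auto simp: Z_def pdisc_def fun_eq_iff not_less) (metis not_less)
  have patm: "\<forall>t\<in>{0..1}. (p t i = 0) = (x i = 0)" "\<forall>s\<in>{0<..<s0}. (\<psi> (complex_of_real s) i = 0) = (x i = 0)"
   using bspec[OF pat, of "\<lambda>x. x i"] i(1) by auto
  have inj: "inj_on (\<lambda>s. \<psi> (complex_of_real s)) {-s0<..<s0}"
  proof -
   have "s0/2 \<in> {0<..<s0}" "complex_of_real (s0/2) \<in> ball 0 s0" using s0 by auto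
   then have "\<psi> (of_real (s0/2)) \<noteq> (\<lambda>_. 0)" using patm(2) i(2) by metis
   then show ?thesis using \<psi>(5) \<open>complex_of_real (s0/2) \<in> ball 0 s0\<close> by blast
  qed
  \<comment> \<open>The arc property concerns positive parameters; the identity theorem carries
    vanishing over to the negative side.\<close>
  have h\<psi>: "h (\<psi> w) = 0" if h: "h \<in> H" and w: "w \<in> ball 0 s0" for h w
  proof (rule analytic_continuation[of "\<lambda>s. h (\<psi> s)" "ball 0 s0" "of_real ` {0<..<s0}" "of_real (s0/2)"])
   show "(\<lambda>s. h (\<psi> s)) holomorphic_on ball 0 s0"
    by (rule hol_germ_curve[OF H(3)[OF h] open_ball _ \<psi>(2)]) (use \<psi>(1) in blast)
   show "complex_of_real (s0 / 2) islimpt of_real ` {0<..<s0}"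
   proof (rule islimpt_isCont_image)
    show "s0 / 2 islimpt {0<..<s0}" using s0 by (intro interior_limit_point) simp
    show "\<forall>\<^sub>F y in at (s0 / 2). complex_of_real y \<noteq> complex_of_real (s0 / 2)"
     unfolding of_real_eq_iff by (simp add: eventually_at_filter)
   qed auto
   fix z :: complex assume "z \<in> of_real ` {0<..<s0}"
   then show "h (\<psi> z) = 0" using pat h x(1) by (auto simp: Z_def)
  qed (use s0 w in auto)
  define \<phi> where "\<phi> t = \<psi> (complex_of_real (t * s))" for t
  have in1: "t * s \<in> {-s0<..<s0}" if "t \<in> {-1..1}" for t
  proof -
   have "\<bar>t * s\<bar> \<le> s" using that s(1) by (auto simp: abs_mult abs_le_iff intro!: mult_left_le_one_le)
   then show ?thesis using s(2) by auto
  qed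
  have in2: "complex_of_real (t * s) \<in> ball 0 s0" if "t \<in> {-1..1}" for t using in1[OF that] by (auto simp: abs_less_iff simp del: of_real_mult)
  have "continuous_on {-1..1} \<phi>" unfolding \<phi>_def
   by (rule continuous_on_compose2[OF continuous_on_holomorphic_coords[of \<psi> "ball 0 s0"]])
    (use in2 \<psi>(1) in \<open>auto intro!: continuous_intros\<close>)
  moreover have "inj_on \<phi> {-1..1}"
  proof (rule inj_onI)
   fix a b assume "a \<in> {-1..1}" "b \<in> {-1..1}" "\<phi> a = \<phi> b"
   then have "a * s = b * s" using inj in1 unfolding \<phi>_def inj_on_def by blast
   then show "a = b" using s(1) by simp
  qed
  moreover have "\<phi> 0 = (\<lambda>_. 0)" by (simp add: \<phi>_def \<psi>(3))
  moreover have "\<phi> ` {-1..1} \<subseteq> Z"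
  proof clarify
   fix t :: real assume t: "t \<in> {-1..1}"
   have "real_pt (\<phi> t)" using real_pt_curve[OF \<psi>(4), of "t * s"] in1[OF t] by (auto simp: \<phi>_def)
   then show "\<phi> t \<in> Z" using subsetD[OF \<psi>(2) imageI[OF in2[OF t]]] h\<psi>[OF _ in2[OF t]] by (auto simp: Z_def \<phi>_def)
  qed
  moreover have "path_image p \<subseteq> Z - {\<lambda>_. 0}"
  proof (clarsimp simp: path_image_def)
   fix t :: real assume t: "0 \<le> t" "t \<le> 1"
   have "p t \<noteq> (\<lambda>_. 0)" using patm(1) i(2) t by (metis atLeastAtMost_iff)
   then show "p t \<in> Z \<and> p t \<noteq> (\<lambda>_. 0)" using p(2) pat x(1) t by (auto simp: Z_def)
  qed
  moreover have "pathfinish p = \<phi> 1" using s(3) by (simp add: \<phi>_def)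
  ultimately show ?thesis using p(1,3) by blast
 qed
 then show ?thesis using \<delta>(1) by blast
qed

section \<open>Extension of arcs\<close>

lemma inj_on_imp_locally_injective: "inj_on f S ==> locally_injective_on f S"
 unfolding locally_injective_on_def by (metis Int_UNIV_right UNIV_I open_UNIV)

text \<open>Two equal values near the seam \<open>b\<close> would have to come from different sides
  of it.\<close>

lemma locally_injective_glue:
 fixes f :: "real \<Rightarrow> 'a"
 assumes 1: "locally_injective_on f S1" "S1 \<subseteq> {..b}" "b \<in> S1"
  and 2: "locally_injective_on f S2" "S2 \<subseteq> {b..}" "b \<in> S2"
  and \<eta>: "0 < \<eta>" "\<And>s t. s \<in> S1 ==> t \<in> S2 ==> b - \<eta> < s ==> s < b ==> b < t ==> t < b + \<eta> ==> f s \<noteq> f t"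
 shows "locally_injective_on f (S1 \<union> S2)"
 unfolding locally_injective_on_def
proof
 fix x assume x: "x \<in> S1 \<union> S2"
 consider "x < b" | "x > b" | "x = b" by linarith
 then show "\<exists>N. open N \<and> x \<in> N \<and> inj_on f ((S1 \<union> S2) \<inter> N)"
 proof cases
  case 1
  then have "x \<in> S1" using x 2 by auto
  then obtain N where N: "open N" "x \<in> N" "inj_on f (S1 \<inter> N)" using assms(1) unfolding locally_injective_on_def by blast
  have "(S1 \<union> S2) \<inter> (N \<inter> {..<b}) \<subseteq> S1 \<inter> N" using 2 by auto
  then show ?thesis using N 1 inj_on_subset by (intro exI[of _ "N \<inter> {..<b}"]) auto
 next
  case 2
  then have "x \<in> S2" using x assms(2) by auto
  then obtain N where N: "open N" "x \<in> N" "inj_on f (S2 \<inter> N)" using assms(4) unfolding locally_injective_on_def by blast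
  have "(S1 \<union> S2) \<inter> (N \<inter> {b<..}) \<subseteq> S2 \<inter> N" using assms(2) by auto
  then show ?thesis using N 2 inj_on_subset by (intro exI[of _ "N \<inter> {b<..}"]) auto
 next
  case 3
  obtain N1 where N1: "open N1" "b \<in> N1" "inj_on f (S1 \<inter> N1)" using assms(1,3) unfolding locally_injective_on_def by blast
  obtain N2 where N2: "open N2" "b \<in> N2" "inj_on f (S2 \<inter> N2)" using assms(4,6) unfolding locally_injective_on_def by blast
  let ?N = "N1 \<inter> N2 \<inter> {b-\<eta><..<b+\<eta>}"
  have "inj_on f ((S1 \<union> S2) \<inter> ?N)"
  proof (rule linorder_inj_onI)
   fix s t assume st: "s < t" "s \<in> (S1 \<union> S2) \<inter> ?N" "t \<in> (S1 \<union> S2) \<inter> ?N"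
   consider "t \<le> b" | "b \<le> s" | "s < b" "b < t" by linarith
   then show "f s \<noteq> f t"
   proof cases
    case 1
    have "s \<in> S1" using st(1,2) 1 assms(5) by force
    moreover have "t \<in> S1" using st(3) 1 assms(3,5) by (cases "t = b") force+
    ultimately have "s \<in> S1 \<inter> N1" "t \<in> S1 \<inter> N1" using st by auto
    then show ?thesis using N1(3) st(1) by (auto dest: inj_onD)
   next
    case 2
    have "t \<in> S2" using st(1,3) 2 assms(2) by force
    moreover have "s \<in> S2" using st(2) 2 assms(2,6) by (cases "s = b") force+
    ultimately have "s \<in> S2 \<inter> N2" "t \<in> S2 \<inter> N2" using st by auto
    then show ?thesis using N2(3) st(1) by (auto dest: inj_onD)
   next
    case 3
    then have "s \<in> S1" "t \<in> S2" using st assms(2,5) by auto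
    then show ?thesis using \<eta>(2) 3 st by auto
   qed
  qed auto
  then show ?thesis using N1 N2 3 \<eta>(1) by (intro exI[of _ ?N]) auto
 qed
qed

text \<open>The path is first reduced to an arc, which is cut at the last time it lies on the part
  of \<open>f\<close> over \<open>[b,r]\<close> and at the first later time it lies on the part over
  \<open>[p,b]\<close>. Since \<open>f b\<close> is avoided, the two ends lie strictly on different
  sides of \<open>b\<close>.\<close>

lemma arc_extraction:
 fixes f :: "real \<Rightarrow> 'a::{complete_space,real_normed_vector}"
 assumes f: "continuous_on {p..r} f" "inj_on f {p..r}" and b: "p < b" "b < r"
  and h: "path h" "pathstart h \<in> f ` {b<..r}" "pathfinish h \<in> f ` {p..<b}" "f b \<notin> path_image h"
 obtains t1 t2 \<sigma> where "t1 \<in> {b<..r}" "t2 \<in> {p..<b}" "arc \<sigma>" "pathstart \<sigma> = f t1" "pathfinish \<sigma> = f t2"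
  "path_image \<sigma> \<subseteq> path_image h" "\<sigma> ` {0<..<1} \<inter> f ` {p..r} = {}"
proof -
 have ne: "pathstart h \<noteq> pathfinish h"
 proof
  assume "pathstart h = pathfinish h"
  then obtain s t where "s \<in> {b<..r}" "t \<in> {p..<b}" "f s = f t" using h(2,3) by auto
  then show False using inj_onD[OF f(2), of s t] b by auto
 qed
 obtain \<zeta> where \<zeta>: "arc \<zeta>" "path_image \<zeta> \<subseteq> path_image h" "pathstart \<zeta> = pathstart h" "pathfinish \<zeta> = pathfinish h"
  using path_contains_arc[OF h(1) refl refl ne] by blast
 have c\<zeta>: "continuous_on {0..1} \<zeta>" using \<zeta>(1) by (simp add: arc_def path_def)
 have K: "compact (f ` {b..r})" "compact (f ` {p..b})"
  using b by (auto intro!: compact_continuous_image continuous_on_subset[OF f(1)])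
 have disj: "x = f b" if x: "x \<in> f ` {b..r}" "x \<in> f ` {p..b}" for x
 proof -
  obtain s t where "s \<in> {b..r}" "t \<in> {p..b}" "x = f s" "x = f t" using x by auto
  then show ?thesis using inj_onD[OF f(2), of s t] b by auto
 qed
 have pre: "compact ({u..1} \<inter> \<zeta> -` K)" if "compact K" "0 \<le> u" for K u
 proof -
  have "continuous_on {u..1} \<zeta>" using that by (intro continuous_on_subset[OF c\<zeta>]) auto
  from continuous_closed_preimage[OF this _ compact_imp_closed[OF that(1)]]
  have "closed ({u..1} \<inter> \<zeta> -` K)" by simp
  moreover have "{u..1} \<inter> \<zeta> -` K = {u..1} \<inter> ({u..1} \<inter> \<zeta> -` K)" by auto
  ultimately show ?thesis using compact_Int_closed[OF compact_Icc, of "{u..1} \<inter> \<zeta> -` K" u 1] by simp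
 qed
 let ?A = "{0..1} \<inter> \<zeta> -` (f ` {b..r})"
 have "0 \<in> ?A" using \<zeta>(3) h(2) by (auto simp: pathstart_def)
 then have "?A \<noteq> {}" by blast
 from compact_attains_sup[OF pre[OF K(1) order_refl] this]
 obtain s1 where s1: "s1 \<in> ?A" "\<forall>t\<in>?A. t \<le> s1" by blast
 let ?B = "{s1..1} \<inter> \<zeta> -` (f ` {p..b})"
 have one: "\<zeta> 1 \<in> f ` {p..<b}" using \<zeta>(4) h(3) by (simp add: pathfinish_def)
 have "1 \<in> ?B" using one s1 by auto
 then have "?B \<noteq> {}" by blast
 have s1': "0 \<le> s1" "s1 \<le> 1" "\<zeta> s1 \<in> f ` {b..r}" using s1 by auto
 from compact_attains_inf[OF pre[OF K(2) s1'(1)] \<open>?B \<noteq> {}\<close>]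
 obtain s2 where s2: "s2 \<in> ?B" "\<forall>t\<in>?B. s2 \<le> t" by blast
 have noB: "\<zeta> s \<noteq> f b" if "s \<in> {0..1}" for s
 proof -
  have "\<zeta> s \<in> path_image \<zeta>" using that by (simp add: path_image_def)
  then show ?thesis using \<zeta>(2) h(4) by auto
 qed
 obtain t1 where t1: "t1 \<in> {b..r}" "\<zeta> s1 = f t1" using s1' by auto
 obtain t2 where t2: "t2 \<in> {p..b}" "\<zeta> s2 = f t2" using s2 by auto
 have t1b: "t1 \<noteq> b" using noB[of s1] s1' t1 by auto
 have t2b: "t2 \<noteq> b" using noB[of s2] s2 s1' t2 by auto
 have "s1 \<noteq> s2"
 proof
  assume "s1 = s2"
  then have "\<zeta> s1 \<in> f ` {p..b}" using s2(1) by simp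
  from disj[OF s1'(3) this] show False using noB[of s1] s1'(1,2) by simp
 qed
 then have s12: "s1 < s2" "s2 \<le> 1" using s2 by auto
 define \<sigma> where "\<sigma> = subpath s1 s2 \<zeta>"
 have "arc \<sigma>" unfolding \<sigma>_def using \<zeta>(1) s1' s12 by (intro arc_subpath_arc) auto
 moreover have "pathstart \<sigma> = f t1" "pathfinish \<sigma> = f t2" by (simp_all add: \<sigma>_def t1 t2)
 moreover have "path_image \<sigma> \<subseteq> path_image h"
  unfolding \<sigma>_def using path_image_subpath_subset[of s1 s2 \<zeta>] \<zeta>(2) s1'(1,2) s12 by (simp add: subset_trans)
 moreover have "\<sigma> ` {0<..<1} \<inter> f ` {p..r} = {}"
 proof -
  have "\<sigma> x \<notin> f ` {p..r}" if x: "0 < x" "x < 1" for x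
  proof
   assume *: "\<sigma> x \<in> f ` {p..r}"
   define s where "s = (s2 - s1) * x + s1"
   have "0 < (s2 - s1) * x" using s12 x by simp
   moreover have "(s2 - s1) * x < (s2 - s1) * 1" using s12 x by (intro mult_strict_left_mono) auto
   ultimately have s: "s1 < s" "s < s2" by (auto simp: s_def)
   have "\<sigma> x = \<zeta> s" by (simp add: \<sigma>_def subpath_def s_def)
   then have "\<zeta> s \<in> f ` {b..r} \<or> \<zeta> s \<in> f ` {p..b}"
   proof -
    have "{p..r} = {b..r} \<union> {p..b}" using b by auto
    then show ?thesis using * \<open>\<sigma> x = \<zeta> s\<close> by auto
   qed
   then show False
   proof
    assume "\<zeta> s \<in> f ` {b..r}"
    then have "s \<in> ?A" using s s12 s1' by auto
    then show False using bspec[OF s1(2), of s] s by simp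
   next
    assume "\<zeta> s \<in> f ` {p..b}"
    then have "s \<in> ?B" using s s12 s1' by auto
    then show False using bspec[OF s2(2), of s] s by simp
   qed
  qed
  then show ?thesis unfolding disjoint_iff by (metis greaterThanLessThan_iff imageE)
 qed
 moreover have "t1 \<in> {b<..r}" "t2 \<in> {p..<b}" using t1 t2 t1b t2b by auto
 ultimately show thesis using that by blast
qed

text \<open>In \<open>arcs\<close>, the path \<open>p\<close> arrives at \<open>\<phi> 1\<close>
  without meeting \<open>y\<close>, so that the half of \<open>\<phi>\<close> over
  \<open>[-1,0]\<close> is left as a continuation beyond \<open>y\<close>. \<open>\<tau>\<close> is
  the second branch at the starting point; \<open>\<gamma>\<tau>\<close> lets a path come in along
  \<open>\<gamma>\<close> and go out along \<open>\<tau>\<close>.\<close>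

locale arc_extension =
 fixes A :: "'a::banach set" and \<gamma> \<tau> :: "real \<Rightarrow> 'a" and c0 :: real
 assumes compact_bounded: "\<And>R. compact (A \<inter> cball 0 R)"
  and arcs: "\<And>y \<epsilon>. y \<in> A ==> 0 < \<epsilon> ==> \<exists>\<delta>>0. \<forall>x\<in>A. x \<noteq> y --> dist x y < \<delta> -->
   (\<exists>p \<phi>. path p \<and> path_image p \<subseteq> A \<inter> ball y \<epsilon> - {y} \<and> pathstart p = x \<and> pathfinish p = \<phi> (1::real) \<and>
     continuous_on {-1..1} \<phi> \<and> inj_on \<phi> {-1..1} \<and> \<phi> 0 = y \<and> \<phi> ` {-1..1} \<subseteq> A \<inter> ball y \<epsilon>)"
  and \<gamma>: "0 < c0" "continuous_on {0..c0} \<gamma>" "inj_on \<gamma> {0..c0}" "\<gamma> ` {0..c0} \<subseteq> A"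
  and \<tau>: "continuous_on {0..} \<tau>" "inj_on \<tau> {0..}" "\<tau> ` {0..} \<subseteq> A" "\<tau> 0 = \<gamma> 0"
  and \<gamma>\<tau>: "\<And>s t. 0 < s ==> 0 < t ==> t \<le> c0 ==> \<tau> s \<noteq> \<gamma> t"
begin

definition good :: bool where
 "good \<longleftrightarrow> (\<exists>\<Gamma>. continuous_on {0..} \<Gamma> \<and> locally_injective_on \<Gamma> {0..} \<and> \<Gamma> ` {0..} \<subseteq> A \<and>
   (\<exists>\<delta>. 0 < \<delta> \<and> \<delta> \<le> c0 \<and> (\<forall>t\<in>{0<..<\<delta>}. \<Gamma> t = \<gamma> t)) \<and>
   (filterlim (\<lambda>t. norm (\<Gamma> t)) at_top at_top \<or> (\<exists>T>0. \<Gamma> T = \<gamma> 0)))"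

text \<open>Injective on all of \<open>[0,c]\<close>, but tied to \<open>\<gamma>\<close> only on
  some initial piece, so that an arc may be cut and rerouted beyond it.\<close>

definition P :: "(real \<Rightarrow> 'a) \<Rightarrow> real \<Rightarrow> bool" where
 "P \<beta> c \<longleftrightarrow> 0 < c \<and> continuous_on {0..c} \<beta> \<and> inj_on \<beta> {0..c} \<and> \<beta> ` {0..c} \<subseteq> A \<and>
   (\<exists>\<delta>. 0 < \<delta> \<and> \<delta> \<le> c0 \<and> \<delta> \<le> c \<and> (\<forall>t\<in>{0..\<delta>}. \<beta> t = \<gamma> t))"

lemma P_subset: assumes "P \<beta> c" "0 < c'" "c' \<le> c" shows "P \<beta> c'"
proof -
 from assms obtain \<delta> where "0 < \<delta>" "\<delta> \<le> c0" "\<delta> \<le> c" "\<forall>t\<in>{0..\<delta>}. \<beta> t = \<gamma> t" unfolding P_def by blast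
 then have "\<exists>\<delta>. 0 < \<delta> \<and> \<delta> \<le> c0 \<and> \<delta> \<le> c' \<and> (\<forall>t\<in>{0..\<delta>}. \<beta> t = \<gamma> t)"
  using assms by (intro exI[of _ "min \<delta> c'"]) auto
 moreover have "{0..c'} \<subseteq> {0..c}" using assms by auto
 ultimately show ?thesis
  using assms continuous_on_subset[of "{0..c}" \<beta> "{0..c'}"] inj_on_subset[of \<beta> "{0..c}" "{0..c'}"]
  unfolding P_def by blast
qed

lemma P_0: "P \<beta> c ==> \<beta> 0 = \<gamma> 0"
 unfolding P_def by force

lemma P_extend:
 assumes "P \<beta> c" and g: "arc g" "pathstart g = \<beta> c" "path_image g \<subseteq> A" "g ` {0<..1} \<inter> \<beta> ` {0..c} = {}"
 shows "P (\<lambda>t. if t \<le> c then \<beta> t else g (t - c)) (c + 1)"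
proof -
 let ?f = "\<lambda>t. if t \<le> c then \<beta> t else g (t - c)"
 have c: "0 < c" and \<beta>: "continuous_on {0..c} \<beta>" "inj_on \<beta> {0..c}" "\<beta> ` {0..c} \<subseteq> A" using assms(1) unfolding P_def by auto
 obtain \<delta> where \<delta>: "0 < \<delta>" "\<delta> \<le> c0" "\<delta> \<le> c" "\<forall>t\<in>{0..\<delta>}. \<beta> t = \<gamma> t" using assms(1) unfolding P_def by blast
 have cg: "continuous_on {0..1} g" and ig: "inj_on g {0..1}" using g(1) by (auto simp: arc_def path_def)
 have "continuous_on ({0..c} \<union> {c..c+1}) ?f"
 proof (rule continuous_on_If)
  show "continuous_on {c..c+1} (\<lambda>t. g (t - c))"
   by (rule continuous_on_compose2[OF cg]) (auto intro!: continuous_intros)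
  show "\<beta> t = g (t - c)" if "t \<in> {0..c}" "\<not> t \<le> c" for t using that by auto
  show "\<beta> t = g (t - c)" if "t \<in> {c..c+1}" "t \<le> c" for t using that g(2) by (auto simp: pathstart_def)
 qed (use \<beta> in auto)
 moreover have "{0..c} \<union> {c..c+1} = {0..c+1}" using c by auto
 ultimately have 1: "continuous_on {0..c+1} ?f" by simp
 have 2: "inj_on ?f {0..c+1}"
 proof (rule linorder_inj_onI)
  fix s t assume st: "s < t" "s \<in> {0..c+1}" "t \<in> {0..c+1}"
  consider "t \<le> c" | "s \<le> c" "c < t" | "c < s" by linarith
  then show "?f s \<noteq> ?f t"
  proof cases
   case 1 then show ?thesis using st inj_onD[OF \<beta>(2), of s t] by auto
  next
   case 2
   then have "\<beta> s \<in> \<beta> ` {0..c}" "g (t - c) \<in> g ` {0<..1}" using st by auto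
   then show ?thesis using g(4) 2 by auto
  next
   case 3 then show ?thesis using st inj_onD[OF ig, of "s - c" "t - c"] by auto
  qed
 qed auto
 have 3: "?f ` {0..c+1} \<subseteq> A" using \<beta>(3) g(3) by (auto simp: path_image_def)
 have "\<exists>\<delta>. 0 < \<delta> \<and> \<delta> \<le> c0 \<and> \<delta> \<le> c + 1 \<and> (\<forall>t\<in>{0..\<delta>}. ?f t = \<gamma> t)" using \<delta> by (intro exI[of _ \<delta>]) auto
 then show ?thesis unfolding P_def using c 1 2 3 by auto
qed

end

context arc_extension begin

text \<open>The path follows \<open>\<beta>\<close> to \<open>\<beta> c\<close>, closes the loop
  along \<open>\<sigma>\<close>, returns along the stem to \<open>\<gamma> 0\<close> and leaves
  along \<open>\<tau>\<close>. It never reverses: at \<open>\<beta> t2\<close> it comes in along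
  \<open>\<sigma>\<close>, and at \<open>\<gamma> 0\<close> it changes from one branch to
  another.\<close>

lemma good_if_lollipop:
 assumes "P \<beta> c" and \<sigma>: "arc \<sigma>" "pathstart \<sigma> = \<beta> c" "pathfinish \<sigma> = \<beta> t2" "path_image \<sigma> \<subseteq> A"
  "0 \<le> t2" "t2 < c" and disj: "\<sigma> ` {0<..<1} \<inter> \<beta> ` {0..c} = {}"
 shows good
proof -
 have c: "0 < c" and \<beta>: "continuous_on {0..c} \<beta>" "inj_on \<beta> {0..c}" "\<beta> ` {0..c} \<subseteq> A" using assms(1) unfolding P_def by auto
 obtain \<delta> where \<delta>: "0 < \<delta>" "\<delta> \<le> c0" "\<delta> \<le> c" "\<forall>t\<in>{0..\<delta>}. \<beta> t = \<gamma> t" using assms(1) unfolding P_def by blast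
 have \<beta>0: "\<beta> 0 = \<gamma> 0" by (rule P_0[OF assms(1)])
 have c\<sigma>: "continuous_on {0..1} \<sigma>" and i\<sigma>: "inj_on \<sigma> {0..1}" using \<sigma>(1) by (auto simp: arc_def path_def)
 have \<sigma>01: "\<sigma> 0 = \<beta> c" "\<sigma> 1 = \<beta> t2" using \<sigma> by (auto simp: pathstart_def pathfinish_def)
 define k where "k t = (if t \<le> c then \<beta> t else \<sigma> (t - c))" for t
 have k2: "k t = \<sigma> (t - c)" if "t \<in> {c..c+1}" for t using that \<sigma>01 by (auto simp: k_def)
 have cont12: "continuous_on {0..c+1} k"
 proof -
  have "continuous_on ({0..c} \<union> {c..c+1}) k"
  proof (rule continuous_on_closed_Un)
   show "continuous_on {0..c} k" by (rule continuous_on_eq[OF \<beta>(1)]) (simp add: k_def)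
   have "continuous_on {c..c+1} (\<lambda>t. \<sigma> (t - c))" by (rule continuous_on_compose2[OF c\<sigma>]) (auto intro!: continuous_intros)
   then show "continuous_on {c..c+1} k" by (rule continuous_on_eq) (simp add: k2)
  qed auto
  moreover have "{0..c} \<union> {c..c+1} = {0..c+1}" using c by auto
  ultimately show ?thesis by simp
 qed
 have li12: "locally_injective_on k {0..c+1}"
 proof -
  have "locally_injective_on k ({0..c} \<union> {c..c+1})"
  proof (rule locally_injective_glue[where b = c and \<eta> = 1])
   have "inj_on k {0..c}" using \<beta>(2) by (rule inj_on_cong[THEN iffD1, rotated]) (simp add: k_def)
   then show "locally_injective_on k {0..c}" by (rule inj_on_imp_locally_injective)
   have "inj_on k {c..c+1}"
   proof (rule inj_onI)
    fix s t assume st: "s \<in> {c..c+1}" "t \<in> {c..c+1}" "k s = k t"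
    then have "\<sigma> (s - c) = \<sigma> (t - c)" by (simp add: k2)
    then have "s - c = t - c" by (rule inj_onD[OF i\<sigma>]) (use st in auto)
    then show "s = t" by simp
   qed
   then show "locally_injective_on k {c..c+1}" by (rule inj_on_imp_locally_injective)
   fix s t assume st: "s \<in> {0..c}" "t \<in> {c..c+1}" "c < t" "t < c + 1"
   then have "\<beta> s \<in> \<beta> ` {0..c}" "\<sigma> (t - c) \<in> \<sigma> ` {0<..<1}" by auto
   then have "\<beta> s \<noteq> \<sigma> (t - c)" using disj by (metis disjoint_iff)
   then show "k s \<noteq> k t" using st by (simp add: k_def)
  qed (use c in auto)
  moreover have "{0..c} \<union> {c..c+1} = {0..c+1}" using c by auto
  ultimately show ?thesis by simp
 qed
 have img: "k ` {0..c+1} \<subseteq> A" using \<beta>(3) \<sigma>(4) by (auto simp: k_def path_image_def)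
 have k\<sigma>: "k s \<notin> \<beta> ` {0..c}" if "c < s" "s < c + 1" for s
 proof -
  have "\<sigma> (s - c) \<in> \<sigma> ` {0<..<1}" using that by auto
  then have "\<sigma> (s - c) \<notin> \<beta> ` {0..c}" using disj by (metis disjoint_iff)
  then show ?thesis using that by (simp add: k_def)
 qed
 have kend: "k (c + 1) = \<beta> t2" using \<sigma>01 by (simp add: k_def)
 define T where "T = c + 1 + t2"
 \<comment> \<open>The part after the loop has closed. For \<open>t2 = 0\<close> there is no stem,
   and the path goes round again along \<open>\<beta>\<close>, with the half-line compressed by
   \<open>s / (1 + s)\<close> so that it stays on the arc and is injective.\<close>
 define \<beta>' where "\<beta>' s = (if t2 = 0 then \<beta> (c * (s / (1 + s))) else if s \<le> t2 then \<beta> (t2 - s) else \<tau> (s - t2))" for s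
 have \<beta>'0: "\<beta>' 0 = \<beta> t2" using \<sigma>(5) by (auto simp: \<beta>'_def)
 have B': "continuous_on {0..} \<beta>' \<and> locally_injective_on \<beta>' {0..} \<and> \<beta>' ` {0..} \<subseteq> A \<and> \<beta>' t2 = \<gamma> 0 \<and>
   (\<exists>\<eta>>0. \<forall>s. 0 < s --> s < \<eta> --> \<beta>' s \<in> \<beta> ` {0..c})"
 proof (cases "t2 = 0")
  case True
  define q where "q s = c * (s / (1 + s))" for s
  have r: "q s \<in> {0..c}" if "s \<in> {0..}" for s
  proof -
   have "0 \<le> s / (1 + s)" "s / (1 + s) \<le> 1" using that by auto
   then have "0 \<le> q s" "q s \<le> c * 1" using c unfolding q_def by (intro mult_nonneg_nonneg mult_left_mono; simp)+
   then show ?thesis by simp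
  qed
  have eq: "\<beta>' = (\<lambda>s. \<beta> (q s))" using True by (simp add: \<beta>'_def q_def fun_eq_iff)
  have "continuous_on {0..} q" unfolding q_def by (intro continuous_intros) auto
  then have "continuous_on {0..} \<beta>'" unfolding eq
   by (rule continuous_on_compose2[OF \<beta>(1)]) (use r in blast)
  moreover have "inj_on \<beta>' {0..}" unfolding eq
  proof (rule inj_onI)
   fix s t assume st: "s \<in> {0..}" "t \<in> {0..}" "\<beta> (q s) = \<beta> (q t)"
   have "q s = q t" using inj_onD[OF \<beta>(2) st(3)] r st by blast
   then have "s / (1 + s) = t / (1 + t)" unfolding q_def by (rule mult_left_cancel[THEN iffD1, rotated]) (use c in simp)
   then have "s * (1 + t) = t * (1 + s)" using st(1,2) by (subst (asm) frac_eq_eq) auto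
   then show "s = t" by (simp add: algebra_simps)
  qed
  moreover have "\<beta>' ` {0..} \<subseteq> A" unfolding eq using r \<beta>(3) by blast
  moreover have "\<beta>' t2 = \<gamma> 0" unfolding eq using True \<beta>0 by (simp add: q_def)
  moreover have "\<forall>s. 0 < s --> s < 1 --> \<beta>' s \<in> \<beta> ` {0..c}" unfolding eq using r by auto
  ultimately show ?thesis using inj_on_imp_locally_injective zero_less_one by blast
 next
  case False
  then have t2: "0 < t2" using \<sigma>(5) by simp
  have e1: "\<beta>' s = \<beta> (t2 - s)" if "s \<in> {0..t2}" for s using False that by (auto simp: \<beta>'_def)
  have e2: "\<beta>' s = \<tau> (s - t2)" if "s \<in> {t2..}" for s using False that \<beta>0 \<tau>(4) by (auto simp: \<beta>'_def)
  have U: "{0..t2} \<union> {t2..} = {0..}" using t2 by auto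
  have "continuous_on ({0..t2} \<union> {t2..}) \<beta>'"
  proof (rule continuous_on_closed_Un)
   have "continuous_on {0..t2} (\<lambda>s. \<beta> (t2 - s))"
    by (rule continuous_on_compose2[OF \<beta>(1)]) (use \<sigma>(6) in \<open>auto intro!: continuous_intros\<close>)
   then show "continuous_on {0..t2} \<beta>'" by (rule continuous_on_eq) (simp add: e1)
   have "continuous_on {t2..} (\<lambda>s. \<tau> (s - t2))"
    by (rule continuous_on_compose2[OF \<tau>(1)]) (auto intro!: continuous_intros)
   then show "continuous_on {t2..} \<beta>'" by (rule continuous_on_eq) (simp add: e2)
  qed auto
  moreover have "locally_injective_on \<beta>' ({0..t2} \<union> {t2..})"
  proof (rule locally_injective_glue[where b = t2 and \<eta> = \<delta>])
   have "inj_on \<beta>' {0..t2}"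
   proof (rule inj_onI)
    fix s t assume st: "s \<in> {0..t2}" "t \<in> {0..t2}" "\<beta>' s = \<beta>' t"
    then have "\<beta> (t2 - s) = \<beta> (t2 - t)" by (simp add: e1)
    then have "t2 - s = t2 - t" by (rule inj_onD[OF \<beta>(2)]) (use st \<sigma>(6) in auto)
    then show "s = t" by simp
   qed
   then show "locally_injective_on \<beta>' {0..t2}" by (rule inj_on_imp_locally_injective)
   have "inj_on \<beta>' {t2..}"
   proof (rule inj_onI)
    fix s t assume st: "s \<in> {t2..}" "t \<in> {t2..}" "\<beta>' s = \<beta>' t"
    then have "\<tau> (s - t2) = \<tau> (t - t2)" by (simp add: e2)
    then have "s - t2 = t - t2" by (rule inj_onD[OF \<tau>(2)]) (use st in auto)
    then show "s = t" by simp
   qed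
   then show "locally_injective_on \<beta>' {t2..}" by (rule inj_on_imp_locally_injective)
   fix s t assume st: "s \<in> {0..t2}" "t \<in> {t2..}" "t2 - \<delta> < s" "s < t2" "t2 < t"
   have "\<beta>' s = \<gamma> (t2 - s)" using e1[OF st(1)] \<delta>(4) st by auto
   then show "\<beta>' s \<noteq> \<beta>' t" using e2[OF st(2)] \<gamma>\<tau>[of "t - t2" "t2 - s"] st \<delta> by auto
  qed (use t2 \<delta> in auto)
  moreover have "\<beta>' ` {0..} \<subseteq> A"
  proof clarify
   fix s :: real assume "0 \<le> s"
   then show "\<beta>' s \<in> A" using e1[of s] e2[of s] \<beta>(3) \<tau>(3) \<sigma>(6) by (cases "s \<le> t2") auto
  qed
  moreover have "\<beta>' t2 = \<gamma> 0" using e2[of t2] \<tau>(4) by simp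
  moreover have "\<exists>\<eta>>0. \<forall>s. 0 < s --> s < \<eta> --> \<beta>' s \<in> \<beta> ` {0..c}"
   using t2 e1 \<sigma>(6) by (intro exI[of _ t2]) auto
  ultimately show ?thesis unfolding U by blast
 qed
 then obtain \<eta> where \<eta>: "0 < \<eta>" "\<And>s. 0 < s ==> s < \<eta> ==> \<beta>' s \<in> \<beta> ` {0..c}" by blast
 define \<Gamma> where "\<Gamma> t = (if t \<le> c + 1 then k t else \<beta>' (t - (c + 1)))" for t
 have \<Gamma>2: "\<Gamma> t = \<beta>' (t - (c + 1))" if "t \<in> {c+1..}" for t using that kend \<beta>'0 by (auto simp: \<Gamma>_def)
 have U: "{0..c+1} \<union> {c+1..} = {0..}" using c by auto
 have "continuous_on ({0..c+1} \<union> {c+1..}) \<Gamma>"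
 proof (rule continuous_on_closed_Un)
  show "continuous_on {0..c+1} \<Gamma>" by (rule continuous_on_eq[OF cont12]) (simp add: \<Gamma>_def)
  have "continuous_on {c+1..} (\<lambda>t. \<beta>' (t - (c + 1)))"
   by (rule continuous_on_compose2[of "{0..}" \<beta>']) (use B' in \<open>auto intro!: continuous_intros\<close>)
  then show "continuous_on {c+1..} \<Gamma>" by (rule continuous_on_eq) (simp add: \<Gamma>2)
 qed auto
 moreover have "locally_injective_on \<Gamma> ({0..c+1} \<union> {c+1..})"
 proof (rule locally_injective_glue[where b = "c+1" and \<eta> = "min 1 \<eta>"])
  show "locally_injective_on \<Gamma> {0..c+1}"
   unfolding locally_injective_on_def
  proof
   fix x assume "x \<in> {0..c+1}"
   then obtain N where "open N" "x \<in> N" "inj_on k ({0..c+1} \<inter> N)" using li12 unfolding locally_injective_on_def by blast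
   moreover have "inj_on \<Gamma> ({0..c+1} \<inter> N) = inj_on k ({0..c+1} \<inter> N)" by (rule inj_on_cong) (simp add: \<Gamma>_def)
   ultimately show "\<exists>N. open N \<and> x \<in> N \<and> inj_on \<Gamma> ({0..c+1} \<inter> N)" by blast
  qed
  show "locally_injective_on \<Gamma> {c+1..}"
   unfolding locally_injective_on_def
  proof
   fix x assume x: "x \<in> {c+1..}"
   then have "x - (c+1) \<in> {0..}" by auto
   then obtain N where N: "open N" "x - (c+1) \<in> N" "inj_on \<beta>' ({0..} \<inter> N)" using B' unfolding locally_injective_on_def by blast
   let ?N = "(\<lambda>t. t - (c+1)) -` N"
   have "open ?N" by (rule open_vimage[OF N(1)]) (intro continuous_intros)
   moreover have "inj_on \<Gamma> ({c+1..} \<inter> ?N)"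
   proof (rule inj_onI)
    fix s t assume st: "s \<in> {c+1..} \<inter> ?N" "t \<in> {c+1..} \<inter> ?N" "\<Gamma> s = \<Gamma> t"
    then have "\<beta>' (s - (c+1)) = \<beta>' (t - (c+1))" by (simp add: \<Gamma>2)
    then have "s - (c+1) = t - (c+1)" by (rule inj_onD[OF N(3)]) (use st in auto)
    then show "s = t" by simp
   qed
   ultimately show "\<exists>N. open N \<and> x \<in> N \<and> inj_on \<Gamma> ({c+1..} \<inter> N)" using N(2) by (intro exI[of _ ?N]) auto
  qed
  fix s t assume st: "s \<in> {0..c+1}" "t \<in> {c+1..}" "c + 1 - min 1 \<eta> < s" "s < c + 1" "c + 1 < t" "t < c + 1 + min 1 \<eta>"
  have "\<Gamma> s \<notin> \<beta> ` {0..c}" using k\<sigma>[of s] st by (auto simp: \<Gamma>_def)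
  moreover have "\<Gamma> t \<in> \<beta> ` {0..c}" using \<Gamma>2[OF st(2)] \<eta>(2)[of "t - (c+1)"] st by auto
  ultimately show "\<Gamma> s \<noteq> \<Gamma> t" by metis
 qed (use c \<eta> in auto)
 moreover have "\<Gamma> ` {0..} \<subseteq> A"
 proof clarify
  fix t :: real assume t: "0 \<le> t"
  show "\<Gamma> t \<in> A"
  proof (cases "t \<le> c + 1")
   case True then show ?thesis using img t by (auto simp: \<Gamma>_def)
  next
   case False
   then have "t - (c+1) \<in> {0..}" by auto
   then show ?thesis using B' False by (auto simp: \<Gamma>_def)
  qed
 qed
 moreover have "\<Gamma> t = \<gamma> t" if "t \<in> {0<..<\<delta>}" for t using that \<delta> by (auto simp: \<Gamma>_def k_def)
 moreover have "\<Gamma> (c + 1 + t2) = \<gamma> 0" using \<Gamma>2[of "c + 1 + t2"] B' \<sigma>(5) by auto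
 moreover have "0 < c + 1 + t2" using c \<sigma>(5) by simp
 ultimately show good unfolding good_def U using \<delta>(1,2) by blast
qed

text \<open>By \<open>arc_extraction\<close> a path back to \<open>\<beta> a\<close> that omits
  \<open>\<beta> b\<close> contains an arc that closes a lollipop.\<close>

lemma good_if_shortcut:
 assumes "P \<beta> c" "0 \<le> a" "a < b" "b < c" and h: "path h" "path_image h \<subseteq> A" "pathstart h = \<beta> c" "pathfinish h = \<beta> a" "\<beta> b \<notin> path_image h"
 shows good
proof -
 have \<beta>: "continuous_on {0..c} \<beta>" "inj_on \<beta> {0..c}" using assms(1) unfolding P_def by auto
 have *: "pathstart h \<in> \<beta> ` {b<..c}" "pathfinish h \<in> \<beta> ` {0..<b}" "0 < b" using assms by auto
 obtain t1 t2 \<sigma> where X: "t1 \<in> {b<..c}" "t2 \<in> {0..<b}" "arc \<sigma>" "pathstart \<sigma> = \<beta> t1" "pathfinish \<sigma> = \<beta> t2"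
  "path_image \<sigma> \<subseteq> path_image h" "\<sigma> ` {0<..<1} \<inter> \<beta> ` {0..c} = {}"
  by (rule arc_extraction[OF \<beta> *(3) assms(4) h(1) *(1,2) h(5)])
 show good
  by (rule good_if_lollipop[OF P_subset[OF assms(1), of t1] X(3,4,5)])
   (use X h(2) *(3) in \<open>auto simp: disjoint_iff\<close>)
qed

text \<open>\<open>\<beta>\<close> is cut where it first meets the loop, and the loop is split there
  and at another point \<open>b\<close> into two arcs: the first prolongs the cut arc, the second
  closes the lollipop. As \<open>\<beta> 0\<close> is off the loop, the cut arc has positive
  length.\<close>

lemma good_if_loop:
 assumes P: "P \<beta> c" and g: "simple_path g" "pathfinish g = pathstart g" "path_image g \<subseteq> A"
  and hit: "\<beta> c \<in> path_image g" "\<beta> 0 \<notin> path_image g"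
 shows good
proof -
 have c: "0 < c" and \<beta>: "continuous_on {0..c} \<beta>" "inj_on \<beta> {0..c}" "\<beta> ` {0..c} \<subseteq> A" using P unfolding P_def by auto
 let ?H = "{0..c} \<inter> \<beta> -` path_image g"
 have "closed ?H"
  by (intro continuous_closed_preimage \<beta> closed_atLeastAtMost compact_imp_closed compact_simple_path_image g)
 then have "compact ({0..c} \<inter> ?H)" by (intro compact_Int_closed compact_Icc)
 then have "compact ?H" by (simp add: Int_assoc[symmetric])
 moreover have "c \<in> ?H" using hit(1) c by simp
 then have "?H \<noteq> {}" by blast
 ultimately obtain t where t: "t \<in> ?H" "\<forall>s\<in>?H. t \<le> s" using compact_attains_inf[of ?H] by blast
 have t0: "0 < t" "t \<le> c" "\<beta> t \<in> path_image g" using t hit by (auto simp: less_le)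
 have before: "\<beta> s \<notin> path_image g" if "s \<in> {0..<t}" for s using t(2) that t0 by force
 have "\<exists>b\<in>path_image g. b \<noteq> \<beta> t"
 proof -
  have "g 0 \<noteq> g (1/2)"
  proof
   assume "g 0 = g (1/2)"
   then have "(0::real) = 1/2 \<or> (0::real) = 0 \<and> (1/2::real) = 1 \<or> (0::real) = 1 \<and> (1/2::real) = 0"
    using g(1) unfolding simple_path_def loop_free_def by (meson atLeastAtMost_iff half_bounded_equal le_divide_eq_1_pos zero_le_one order_refl zero_le_divide_1_iff zero_le_numeral divide_le_eq_1_pos one_le_numeral zero_less_numeral)
   then show False by simp
  qed
  moreover have "g 0 \<in> path_image g" "g (1/2) \<in> path_image g" by (auto simp: path_image_def)
  ultimately show ?thesis by metis
 qed
 then obtain b where b: "b \<in> path_image g" "\<beta> t \<noteq> b" by metis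
 obtain u d where ud: "arc u" "arc d" "pathstart u = \<beta> t" "pathfinish u = b" "pathstart d = b" "pathfinish d = \<beta> t"
  "path_image u \<inter> path_image d = {\<beta> t, b}" "path_image u \<union> path_image d = path_image g"
  by (rule exists_double_arc[OF g(1,2) t0(3) b])
 have iu: "inj_on u {0..1}" "inj_on d {0..1}" using ud by (auto simp: arc_def)
 have u0: "u 0 = \<beta> t" "u 1 = b" "d 0 = b" "d 1 = \<beta> t" using ud by (auto simp: pathstart_def pathfinish_def)
 have un: "u x \<in> path_image g" "u x \<noteq> \<beta> t" if "x \<in> {0<..1}" for x
 proof -
  show "u x \<in> path_image g" using ud(8) that by (auto simp: path_image_def)
  show "u x \<noteq> \<beta> t" using inj_onD[OF iu(1), of x 0] u0 that by auto
 qed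
 have dn: "d x \<in> path_image g" "d x \<noteq> \<beta> t" "d x \<noteq> b" if "x \<in> {0<..<1}" for x
 proof -
  show "d x \<in> path_image g" using ud(8) that by (auto simp: path_image_def)
  show "d x \<noteq> \<beta> t" using inj_onD[OF iu(2), of x 1] u0 that by auto
  show "d x \<noteq> b" using inj_onD[OF iu(2), of x 0] u0 that by auto
 qed
 have dist1: "v \<notin> \<beta> ` {0..t}" if "v \<in> path_image g" "v \<noteq> \<beta> t" for v
 proof
  assume "v \<in> \<beta> ` {0..t}"
  then obtain s where s: "s \<in> {0..t}" "v = \<beta> s" by auto
  then show False using before[of s] that by (cases "s = t") auto
 qed
 let ?f = "\<lambda>s. if s \<le> t then \<beta> s else u (s - t)"
 have Pt: "P \<beta> t" by (rule P_subset[OF P t0(1,2)])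
 have Pf: "P ?f (t + 1)"
 proof (rule P_extend[OF Pt ud(1,3)])
  show "path_image u \<subseteq> A" using ud(8) g(3) by blast
  have "u x \<notin> \<beta> ` {0..t}" if "x \<in> {0<..1}" for x by (rule dist1[OF un[OF that]])
  then show "u ` {0<..1} \<inter> \<beta> ` {0..t} = {}" by blast
 qed
 show good
 proof (rule good_if_lollipop[OF Pf ud(2), of t])
  show "d ` {0<..<1} \<inter> ?f ` {0..t+1} = {}"
  proof -
   have "d x \<noteq> ?f s" if x: "x \<in> {0<..<1}" and s: "s \<in> {0..t+1}" for x s
   proof (cases "s \<le> t")
    case True
    then have "\<beta> s \<in> \<beta> ` {0..t}" using s by auto
    then show ?thesis using dist1[OF dn(1,2)[OF x]] True by auto
   next
    case False
    have "d x \<in> path_image d" using x by (auto simp: path_image_def)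
    then have "d x \<notin> path_image u" using dn[OF x] ud(7) by auto
    moreover have "u (s - t) \<in> path_image u" using False s by (auto simp: path_image_def)
    ultimately show ?thesis using False by auto
   qed
   then show ?thesis by blast
  qed
 qed (use ud u0 g(3) t0 in \<open>auto simp: pathstart_def pathfinish_def\<close>)
qed

end

context arc_extension begin

text \<open>Along \<open>p\<close> to \<open>\<phi> 1\<close> and then along \<open>\<phi>\<close>
  backwards to \<open>\<phi> 0 = y\<close>.\<close>

lemma local_path:
 assumes "y \<in> A" "0 < \<epsilon>"
 obtains \<delta> where "0 < \<delta>" "\<And>x. x \<in> A ==> dist x y < \<delta> ==> \<exists>p. path p \<and> path_image p \<subseteq> A \<inter> ball y \<epsilon> \<and> pathstart p = x \<and> pathfinish p = y"
proof -
 obtain \<delta> where \<delta>: "\<delta> > 0" "\<forall>x\<in>A. x \<noteq> y --> dist x y < \<delta> -->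
   (\<exists>p \<phi>. path p \<and> path_image p \<subseteq> A \<inter> ball y \<epsilon> - {y} \<and> pathstart p = x \<and> pathfinish p = \<phi> (1::real) \<and>
     continuous_on {-1..1} \<phi> \<and> inj_on \<phi> {-1..1} \<and> \<phi> 0 = y \<and> \<phi> ` {-1..1} \<subseteq> A \<inter> ball y \<epsilon>)"
  using arcs[OF assms] by blast
 have "\<exists>p. path p \<and> path_image p \<subseteq> A \<inter> ball y \<epsilon> \<and> pathstart p = x \<and> pathfinish p = y" if x: "x \<in> A" "dist x y < \<delta>" for x
 proof (cases "x = y")
  case True
  then show ?thesis using assms by (intro exI[of _ "linepath y y"]) auto
 next
  case False
  then obtain p \<phi> where p: "path p" "path_image p \<subseteq> A \<inter> ball y \<epsilon> - {y}" "pathstart p = x" "pathfinish p = \<phi> (1::real)"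
    and \<phi>: "continuous_on {-1..1} \<phi>" "\<phi> 0 = y" "\<phi> ` {-1..1} \<subseteq> A \<inter> ball y \<epsilon>" using \<delta>(2) x by metis
  define q where "q t = \<phi> (1 - t)" for t
  have q: "path q" unfolding path_def q_def
   by (rule continuous_on_compose2[OF \<phi>(1)]) (auto intro!: continuous_intros)
  have qi: "path_image q \<subseteq> A \<inter> ball y \<epsilon>" using \<phi>(3) by (auto simp: path_image_def q_def)
  have q01: "pathstart q = \<phi> 1" "pathfinish q = y" using \<phi>(2) by (simp_all add: q_def pathstart_def pathfinish_def)
  have "path (p +++ q)" using p q q01 by (intro path_join_imp) auto
  moreover have "path_image (p +++ q) \<subseteq> A \<inter> ball y \<epsilon>" using path_image_join_subset[of p q] p(2) qi by blast
  ultimately show ?thesis using p(3) q01 by (intro exI[of _ "p +++ q"]) simp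
 qed
 then show thesis using that \<delta>(1) by blast
qed

text \<open>The arc \<open>\<phi>\<close> through \<open>y = \<beta> c\<close> is reached from a
  point \<open>\<beta> s1\<close> shortly before the end, and its half over \<open>[-1,0]\<close>
  prolongs \<open>\<beta>\<close> unless it meets \<open>\<beta>\<close> again. In that case
  \<open>p\<close> and a stretch of \<open>\<beta>\<close> connect the two halves of
  \<open>\<phi>\<close> without passing \<open>y\<close>; an arc \<open>\<sigma>\<close> extracted
  from this connection closes with \<open>\<phi>\<close> to a simple loop through \<open>y\<close>,
  and \<open>good_if_loop\<close> applies.\<close>

lemma extend_past_end:
 assumes ng: "\<not> good" and P: "P \<beta> c"
 obtains g where "arc g" "pathstart g = \<beta> c" "path_image g \<subseteq> A" "g ` {0<..1} \<inter> \<beta> ` {0..c} = {}"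
proof -
 have c: "0 < c" and \<beta>: "continuous_on {0..c} \<beta>" "inj_on \<beta> {0..c}" "\<beta> ` {0..c} \<subseteq> A" using P unfolding P_def by auto
 define y where "y = \<beta> c"
 have yA: "y \<in> A" using \<beta>(3) c by (auto simp: y_def)
 \<comment> \<open>Keeps the local picture away from the first half of \<open>\<beta>\<close>, so
   that meeting points have parameters above \<open>c/2\<close> and the loop misses
   \<open>\<beta> 0\<close>.\<close>
 have far: "\<exists>\<epsilon>>0. \<forall>s\<in>{0..c/2}. \<beta> s \<notin> ball y \<epsilon>"
 proof -
  have "closed (\<beta> ` {0..c/2})"
   by (intro compact_imp_closed compact_continuous_image continuous_on_subset[OF \<beta>(1)]) (use c in auto)
  moreover have "y \<notin> \<beta> ` {0..c/2}"
  proof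
   assume "y \<in> \<beta> ` {0..c/2}"
   then obtain s where "s \<in> {0..c/2}" "\<beta> s = \<beta> c" by (auto simp: y_def)
   then show False using inj_onD[OF \<beta>(2), of s c] c by auto
  qed
  ultimately have "open (- (\<beta> ` {0..c/2}))" "y \<in> - (\<beta> ` {0..c/2})" by (auto simp: open_Compl)
  then obtain \<epsilon> where "\<epsilon> > 0" "ball y \<epsilon> \<subseteq> - (\<beta> ` {0..c/2})" using open_contains_ball by blast
  then show ?thesis by (intro exI[of _ \<epsilon>]) auto
 qed
 then obtain \<epsilon> where \<epsilon>: "\<epsilon> > 0" "\<And>s. s \<in> {0..c/2} ==> \<beta> s \<notin> ball y \<epsilon>" by blast
 obtain \<delta> where \<delta>: "\<delta> > 0" "\<forall>x\<in>A. x \<noteq> y --> dist x y < \<delta> -->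
   (\<exists>p \<phi>. path p \<and> path_image p \<subseteq> A \<inter> ball y \<epsilon> - {y} \<and> pathstart p = x \<and> pathfinish p = \<phi> (1::real) \<and>
     continuous_on {-1..1} \<phi> \<and> inj_on \<phi> {-1..1} \<and> \<phi> 0 = y \<and> \<phi> ` {-1..1} \<subseteq> A \<inter> ball y \<epsilon>)"
  using arcs[OF yA \<epsilon>(1)] by blast
 obtain d where d: "d > 0" "\<forall>s\<in>{0..c}. dist s c < d --> dist (\<beta> s) (\<beta> c) < \<delta>"
  using \<beta>(1) \<delta>(1) c unfolding continuous_on_iff by (metis atLeastAtMost_iff less_eq_real_def order_refl)
 define s1 where "s1 = max (3 * c / 4) (c - d / 2)"
 have s1: "c/2 < s1" "s1 < c" "dist s1 c < d"
  using c d(1) max.cobounded1[of "3*c/4" "c-d/2"] max.cobounded2[of "c-d/2" "3*c/4"]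
  unfolding s1_def dist_real_def by linarith+
 have "\<beta> s1 \<noteq> y" using inj_onD[OF \<beta>(2), of s1 c] s1 c by (auto simp: y_def)
 moreover have "\<beta> s1 \<in> A" "dist (\<beta> s1) y < \<delta>" using \<beta>(3) s1 c d(2) by (auto simp: y_def)
 ultimately obtain p \<phi> where p: "path p" "path_image p \<subseteq> A \<inter> ball y \<epsilon> - {y}" "pathstart p = \<beta> s1" "pathfinish p = \<phi> (1::real)"
   and \<phi>: "continuous_on {-1..1} \<phi>" "inj_on \<phi> {-1..1}" "\<phi> 0 = y" "\<phi> ` {-1..1} \<subseteq> A \<inter> ball y \<epsilon>" using \<delta>(2) by metis
 have "\<phi> ` {-1..<0} \<inter> \<beta> ` {0..c} = {}"
 proof (rule ccontr)
  assume "\<phi> ` {-1..<0} \<inter> \<beta> ` {0..c} \<noteq> {}"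
  then obtain b t where b: "b \<in> {-1..<0}" "t \<in> {0..c}" "\<phi> b = \<beta> t" by blast
  have "\<phi> b \<noteq> y" using inj_onD[OF \<phi>(2), of b 0] b \<phi>(3) by auto
  then have tc: "t < c" using b by (cases "t = c") (auto simp: y_def)
  have "b \<in> {-1..1}" using b(1) by auto
  then have "\<phi> b \<in> \<phi> ` {-1..1}" by (rule imageI)
  then have "\<phi> b \<in> ball y \<epsilon>" using \<phi>(4) by blast
  then have t2: "c/2 < t" using \<epsilon>(2)[of t] b by (cases "t \<le> c/2") auto
  \<comment> \<open>Both \<open>s1\<close> and \<open>t\<close> lie strictly between
    \<open>c/2\<close> and \<open>c\<close>, so this stretch of \<open>\<beta>\<close> meets neither
    \<open>y\<close> nor \<open>\<beta> 0\<close>.\<close>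
  define q where "q x = \<beta> (linepath s1 t x)" for x
  have seg: "linepath s1 t x \<in> {c/2<..<c}" if "x \<in> {0..1}" for x
  proof -
   have "linepath s1 t x \<in> closed_segment s1 t" using that by (intro linepath_in_path) auto
   moreover have "closed_segment s1 t \<subseteq> {c/2<..<c}" using s1 t2 tc by (intro closed_segment_subset) (auto simp: is_interval_convex_1[symmetric] is_interval_oo)
   ultimately show ?thesis by blast
  qed
  have q: "path q" unfolding path_def q_def
  proof (rule continuous_on_compose2[OF \<beta>(1)])
   show "continuous_on {0..1} (linepath s1 t)" by (intro continuous_intros)
   show "linepath s1 t ` {0..1} \<subseteq> {0..c}"
   proof clarify
    fix x :: real assume "x \<in> {0..1}"
    from seg[OF this] show "linepath s1 t x \<in> {0..c}" using c by auto
   qed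
  qed
  have qi: "path_image q \<subseteq> \<beta> ` {c/2<..<c}" using seg by (auto simp: path_image_def q_def)
  define h where "h = reversepath p +++ q"
  have h: "path h" "pathstart h = \<phi> 1" "pathfinish h = \<phi> b"
  proof -
   have q01: "pathstart q = \<beta> s1" "pathfinish q = \<beta> t" by (simp_all add: q_def pathstart_def pathfinish_def linepath_def)
   then show "path h" unfolding h_def using p q by (intro path_join_imp) auto
   show "pathstart h = \<phi> 1" "pathfinish h = \<phi> b" using p q01 b by (simp_all add: h_def)
  qed
  have hi: "path_image h \<subseteq> path_image p \<union> \<beta> ` {c/2<..<c}"
   using path_image_join_subset[of "reversepath p" q] qi by (auto simp: h_def)
  have \<beta>ne: "v \<notin> \<beta> ` {c/2<..<c}" if "v = y \<or> v = \<beta> 0" for v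
  proof
   assume "v \<in> \<beta> ` {c/2<..<c}"
   then obtain s where s: "s \<in> {c/2<..<c}" "v = \<beta> s" by auto
   then show False using that inj_onD[OF \<beta>(2), of s c] inj_onD[OF \<beta>(2), of s 0] c by (auto simp: y_def)
  qed
  have yh: "\<phi> 0 \<notin> path_image h" using hi p(2) \<phi>(3) \<beta>ne[of y] by auto
  have \<phi>': "continuous_on {b..1} \<phi>" "inj_on \<phi> {b..1}"
   using \<phi> b by (auto intro: continuous_on_subset inj_on_subset)
  have hh: "pathstart h \<in> \<phi> ` {0<..1}" "pathfinish h \<in> \<phi> ` {b..<0}" "b < 0"
   unfolding h(2,3) using b(1) by (auto intro!: imageI)
  obtain t1 t2 \<sigma> where X: "t1 \<in> {0<..1}" "t2 \<in> {b..<0}" "arc \<sigma>" "pathstart \<sigma> = \<phi> t1" "pathfinish \<sigma> = \<phi> t2"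
   "path_image \<sigma> \<subseteq> path_image h" "\<sigma> ` {0<..<1} \<inter> \<phi> ` {b..1} = {}"
   by (rule arc_extraction[OF \<phi>' hh(3) zero_less_one h(1) hh(1,2) yh])
  define k where "k x = \<phi> (linepath t2 t1 x)" for x
  have lk: "linepath t2 t1 x = (t1 - t2) * x + t2" for x by (simp add: linepath_def algebra_simps)
  have t12: "0 < t1 - t2" using X by auto
  have kin: "linepath t2 t1 x \<in> {t2..t1}" if "x \<in> {0..1}" for x
  proof -
   have "0 \<le> (t1 - t2) * x" "(t1 - t2) * x \<le> (t1 - t2) * 1" using that t12 by (auto intro!: mult_left_mono)
   then show ?thesis unfolding lk by auto
  qed
  have ik: "inj_on k {0..1}"
  proof (rule inj_onI)
   fix u v :: real assume uv: "u \<in> {0..1}" "v \<in> {0..1}" "k u = k v"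
   have "linepath t2 t1 u = linepath t2 t1 v"
    using inj_onD[OF \<phi>'(2), of "linepath t2 t1 u" "linepath t2 t1 v"] kin[OF uv(1)] kin[OF uv(2)] uv(3) X by (auto simp: k_def)
   then show "u = v" using t12 unfolding lk by simp
  qed
  have "path k" unfolding path_def k_def
  proof (rule continuous_on_compose2[OF \<phi>'(1)])
   show "continuous_on {0..1} (linepath t2 t1)" by (intro continuous_intros)
   show "linepath t2 t1 ` {0..1} \<subseteq> {b..1}"
   proof clarify
    fix x :: real assume "x \<in> {0..1}"
    from kin[OF this] show "linepath t2 t1 x \<in> {b..1}" using X by auto
   qed
  qed
  then have ak: "arc k" using ik by (simp add: arc_def)
  have k01: "pathstart k = \<phi> t2" "pathfinish k = \<phi> t1" by (simp_all add: k_def pathstart_def pathfinish_def linepath_def)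
  have ki: "path_image k \<subseteq> \<phi> ` {b..1}"
  proof (clarsimp simp: path_image_def)
   fix x :: real assume "0 \<le> x" "x \<le> 1"
   then have "linepath t2 t1 x \<in> {t2..t1}" by (intro kin) auto
   then show "k x \<in> \<phi> ` {b..1}" using X by (auto simp: k_def)
  qed
  have \<sigma>i: "path_image \<sigma> \<subseteq> {\<phi> t1, \<phi> t2} \<union> \<sigma> ` {0<..<1}"
  proof
   fix v assume "v \<in> path_image \<sigma>"
   then obtain x where x: "x \<in> {0..1}" "v = \<sigma> x" by (auto simp: path_image_def)
   consider "x = 0" | "x = 1" | "x \<in> {0<..<1}" using x by force
   then show "v \<in> {\<phi> t1, \<phi> t2} \<union> \<sigma> ` {0<..<1}" using x X(4,5) by cases (auto simp: pathstart_def pathfinish_def)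
  qed
  have J: "simple_path (k +++ \<sigma>)"
  proof (rule simple_path_join_loop[OF ak X(3)])
   show "path_image k \<inter> path_image \<sigma> \<subseteq> {pathstart k, pathstart \<sigma>}"
   proof
    fix v assume v: "v \<in> path_image k \<inter> path_image \<sigma>"
    have "v \<in> \<phi> ` {b..1}" using v ki by blast
    then have "v \<notin> \<sigma> ` {0<..<1}" using X(7) by (metis IntI emptyE)
    then have "v \<in> {\<phi> t1, \<phi> t2}" using v \<sigma>i by blast
    then show "v \<in> {pathstart k, pathstart \<sigma>}" using k01 X(4) by auto
   qed
  qed (use k01 X in auto)
  have Ji: "path_image (k +++ \<sigma>) = path_image k \<union> path_image \<sigma>" by (rule path_image_join) (use k01 X in auto)
  have bsub: "\<phi> ` {b..1} \<subseteq> A \<inter> ball y \<epsilon>" using \<phi>(4) b by (auto simp: image_subset_iff)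
  have "\<beta> c \<in> path_image (k +++ \<sigma>)"
  proof -
   have "(-t2) / (t1 - t2) \<in> {0..1}" using X by (auto simp: field_simps)
   moreover have "k ((-t2) / (t1 - t2)) = \<phi> 0" using t12 by (simp add: k_def lk)
   ultimately have "\<phi> 0 \<in> path_image k" unfolding path_image_def by (metis imageI)
   then show ?thesis using \<phi>(3) Ji by (simp add: y_def)
  qed
  moreover have "\<beta> 0 \<notin> path_image (k +++ \<sigma>)"
  proof -
   have "\<beta> 0 \<notin> ball y \<epsilon>" using \<epsilon>(2)[of 0] c by simp
   then have "\<beta> 0 \<notin> path_image k" "\<beta> 0 \<notin> path_image p" using ki bsub p(2) by blast+
   moreover have "\<beta> 0 \<notin> path_image \<sigma>" using X(6) hi calculation(2) \<beta>ne[of "\<beta> 0"] by blast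
   ultimately show ?thesis using Ji by simp
  qed
  moreover have "path_image (k +++ \<sigma>) \<subseteq> A"
  proof -
   have "\<beta> ` {c/2<..<c} \<subseteq> A" using \<beta>(3) c by (auto simp: image_subset_iff)
   then show ?thesis unfolding Ji using ki bsub X(6) hi p(2) by blast
  qed
  moreover have "pathfinish (k +++ \<sigma>) = pathstart (k +++ \<sigma>)" using k01 X by simp
  ultimately show False using good_if_loop[OF P J] ng by blast
 qed
 note disj = this
 define g where "g t = \<phi> (- t)" for t
 have "path g" unfolding path_def g_def by (rule continuous_on_compose2[OF \<phi>(1)]) (auto intro!: continuous_intros)
 moreover have "inj_on g {0..1}"
 proof (rule inj_onI)
  fix u v assume uv: "u \<in> {0..1}" "v \<in> {0..1}" "g u = g v"
  then have "- u = - v" by (intro inj_onD[OF \<phi>(2), of "-u" "-v"]) (auto simp: g_def)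
  then show "u = v" by simp
 qed
 moreover have "g ` {0<..1} \<subseteq> \<phi> ` {-1..<0}"
 proof clarify
  fix x :: real assume "x \<in> {0<..1}"
  then show "g x \<in> \<phi> ` {-1..<0}" by (auto simp: g_def intro!: imageI)
 qed
 moreover have "path_image g \<subseteq> A"
 proof (clarsimp simp: path_image_def)
  fix x :: real assume "0 \<le> x" "x \<le> 1"
  then have "\<phi> (-x) \<in> \<phi> ` {-1..1}" by (intro imageI) auto
  then show "g x \<in> A" using \<phi>(4) by (auto simp: g_def)
 qed
 moreover have "pathstart g = \<beta> c" using \<phi>(3) by (simp add: g_def pathstart_def y_def)
 ultimately show thesis using that[of g] disj by (auto simp: arc_def)
qed

end

context arc_extension begin

text \<open>A greedily chosen sequence of extensions: every step is at least half as long as possible, so that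
 the union of the arcs cannot be extended past a limit point.\<close>

lemma greedy_extension:
 assumes ng: "\<not> good" and P: "P \<beta> c"
 obtains g where "P g (c + 1)" "\<forall>t\<in>{0..c}. g t = \<beta> t"
  "\<forall>h. P h (c + 1) --> (\<forall>t\<in>{0..c}. h t = \<beta> t) --> min 1 (dist (h (c + 1)) (\<beta> c)) \<le> 2 * dist (g (c + 1)) (\<beta> c)"
proof -
 define E where "E = {h. P h (c + 1) \<and> (\<forall>t\<in>{0..c}. h t = \<beta> t)}"
 \<comment> \<open>Step lengths may be unbounded; cut off at 1 they have a supremum, and some
   extension exceeds half of it.\<close>
 define D where "D h = min 1 (dist (h (c + 1)) (\<beta> c))" for h :: "real \<Rightarrow> 'a"
 have c: "0 < c" using P unfolding P_def by auto
 obtain g0 where g0: "arc g0" "pathstart g0 = \<beta> c" "path_image g0 \<subseteq> A" "g0 ` {0<..1} \<inter> \<beta> ` {0..c} = {}"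
  by (rule extend_past_end[OF ng P])
 have "(\<lambda>t. if t \<le> c then \<beta> t else g0 (t - c)) \<in> E"
  unfolding E_def using P_extend[OF P g0] by auto
 then have ne: "E \<noteq> {}" by blast
 have pos: "0 < D h" if "h \<in> E" for h
 proof -
  have "inj_on h {0..c+1}" "h c = \<beta> c" using that c unfolding E_def P_def by auto
  then have "h (c + 1) \<noteq> \<beta> c" using inj_onD[of h "{0..c+1}" "c+1" c] c by auto
  then show ?thesis by (simp add: D_def)
 qed
 have bdd: "bdd_above (D ` E)" by (rule bdd_aboveI[of _ 1]) (auto simp: D_def)
 define S where "S = Sup (D ` E)"
 have le: "D h \<le> S" if "h \<in> E" for h unfolding S_def using that bdd by (intro cSup_upper) auto
 have "0 < S" using ne pos le by (meson all_not_in_conv less_le_trans)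
 then have "S / 2 < Sup (D ` E)" by (simp add: S_def)
 then obtain g where g: "g \<in> E" "S / 2 < D g" using less_cSup_iff[of "D ` E" "S / 2"] ne bdd by auto
 have "min 1 (dist (h (c + 1)) (\<beta> c)) \<le> 2 * dist (g (c + 1)) (\<beta> c)"
  if "P h (c + 1)" "\<forall>t\<in>{0..c}. h t = \<beta> t" for h
 proof -
  have "h \<in> E" using that by (simp add: E_def)
  then have "D h \<le> 2 * D g" using le[of h] g(2) by linarith
  also have "D g \<le> dist (g (c + 1)) (\<beta> c)" by (simp add: D_def)
  finally show ?thesis by (simp add: D_def)
 qed
 then show thesis using that g(1) unfolding E_def by blast
qed

text \<open>Otherwise greedy prolongation yields an injective \<open>\<beta>\<close> on the
  half-line with a finite accumulation point \<open>y\<close>. Since shortcuts are excluded,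
  \<open>\<beta>\<close> converges to \<open>y\<close> and never attains it. Then
  \<open>\<beta>\<close> together with \<open>y\<close> is an arc and can be prolonged beyond
  \<open>y\<close> to some \<open>w\<close>; this prolongation competed at every step, so the steps
  could not have become small, as convergence demands.\<close>

lemma good: good
proof (rule ccontr)
 assume ng: "\<not> good"
 define Q where "Q n \<beta> \<beta>' \<longleftrightarrow> (\<forall>t\<in>{0..c0+real n}. \<beta>' t = \<beta> t) \<and>
   (\<forall>h. P h (c0 + real n + 1) --> (\<forall>t\<in>{0..c0+real n}. h t = \<beta> t) -->
    min 1 (dist (h (c0 + real n + 1)) (\<beta> (c0 + real n))) \<le> 2 * dist (\<beta>' (c0 + real n + 1)) (\<beta> (c0 + real n)))"
  for n and \<beta> \<beta>' :: "real \<Rightarrow> 'a"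
 have "\<exists>B. \<forall>n. P (B n) (c0 + real n) \<and> Q n (B n) (B (Suc n))"
 proof (rule dependent_nat_choice)
  have "P \<gamma> c0" unfolding P_def using \<gamma> by auto
  then show "\<exists>\<beta>. P \<beta> (c0 + real 0)" by auto
  fix \<beta> n assume "P \<beta> (c0 + real n)"
  then obtain g where "P g (c0 + real n + 1)" "\<forall>t\<in>{0..c0+real n}. g t = \<beta> t"
   "\<forall>h. P h (c0 + real n + 1) --> (\<forall>t\<in>{0..c0+real n}. h t = \<beta> t) -->
     min 1 (dist (h (c0 + real n + 1)) (\<beta> (c0 + real n))) \<le> 2 * dist (g (c0 + real n + 1)) (\<beta> (c0 + real n))"
   by (rule greedy_extension[OF ng])
  moreover have "c0 + real (Suc n) = c0 + real n + 1" by simp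
  ultimately have "P g (c0 + real (Suc n)) \<and> Q n \<beta> g" unfolding Q_def by (simp only: simp_thms)
  then show "\<exists>\<beta>'. P \<beta>' (c0 + real (Suc n)) \<and> Q n \<beta> \<beta>'" by (intro exI[of _ g])
 qed
 then obtain B where B: "\<And>n. P (B n) (c0 + real n)" "\<And>n. Q n (B n) (B (Suc n))" by blast
 have coh: "B (n + k) t = B n t" if "t \<in> {0..c0 + real n}" for n k t
 proof (induction k)
  case (Suc k)
  have "B (Suc (n + k)) t = B (n + k) t" using B(2)[of "n + k"] that unfolding Q_def by auto
  then show ?case using Suc by simp
 qed simp
 define \<beta> where "\<beta> t = B (nat \<lceil>t\<rceil>) t" for t
 have \<beta>B: "\<beta> t = B n t" if "t \<in> {0..c0 + real n}" for t n
 proof -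
  define m where "m = nat \<lceil>t\<rceil>"
  have "t \<le> real m" unfolding m_def by linarith
  then have tm: "t \<in> {0..c0 + real m}" using that \<gamma>(1) by auto
  show ?thesis
  proof (cases "n \<le> m")
   case True then show ?thesis using coh[OF that, of "m - n"] by (simp add: \<beta>_def m_def[symmetric])
  next
   case False then show ?thesis using coh[OF tm, of "n - m"] by (simp add: \<beta>_def m_def[symmetric])
  qed
 qed
 have P\<beta>: "P \<beta> c" if "0 < c" for c
 proof -
  obtain n where n: "c \<le> c0 + real n" using \<gamma>(1) real_arch_simple[of c] by (metis add_increasing less_eq_real_def)
  have "P (B n) c" by (rule P_subset[OF B(1) that n])
  have eq: "\<beta> t = B n t" if "t \<in> {0..c}" for t using \<beta>B[of t n] that n by auto
  have "continuous_on {0..c} \<beta> \<longleftrightarrow> continuous_on {0..c} (B n)" by (rule continuous_on_cong) (simp_all add: eq)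
  moreover have "inj_on \<beta> {0..c} \<longleftrightarrow> inj_on (B n) {0..c}" by (rule inj_on_cong) (rule eq)
  moreover have "\<beta> ` {0..c} = B n ` {0..c}" by (rule image_cong) (simp_all add: eq)
  ultimately have "continuous_on {0..c} \<beta>" "inj_on \<beta> {0..c}" "\<beta> ` {0..c} \<subseteq> A"
   using \<open>P (B n) c\<close> unfolding P_def by simp_all
  moreover have "\<exists>\<delta>. 0 < \<delta> \<and> \<delta> \<le> c0 \<and> \<delta> \<le> c \<and> (\<forall>t\<in>{0..\<delta>}. \<beta> t = \<gamma> t)"
  proof -
   obtain \<delta> where "0 < \<delta>" "\<delta> \<le> c0" "\<delta> \<le> c" "\<forall>t\<in>{0..\<delta>}. B n t = \<gamma> t" using \<open>P (B n) c\<close> unfolding P_def by blast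
   then show ?thesis using eq by (intro exI[of _ \<delta>]) auto
  qed
  ultimately show ?thesis unfolding P_def using that by blast
 qed
 have inj: "s = t" if "0 \<le> s" "0 \<le> t" "\<beta> s = \<beta> t" for s t
  using P\<beta>[of "max (max s t) 1"] that inj_onD[of \<beta> "{0..max (max s t) 1}" s t] unfolding P_def by auto
 have \<beta>A: "\<beta> t \<in> A" if "0 \<le> t" for t
 proof -
  have "\<beta> ` {0..max t 1} \<subseteq> A" using P\<beta>[of "max t 1"] unfolding P_def by simp
  moreover have "t \<in> {0..max t 1}" using that by simp
  ultimately show ?thesis by blast
 qed
 have cont\<beta>: "continuous_on {0..} \<beta>"
  unfolding continuous_on_eq_continuous_within
 proof
  fix t :: real assume t: "t \<in> {0..}"
  have "continuous_on {0..t+1} \<beta>" using P\<beta>[of "t+1"] t unfolding P_def by auto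
  then have "continuous (at t within {0..t+1}) \<beta>" using t by (simp add: continuous_on_eq_continuous_within)
  moreover have "at t within {0..} = at t within {0..t+1}"
   by (rule at_within_nhd[of t "{..<t+1}"]) auto
  ultimately show "continuous (at t within {0..}) \<beta>" by (simp add: continuous_within)
 qed
 have shortcut: False
  if "0 \<le> a" "a < b" "b < c" "path h" "path_image h \<subseteq> A" "pathstart h = \<beta> c" "pathfinish h = \<beta> a" "\<beta> b \<notin> path_image h" for a b c h
  using good_if_shortcut[OF P\<beta>[of c] that] that ng by auto
 have "\<not> filterlim (\<lambda>t. norm (\<beta> t)) at_top at_top"
 proof
  assume "filterlim (\<lambda>t. norm (\<beta> t)) at_top at_top"
  moreover have "inj_on \<beta> {0..}" using inj by (auto simp: inj_on_def)
  moreover obtain \<delta> where "0 < \<delta>" "\<delta> \<le> c0" "\<forall>t\<in>{0..\<delta>}. \<beta> t = \<gamma> t" using P\<beta>[of 1] unfolding P_def by auto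
  ultimately have good unfolding good_def
   using cont\<beta> \<beta>A inj_on_imp_locally_injective by (intro exI[of _ \<beta>]) fastforce
  then show False using ng by simp
 qed
 then obtain R where R: "\<And>N. \<exists>t\<ge>N. norm (\<beta> t) < R"
  unfolding filterlim_at_top eventually_at_top_linorder by (metis not_le)
 then have "\<exists>u. \<forall>n::nat. u n \<ge> real n \<and> norm (\<beta> (u n)) < R" by (intro choice) blast
 then obtain u where u: "\<And>n::nat. u n \<ge> real n \<and> norm (\<beta> (u n)) < R" by blast
 have un: "\<beta> (u n) \<in> A \<inter> cball 0 R" for n using u[of n] \<beta>A[of "u n"] by (auto intro: order_trans[OF of_nat_0_le_iff])
 obtain y r where y: "y \<in> A \<inter> cball 0 R" "strict_mono r" "((\<lambda>n. \<beta> (u n)) \<circ> r) \<longlonglongrightarrow> y"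
  using compact_bounded[of R] un unfolding compact_def by meson
 have acc: "\<exists>t\<ge>N. dist (\<beta> t) y < \<epsilon>" if "0 < \<epsilon>" for N \<epsilon>
 proof -
  obtain n0 where n0: "\<forall>n\<ge>n0. dist (((\<lambda>n. \<beta> (u n)) \<circ> r) n) y < \<epsilon>" using metric_LIMSEQ_D[OF y(3) \<open>0 < \<epsilon>\<close>] by blast
  obtain k where k: "N \<le> real k" using real_arch_simple by blast
  let ?n = "max n0 k"
  have "k \<le> r ?n" using seq_suble[OF y(2), of ?n] by linarith
  then have "N \<le> u (r ?n)" using u[of "r ?n"] k by linarith
  then show ?thesis using n0 by (intro exI[of _ "u (r ?n)"]) auto
 qed
 have yA: "y \<in> A" using y by auto
 \<comment> \<open>If \<open>\<beta>\<close> left a ball around \<open>y\<close> again and again,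
   two points near \<open>y\<close> could be joined inside the ball past a point
   \<open>\<beta> b\<close> outside it.\<close>
 have lim: "\<exists>N. \<forall>t\<ge>N. dist (\<beta> t) y < \<epsilon>" if "0 < \<epsilon>" for \<epsilon>
 proof (rule ccontr)
  assume "\<not> ?thesis"
  then have far: "\<exists>t\<ge>N. \<not> dist (\<beta> t) y < \<epsilon>" for N by blast
  obtain \<delta> where \<delta>: "0 < \<delta>" "\<And>x. x \<in> A ==> dist x y < \<delta> ==> \<exists>p. path p \<and> path_image p \<subseteq> A \<inter> ball y \<epsilon> \<and> pathstart p = x \<and> pathfinish p = y"
   by (rule local_path[OF yA \<open>0 < \<epsilon>\<close>]) (rule that, assumption, blast)
  obtain a where a: "a \<ge> 0" "dist (\<beta> a) y < \<delta>" using acc[OF \<delta>(1)] by blast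
  obtain b where b: "b \<ge> a + 1" "\<not> dist (\<beta> b) y < \<epsilon>" using far by blast
  obtain c where c: "c \<ge> b + 1" "dist (\<beta> c) y < \<delta>" using acc[OF \<delta>(1)] by blast
  obtain p where p: "path p" "path_image p \<subseteq> A \<inter> ball y \<epsilon>" "pathstart p = \<beta> c" "pathfinish p = y"
   using \<delta>(2)[OF \<beta>A c(2)] a b c by auto
  obtain q where q: "path q" "path_image q \<subseteq> A \<inter> ball y \<epsilon>" "pathstart q = \<beta> a" "pathfinish q = y"
   using \<delta>(2)[OF \<beta>A a(2)] a by auto
  let ?h = "p +++ reversepath q"
  have hi: "path_image ?h \<subseteq> A \<inter> ball y \<epsilon>" using path_image_join_subset[of p "reversepath q"] p q by auto
  moreover have "\<beta> b \<notin> ball y \<epsilon>" using b by (simp add: dist_commute)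
  moreover have "path ?h" using p q by (intro path_join_imp) auto
  ultimately have "\<beta> b \<notin> path_image ?h" "path ?h" by blast+
  then show False using shortcut[of a b c ?h] hi a b c p q by auto
 qed
 have yne: "y \<noteq> \<beta> s" if "0 \<le> s" for s
 proof
  assume ys: "y = \<beta> s"
  define \<epsilon> where "\<epsilon> = dist (\<beta> (s + 1)) y"
  have "\<beta> (s + 1) \<noteq> \<beta> s" using inj[of "s + 1" s] that by auto
  then have "0 < \<epsilon>" using ys by (simp add: \<epsilon>_def)
  obtain \<delta> where \<delta>: "0 < \<delta>" "\<And>x. x \<in> A ==> dist x y < \<delta> ==> \<exists>p. path p \<and> path_image p \<subseteq> A \<inter> ball y \<epsilon> \<and> pathstart p = x \<and> pathfinish p = y"
   by (rule local_path[OF yA \<open>0 < \<epsilon>\<close>]) (rule that, assumption, blast)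
  obtain c where c: "c \<ge> s + 2" "dist (\<beta> c) y < \<delta>" using acc[OF \<delta>(1)] by blast
  obtain p where p: "path p" "path_image p \<subseteq> A \<inter> ball y \<epsilon>" "pathstart p = \<beta> c" "pathfinish p = y"
   using \<delta>(2)[OF \<beta>A c(2)] \<open>0 \<le> s\<close> c by auto
  have "\<beta> (s + 1) \<notin> ball y \<epsilon>" by (simp add: \<epsilon>_def dist_commute)
  then have "\<beta> (s + 1) \<notin> path_image p" using p(2) by blast
  then show False using shortcut[of s "s + 1" c p] p that c ys by auto
 qed
 \<comment> \<open>The part of \<open>\<beta>\<close> from \<open>a\<close> on, compressed to
   \<open>[0,1)\<close> and completed by \<open>y\<close> at 1.\<close>
 define e where "e a x = (if x < 1 then \<beta> (a + x / (1 - x)) else y)" for a x :: real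
 have arg: "0 \<le> x / (1 - x)" if "0 \<le> x" "x < 1" for x :: real using that by simp
 have arce: "arc (e a)" "pathstart (e a) = \<beta> a" "pathfinish (e a) = y" "path_image (e a) \<subseteq> insert y (\<beta> ` {a..})"
  "e a ` {0<..1} \<inter> \<beta> ` {0..a} = {}" if a: "0 \<le> a" for a
 proof -
  have "continuous_on {0..1} (e a)"
   unfolding continuous_on_eq_continuous_within
  proof
   fix x :: real assume x: "x \<in> {0..1}"
   show "continuous (at x within {0..1}) (e a)"
   proof (cases "x < 1")
    case True
    have "continuous_on {0..<1} (\<lambda>x. \<beta> (a + x / (1 - x)))"
     by (rule continuous_on_compose2[OF cont\<beta>]) (use arg a in \<open>auto intro!: continuous_intros add_nonneg_nonneg\<close>)
    then have "continuous_on {0..<1} (e a)" by (rule continuous_on_eq) (simp add: e_def)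
    then have "continuous (at x within {0..<1}) (e a)" using x True by (simp add: continuous_on_eq_continuous_within)
    moreover have "at x within {0..1} = at x within {0..<1}" using True by (intro at_within_nhd[of x "{..<1}"]) auto
    ultimately show ?thesis by (simp add: continuous_within)
   next
    case False
    then have x1: "x = 1" using x by simp
    show ?thesis unfolding x1 continuous_within_eps_delta
    proof (intro allI impI)
     fix \<epsilon> :: real assume "0 < \<epsilon>"
     then obtain N where N: "\<And>t. t \<ge> N ==> dist (\<beta> t) y < \<epsilon>" using lim by blast
     define d where "d = 1 / (\<bar>N\<bar> + 1)"
     have d: "0 < d" by (simp add: d_def)
     have "dist (e a x) (e a 1) < \<epsilon>" if "x \<in> {0..1}" "dist x 1 < d" for x
     proof (cases "x < 1")
      case True
      then have xd: "1 - d < x" "0 \<le> x" using that by (auto simp: dist_real_def)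
      have "\<bar>N\<bar> \<le> x / (1 - x)"
      proof -
       have "(1 - x) * (\<bar>N\<bar> + 1) < d * (\<bar>N\<bar> + 1)" using xd by (intro mult_strict_right_mono) auto
       moreover have "d * (\<bar>N\<bar> + 1) = 1" using abs_ge_zero[of N] by (simp add: d_def add_nonneg_eq_0_iff)
       ultimately have "(1 - x) * (\<bar>N\<bar> + 1) < 1" by simp
       then show ?thesis using True by (simp add: pos_le_divide_eq algebra_simps)
      qed
      then have "N \<le> a + x / (1 - x)" using a by linarith
      then show ?thesis using N True by (simp add: e_def)
     next
      case False then show ?thesis using that \<open>0 < \<epsilon>\<close> by (simp add: e_def)
     qed
     then show "\<exists>d>0. \<forall>x'\<in>{0..1}. dist x' 1 < d --> dist (e a x') (e a 1) < \<epsilon>" using d by blast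
    qed
   qed
  qed
  moreover have "inj_on (e a) {0..1}"
  proof (rule linorder_inj_onI)
   fix s t :: real assume st: "s < t" "s \<in> {0..1}" "t \<in> {0..1}"
   show "e a s \<noteq> e a t"
   proof (cases "t < 1")
    case True
    have "s / (1 - s) \<noteq> t / (1 - t)"
    proof
     assume "s / (1 - s) = t / (1 - t)"
     then have "s * (1 - t) = t * (1 - s)" using st True by (subst (asm) frac_eq_eq) auto
     then show False using st by (simp add: algebra_simps)
    qed
    then show ?thesis using inj[of "a + s / (1 - s)" "a + t / (1 - t)"] arg[of s] arg[of t] st True a by (auto simp: e_def)
   next
    case False
    then show ?thesis using yne[of "a + s / (1 - s)"] arg[of s] st a by (auto simp: e_def)
   qed
  qed auto
  ultimately show "arc (e a)" by (simp add: arc_def path_def)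
  show "pathstart (e a) = \<beta> a" "pathfinish (e a) = y" by (simp_all add: e_def pathstart_def pathfinish_def)
  show "path_image (e a) \<subseteq> insert y (\<beta> ` {a..})" using arg by (auto simp: path_image_def e_def)
  show "e a ` {0<..1} \<inter> \<beta> ` {0..a} = {}"
  proof -
   have "e a x \<noteq> \<beta> s" if "x \<in> {0<..1}" "s \<in> {0..a}" for x s
   proof (cases "x < 1")
    case True
    define q where "q = x / (1 - x)"
    have q: "0 < q" using that True by (simp add: q_def)
    have "e a x = \<beta> (a + q)" using True by (simp add: e_def q_def)
    then show ?thesis using inj[of "a + q" s] q that a by auto
   next
    case False then show ?thesis using yne[of s] that by (auto simp: e_def)
   qed
   then show ?thesis by blast
  qed
 qed
 have eA: "path_image (e a) \<subseteq> A" if "0 \<le> a" for a using arce(4)[OF that] \<beta>A yA that by force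
 have "0 < c0" by (rule \<gamma>(1))
 \<comment> \<open>\<open>\<beta>\<close> up to \<open>c0\<close> followed by \<open>e c0\<close>
   traverses all of \<open>\<beta>\<close> and ends at \<open>y\<close>; thus the prolongation
   \<open>g\<close> below avoids every point of \<open>\<beta>\<close>.\<close>
 have Pe: "P (\<lambda>t. if t \<le> c0 then \<beta> t else e c0 (t - c0)) (c0 + 1)"
  by (rule P_extend[OF P\<beta>[OF \<open>0 < c0\<close>] arce(1,2) eA arce(5)]) (use \<open>0 < c0\<close> in auto)
 obtain g where g: "arc g" "pathstart g = y" "path_image g \<subseteq> A"
   "g ` {0<..1} \<inter> (\<lambda>t. if t \<le> c0 then \<beta> t else e c0 (t - c0)) ` {0..c0+1} = {}"
 proof (rule extend_past_end[OF ng Pe])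
  fix g assume *: "arc g" "pathstart g = (if c0 + 1 \<le> c0 then \<beta> (c0 + 1) else e c0 (c0 + 1 - c0))" "path_image g \<subseteq> A"
   "g ` {0<..1} \<inter> (\<lambda>t. if t \<le> c0 then \<beta> t else e c0 (t - c0)) ` {0..c0+1} = {}"
  show thesis by (rule that[OF *(1) _ *(3,4)]) (use *(2) in \<open>simp add: e_def\<close>)
 qed
 have g\<beta>: "g x \<noteq> \<beta> s" if x: "x \<in> {0<..1}" and s: "0 \<le> s" for x s
 proof -
  have "\<beta> s \<in> (\<lambda>t. if t \<le> c0 then \<beta> t else e c0 (t - c0)) ` {0..c0+1}"
  proof (cases "s \<le> c0")
   case True then show ?thesis using s \<open>0 < c0\<close> by (intro image_eqI[of _ _ s]) auto
  next
   case False
   define v where "v = (s - c0) / (1 + (s - c0))"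
   have v: "0 < v" "v < 1" "v / (1 - v) = s - c0" using False by (auto simp: v_def field_simps)
   then show ?thesis using \<open>0 < c0\<close> by (intro image_eqI[of _ _ "c0 + v"]) (auto simp: e_def)
  qed
  moreover have "g x \<in> g ` {0<..1}" using x by blast
  ultimately show ?thesis using g(4) by (metis disjoint_iff)
 qed
 have gy: "g x \<noteq> y" if "x \<in> {0<..1}" for x
 proof -
  have "inj_on g {0..1}" "g 0 = y" using g by (auto simp: arc_def pathstart_def)
  then show ?thesis using inj_onD[of g "{0..1}" x 0] that by auto
 qed
 define w where "w = g 1"
 have wy: "0 < dist w y" using gy[of 1] by (simp add: w_def)
 \<comment> \<open>The competitor in step \<open>n\<close> runs along the rest of
   \<open>\<beta>\<close> to \<open>y\<close> and then along \<open>g\<close>, so that it ends at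
   \<open>w = g 1\<close>.\<close>
 have step: "min 1 (dist w (\<beta> (c0 + real n))) \<le> 2 * dist (\<beta> (c0 + real n + 1)) (\<beta> (c0 + real n))" for n
 proof -
  define a where "a = c0 + real n"
  have a: "0 < a" using \<open>0 < c0\<close> by (simp add: a_def)
  then have a': "0 \<le> a" by simp
  let ?k = "e a +++ g"
  have k: "arc ?k"
  proof (rule arc_join[OF arce(1)[OF a'] g(1)])
   show "pathfinish (e a) = pathstart g" using arce(3)[OF a'] g by simp
   have "v = y" if va: "v \<in> path_image (e a)" and vg: "v \<in> path_image g" for v
   proof (rule ccontr)
    assume "v \<noteq> y"
    then obtain s where s: "s \<ge> a" "v = \<beta> s" using arce(4)[OF a'] va by auto
    obtain x where x: "x \<in> {0..1}" "v = g x" using vg by (auto simp: path_image_def)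
    then have "x \<noteq> 0" using \<open>v \<noteq> y\<close> g(2) by (auto simp: pathstart_def)
    then show False using g\<beta>[of x s] x s a by auto
   qed
   then show "path_image (e a) \<inter> path_image g \<subseteq> {pathstart g}" using g(2) by auto
  qed
  have "P (\<lambda>t. if t \<le> a then \<beta> t else ?k (t - a)) (a + 1)"
  proof (rule P_extend[OF P\<beta>[OF a] k])
   show "pathstart ?k = \<beta> a" using arce(2)[OF a'] by simp
   show "path_image ?k \<subseteq> A" using path_image_join_subset[of "e a" g] eA[OF a'] g(3) by blast
   have "?k x \<noteq> \<beta> s" if x: "x \<in> {0<..1}" and s: "s \<in> {0..a}" for x s
   proof (cases "x \<le> 1/2")
    case True
    then have "?k x = e a (2 * x)" "2 * x \<in> {0<..1}" using x by (auto simp: joinpaths_def)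
    then have "?k x \<in> e a ` {0<..1}" by auto
    moreover have "\<beta> s \<in> \<beta> ` {0..a}" using s by blast
    ultimately show ?thesis using arce(5)[OF a'] by (metis disjoint_iff)
   next
    case False
    then have "?k x = g (2 * x - 1)" "2 * x - 1 \<in> {0<..1}" using x by (auto simp: joinpaths_def)
    then show ?thesis using g\<beta>[of "2 * x - 1" s] s by auto
   qed
   then show "?k ` {0<..1} \<inter> \<beta> ` {0..a} = {}" by blast
  qed
  moreover have "\<forall>t\<in>{0..a}. (if t \<le> a then \<beta> t else ?k (t - a)) = B n t" using \<beta>B by (simp add: a_def)
  ultimately have "min 1 (dist ((\<lambda>t. if t \<le> a then \<beta> t else ?k (t - a)) (a + 1)) (B n a)) \<le> 2 * dist (B (Suc n) (a + 1)) (B n a)"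
   using B(2)[of n] unfolding Q_def a_def[symmetric] by blast
  moreover have "(\<lambda>t. if t \<le> a then \<beta> t else ?k (t - a)) (a + 1) = w" by (simp add: w_def joinpaths_def)
  moreover have "B n a = \<beta> a" "B (Suc n) (a + 1) = \<beta> (a + 1)" using \<beta>B[of a n] \<beta>B[of "a+1" "Suc n"] a by (auto simp: a_def)
  ultimately show ?thesis by (simp add: a_def)
 qed
 \<comment> \<open>Once \<open>\<beta>\<close> is within \<open>\<kappa>\<close> of
   \<open>y\<close>, twice a step is below \<open>4 * \<kappa>\<close>, whereas \<open>w\<close> is
   at least \<open>7 * \<kappa>\<close> away and \<open>1 \<ge> 8 * \<kappa>\<close>; this
   contradicts \<open>step\<close>.\<close>
 define \<kappa> where "\<kappa> = min (1/8) (dist w y / 8)"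
 have \<kappa>: "0 < \<kappa>" "8 * \<kappa> \<le> 1" "8 * \<kappa> \<le> dist w y" using wy by (auto simp: \<kappa>_def)
 obtain N where N: "\<And>t. t \<ge> N ==> dist (\<beta> t) y < \<kappa>" using lim[OF \<kappa>(1)] by blast
 obtain n where n: "N \<le> real n" using real_arch_simple by blast
 have n1: "dist (\<beta> (c0 + real n)) y < \<kappa>" "dist (\<beta> (c0 + real n + 1)) y < \<kappa>" using N n \<open>0 < c0\<close> by auto
 have "dist (\<beta> (c0 + real n + 1)) (\<beta> (c0 + real n)) < 2 * \<kappa>"
  using dist_triangle2[of "\<beta> (c0 + real n + 1)" "\<beta> (c0 + real n)" y] n1 by linarith
 moreover have "dist w y \<le> dist w (\<beta> (c0 + real n)) + dist (\<beta> (c0 + real n)) y" by (rule dist_triangle)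
 ultimately show False using step[of n] n1 \<kappa> by (auto simp: min_def split: if_splits)
qed

end

section \<open>Bounded functionals and bounded inverses\<close>

definition sublinear :: "('a::real_vector \<Rightarrow> real) \<Rightarrow> bool" where
 "sublinear p \<longleftrightarrow> (\<forall>x y. p (x + y) \<le> p x + p y) \<and> (\<forall>t x. 0 \<le> t --> p (t *\<^sub>R x) = t * p x)"

lemma sublinearD:
 assumes "sublinear p"
 shows "p (x + y) \<le> p x + p y" "0 \<le> t ==> p (t *\<^sub>R x) = t * p x" "p 0 = 0" "- p (- x) \<le> p x"
proof -
 show 1: "p (x + y) \<le> p x + p y" and 2: "0 \<le> t ==> p (t *\<^sub>R x) = t * p x" for x y t
  using assms unfolding sublinear_def by blast+
 show 3: "p 0 = 0" using 2[of 0 0] by simp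
 show "- p (- x) \<le> p x" using 1[of x "-x"] 3 by simp
qed

text \<open>A minimal \<open>p\<close> coincides with \<open>q\<close>, and then the last conclusion
  complements subadditivity to additivity. The bound at \<open>- y\<close>, applied to the norm,
  makes the functional obtained in the end nonzero at \<open>y\<close>.\<close>

lemma sublinear_shift:
 fixes p :: "'a::real_vector \<Rightarrow> real" and y :: 'a
 assumes p: "sublinear p"
 defines "q \<equiv> \<lambda>x. INF t\<in>{0..}. p (x + t *\<^sub>R y) - t * p y"
 shows "sublinear q" "q x \<le> p x" "q (- y) \<le> - p y" "q x + p y \<le> p (x + y)"
proof -
 have lb: "- p (- x) \<le> p (x + t *\<^sub>R y) - t * p y" if "0 \<le> t" for x t
 proof -
  have "p (t *\<^sub>R y) \<le> p (x + t *\<^sub>R y) + p (- x)" using sublinearD(1)[OF p, of "x + t *\<^sub>R y" "-x"] by simp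
  then show ?thesis using sublinearD(2)[OF p that, of y] by simp
 qed
 have bdd: "bdd_below ((\<lambda>t. p (x + t *\<^sub>R y) - t * p y) ` {0..})" for x
  by (rule bdd_belowI2[of _ "- p (- x)"]) (use lb in auto)
 have le: "q x \<le> p (x + t *\<^sub>R y) - t * p y" if "0 \<le> t" for x t
  unfolding q_def by (rule cINF_lower[OF bdd]) (use that in auto)
 have ge: "c \<le> q x" if "\<And>t. 0 \<le> t ==> c \<le> p (x + t *\<^sub>R y) - t * p y" for x c
  unfolding q_def by (rule cINF_greatest) (use that in auto)
 show "q x \<le> p x" using le[of 0 x] by simp
 show "q (- y) \<le> - p y" using le[of 1 "-y"] sublinearD(3)[OF p] by simp
 show "q x + p y \<le> p (x + y)" using le[of 1 x] by simp
 show "sublinear q" unfolding sublinear_def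
 proof (intro conjI allI impI)
  fix x z
  have "q (x + z) - (p (z + s *\<^sub>R y) - s * p y) \<le> q x" if s: "0 \<le> s" for s
  proof (rule ge)
   fix t :: real assume t: "0 \<le> t"
   have "q (x + z) \<le> p (x + z + (t + s) *\<^sub>R y) - (t + s) * p y" using s t by (intro le) simp
   also have "x + z + (t + s) *\<^sub>R y = (x + t *\<^sub>R y) + (z + s *\<^sub>R y)" by (simp add: algebra_simps)
   also have "p \<dots> \<le> p (x + t *\<^sub>R y) + p (z + s *\<^sub>R y)" by (rule sublinearD(1)[OF p])
   finally show "q (x + z) - (p (z + s *\<^sub>R y) - s * p y) \<le> p (x + t *\<^sub>R y) - t * p y"
    by (simp add: algebra_simps)
  qed
  then have "q (x + z) - q x \<le> q z" by (intro ge) (simp add: algebra_simps)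
  then show "q (x + z) \<le> q x + q z" by simp
 next
  fix t :: real and x assume t: "0 \<le> t"
  have q0: "q 0 = 0"
  proof (rule antisym)
   show "q 0 \<le> 0" using le[of 0 0] sublinearD(3)[OF p] by simp
   show "0 \<le> q 0" by (rule ge) (use sublinearD(2)[OF p] in simp)
  qed
  have half: "a * q x \<le> q (a *\<^sub>R x)" if a: "0 < a" for a x
  proof (rule ge)
   fix s :: real assume s: "0 \<le> s"
   have "q x \<le> p (x + (s / a) *\<^sub>R y) - (s / a) * p y" using a s by (intro le) simp
   then have "a * q x \<le> a * (p (x + (s / a) *\<^sub>R y) - (s / a) * p y)" using a by (intro mult_left_mono) auto
   also have "\<dots> = a * p (x + (s / a) *\<^sub>R y) - s * p y" using a by (simp add: right_diff_distrib)
   also have "a * p (x + (s / a) *\<^sub>R y) = p (a *\<^sub>R (x + (s / a) *\<^sub>R y))" using a sublinearD(2)[OF p] by simp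
   also have "a *\<^sub>R (x + (s / a) *\<^sub>R y) = a *\<^sub>R x + s *\<^sub>R y" using a by (simp add: scaleR_add_right)
   finally show "a * q x \<le> p (a *\<^sub>R x + s *\<^sub>R y) - s * p y" .
  qed
  show "q (t *\<^sub>R x) = t * q x"
  proof (cases "t = 0")
   case True then show ?thesis using q0 by simp
  next
   case False
   then have t: "0 < t" using t by simp
   have "(1 / t) * q (t *\<^sub>R x) \<le> q x" using half[of "1 / t" "t *\<^sub>R x"] t by simp
   then have "q (t *\<^sub>R x) \<le> t * q x" using t by (simp add: divide_le_eq mult.commute)
   then show ?thesis using half[OF t, of x] by simp
  qed
 qed
qed

text \<open>Hahn--Banach: a minimal sublinear functional is linear, because it cannot be decreased by
 \<open>sublinear_shift\<close>.\<close>

lemma exists_bounded_functional: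
 fixes y :: "'a::real_normed_vector"
 assumes "y \<noteq> 0"
 obtains l :: "'a \<Rightarrow> real" where "bounded_linear l" "l y \<noteq> 0"
proof -
 have sn: "sublinear (norm :: 'a \<Rightarrow> real)" by (simp add: sublinear_def norm_triangle_ineq)
 define p0 where "p0 = (\<lambda>x::'a. INF t\<in>{0..}. norm (x + t *\<^sub>R y) - t * norm y)"
 have p0: "sublinear p0" "\<And>x. p0 x \<le> norm x" "p0 (- y) \<le> - norm y"
  unfolding p0_def by (rule sublinear_shift[OF sn])+
 define A where "A = {p. sublinear p \<and> (\<forall>x. p x \<le> p0 x)}"
 have Alb: "- norm x \<le> p x" if "p \<in> A" for p and x :: 'a
 proof -
  have "p (- x) \<le> norm (- x)" using that p0(2)[of "-x"] unfolding A_def by (blast intro: order_trans)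
  moreover have "- p (- x) \<le> p x" using that sublinearD(4) unfolding A_def by blast
  ultimately show ?thesis by simp
 qed
 have "\<exists>m\<in>A. \<forall>a\<in>A. (\<forall>x. a x \<le> m x) --> a = m"
 proof (rule predicate_Zorn)
  show "partial_order_on A (relation_of (\<lambda>m a. \<forall>x. a x \<le> m x) A)"
   by (rule partial_order_on_relation_ofI) (auto intro: order_trans antisym simp: fun_eq_iff)
  fix C assume C: "C \<in> Chains (relation_of (\<lambda>m a. \<forall>x. a x \<le> m x) A)"
  have CA: "C \<subseteq> A" using C unfolding Chains_def relation_of_def by auto
  have ch: "(\<forall>x. b x \<le> a x) \<or> (\<forall>x. a x \<le> b x)" if "a \<in> C" "b \<in> C" for a b
   using C that unfolding Chains_def relation_of_def by blast
  show "\<exists>u\<in>A. \<forall>a\<in>C. \<forall>x. u x \<le> a x"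
  proof (cases "C = {}")
   case True then show ?thesis using p0 by (intro bexI[of _ p0]) (auto simp: A_def)
  next
   case False
   define u where "u x = (INF p\<in>C. p x)" for x
   have bdd: "bdd_below ((\<lambda>p. p x) ` C)" for x by (rule bdd_belowI2[of _ "- norm x"]) (use Alb CA in blast)
   have le: "u x \<le> p x" if "p \<in> C" for p x unfolding u_def by (rule cINF_lower[OF bdd that])
   have ge: "c \<le> u x" if "\<And>p. p \<in> C ==> c \<le> p x" for c x unfolding u_def by (rule cINF_greatest[OF False that])
   have sl: "sublinear p" if "p \<in> C" for p using that CA unfolding A_def by blast
   have add: "u (x + z) \<le> u x + u z" for x z
   proof -
    have "u (x + z) - p x \<le> r z" if pr: "p \<in> C" "r \<in> C" for p r
    proof -
     obtain s where s: "s \<in> C" "s x \<le> p x" "s z \<le> r z" using ch[OF pr] pr by blast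
     show ?thesis using le[OF s(1), of "x + z"] sublinearD(1)[OF sl[OF s(1)], of x z] s by linarith
    qed
    then have "u (x + z) - p x \<le> u z" if "p \<in> C" for p using that by (intro ge)
    then have "u (x + z) - u z \<le> p x" if "p \<in> C" for p using that by (simp add: algebra_simps)
    then have "u (x + z) - u z \<le> u x" by (rule ge)
    then show ?thesis by simp
   qed
   have u0: "u 0 = 0"
   proof (rule antisym)
    obtain p where "p \<in> C" using False by blast
    then show "u 0 \<le> 0" using le[of p 0] sublinearD(3)[OF sl[of p]] by simp
    show "0 \<le> u 0"
    proof (rule ge)
     fix p assume "p \<in> C"
     then show "0 \<le> p 0" using sublinearD(3)[OF sl[of p]] by simp
    qed
   qed
   have half: "a * u x \<le> u (a *\<^sub>R x)" if "0 < a" for a x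
   proof (rule ge)
    fix p assume p: "p \<in> C"
    have "a * u x \<le> a * p x" using le[OF p] that by (intro mult_left_mono) auto
    then show "a * u x \<le> p (a *\<^sub>R x)" using sublinearD(2)[OF sl[OF p], of a x] that by simp
   qed
   have "u (t *\<^sub>R x) = t * u x" if "0 \<le> t" for t x
   proof (cases "t = 0")
    case False
    then have t: "0 < t" using that by simp
    have "(1 / t) * u (t *\<^sub>R x) \<le> u x" using half[of "1 / t" "t *\<^sub>R x"] t by simp
    then have "u (t *\<^sub>R x) \<le> t * u x" using t by (simp add: divide_le_eq mult.commute)
    then show ?thesis using half[OF t, of x] by simp
   qed (simp add: u0)
   moreover have "u x \<le> p0 x" for x
   proof -
    obtain p where "p \<in> C" using False by blast
    then show ?thesis using le[of p x] CA unfolding A_def by (auto intro: order_trans)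
   qed
   ultimately have "u \<in> A" using add unfolding A_def sublinear_def by blast
   then show ?thesis using le by blast
  qed
 qed
 then obtain m where m: "m \<in> A" "\<And>a. a \<in> A ==> (\<forall>x. a x \<le> m x) ==> a = m" by blast
 have sm: "sublinear m" using m(1) by (simp add: A_def)
 have add: "m (x + z) = m x + m z" for x z
 proof (rule antisym)
  show "m (x + z) \<le> m x + m z" by (rule sublinearD(1)[OF sm])
  define q where "q = (\<lambda>x. INF t\<in>{0..}. m (x + t *\<^sub>R z) - t * m z)"
  have q: "sublinear q" "\<And>x. q x \<le> m x" "q x + m z \<le> m (x + z)"
   unfolding q_def by (rule sublinear_shift[OF sm])+
  have "q = m" using q m(1) by (intro m(2)) (auto simp: A_def intro: order_trans)
  then show "m x + m z \<le> m (x + z)" using q(3) by simp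
 qed
 have neg: "m (- x) = - m x" for x using add[of x "-x"] sublinearD(3)[OF sm] by simp
 have scale: "m (t *\<^sub>R x) = t * m x" for t x
 proof (cases "0 \<le> t")
  case False
  then have "m ((- t) *\<^sub>R x) = (- t) * m x" by (intro sublinearD(2)[OF sm]) simp
  then show ?thesis using neg[of "t *\<^sub>R x"] by simp
 qed (rule sublinearD(2)[OF sm])
 have up: "m x \<le> norm x" for x using m(1) p0(2)[of x] unfolding A_def by (blast intro: order_trans)
 have "bounded_linear m"
 proof (rule bounded_linear_intro[where K = 1])
  show "norm (m x) \<le> norm x * 1" for x using up[of x] up[of "-x"] neg[of x] by (simp add: abs_le_iff)
 qed (simp_all add: add scale)
 moreover have "m y \<noteq> 0"
 proof -
  have "m (- y) \<le> - norm y" using m(1) p0(3) unfolding A_def by (blast intro: order_trans)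
  then show ?thesis using neg[of y] assms by auto
 qed
 ultimately show thesis by (rule that)
qed

text \<open>For a new vector \<open>y\<close>, \<open>pr\<close> removes the components along
  \<open>B\<close>; a functional that is nonzero at \<open>pr y\<close>, composed with
  \<open>pr\<close> and normalised, is dual to \<open>y\<close>, and the old functionals are
  corrected by multiples of it.\<close>

lemma dual_functionals:
 fixes B :: "'a::real_normed_vector set"
 assumes "finite B" "independent B"
 shows "\<exists>l. (\<forall>b\<in>B. bounded_linear (l b)) \<and> (\<forall>b\<in>B. \<forall>c\<in>B. l b c = (if b = c then 1 else (0::real)))"
 using assms
proof (induction rule: finite_induct)
 case (insert y B)
 have B: "independent B" "y \<notin> span B" using insert by (auto simp: independent_insert)
 obtain l where l: "\<And>b. b \<in> B ==> bounded_linear (l b)" "\<And>b c. b \<in> B ==> c \<in> B ==> l b c = (if b = c then 1 else (0::real))"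
  using insert.IH[OF B(1)] by blast
 define pr where "pr u = u - (\<Sum>b\<in>B. l b u *\<^sub>R b)" for u
 have blpr: "bounded_linear pr" unfolding pr_def
  by (intro bounded_linear_sub bounded_linear_ident bounded_linear_sum bounded_linear_scaleR_const l)
 have prB: "pr c = 0" if "c \<in> B" for c
 proof -
  have "(\<Sum>b\<in>B. l b c *\<^sub>R b) = (\<Sum>b\<in>B. if c = b then b else 0)" using l(2) that by (intro sum.cong) auto
  then show ?thesis using that insert.hyps by (simp add: pr_def)
 qed
 have "(\<Sum>b\<in>B. l b y *\<^sub>R b) \<in> span B" by (intro span_sum span_scale span_base)
 then have "pr y \<noteq> 0" using B(2) by (auto simp: pr_def)
 then obtain f where f: "bounded_linear f" "f (pr y) \<noteq> (0::real)" by (rule exists_bounded_functional)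
 define ly where "ly u = f (pr u) / f (pr y)" for u
 have bly: "bounded_linear ly" unfolding ly_def
  using bounded_linear_compose[OF bounded_linear_divide bounded_linear_compose[OF f(1) blpr]] by simp
 have ly: "ly y = 1" "\<And>c. c \<in> B ==> ly c = 0" using f prB linear_0[OF bounded_linear.linear[OF f(1)]] by (auto simp: ly_def)
 define l' where "l' b = (if b = y then ly else (\<lambda>u. l b u - l b y * ly u))" for b
 have "bounded_linear (l' b)" if "b \<in> insert y B" for b
  unfolding l'_def using that bly l(1)
  by (auto intro!: bounded_linear_sub bounded_linear_const_mult)
 moreover have "l' b c = (if b = c then 1 else 0)" if "b \<in> insert y B" "c \<in> insert y B" for b c
  using that ly l(2) insert.hyps by (auto simp: l'_def)
 ultimately show ?case by blast
qed simp

text \<open>Banach's theorem. By Baire's theorem the closure of the image of some ball contains a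
  ball; differences of two of its points solve \<open>S x = y\<close> up to an error of half the
  norm of \<open>y\<close>, and iterating the correction gives a geometric series.\<close>

lemma bounded_inverse:
 fixes S :: "'a::banach \<Rightarrow> 'b::banach"
 assumes S: "bounded_linear S" and bij: "bij S"
 shows "bounded_linear (inv_into UNIV S)"
proof -
 interpret S: bounded_linear S by (rule S)
 define K where "K n = closure (S ` cball 0 (real n))" for n :: nat
 have "\<exists>n. interior (K n) \<noteq> {}"
 proof (rule ccontr)
  assume "\<not> ?thesis"
  then have e: "interior (K n) = {}" for n by blast
  have "euclidean interior_of (\<Union>(range K)) = {}"
  proof (rule Baire_category_alt)
   show "completely_metrizable_space (euclidean :: 'b topology) \<or> locally_compact_space (euclidean::'b topology) \<and> regular_space (euclidean::'b topology)"
    by (simp add: completely_metrizable_space_euclidean)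
  qed (use e in \<open>auto simp: K_def\<close>)
  moreover have "\<Union>(range K) = UNIV"
  proof -
   have "y \<in> \<Union>(range K)" for y
   proof -
    obtain x where x: "y = S x" by (rule surjE[OF bij_is_surj[OF bij]])
    obtain n where "norm x \<le> real n" using real_arch_simple by blast
    then have "y \<in> S ` cball 0 (real n)" using x by auto
    then have "y \<in> K n" unfolding K_def by (rule subsetD[OF closure_subset])
    then show ?thesis by blast
   qed
   then show ?thesis by blast
  qed
  ultimately show False by simp
 qed
 then obtain n y0 where "y0 \<in> interior (K n)" by blast
 then obtain e where e: "0 < e" "ball y0 e \<subseteq> K n" unfolding mem_interior by blast
 have near: "\<exists>x. norm x \<le> real n \<and> dist (S x) y < d" if "dist y0 y < e" "0 < d" for y d
 proof -
  have "y \<in> K n" using that e by auto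
  then have "\<exists>z\<in>S ` cball 0 (real n). dist z y < d" using that(2) unfolding K_def closure_approachable by blast
  then obtain x where "x \<in> cball 0 (real n)" "dist (S x) y < d" by blast
  then show ?thesis by (intro exI[of _ x]) simp
 qed
 \<comment> \<open>A vector \<open>y\<close> is scaled to norm \<open>e / 2\<close>; the difference
   of two points of norm at most \<open>n\<close>, scaled back by \<open>2 * norm y / e\<close>, has
   norm at most \<open>M * norm y\<close>.\<close>
 define M where "M = 4 * (real n + 1) / e"
 have M: "0 < M" using e by (simp add: M_def)
 have step: "\<exists>x. norm x \<le> M * norm y \<and> norm (y - S x) \<le> norm y / 2" for y
 proof (cases "y = 0")
  case True then show ?thesis by (intro exI[of _ 0]) (simp add: S.zero)
 next
  case False
  define c where "c = e / (2 * norm y)"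
  have c: "0 < c" using False e by (simp add: c_def)
  have ncy: "norm (c *\<^sub>R y) = e / 2" using False e by (simp add: c_def)
  obtain x1 where x1: "norm x1 \<le> real n" "dist (S x1) (y0 + c *\<^sub>R y) < e / 8"
   using near[of "y0 + c *\<^sub>R y" "e/8"] ncy e by (auto simp: dist_norm)
  obtain x2 where x2: "norm x2 \<le> real n" "dist (S x2) y0 < e / 8"
   using near[of y0 "e/8"] e by auto
  define x where "x = (1 / c) *\<^sub>R (x1 - x2)"
  have "norm (x1 - x2) \<le> 2 * (real n + 1)" using norm_triangle_ineq4[of x1 x2] x1 x2 by simp
  then have "norm x \<le> (1 / c) * (2 * (real n + 1))" using c by (simp add: x_def divide_right_mono)
  also have "\<dots> = M * norm y" using e False by (simp add: c_def M_def field_simps)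
  finally have nx: "norm x \<le> M * norm y" .
  have "norm (c *\<^sub>R y - (S x1 - S x2)) \<le> e / 4"
  proof -
   have eq: "c *\<^sub>R y - (S x1 - S x2) = (S x2 - y0) - (S x1 - (y0 + c *\<^sub>R y))" by simp
   have "norm (c *\<^sub>R y - (S x1 - S x2)) \<le> norm (S x2 - y0) + norm (S x1 - (y0 + c *\<^sub>R y))"
    unfolding eq by (rule norm_triangle_ineq4)
   then show ?thesis using x1 x2 by (simp add: dist_norm)
  qed
  moreover have "y - S x = (1 / c) *\<^sub>R (c *\<^sub>R y - (S x1 - S x2))"
   using c by (simp add: x_def S.scaleR S.diff scaleR_diff_right)
  ultimately have "norm (y - S x) \<le> (1 / c) * (e / 4)"
   using c mult_left_mono[of "norm (c *\<^sub>R y - (S x1 - S x2))" "e / 4" "1 / c"] by simp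
  also have "\<dots> = norm y / 2" using e False by (simp add: c_def field_simps)
  finally show ?thesis using nx by blast
 qed
 then obtain X where X: "\<And>y. norm (X y) \<le> M * norm y" "\<And>y. norm (y - S (X y)) \<le> norm y / 2" by metis
 have bound: "norm (inv_into UNIV S y) \<le> norm y * (2 * M)" for y
 proof -
  define r where "r k = ((\<lambda>y. y - S (X y)) ^^ k) y" for k
  have r: "norm (r k) \<le> norm y * (1/2) ^ k" for k
  proof (induction k)
   case (Suc k)
   have "norm (r (Suc k)) \<le> norm (r k) / 2" using X(2)[of "r k"] by (simp add: r_def)
   then show ?case using Suc by simp
  qed (simp add: r_def)
  have nX: "norm (X (r k)) \<le> (M * norm y) * (1/2) ^ k" for k
   using order_trans[OF X(1)[of "r k"] mult_left_mono[OF r[of k], of M]] M by (simp add: mult.assoc)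
  have sg: "summable (\<lambda>k. (M * norm y) * (1/2::real) ^ k)" by (intro summable_mult summable_geometric) simp
  have sm: "summable (\<lambda>k. X (r k))" by (rule summable_comparison_test'[OF sg]) (use nX in simp)
  have part: "S (\<Sum>k<N. X (r k)) = y - r N" for N
  proof (induction N)
   case (Suc N)
   have "r (Suc N) = r N - S (X (r N))" by (simp add: r_def)
   then show ?case using Suc by (simp add: S.add)
  qed (simp add: r_def S.zero)
  have "(\<lambda>N. norm y * (1/2::real) ^ N) \<longlonglongrightarrow> norm y * 0"
   by (intro tendsto_intros LIMSEQ_realpow_zero) auto
  then have "r \<longlonglongrightarrow> 0" using r by (intro Lim_null_comparison[of r "\<lambda>N. norm y * (1/2) ^ N"]) auto
  then have "(\<lambda>N. y - r N) \<longlonglongrightarrow> y - 0" by (intro tendsto_intros)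
  then have "(\<lambda>N. S (\<Sum>k<N. X (r k))) \<longlonglongrightarrow> y" by (simp add: part)
  moreover have "(\<lambda>N. S (\<Sum>k<N. X (r k))) \<longlonglongrightarrow> S (\<Sum>k. X (r k))"
   by (rule S.tendsto[OF summable_LIMSEQ[OF sm]])
  ultimately have "S (\<Sum>k. X (r k)) = y" using LIMSEQ_unique by blast
  then have "inv_into UNIV S y = (\<Sum>k. X (r k))" using bij by (metis bij_inv_eq_iff)
  also have "norm \<dots> \<le> (\<Sum>k. (M * norm y) * (1/2) ^ k)" by (rule norm_suminf_le[OF nX sg])
  also have "\<dots> = norm y * (2 * M)" using suminf_mult[OF summable_geometric[of "1/2::real"], of "M * norm y"] by (simp add: suminf_geometric)
  finally show ?thesis .
 qed
 have lin: "linear (inv_into UNIV S)"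
 proof (rule linearI)
  have SI: "S (inv_into UNIV S x) = x" for x by (rule surj_f_inv_f[OF bij_is_surj[OF bij]])
  show "inv_into UNIV S (x + y) = inv_into UNIV S x + inv_into UNIV S y" "inv_into UNIV S (c *\<^sub>R x) = c *\<^sub>R inv_into UNIV S x" for x y c
   by (rule inv_f_eq[OF bij_is_inj[OF bij]], simp add: S.add S.scaleR SI)+
 qed
 show ?thesis
  by (rule bounded_linear_intro[where K = "2 * M"]) (use bound linear_add[OF lin] linear_scale[OF lin] in auto)
qed

text \<open>Index zero means that a basis \<open>b\<close> of the kernel can be paired with vectors
  \<open>v\<close> that complete the range. With \<open>l\<close> dual to \<open>b\<close>, the
  operator \<open>S u = T u + (\<Sum>i<n. l i u *\<^sub>R v i)\<close> is bijective;
  \<open>Q\<close> is its inverse and \<open>e i\<close> is \<open>Q (v i)\<close>.\<close>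

lemma fredholm_index_zero_perturbation:
 fixes T :: "'a::banach \<Rightarrow> 'b::banach"
 assumes "T \<in> Phi0"
 obtains Q :: "'b \<Rightarrow> 'a" and n :: nat and l :: "nat \<Rightarrow> 'a \<Rightarrow> real" and e :: "nat \<Rightarrow> 'a"
 where "bounded_linear Q" "inj Q" "\<And>i. i < n ==> bounded_linear (l i)" "\<And>u. Q (T u) = u - (\<Sum>i<n. l i u *\<^sub>R e i)"
proof -
 have T: "bounded_linear T" and ind: "dim (null_space T) = codim (range T)"
  using assms by (auto simp: Phi0_def fredholm_def fredholm_index_def)
 interpret T: bounded_linear T by (rule T)
 have lT: "linear T" by (rule T.linear)
 obtain B0 where B0: "finite B0" "null_space T = span B0" using assms by (auto simp: Phi0_def fredholm_def)
 obtain B where B: "B \<subseteq> null_space T" "independent B" "null_space T \<subseteq> span B" "card B = dim (null_space T)"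
  by (rule basis_exists)
 have finB: "finite B"
  using B(1,2) B0 independent_span_bound[of B0 B] by auto
 have nsub: "subspace (null_space T)" unfolding B0(2) by (rule subspace_span)
 have kerB: "T u = 0 \<longleftrightarrow> u \<in> span B" for u
  using B(1,3) span_minimal[OF B(1) nsub] by (auto simp: null_space_def)
 define n where "n = dim (null_space T)"
 have "\<exists>m C. finite C \<and> card C = m \<and> span (range T \<union> C) = UNIV" using assms by (auto simp: Phi0_def fredholm_def)
 then have "\<exists>C. finite C \<and> card C = codim (range T) \<and> span (range T \<union> C) = UNIV"
  unfolding codim_def by (rule LeastI_ex)
 then obtain C where C: "finite C" "card C = n" "span (range T \<union> C) = UNIV" using ind by (auto simp: n_def)
 \<comment> \<open>\<open>C\<close> has the least possible size, so its vectors are independent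
   modulo the range; this will give injectivity of \<open>S\<close>.\<close>
 have Cmin: "v \<notin> span (range T \<union> (C - {v}))" if v: "v \<in> C" for v
 proof
  assume a: "v \<in> span (range T \<union> (C - {v}))"
  have "range T \<union> C \<subseteq> span (range T \<union> (C - {v}))"
  proof
   fix w assume "w \<in> range T \<union> C"
   then show "w \<in> span (range T \<union> (C - {v}))" using a by (cases "w = v") (auto intro: span_base)
  qed
  then have "span (range T \<union> C) \<subseteq> span (range T \<union> (C - {v}))" by (rule span_minimal[OF _ subspace_span])
  then have "span (range T \<union> (C - {v})) = UNIV" unfolding C(3) by (simp add: top.extremum_unique)
  then have "codim (range T) \<le> card (C - {v})" unfolding codim_def using C(1)
   by (intro Least_le exI[of _ "C - {v}"]) simp
  then show False using v C ind card_Diff1_less[of C v] by (simp add: n_def)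
 qed
 obtain b where b: "bij_betw b {..<n} B" using ex_bij_betw_nat_finite[OF finB] B(4) by (auto simp: n_def atLeast0LessThan)
 obtain v where v: "bij_betw v {..<n} C" using ex_bij_betw_nat_finite[OF C(1)] C(2) by (auto simp: atLeast0LessThan)
 obtain d where d: "\<And>c. c \<in> B ==> bounded_linear (d c)" "\<And>c c'. c \<in> B ==> c' \<in> B ==> d c c' = (if c = c' then 1 else (0::real))"
  using dual_functionals[OF finB B(2)] by blast
 define l where "l i = d (b i)" for i
 have bB: "b i \<in> B" if "i < n" for i using b that by (auto simp: bij_betw_def)
 have vC: "v i \<in> C" if "i < n" for i using v that by (auto simp: bij_betw_def)
 have l: "bounded_linear (l i)" if "i < n" for i using d bB that by (simp add: l_def)
 have lb: "l i (b j) = (if i = j then 1 else 0)" if "i < n" "j < n" for i j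
  using d(2)[OF bB bB, of i j] that b by (auto simp: l_def bij_betw_def inj_on_def)
 define S where "S u = T u + (\<Sum>i<n. l i u *\<^sub>R v i)" for u
 have blS: "bounded_linear S" unfolding S_def
  by (intro bounded_linear_add T bounded_linear_sum bounded_linear_scaleR_const l) auto
 interpret S: bounded_linear S by (rule blS)
 have Tb: "T (b i) = 0" if "i < n" for i using kerB[of "b i"] bB[OF that] by (simp add: span_base)
 have lsum: "l i (\<Sum>j<n. a j *\<^sub>R b j) = a i" if "i < n" for i a
 proof -
  interpret li: bounded_linear "l i" by (rule l[OF that])
  have "l i (\<Sum>j<n. a j *\<^sub>R b j) = (\<Sum>j<n. if i = j then a j else 0)"
   unfolding li.sum using that by (intro sum.cong) (auto simp: li.scaleR lb)
  then show ?thesis using that by simp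
 qed
 have Tsum: "T (\<Sum>j<n. a j *\<^sub>R b j) = 0" for a
  unfolding T.sum by (intro sum.neutral) (simp add: T.scaleR Tb)
 have Ssum: "S (\<Sum>j<n. a j *\<^sub>R b j) = (\<Sum>j<n. a j *\<^sub>R v j)" for a
  unfolding S_def Tsum using lsum by simp
 have rsub: "subspace (range T)" using linear_subspace_image[OF lT subspace_UNIV] .
 have "inj S"
 proof (rule linear_injective_0[OF S.linear, THEN iffD2], intro allI impI)
  fix u assume Su: "S u = 0"
  have l0: "l i u = 0" if i: "i < n" for i
  proof (rule ccontr)
   assume ne: "l i u \<noteq> 0"
   have "l i u *\<^sub>R v i = - (T u + (\<Sum>j\<in>{..<n}-{i}. l j u *\<^sub>R v j))"
    using Su i unfolding S_def by (simp add: sum.remove[of "{..<n}" i] eq_neg_iff_add_eq_0 algebra_simps)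
   moreover have "- (T u + (\<Sum>j\<in>{..<n}-{i}. l j u *\<^sub>R v j)) \<in> span (range T \<union> (C - {v i}))"
   proof (intro span_neg span_add span_sum span_scale)
    show "T u \<in> span (range T \<union> (C - {v i}))" by (intro span_base) auto
    fix j assume j: "j \<in> {..<n} - {i}"
    then have "v j \<noteq> v i" using v i by (auto simp: bij_betw_def inj_on_def)
    then show "v j \<in> span (range T \<union> (C - {v i}))" using j vC by (intro span_base) auto
   qed
   ultimately have "(1 / l i u) *\<^sub>R (l i u *\<^sub>R v i) \<in> span (range T \<union> (C - {v i}))" by (metis span_scale)
   then show False using ne Cmin[OF vC[OF i]] by simp
  qed
  then have "T u = 0" using Su by (simp add: S_def)
  then have "u \<in> span (b ` {..<n})" using kerB b by (simp add: bij_betw_def)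
  then obtain a where "u = (\<Sum>x\<in>b ` {..<n}. a x *\<^sub>R x)" by (auto simp: span_finite)
  also have "\<dots> = (\<Sum>j<n. a (b j) *\<^sub>R b j)" using b by (subst sum.reindex) (auto simp: bij_betw_def)
  finally have u: "u = (\<Sum>j<n. a (b j) *\<^sub>R b j)" .
  have "a (b i) = 0" if "i < n" for i using lsum[OF that, of "\<lambda>j. a (b j)"] l0[OF that] u by simp
  then show "u = 0" using u by simp
 qed
 moreover have "surj S"
 proof -
  have "y \<in> range S" for y
  proof -
   have "y \<in> span (range T \<union> C)" using C(3) by simp
   then obtain t w where tw: "t \<in> span (range T)" "w \<in> span C" "y = t + w" by (auto simp: span_Un)
   have "t \<in> range T" using tw(1) rsub by (simp add: span_eq_iff[THEN iffD2])
   then obtain u where u: "t = T u" by blast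
   have "w \<in> span (v ` {..<n})" using tw(2) v by (simp add: bij_betw_def)
   then obtain a where "w = (\<Sum>x\<in>v ` {..<n}. a x *\<^sub>R x)" by (auto simp: span_finite)
   also have "\<dots> = (\<Sum>j<n. a (v j) *\<^sub>R v j)" using v by (subst sum.reindex) (auto simp: bij_betw_def)
   finally have w: "w = (\<Sum>j<n. a (v j) *\<^sub>R v j)" .
   have "S (u - (\<Sum>j<n. l j u *\<^sub>R b j) + (\<Sum>j<n. a (v j) *\<^sub>R b j)) = S u - (\<Sum>j<n. l j u *\<^sub>R v j) + w"
    using Ssum[of "\<lambda>j. l j u"] Ssum[of "\<lambda>j. a (v j)"] w by (simp add: S.add S.diff)
   also have "\<dots> = y" using tw(3) u by (simp add: S_def)
   finally show ?thesis by (metis rangeI)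
  qed
  then show ?thesis by blast
 qed
 ultimately have bijS: "bij S" by (simp add: bij_def)
 have blQ: "bounded_linear (inv_into UNIV S)" by (rule bounded_inverse[OF blS bijS])
 interpret Q: bounded_linear "inv_into UNIV S" by (rule blQ)
 have Qid: "inv_into UNIV S (T u) = u - (\<Sum>i<n. l i u *\<^sub>R inv_into UNIV S (v i))" for u
 proof -
  have "inv_into UNIV S (S u) = u" using bijS by (simp add: bij_is_inj)
  moreover have "S u = T u + (\<Sum>i<n. l i u *\<^sub>R v i)" by (simp add: S_def)
  ultimately have "inv_into UNIV S (T u) + (\<Sum>i<n. l i u *\<^sub>R inv_into UNIV S (v i)) = u"
   by (simp add: Q.add Q.sum Q.scaleR)
  then show ?thesis by (simp add: eq_diff_eq)
 qed
 have Qinj: "inj (inv_into UNIV S)" using bijS by (simp add: bij_imp_bij_inv bij_is_inj)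
 show thesis by (rule that[OF blQ Qinj l Qid])
qed

section \<open>Power series of multilinear maps and their complexification\<close>

definition multilinear_bd :: "nat \<Rightarrow> real \<Rightarrow> ((nat \<Rightarrow> 'a::real_normed_vector) \<Rightarrow> 'b::real_normed_vector) \<Rightarrow> bool" where
 "multilinear_bd n C m \<longleftrightarrow> (\<forall>v w. (\<forall>i<n. v i = w i) --> m v = m w) \<and>
   (\<forall>v. \<forall>i<n. linear (\<lambda>x. m (v(i := x)))) \<and> (\<forall>v. norm (m v) \<le> C * (\<Prod>i<n. norm (v i)))"

lemma multilinear_bdD:
 assumes "multilinear_bd n C m"
 shows "(\<And>i. i < n ==> v i = w i) ==> m v = m w" "i < n ==> linear (\<lambda>x. m (v(i := x)))"
  "norm (m v) \<le> C * (\<Prod>i<n. norm (v i))"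
 using assms unfolding multilinear_bd_def by blast+

lemma sym_multilinear_imp_bd: "sym_multilinear n C m ==> multilinear_bd n C m"
 unfolding sym_multilinear_def multilinear_bd_def by blast

lemma multilinear_bd_nonneg:
 fixes m :: "(nat \<Rightarrow> 'a::real_normed_vector) \<Rightarrow> 'b::real_normed_vector"
 assumes "multilinear_bd n C m"
 shows "multilinear_bd n (max 0 C) m"
proof -
 have "norm (m v) \<le> max 0 C * (\<Prod>i<n. norm (v i))" for v
  by (rule order_trans[OF multilinear_bdD(3)[OF assms]]) (intro mult_right_mono prod_nonneg, auto)
 then show ?thesis using assms unfolding multilinear_bd_def by blast
qed

text \<open>The arguments are exchanged one slot at a time.\<close>

lemma multilinear_telescope:
 assumes m: "multilinear_bd n C m"
 shows "m v - m w = (\<Sum>j<n. m (\<lambda>i. if i < j then v i else if i = j then v j - w j else w i))"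
proof -
 define f where "f j = m (\<lambda>i. if i < j then v i else w i)" for j
 have "f (Suc j) - f j = m (\<lambda>i. if i < j then v i else if i = j then v j - w j else w i)" if j: "j < n" for j
 proof -
  let ?u = "\<lambda>i. if i < j then v i else w i"
  have lin: "linear (\<lambda>x. m (?u(j := x)))" by (rule multilinear_bdD(2)[OF m j])
  have A: "f (Suc j) = m (?u(j := v j))" unfolding f_def by (rule arg_cong[where f = m]) (auto simp: fun_eq_iff)
  have B: "f j = m (?u(j := w j))" unfolding f_def by (rule arg_cong[where f = m]) (auto simp: fun_eq_iff)
  have C: "m (\<lambda>i. if i < j then v i else if i = j then v j - w j else w i) = m (?u(j := v j - w j))"
   by (rule arg_cong[where f = m]) (auto simp: fun_eq_iff)
  show ?thesis unfolding A B C by (rule linear_diff[OF lin, symmetric])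
 qed
 then have "(\<Sum>j<n. m (\<lambda>i. if i < j then v i else if i = j then v j - w j else w i)) = (\<Sum>j<n. f (Suc j) - f j)"
  by (intro sum.cong) auto
 also have "\<dots> = f n - f 0" by (rule sum_lessThan_telescope)
 also have "f n = m v" unfolding f_def by (rule multilinear_bdD(1)[OF m]) simp
 finally show ?thesis by (simp add: f_def)
qed

lemma prod_one_slot_le:
 fixes f :: "nat \<Rightarrow> real"
 assumes "j < n" "\<And>i. i < n ==> 0 \<le> f i" "\<And>i. i < n ==> i \<noteq> j ==> f i \<le> R"
 shows "(\<Prod>i<n. f i) \<le> f j * R ^ (n - 1)"
proof -
 have "(\<Prod>i<n. f i) = f j * (\<Prod>i\<in>{..<n}-{j}. f i)" using assms(1) by (intro prod.remove) auto
 also have "(\<Prod>i\<in>{..<n}-{j}. f i) \<le> (\<Prod>i\<in>{..<n}-{j}. R)" using assms by (intro prod_mono) auto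
 also have "\<dots> = R ^ (n - 1)" using assms(1) by simp
 finally show ?thesis using assms(1,2) by (simp add: mult_left_mono)
qed

lemma multilinear_Lipschitz:
 assumes m: "multilinear_bd n C m" and C: "0 \<le> C" and v: "\<And>i. i < n ==> norm (v i) \<le> R" "\<And>i. i < n ==> norm (w i) \<le> R"
 shows "norm (m v - m w) \<le> C * R ^ (n - 1) * (\<Sum>j<n. norm (v j - w j))"
proof -
 have "norm (m (\<lambda>i. if i < j then v i else if i = j then v j - w j else w i)) \<le> C * (norm (v j - w j) * R ^ (n - 1))"
  if j: "j < n" for j
 proof -
  let ?u = "\<lambda>i. if i < j then v i else if i = j then v j - w j else w i"
  have "norm (m ?u) \<le> C * (\<Prod>i<n. norm (?u i))" by (rule multilinear_bdD(3)[OF m])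
  also have "(\<Prod>i<n. norm (?u i)) \<le> norm (?u j) * R ^ (n - 1)" by (rule prod_one_slot_le[OF j]) (use v in auto)
  finally show ?thesis using C by (simp add: mult_left_mono)
 qed
 then have "norm (m v - m w) \<le> (\<Sum>j<n. C * (norm (v j - w j) * R ^ (n - 1)))"
  unfolding multilinear_telescope[OF m] by (intro sum_norm_le) auto
 also have "\<dots> = C * R ^ (n - 1) * (\<Sum>j<n. norm (v j - w j))" by (simp add: sum_distrib_left mult_ac)
 finally show ?thesis .
qed

text \<open>Telescoping writes the increment as a sum of terms with \<open>h\<close> in slot
  \<open>j\<close>, \<open>y\<close> before and \<open>x\<close> after it. Replacing
  \<open>y\<close> by \<open>x\<close> costs a second factor \<open>norm h\<close>, so the error is
  quadratic.\<close>

lemma multilinear_diag_derivative: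
 fixes m :: "(nat \<Rightarrow> 'a::real_normed_vector) \<Rightarrow> 'b::real_normed_vector"
 assumes m: "multilinear_bd n C m" and C: "0 \<le> C"
 shows "((\<lambda>x. m (\<lambda>_. x)) has_derivative (\<lambda>h. \<Sum>j<n. m ((\<lambda>_. x)(j := h)))) (at x)"
proof -
 have bl: "bounded_linear (\<lambda>h. m ((\<lambda>_. x)(j := h)))" if j: "j < n" for j
 proof -
  have lin: "linear (\<lambda>h. m ((\<lambda>_. x)(j := h)))" by (rule multilinear_bdD(2)[OF m j])
  have "norm (m ((\<lambda>_. x)(j := h))) \<le> norm h * (C * norm x ^ (n - 1))" for h
  proof -
   have "norm (m ((\<lambda>_. x)(j := h))) \<le> C * (\<Prod>i<n. norm (((\<lambda>_. x)(j := h)) i))" by (rule multilinear_bdD(3)[OF m])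
   also have "(\<Prod>i<n. norm (((\<lambda>_. x)(j := h)) i)) \<le> norm (((\<lambda>_. x)(j := h)) j) * norm x ^ (n - 1)"
    by (rule prod_one_slot_le[OF j]) auto
   finally have "norm (m ((\<lambda>_. x)(j := h))) \<le> C * (norm h * norm x ^ (n - 1))" using C by (simp add: mult_left_mono)
   then show ?thesis by (simp add: mult_ac)
  qed
  then show ?thesis using linear_add[OF lin] linear_scale[OF lin] by (intro bounded_linear_intro)
 qed
 define R where "R = norm x + 1"
 define K where "K = real n * (C * R ^ (n - 1) * real n)"
 have R: "1 \<le> R" by (simp add: R_def)
 have K: "0 \<le> K" using C R by (simp add: K_def)
 have est: "norm (m (\<lambda>_. y) - m (\<lambda>_. x) - (\<Sum>j<n. m ((\<lambda>_. x)(j := y - x)))) \<le> K * norm (y - x) * norm (y - x)"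
  if y: "norm (y - x) \<le> 1" for y
 proof -
  define h where "h = y - x"
  have yR: "norm y \<le> R" "norm x \<le> R" using norm_triangle_ineq[of x "y - x"] y by (auto simp: R_def)
  have *: "norm (m (\<lambda>i. if i < j then y else if i = j then h else x) - m ((\<lambda>_. x)(j := h))) \<le> C * R ^ (n - 1) * real n * norm h * norm h"
   if j: "j < n" for j
  proof (cases "h = 0")
   case True
   have "m ((\<lambda>i. if i < j then y else x)(j := 0)) = 0" "m ((\<lambda>_. x)(j := 0)) = 0"
    using linear_0[OF multilinear_bdD(2)[OF m j]] by blast+
   moreover have "(\<lambda>i. if i < j then y else if i = j then h else x) = (\<lambda>i. if i < j then y else x)(j := 0)"
    using True by auto
   ultimately show ?thesis using True by simp
  next
   case False
   \<comment> \<open>The slot of \<open>h\<close> is normalised, so that its length is extracted as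
     a factor and all arguments stay within the bound \<open>R \<ge> 1\<close> of the Lipschitz
     estimate.\<close>
   define e where "e = (1 / norm h) *\<^sub>R h"
   have he: "h = norm h *\<^sub>R e" "norm e = 1" using False by (auto simp: e_def)
   let ?a = "\<lambda>i. if i < j then y else if i = j then e else x"
   let ?b = "(\<lambda>_. x)(j := e)"
   have 1: "m (\<lambda>i. if i < j then y else if i = j then h else x) = norm h *\<^sub>R m ?a"
   proof -
    have A: "(\<lambda>i. if i < j then y else if i = j then h else x) = (\<lambda>i. if i < j then y else x)(j := norm h *\<^sub>R e)"
     by (simp add: he(1)[symmetric] fun_eq_iff)
    have B: "?a = (\<lambda>i. if i < j then y else x)(j := e)" by (simp add: fun_eq_iff)
    show ?thesis unfolding A B by (rule linear_scale[OF multilinear_bdD(2)[OF m j]])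
   qed
   have 2: "m ((\<lambda>_. x)(j := h)) = norm h *\<^sub>R m ?b"
    using linear_scale[OF multilinear_bdD(2)[OF m j], of "\<lambda>_. x" "norm h" e] unfolding he(1)[symmetric] .
   have "norm (m ?a - m ?b) \<le> C * R ^ (n - 1) * (\<Sum>i<n. norm (?a i - ?b i))"
    by (rule multilinear_Lipschitz[OF m C]) (use yR R he in auto)
   also have "\<dots> \<le> C * R ^ (n - 1) * (\<Sum>i<n. norm h)"
    using C R by (intro mult_left_mono sum_mono) (auto simp: h_def)
   finally have "norm (m ?a - m ?b) \<le> C * R ^ (n - 1) * (real n * norm h)" by simp
   then have "norm h * norm (m ?a - m ?b) \<le> norm h * (C * R ^ (n - 1) * (real n * norm h))" by (intro mult_left_mono) auto
   then show ?thesis unfolding 1 2 scaleR_diff_right[symmetric] by (simp add: mult_ac)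
  qed
  have "m (\<lambda>_. y) - m (\<lambda>_. x) - (\<Sum>j<n. m ((\<lambda>_. x)(j := h))) =
    (\<Sum>j<n. m (\<lambda>i. if i < j then y else if i = j then h else x) - m ((\<lambda>_. x)(j := h)))"
   using multilinear_telescope[OF m, of "\<lambda>_. y" "\<lambda>_. x"] by (simp only: sum_subtractf h_def)
  also have "norm \<dots> \<le> (\<Sum>j<n. C * R ^ (n - 1) * real n * norm h * norm h)" using * by (intro sum_norm_le) auto
  also have "\<dots> = K * norm h * norm h" by (simp add: K_def)
  finally show ?thesis by (simp add: h_def)
 qed
 show ?thesis unfolding has_derivative_within_alt
 proof (intro conjI allI impI)
  show "bounded_linear (\<lambda>h. \<Sum>j<n. m ((\<lambda>_. x)(j := h)))" by (intro bounded_linear_sum bl) auto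
  fix e :: real assume e: "0 < e"
  define d where "d = min 1 (e / (K + 1))"
  have d: "0 < d" using e K by (simp add: d_def)
  have "norm (m (\<lambda>_. y) - m (\<lambda>_. x) - (\<Sum>j<n. m ((\<lambda>_. x)(j := y - x)))) \<le> e * norm (y - x)" if "norm (y - x) < d" for y
  proof -
   have "norm (y - x) \<le> 1" "norm (y - x) \<le> e / (K + 1)" using that by (auto simp: d_def)
   then have "(K + 1) * norm (y - x) \<le> e" using K by (simp add: pos_le_divide_eq mult.commute)
   then have "K * norm (y - x) \<le> e" using norm_ge_zero[of "y - x"] by (simp only: distrib_right)
   then have "K * norm (y - x) * norm (y - x) \<le> e * norm (y - x)" by (intro mult_right_mono) auto
   then show ?thesis by (rule order_trans[OF est[OF \<open>norm (y - x) \<le> 1\<close>]])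
  qed
  then show "\<exists>d>0. \<forall>y\<in>UNIV. norm (y - x) < d --> norm (m (\<lambda>_. y) - m (\<lambda>_. x) - (\<Sum>j<n. m ((\<lambda>_. x)(j := y - x)))) \<le> e * norm (y - x)"
   using d by blast
 qed
qed

text \<open>On a quarter of the radius the term derivatives are dominated by multiples of
  \<open>n * (1/4) ^ n\<close>, so the series may be differentiated term by term. Terms of degree at
  least 2 carry a factor \<open>norm x\<close>, which gives the last estimate.\<close>

lemma multilinear_series_derivative:
 fixes m :: "nat \<Rightarrow> (nat \<Rightarrow> 'a::real_normed_vector) \<Rightarrow> 'b::banach"
 assumes m: "\<And>n. multilinear_bd n (C n) (m n)" and r: "0 < r" and K: "\<And>n. C n * r ^ n \<le> K"
 defines "\<rho> \<equiv> r / 4"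
 obtains G D M where "\<And>x. norm x < \<rho> ==> (\<lambda>n. m n (\<lambda>_. x)) sums G x"
  "\<And>x. norm x < \<rho> ==> (G has_derivative D x) (at x)"
  "\<And>x h. norm x < \<rho> ==> (\<lambda>n. \<Sum>j<n. m n ((\<lambda>_. x)(j := h))) sums D x h"
  "\<And>x h. norm x < \<rho> ==> norm (D x h - m 1 (\<lambda>_. h)) \<le> M * norm x * norm h"
proof -
 define C' where "C' n = max 0 (C n)" for n
 have C0: "0 \<le> C' n" for n by (simp add: C'_def)
 have m': "multilinear_bd n (C' n) (m n)" for n using multilinear_bd_nonneg[OF m] by (simp add: C'_def)
 obtain K' where K': "0 \<le> K'" "\<And>n. \<forall>v. norm (m n v) \<le> K' / r ^ n * (\<Prod>i<n. norm (v i))"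
 proof
  show "0 \<le> \<bar>K\<bar>" by simp
  have "norm (m n v) \<le> \<bar>K\<bar> / r ^ n * (\<Prod>i<n. norm (v i))" for n v
  proof -
   have "C n \<le> \<bar>K\<bar> / r ^ n" using K[of n] r by (simp add: pos_le_divide_eq)
   then have "C n * (\<Prod>i<n. norm (v i)) \<le> \<bar>K\<bar> / r ^ n * (\<Prod>i<n. norm (v i))" by (intro mult_right_mono prod_nonneg) auto
   then show ?thesis using multilinear_bdD(3)[OF m, of n v] by linarith
  qed
  then show "\<forall>v. norm (m n v) \<le> \<bar>K\<bar> / r ^ n * (\<Prod>i<n. norm (v i))" for n by blast
 qed
 define f' where "f' n x h = (\<Sum>j<n. m n ((\<lambda>_. x)(j := h)))" for n x h
 have f'_le: "norm (f' n x h) \<le> real n * (K' / r ^ n * s ^ (n - 1)) * norm h" if "norm x \<le> s" for n x h s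
 proof -
  have s: "0 \<le> s" using that norm_ge_zero[of x] by linarith
  have "norm (m n ((\<lambda>_. x)(j := h))) \<le> K' / r ^ n * s ^ (n - 1) * norm h" if j: "j < n" for j
  proof -
   have "norm (m n ((\<lambda>_. x)(j := h))) \<le> K' / r ^ n * (\<Prod>i<n. norm (((\<lambda>_. x)(j := h)) i))" using K'(2) by blast
   also have "(\<Prod>i<n. norm (((\<lambda>_. x)(j := h)) i)) \<le> norm (((\<lambda>_. x)(j := h)) j) * s ^ (n - 1)"
    by (rule prod_one_slot_le[OF j]) (use \<open>norm x \<le> s\<close> in auto)
   finally have "norm (m n ((\<lambda>_. x)(j := h))) \<le> K' / r ^ n * (norm h * s ^ (n - 1))" using K'(1) r
    by (simp add: mult_left_mono divide_right_mono)
   then show ?thesis by (simp add: mult_ac)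
  qed
  then have "norm (f' n x h) \<le> (\<Sum>j<n. K' / r ^ n * s ^ (n - 1) * norm h)" unfolding f'_def by (intro sum_norm_le) auto
  then show ?thesis by (simp add: mult_ac)
 qed
 \<comment> \<open>\<open>(\<rho> / r) ^ n = (1/4) ^ n\<close>; the division by
   \<open>\<rho>\<close> is due to the derivative having one factor less.\<close>
 define b where "b n = (K' / \<rho>) * (real n * (1/4) ^ n)" for n
 have rho: "0 < \<rho>" using r by (simp add: \<rho>_def)
 have f'_b: "norm (f' n x h) \<le> b n * norm h" if "norm x \<le> \<rho>" for n x h
 proof (cases n)
  case 0 then show ?thesis by (simp add: f'_def b_def)
 next
  case (Suc k)
  have "(1/4) ^ n = \<rho> ^ n / r ^ n" using r by (simp add: \<rho>_def power_divide)
  then have "real n * (K' / r ^ n * \<rho> ^ (n - 1)) = b n" using Suc r rho by (simp add: b_def field_simps)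
  then show ?thesis using f'_le[OF that, of n h] by simp
 qed
 have b0: "0 \<le> b n" for n using K'(1) rho by (simp add: b_def)
 have sgeo: "summable (\<lambda>n. real n * (1/4) ^ n)"
 proof (rule summable_comparison_test'[of "\<lambda>n. (1/2::real) ^ n" 0])
  show "summable (\<lambda>n. (1/2::real) ^ n)" by (rule summable_geometric) simp
  fix n :: nat
  have "real n \<le> 2 ^ n" using of_nat_less_two_power[of n, where 'a=real] by linarith
  then have "real n * (1/4) ^ n \<le> 2 ^ n * (1/4) ^ n" by (intro mult_right_mono) auto
  also have "\<dots> = (1/2) ^ n" by (simp add: power_mult_distrib[symmetric])
  finally show "norm (real n * (1/4) ^ n) \<le> (1/2::real) ^ n" by simp
 qed
 have sb: "summable b" unfolding b_def by (intro summable_mult sgeo)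
 have sf': "summable (\<lambda>n. f' n x h)" if "norm x < \<rho>" for x h
  by (rule summable_comparison_test'[of "\<lambda>n. b n * norm h" 0])
   (use f'_b that in \<open>auto intro!: summable_mult2 sb simp: less_imp_le\<close>)
 define D where "D x h = (\<Sum>n. f' n x h)" for x h
 have tail: "norm ((\<Sum>n<N. f' n x h) - D x h) \<le> (\<Sum>n. b (n + N)) * norm h" if x: "norm x < \<rho>" for N x h
 proof -
  have "D x h = (\<Sum>n. f' (n + N) x h) + (\<Sum>n<N. f' n x h)"
   unfolding D_def by (rule suminf_split_initial_segment[OF sf'[OF x]])
  then have "norm ((\<Sum>n<N. f' n x h) - D x h) = norm (\<Sum>n. f' (n + N) x h)" by simp
  also have "\<dots> \<le> (\<Sum>n. b (n + N) * norm h)"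
  proof (rule norm_suminf_le)
   show "summable (\<lambda>n. b (n + N) * norm h)" by (intro summable_mult2 summable_ignore_initial_segment sb)
   show "norm (f' (n + N) x h) \<le> b (n + N) * norm h" for n using f'_b x by simp
  qed
  also have "\<dots> = (\<Sum>n. b (n + N)) * norm h" by (intro suminf_mult2[symmetric] summable_ignore_initial_segment sb)
  finally show ?thesis .
 qed
 have unif: "\<forall>\<^sub>F N in sequentially. \<forall>x\<in>ball 0 \<rho>. \<forall>h. norm ((\<Sum>n<N. f' n x h) - D x h) \<le> e * norm h" if e: "0 < e" for e
 proof -
  obtain N0 where N0: "\<forall>N\<ge>N0. norm (\<Sum>n. b (n + N)) < e" using suminf_exist_split[OF e sb] by blast
  have le: "(\<Sum>n. b (n + N)) \<le> e" if "N \<ge> N0" for N using N0 using that by (fastforce simp: abs_less_iff)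
  show ?thesis
  proof (rule eventually_sequentiallyI[of N0], intro ballI allI)
   fix N and x h :: 'a assume N: "N \<ge> N0" and x: "x \<in> ball 0 \<rho>"
   have "norm ((\<Sum>n<N. f' n x h) - D x h) \<le> (\<Sum>n. b (n + N)) * norm h" using x by (intro tail) simp
   also have "\<dots> \<le> e * norm h" by (rule mult_right_mono[OF le[OF N] norm_ge_zero])
   finally show "norm ((\<Sum>n<N. f' n x h) - D x h) \<le> e * norm h" .
  qed
 qed
 have sum0: "(\<lambda>n. m n (\<lambda>_. 0)) sums m 0 (\<lambda>_. 0)"
 proof -
  have "m n (\<lambda>_. 0) = 0" if "n \<noteq> 0" for n
  proof -
   have "norm (m n (\<lambda>_. 0)) \<le> K' / r ^ n * (\<Prod>i<n. norm (0::'a))" by (rule K'(2)[THEN spec])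
   then show ?thesis using that by (simp add: power_0_left)
  qed
  then show ?thesis using sums_finite[of "{0}" "\<lambda>n. m n (\<lambda>_. 0)"] by simp
 qed
 obtain G where G: "\<And>x. x \<in> ball 0 \<rho> ==> (\<lambda>n. m n (\<lambda>_. x)) sums G x \<and> (G has_derivative D x) (at x within ball 0 \<rho>)"
 proof -
  have "\<exists>g. \<forall>x\<in>ball 0 \<rho>. (\<lambda>n. m n (\<lambda>_. x)) sums g x \<and> (g has_derivative D x) (at x within ball 0 \<rho>)"
  proof (rule has_derivative_series[OF convex_ball _ unif])
   fix n x
   show "((\<lambda>x. m n (\<lambda>_. x)) has_derivative f' n x) (at x within ball 0 \<rho>)"
    using has_derivative_at_withinI[OF multilinear_diag_derivative[OF m' C0]] unfolding f'_def .
  qed (use sum0 rho in auto)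
  then show thesis using that by blast
 qed
 show thesis
 proof
  fix x :: 'a assume x: "norm x < \<rho>"
  then have xb: "x \<in> ball 0 \<rho>" by simp
  show "(\<lambda>n. m n (\<lambda>_. x)) sums G x" using G[OF xb] by blast
  show "(G has_derivative D x) (at x)" using G[OF xb] at_within_open[OF xb open_ball] by simp
  fix h
  show "(\<lambda>n. \<Sum>j<n. m n ((\<lambda>_. x)(j := h))) sums D x h"
   using summable_sums[OF sf'[OF x, of h]] unfolding D_def f'_def .
  have f1: "f' (Suc 0) x h = m 1 (\<lambda>_. h)"
  proof -
   have "m (Suc 0) ((\<lambda>_. x)(0 := h)) = m (Suc 0) (\<lambda>_. h)" by (rule multilinear_bdD(1)[OF m]) simp
   then show ?thesis by (simp add: f'_def)
  qed
  have sf2: "summable (\<lambda>n. f' (n + 2) x h)" by (rule summable_ignore_initial_segment[OF sf'[OF x]])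
  have "D x h = (\<Sum>n. f' (n + 2) x h) + (\<Sum>n<2. f' n x h)"
   unfolding D_def by (rule suminf_split_initial_segment[OF sf'[OF x]])
  also have "(\<Sum>n<2. f' n x h) = m 1 (\<lambda>_. h)" using f1 by (simp add: numeral_2_eq_2 f'_def)
  finally have "norm (D x h - m 1 (\<lambda>_. h)) = norm (\<Sum>n. f' (n + 2) x h)" by simp
  also have "\<dots> \<le> (\<Sum>n. b (n + 2) * (norm x * norm h / \<rho>))"
  proof (rule norm_suminf_le)
   show "summable (\<lambda>n. b (n + 2) * (norm x * norm h / \<rho>))" by (intro summable_mult2 summable_ignore_initial_segment sb)
   fix n
   have pw: "norm x ^ (n + 2 - 1) \<le> \<rho> ^ n * norm x"
   proof -
    have "norm x ^ n * norm x \<le> \<rho> ^ n * norm x" using x by (intro mult_right_mono power_mono) auto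
    then show ?thesis by (simp add: mult.commute)
   qed
   have "norm (f' (n + 2) x h) \<le> real (n + 2) * (K' / r ^ (n + 2) * norm x ^ (n + 2 - 1)) * norm h" by (rule f'_le) simp
   also have "\<dots> \<le> real (n + 2) * (K' / r ^ (n + 2) * (\<rho> ^ n * norm x)) * norm h"
    using K'(1) r pw by (intro mult_right_mono mult_left_mono) auto
   also have "\<dots> = b (n + 2) * (norm x * norm h / \<rho>)"
   proof -
    have "(1/4) ^ (n + 2) = \<rho> ^ (n + 2) / r ^ (n + 2)" using r by (simp add: \<rho>_def power_divide)
    moreover have "\<rho> ^ (n + 2) = \<rho> ^ n * \<rho> * \<rho>" by simp
    ultimately have "b (n + 2) = K' / \<rho> * (real (n + 2) * (\<rho> ^ n * \<rho> * \<rho> / r ^ (n + 2)))" unfolding b_def by simp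
    then show ?thesis using rho by (simp del: power_Suc power_add of_nat_add)
   qed
   finally show "norm (f' (n + 2) x h) \<le> b (n + 2) * (norm x * norm h / \<rho>)" .
  qed
  also have "\<dots> = (\<Sum>n. b (n + 2)) * (norm x * norm h / \<rho>)" by (intro suminf_mult2[symmetric] summable_ignore_initial_segment sb)
  also have "\<dots> = (\<Sum>n. b (n + 2)) / \<rho> * norm x * norm h" by simp
  finally show "norm (D x h - m 1 (\<lambda>_. h)) \<le> (\<Sum>n. b (n + 2)) / \<rho> * norm x * norm h" .
 qed
qed

text \<open>The complexification of a real space is the product of two copies, with multiplication by the
 imaginary unit given by \<open>imult\<close>.\<close>

definition imult :: "'a::real_normed_vector \<times> 'a \<Rightarrow> 'a \<times> 'a" where
 "imult w = (- snd w, fst w)"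

lemma bounded_linear_imult: "bounded_linear imult"
 unfolding imult_def[abs_def]
 by (intro bounded_linear_Pair bounded_linear_minus bounded_linear_fst bounded_linear_snd)

lemma linear_imult: "linear imult" by (rule bounded_linear.linear[OF bounded_linear_imult])

lemma imult_imult: "imult (imult w) = - w" by (simp add: imult_def prod_eq_iff)

lemma fst_imult: "fst (imult w) = - snd w" and snd_imult: "snd (imult w) = fst w" by (simp_all add: imult_def)

lemma norm_imult: "norm (imult w) = norm w" by (cases w) (simp add: imult_def norm_Pair add.commute)

text \<open>Slots below \<open>k\<close> are still to be read from the complex arguments
  \<open>w\<close>, the others have real arguments in \<open>v\<close>. Resolving slot
  \<open>k\<close> into real and imaginary part expands the complex multilinear extension.\<close>

primrec complexify :: "nat \<Rightarrow> ((nat \<Rightarrow> 'a::real_normed_vector) \<Rightarrow> 'b::real_normed_vector) \<Rightarrow> (nat \<Rightarrow> 'a \<times> 'a) \<Rightarrow> (nat \<Rightarrow> 'a) \<Rightarrow> 'b \<times> 'b" where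
 "complexify 0 m w v = (m v, 0)"
| "complexify (Suc k) m w v = complexify k m w (v(k := fst (w k))) + imult (complexify k m w (v(k := snd (w k))))"

lemma complexify_cong:
 assumes m: "multilinear_bd n C m"
 shows "(\<And>i. i < k ==> w i = w' i) ==> (\<And>i. k \<le> i ==> i < n ==> v i = v' i) ==> complexify k m w v = complexify k m w' v'"
proof (induction k arbitrary: v v')
 case 0 then show ?case using multilinear_bdD(1)[OF m, of v v'] by simp
next
 case (Suc k)
 have "complexify k m w (v(k := a)) = complexify k m w' (v'(k := a))" for a
  by (rule Suc.IH) (use Suc.prems in auto)
 then show ?case using Suc.prems(1)[of k] by simp
qed

lemma complexify_linear_arg:
 assumes m: "multilinear_bd n C m" and i: "i < n"
 shows "k \<le> i ==> linear (\<lambda>x. complexify k m w (v(i := x)))"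
proof (induction k arbitrary: v)
 case 0
 have lin: "linear (\<lambda>x. m (v(i := x)))" by (rule multilinear_bdD(2)[OF m i])
 show ?case unfolding complexify.simps by (rule linearI) (simp_all add: linear_add[OF lin] linear_scale[OF lin])
next
 case (Suc k)
 have tw: "(v(i := x))(k := a) = (v(k := a))(i := x)" for x a using Suc.prems by (simp add: fun_upd_twist)
 have 1: "linear (\<lambda>x. complexify k m w ((v(k := a))(i := x)))" for a by (rule Suc.IH) (use Suc.prems in simp)
 show ?case unfolding complexify.simps tw
  by (intro linear_compose_add 1 linear_compose[OF 1 linear_imult, unfolded o_def])
qed

lemma complexify_slot:
 assumes m: "multilinear_bd n C m" and j: "j < k" "k \<le> n"
 shows "linear (\<lambda>x. complexify k m (w(j := x)) v) \<and> complexify k m (w(j := imult y)) v = imult (complexify k m (w(j := y)) v)"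
 using j
proof (induction k arbitrary: v)
 case (Suc k)
 show ?case
 proof (cases "j = k")
  case True
  have c: "complexify k m (w(j := x)) u = complexify k m w u" for x u
   by (rule complexify_cong[OF m]) (use True in auto)
  have lin: "linear (\<lambda>x. complexify k m w (v(k := x)))" using Suc.prems by (intro complexify_linear_arg[OF m]) auto
  have l1: "linear (\<lambda>x. complexify k m w (v(k := fst x)))" "linear (\<lambda>x. complexify k m w (v(k := snd x)))"
   using linear_compose[OF linear_fst lin] linear_compose[OF linear_snd lin] by (simp_all add: o_def)
  have e: "complexify (Suc k) m (w(j := x)) v = complexify k m w (v(k := fst x)) + imult (complexify k m w (v(k := snd x)))" for x
   unfolding complexify.simps c using True by (simp only: fun_upd_same)
  have "linear (\<lambda>x. complexify (Suc k) m (w(j := x)) v)"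
   unfolding e by (intro linear_compose_add l1 linear_compose[OF l1(2) linear_imult, unfolded o_def])
  moreover have "complexify (Suc k) m (w(j := imult y)) v = imult (complexify (Suc k) m (w(j := y)) v)"
   unfolding e fst_imult snd_imult linear_neg[OF lin] linear_add[OF linear_imult] imult_imult by simp
  ultimately show ?thesis by blast
 next
  case False
  then have jk: "j < k" "k \<le> n" using Suc.prems by auto
  have IH: "linear (\<lambda>x. complexify k m (w(j := x)) u)" "complexify k m (w(j := imult y)) u = imult (complexify k m (w(j := y)) u)" for u
   using Suc.IH[OF jk] by blast+
  have e: "complexify (Suc k) m (w(j := x)) v =
    complexify k m (w(j := x)) (v(k := fst (w k))) + imult (complexify k m (w(j := x)) (v(k := snd (w k))))" for x
   unfolding complexify.simps using False by (simp only: fun_upd_other not_sym[of j k] simp_thms)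
  have "linear (\<lambda>x. complexify (Suc k) m (w(j := x)) v)"
   unfolding e by (intro linear_compose_add IH(1) linear_compose[OF IH(1) linear_imult, unfolded o_def])
  moreover have "complexify (Suc k) m (w(j := imult y)) v = imult (complexify (Suc k) m (w(j := y)) v)"
   unfolding e IH(2) linear_add[OF linear_imult] ..
  ultimately show ?thesis by blast
 qed
qed simp

text \<open>Every slot resolved doubles the number of terms.\<close>

lemma complexify_norm:
 assumes m: "multilinear_bd n C m" and C: "0 \<le> C"
 shows "norm (complexify k m w v) \<le> 2 ^ k * C * (\<Prod>i<n. if i < k then norm (w i) else norm (v i))"
proof (induction k arbitrary: v)
 case 0 then show ?case using multilinear_bdD(3)[OF m, of v] by (simp add: norm_Pair)
next
 case (Suc k)
 let ?P = "\<Prod>i<n. if i < Suc k then norm (w i) else norm (v i)"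
 have *: "norm (complexify k m w (v(k := a))) \<le> 2 ^ k * C * ?P" if a: "norm a \<le> norm (w k)" for a
 proof -
  have "norm (complexify k m w (v(k := a))) \<le> 2 ^ k * C * (\<Prod>i<n. if i < k then norm (w i) else norm ((v(k := a)) i))"
   by (rule Suc.IH)
  also have "\<dots> \<le> 2 ^ k * C * ?P"
   using C a by (intro mult_left_mono prod_mono) (auto simp: less_Suc_eq)
  finally show ?thesis .
 qed
 have "norm (fst (w k)) \<le> norm (w k)" "norm (snd (w k)) \<le> norm (w k)"
  by (cases "w k", simp add: norm_fst_le norm_snd_le)+
 from *[OF this(1)] *[OF this(2)] show ?case
  unfolding complexify.simps
  using norm_triangle_ineq[of "complexify k m w (v(k := fst (w k)))" "imult (complexify k m w (v(k := snd (w k))))"]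
  by (simp add: norm_imult)
qed

lemma complexify_real:
 assumes m: "multilinear_bd n C m"
 shows "k \<le> n ==> complexify k m (\<lambda>i. (u i, 0)) v = (m (\<lambda>i. if i < k then u i else v i), 0)"
proof (induction k arbitrary: v)
 case (Suc k)
 have 1: "m (\<lambda>i. if i < k then u i else (v(k := a)) i) = m ((\<lambda>i. if i < Suc k then u i else v i)(k := a))" for a
  by (rule arg_cong[where f = m]) auto
 have "m ((\<lambda>i. if i < Suc k then u i else v i)(k := 0)) = 0"
  using linear_0[OF multilinear_bdD(2)[OF m, of k]] Suc.prems by simp
 moreover have "(\<lambda>i. if i < Suc k then u i else v i)(k := u k) = (\<lambda>i. if i < Suc k then u i else v i)" by auto
 ultimately show ?case using Suc by (simp only: complexify.simps 1 fst_conv snd_conv Suc_leD) (simp add: imult_def)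
qed simp

definition cplx :: "nat \<Rightarrow> ((nat \<Rightarrow> 'a::real_normed_vector) \<Rightarrow> 'b::real_normed_vector) \<Rightarrow> (nat \<Rightarrow> 'a \<times> 'a) \<Rightarrow> 'b \<times> 'b" where
 "cplx n m w = complexify n m w (\<lambda>_. 0)"

lemma multilinear_bd_cplx:
 assumes m: "multilinear_bd n C m" and C: "0 \<le> C"
 shows "multilinear_bd n (2 ^ n * C) (cplx n m)"
 unfolding multilinear_bd_def
proof (intro conjI allI impI)
 show "cplx n m v = cplx n m w" if "\<forall>i<n. v i = w i" for v w
  unfolding cplx_def by (rule complexify_cong[OF m]) (use that in auto)
 show "linear (\<lambda>x. cplx n m (v(i := x)))" if "i < n" for v i
  unfolding cplx_def using complexify_slot[OF m that] by blast
 fix w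
 have "norm (cplx n m w) \<le> 2 ^ n * C * (\<Prod>i<n. if i < n then norm (w i) else norm (0::'a))"
  unfolding cplx_def by (rule complexify_norm[OF m C])
 also have "(\<Prod>i<n. if i < n then norm (w i) else norm (0::'a)) = (\<Prod>i<n. norm (w i))" by (intro prod.cong) auto
 finally show "norm (cplx n m w) \<le> 2 ^ n * C * (\<Prod>i<n. norm (w i))" .
qed

text \<open>The bounds \<open>2 ^ n\<close> of complexification cost half of the radius and
  differentiation term by term a further quarter, hence \<open>r / 8\<close>. Commutation with
  \<open>imult\<close> makes the derivative complex linear.\<close>

lemma complexified_series:
 fixes m :: "nat \<Rightarrow> (nat \<Rightarrow> 'a::real_normed_vector) \<Rightarrow> 'b::banach"
 assumes m: "\<And>n. multilinear_bd n (C n) (m n)" and r: "0 < r" and K: "\<And>n. C n * r ^ n \<le> K"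
  and f: "\<And>h. norm h < r ==> (\<lambda>n. m n (\<lambda>_. h)) sums f h"
 obtains \<rho> M and G :: "'a \<times> 'a \<Rightarrow> 'b \<times> 'b" and D where "0 < \<rho>" "\<rho> \<le> r"
  "\<And>h. norm h < \<rho> ==> G (h, 0) = (f h, 0)"
  "\<And>x. norm x < \<rho> ==> (G has_derivative D x) (at x)"
  "\<And>x h. norm x < \<rho> ==> D x (imult h) = imult (D x h)"
  "\<And>x h. norm x < \<rho> ==> norm (D x h - (m 1 (\<lambda>_. fst h), m 1 (\<lambda>_. snd h))) \<le> M * norm x * norm h"
proof -
 define C' where "C' n = 2 ^ n * max 0 (C n)" for n
 have mc: "multilinear_bd n (C' n) (cplx n (m n))" for n
  unfolding C'_def by (intro multilinear_bd_cplx multilinear_bd_nonneg m) simp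
 have K': "C' n * (r / 2) ^ n \<le> max 0 K" for n
 proof -
  have "C' n * (r / 2) ^ n = max 0 (C n) * r ^ n" by (simp add: C'_def power_divide)
  also have "\<dots> \<le> max 0 K" using K[of n] r by (simp add: max_def)
  finally show ?thesis .
 qed
 obtain G D M where G: "\<And>x. norm x < r / 2 / 4 ==> (\<lambda>n. cplx n (m n) (\<lambda>_. x)) sums G x"
  "\<And>x. norm x < r / 2 / 4 ==> (G has_derivative D x) (at x)"
  "\<And>x h. norm x < r / 2 / 4 ==> (\<lambda>n. \<Sum>j<n. cplx n (m n) ((\<lambda>_. x)(j := h))) sums D x h"
  "\<And>x h. norm x < r / 2 / 4 ==> norm (D x h - cplx 1 (m 1) (\<lambda>_. h)) \<le> M * norm x * norm h"
  by (rule multilinear_series_derivative[OF mc half_gt_zero[OF r] K']) (rule that; (assumption | blast))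
 have one: "cplx 1 (m 1) (\<lambda>_. h) = (m 1 (\<lambda>_. fst h), m 1 (\<lambda>_. snd h))" for h
 proof -
  have e: "m (Suc 0) ((\<lambda>_. 0)(0 := a)) = m (Suc 0) (\<lambda>_. a)" for a by (rule multilinear_bdD(1)[OF m]) simp
  show ?thesis unfolding cplx_def One_nat_def complexify.simps e by (simp add: imult_def)
 qed
 show thesis
 proof (rule that[of "r / 8" G D M])
  show "0 < r / 8" "r / 8 \<le> r" using r by auto
  fix h :: 'a assume h: "norm h < r / 8"
  have "cplx n (m n) (\<lambda>_. (h, 0)) = (m n (\<lambda>_. h), 0)" for n
  proof -
   have "m n (\<lambda>i. if i < n then h else 0) = m n (\<lambda>_. h)" by (rule multilinear_bdD(1)[OF m]) simp
   then show ?thesis using complexify_real[OF m order_refl, of n "\<lambda>_. h" "\<lambda>_. 0"] by (simp add: cplx_def)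
  qed
  moreover have "(\<lambda>n. (m n (\<lambda>_. h), 0::'b)) sums (f h, 0)"
   by (rule bounded_linear.sums[OF bounded_linear_Pair[OF bounded_linear_ident bounded_linear_zero] f]) (use h r in simp)
  ultimately show "G (h, 0) = (f h, 0)" using G(1)[of "(h, 0)"] h by (simp add: norm_Pair sums_unique2)
 next
  fix x :: "'a \<times> 'a" assume x: "norm x < r / 8"
  show "(G has_derivative D x) (at x)" using G(2) x by simp
  fix h
  show "norm (D x h - (m 1 (\<lambda>_. fst h), m 1 (\<lambda>_. snd h))) \<le> M * norm x * norm h" using G(4)[of x h] x unfolding one by simp
  have "(\<Sum>j<n. cplx n (m n) ((\<lambda>_. x)(j := imult h))) = imult (\<Sum>j<n. cplx n (m n) ((\<lambda>_. x)(j := h)))" for n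
   unfolding linear_sum[OF linear_imult] cplx_def
   by (intro sum.cong refl) (use complexify_slot[OF m] in auto)
  moreover have "(\<lambda>n. imult (\<Sum>j<n. cplx n (m n) ((\<lambda>_. x)(j := h)))) sums imult (D x h)"
   using x by (intro bounded_linear.sums[OF bounded_linear_imult G(3)]) simp
  ultimately show "D x (imult h) = imult (D x h)" using G(3)[of x "imult h"] x by (simp add: sums_unique2)
 qed
qed

section \<open>Zero sets of analytic maps with finite rank defect\<close>

text \<open>\<open>T h = y\<close> says that \<open>h\<close> is the fixed point of the contraction
  sending \<open>h\<close> to \<open>y - (T h - h)\<close>.\<close>

lemma near_identity_bij:
 fixes T :: "'a::banach \<Rightarrow> 'a"
 assumes T: "bounded_linear T" and near: "\<And>h. norm (T h - h) \<le> norm h / 2"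
 shows "bij T"
proof -
 interpret T: bounded_linear T by (rule T)
 have "inj T"
 proof (rule linear_injective_0[OF T.linear, THEN iffD2], intro allI impI)
  fix h assume "T h = 0"
  then show "h = 0" using near[of h] by simp
 qed
 moreover have "y \<in> range T" for y
 proof -
  have "\<exists>!h. y - (T h - h) = h"
  proof (rule banach_fix_type[of "1/2"])
   show "\<forall>x z. dist (y - (T x - x)) (y - (T z - z)) \<le> 1/2 * dist x z"
   proof (intro allI)
    fix x z
    have eq: "(y - (T x - x)) - (y - (T z - z)) = - (T (x - z) - (x - z))" by (simp add: T.diff)
    show "dist (y - (T x - x)) (y - (T z - z)) \<le> 1/2 * dist x z"
     unfolding dist_norm eq norm_minus_cancel using near[of "x - z"] by simp
   qed
  qed auto
  then obtain h where h: "y - (T h - h) = h" by blast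
  have "y - T h = (y - (T h - h)) - h" by simp
  then have "y = T h" using h by simp
  then show ?thesis by simp
 qed
 ultimately show ?thesis unfolding bij_def by blast
qed

text \<open>The contraction is restricted to a closed set \<open>S\<close> that it preserves, so the
  solution lies in \<open>S\<close>. With the real subspace as \<open>S\<close> this will show that
  real data have real solutions.\<close>

lemma perturbed_identity_solve:
 fixes G :: "'a::banach \<Rightarrow> 'a"
 assumes lip: "\<And>x y. norm x < \<rho> ==> norm y < \<rho> ==> norm ((G x - x) - (G y - y)) \<le> norm (x - y) / 2"
  and G0: "G 0 = 0" and \<rho>: "0 < \<rho>" and y: "norm y \<le> \<rho> / 4"
  and S: "closed S" "0 \<in> S" "\<And>w. w \<in> S ==> norm w < \<rho> ==> y - (G w - w) \<in> S"
 shows "\<exists>x\<in>S. norm x < \<rho> \<and> G x = y"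
proof -
 let ?s = "S \<inter> cball 0 (\<rho> / 2)"
 have lt: "norm w < \<rho>" if "w \<in> ?s" for w using that \<rho> by simp
 have "\<exists>!x\<in>?s. y - (G x - x) = x"
 proof (rule Banach_fix[where c = "1/2"])
  show "complete ?s" unfolding complete_eq_closed using S(1) by (intro closed_Int) auto
  show "?s \<noteq> {}" using S(2) \<rho> by auto
  show "(\<lambda>x. y - (G x - x)) ` ?s \<subseteq> ?s"
  proof
   fix z assume "z \<in> (\<lambda>x. y - (G x - x)) ` ?s"
   then obtain w where w: "w \<in> ?s" "z = y - (G w - w)" by blast
   have "norm (G w - w) \<le> norm w / 2" using lip[OF lt[OF w(1)], of 0] G0 \<rho> by simp
   moreover have "norm w \<le> \<rho> / 2" using w(1) by simp
   ultimately have "norm z \<le> \<rho> / 2" using norm_triangle_ineq4[of y "G w - w"] y unfolding w(2) by linarith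
   then show "z \<in> ?s" using S(3)[of w] w lt by simp
  qed
  fix x z assume xz: "x \<in> ?s" "z \<in> ?s"
  have eq: "(y - (G x - x)) - (y - (G z - z)) = - ((G x - x) - (G z - z))" by simp
  show "dist (y - (G x - x)) (y - (G z - z)) \<le> 1/2 * dist x z"
   unfolding dist_norm eq norm_minus_cancel using lip[OF lt[OF xz(1)] lt[OF xz(2)]] by simp
 qed auto
 then obtain x where "x \<in> ?s \<and> y - (G x - x) = x" by (rule exE[OF ex1_implies_ex])
 then have x: "x \<in> ?s" "y - (G x - x) = x" by (rule conjunct1, rule conjunct2)
 have "y - G x = (y - (G x - x)) - x" by simp
 then have "G x = y" using x(2) by simp
 then show ?thesis using x(1) lt[OF x(1)] by blast
qed

text \<open>The inverse function theorem at a point with identity derivative, in a quantitative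
  form. The last conclusion passes invariant closed sets of the iteration on to the inverse
  \<open>\<Theta>\<close>.\<close>

lemma local_inverse:
 fixes G :: "'a::banach \<Rightarrow> 'a"
 assumes \<rho>0: "0 < \<rho>0" and der: "\<And>x. norm x < \<rho>0 ==> (G has_derivative D x) (at x)"
  and M: "\<And>x h. norm x < \<rho>0 ==> norm (D x h - h) \<le> M * norm x * norm h" and G0: "G 0 = 0" and \<epsilon>: "0 < \<epsilon>"
 obtains \<rho> \<Theta> where "0 < \<rho>" "\<rho> \<le> \<rho>0" "\<rho> \<le> \<epsilon>"
  "\<forall>y. norm y < \<rho> / 4 --> norm (\<Theta> y) < \<rho> \<and> G (\<Theta> y) = y"
  "\<forall>x. norm x < \<rho> --> norm (G x) < \<rho> / 4 --> \<Theta> (G x) = x"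
  "\<forall>y. norm y < \<rho> / 4 --> bij (D (\<Theta> y)) \<and> (\<Theta> has_derivative inv_into UNIV (D (\<Theta> y))) (at y)"
  "\<forall>y S. norm y < \<rho> / 4 --> closed S --> 0 \<in> S --> (\<forall>w\<in>S. norm w < \<rho> --> y - (G w - w) \<in> S) --> \<Theta> y \<in> S"
proof -
 \<comment> \<open>On this ball \<open>M * norm x\<close> is at most \<open>1/2\<close>, so that
   \<open>G\<close> differs from the identity by a map with Lipschitz constant
   \<open>1/2\<close>.\<close>
 define \<rho> where "\<rho> = min (min \<rho>0 \<epsilon>) (1 / (2 * (\<bar>M\<bar> + 1)))"
 have \<rho>: "0 < \<rho>" "\<rho> \<le> \<rho>0" "\<rho> \<le> \<epsilon>" "\<rho> \<le> 1 / (2 * (\<bar>M\<bar> + 1))" using \<rho>0 \<epsilon> by (auto simp: \<rho>_def)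
 have near: "norm (D x h - h) \<le> 1 / 2 * norm h" if x: "norm x < \<rho>" for x h
 proof -
  have "M * norm x \<le> (\<bar>M\<bar> + 1) * \<rho>" using x by (intro mult_mono) auto
  also have "\<dots> \<le> (\<bar>M\<bar> + 1) * (1 / (2 * (\<bar>M\<bar> + 1)))" using \<rho>(4) by (intro mult_left_mono) auto
  also have "\<dots> = 1 / 2" by (simp add: field_simps)
  finally have "M * norm x * norm h \<le> 1 / 2 * norm h" by (intro mult_right_mono) auto
  then show ?thesis using M[of x h] x \<rho>(2) by linarith
 qed
 have lip: "norm ((G x - x) - (G y - y)) \<le> norm (x - y) / 2" if "norm x < \<rho>" "norm y < \<rho>" for x y
 proof -
  have "norm ((G x - x) - (G y - y)) \<le> 1 / 2 * norm (x - y)"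
  proof (rule differentiable_bound[of "ball 0 \<rho>" "\<lambda>x. G x - x" "\<lambda>x h. D x h - h"])
   fix z :: 'a assume "z \<in> ball 0 \<rho>"
   then have z: "norm z < \<rho>" "norm z < \<rho>0" using \<rho>(2) by auto
   show "((\<lambda>x. G x - x) has_derivative (\<lambda>h. D z h - h)) (at z within ball 0 \<rho>)"
    by (intro has_derivative_diff has_derivative_at_withinI[OF der[OF z(2)]] has_derivative_ident)
   show "onorm (\<lambda>h. D z h - h) \<le> 1 / 2" by (rule onorm_bound) (use near[OF z(1)] in auto)
  qed (use that in auto)
  then show ?thesis by simp
 qed
 have uniq: "x = y" if "norm x < \<rho>" "norm y < \<rho>" "G x = G y" for x y
  using lip[OF that(1,2)] that(3) by (simp add: norm_minus_commute)
 define \<Theta> where "\<Theta> y = (SOME x. norm x < \<rho> \<and> G x = y)" for y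
 have ex: "\<exists>x\<in>S. norm x < \<rho> \<and> G x = y"
  if "norm y < \<rho> / 4" "closed S" "0 \<in> S" "\<forall>w\<in>S. norm w < \<rho> --> y - (G w - w) \<in> S" for y S
  by (rule perturbed_identity_solve[OF lip G0 \<rho>(1)]) (use that in auto)
 have \<Theta>: "norm (\<Theta> y) < \<rho> \<and> G (\<Theta> y) = y" if "norm y < \<rho> / 4" for y
  unfolding \<Theta>_def by (rule someI_ex) (use ex[OF that, of UNIV] in auto)
 have \<Theta>lip: "norm (\<Theta> y - \<Theta> z) \<le> 2 * norm (y - z)" if "norm y < \<rho> / 4" "norm z < \<rho> / 4" for y z
 proof -
  define a where "a = (y - \<Theta> y) - (z - \<Theta> z)"
  have "norm a \<le> norm (\<Theta> y - \<Theta> z) / 2" unfolding a_def using lip[of "\<Theta> y" "\<Theta> z"] \<Theta>[OF that(1)] \<Theta>[OF that(2)] by simp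
  moreover have "norm ((y - z) - a) \<le> norm (y - z) + norm a" by (rule norm_triangle_ineq4)
  moreover have "(y - z) - a = \<Theta> y - \<Theta> z" by (simp add: a_def)
  ultimately show ?thesis by simp
 qed
 show thesis
 proof (rule that[OF \<rho>(1-3)])
  show "\<forall>y. norm y < \<rho> / 4 --> norm (\<Theta> y) < \<rho> \<and> G (\<Theta> y) = y" using \<Theta> by blast
  show "\<forall>x. norm x < \<rho> --> norm (G x) < \<rho> / 4 --> \<Theta> (G x) = x"
  proof (intro allI impI)
   fix x assume x: "norm x < \<rho>" "norm (G x) < \<rho> / 4"
   show "\<Theta> (G x) = x" by (rule uniq) (use \<Theta>[OF x(2)] x in simp_all)
  qed
  show "\<forall>y S. norm y < \<rho> / 4 --> closed S --> 0 \<in> S --> (\<forall>w\<in>S. norm w < \<rho> --> y - (G w - w) \<in> S) --> \<Theta> y \<in> S"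
  proof (intro allI impI)
   fix y S assume a: "norm y < \<rho> / 4" "closed S" "0 \<in> S" "\<forall>w\<in>S. norm w < \<rho> --> y - (G w - w) \<in> S"
   obtain x where x: "x \<in> S" "norm x < \<rho>" "G x = y" using ex[OF a] by blast
   have "\<Theta> y = x" by (rule uniq) (use \<Theta>[OF a(1)] x in simp_all)
   then show "\<Theta> y \<in> S" using x by simp
  qed
  show "\<forall>y. norm y < \<rho> / 4 --> bij (D (\<Theta> y)) \<and> (\<Theta> has_derivative inv_into UNIV (D (\<Theta> y))) (at y)"
  proof (intro allI impI)
   fix y :: 'a assume y: "norm y < \<rho> / 4"
   have x: "norm (\<Theta> y) < \<rho>" "norm (\<Theta> y) < \<rho>0" using \<Theta>[OF y] \<rho>(2) by auto
   have bl: "bounded_linear (D (\<Theta> y))" using der[OF x(2)] by (rule has_derivative_bounded_linear)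
   have bij: "bij (D (\<Theta> y))" by (rule near_identity_bij[OF bl]) (use near[OF x(1)] in simp)
   have cont: "continuous (at y) \<Theta>" unfolding continuous_at_eps_delta
   proof (intro allI impI)
    fix e :: real assume e: "0 < e"
    define d where "d = min (e / 2) (\<rho> / 4 - norm y)"
    have "dist (\<Theta> z) (\<Theta> y) < e" if z: "dist z y < d" for z
    proof -
     have "norm z < \<rho> / 4" using z norm_triangle_ineq2[of z y] by (simp add: d_def dist_norm)
     then show ?thesis using \<Theta>lip[of z y] y z by (simp add: d_def dist_norm)
    qed
    moreover have "0 < d" using e y by (simp add: d_def)
    ultimately show "\<exists>d>0. \<forall>x'. dist x' y < d --> dist (\<Theta> x') (\<Theta> y) < e" by blast
   qed
   have "(\<Theta> has_derivative inv_into UNIV (D (\<Theta> y))) (at y)"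
   proof (rule has_derivative_inverse_basic[OF der[OF x(2)] bounded_inverse[OF bl bij] _ cont open_ball])
    show "inv_into UNIV (D (\<Theta> y)) \<circ> D (\<Theta> y) = id" using bij by (simp add: bij_is_inj)
    show "y \<in> ball 0 (\<rho> / 4)" using y by simp
    show "G (\<Theta> z) = z" if "z \<in> ball 0 (\<rho> / 4)" for z using \<Theta>[of z] that by simp
   qed
   then show "bij (D (\<Theta> y)) \<and> (\<Theta> has_derivative inv_into UNIV (D (\<Theta> y))) (at y)" using bij by blast
  qed
 qed
qed

lemma complex_linear_imp_field_differentiable:
 assumes f: "(f has_derivative P) (at s)" and P: "\<And>t. P (\<i> * t) = \<i> * P t"
 shows "f field_differentiable (at s)"
proof -
 have lin: "linear P" using f by (rule has_derivative_linear)
 have "P t = P 1 * t" for t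
 proof -
  have "t = Re t *\<^sub>R 1 + Im t *\<^sub>R (\<i> * 1)" by (simp add: complex_eq_iff)
  then have "P t = Re t *\<^sub>R P 1 + Im t *\<^sub>R P (\<i> * 1)" by (metis linear_add[OF lin] linear_scale[OF lin])
  also have "P (\<i> * 1) = \<i> * P 1" by (rule P)
  also have "Re t *\<^sub>R P 1 + Im t *\<^sub>R (\<i> * P 1) = P 1 * t" by (simp add: complex_eq_iff algebra_simps)
  finally show ?thesis .
 qed
 then have "P = (*) (P 1)" by (rule ext)
 then show ?thesis using f unfolding field_differentiable_def has_field_derivative_def by metis
qed

definition cfun :: "('a \<Rightarrow> real) \<Rightarrow> 'a \<times> 'a \<Rightarrow> complex" where
 "cfun c w = complex_of_real (c (fst w)) + \<i> * complex_of_real (c (snd w))"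

text \<open>The combination of the vectors \<open>e i\<close> with complex coefficients
  \<open>x i\<close>, in the model of the complexification by pairs.\<close>

definition ccomb :: "nat \<Rightarrow> (nat \<Rightarrow> 'a::real_normed_vector) \<Rightarrow> (nat \<Rightarrow> complex) \<Rightarrow> 'a \<times> 'a" where
 "ccomb k e x = (\<Sum>i<k. (Re (x i) *\<^sub>R e i, Im (x i) *\<^sub>R e i))"

lemma bounded_linear_cfun:
 assumes "bounded_linear c"
 shows "bounded_linear (cfun c)"
 unfolding cfun_def[abs_def]
 by (rule bounded_linear_add[OF bounded_linear_compose[OF bounded_linear_of_real bounded_linear_compose[OF assms bounded_linear_fst]]
   bounded_linear_compose[OF bounded_linear_mult_right
    bounded_linear_compose[OF bounded_linear_of_real bounded_linear_compose[OF assms bounded_linear_snd]]]])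

lemma cfun_imult: "bounded_linear c ==> cfun c (imult w) = \<i> * cfun c w"
 using linear_neg[of c] by (simp add: cfun_def imult_def bounded_linear.linear algebra_simps)

lemma bounded_linear_Re_Im: "bounded_linear (\<lambda>z. (Re z *\<^sub>R e, Im z *\<^sub>R e))"
 by (intro bounded_linear_Pair bounded_linear_scaleR_const bounded_linear_Re bounded_linear_Im)

text \<open>Chain rule along a holomorphic curve: all derivatives involved commute with
  multiplication by \<open>\<i>\<close>, so the composite has a complex linear derivative.\<close>

lemma hol_germ_chart:
 fixes \<Theta> :: "'a::real_normed_vector \<times> 'a \<Rightarrow> 'a \<times> 'a"
 assumes \<Theta>: "\<And>y. norm y < \<sigma> ==> (\<Theta> has_derivative E y) (at y)" "\<And>y h. norm y < \<sigma> ==> E y (imult h) = imult (E y h)"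
  and L: "\<And>x. x \<in> pdisc k \<delta> ==> norm (ccomb k e x) < \<sigma>" and c: "bounded_linear c"
 shows "hol_germ k \<delta> (\<lambda>x. cfun c (\<Theta> (ccomb k e x)) - x j)"
proof (rule hol_germI)
 have coord: "continuous_on (pdisc k \<delta>) (\<lambda>x. x i)" for i
  by (rule continuous_on_subset[OF continuous_on_product_coordinates]) simp
 have cL: "continuous_on (pdisc k \<delta>) (ccomb k e)"
  unfolding ccomb_def[abs_def] by (intro continuous_intros coord)
 have "continuous_on (ball 0 \<sigma>) \<Theta>"
  by (rule continuous_at_imp_continuous_on) (use has_derivative_continuous[OF \<Theta>(1)] in auto)
 then have "continuous_on (pdisc k \<delta>) (\<lambda>x. \<Theta> (ccomb k e x))"
  by (rule continuous_on_compose2[OF _ cL]) (use L in auto)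
 then have "continuous_on (pdisc k \<delta>) (\<lambda>x. cfun c (\<Theta> (ccomb k e x)))"
  by (rule bounded_linear.continuous_on[OF bounded_linear_cfun[OF c]])
 then show "continuous_on (pdisc k \<delta>) (\<lambda>x. cfun c (\<Theta> (ccomb k e x)) - x j)"
  by (intro continuous_intros coord)
 fix S \<psi> assume S: "open S" and \<psi>: "\<And>i. (\<lambda>s. \<psi> s i) holomorphic_on S" and sub: "\<psi> ` S \<subseteq> pdisc k \<delta>"
 have "(\<lambda>s. cfun c (\<Theta> (ccomb k e (\<psi> s)))) field_differentiable (at s)" if s: "s \<in> S" for s
 proof -
  define d where "d i = deriv (\<lambda>s. \<psi> s i) s" for i
  have d: "((\<lambda>s. \<psi> s i) has_derivative (*) (d i)) (at s)" for i
   using holomorphic_derivI[OF \<psi> S s] unfolding d_def has_field_derivative_def .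
  define \<Lambda> where "\<Lambda> t = ccomb k e (\<lambda>i. d i * t)" for t
  have 1: "((\<lambda>s. ccomb k e (\<psi> s)) has_derivative \<Lambda>) (at s)"
   unfolding ccomb_def \<Lambda>_def[abs_def] by (intro has_derivative_sum bounded_linear.has_derivative[OF bounded_linear_Re_Im d])
  have \<Lambda>i: "\<Lambda> (\<i> * t) = imult (\<Lambda> t)" for t
   unfolding \<Lambda>_def ccomb_def linear_sum[OF linear_imult] by (intro sum.cong) (auto simp: imult_def algebra_simps)
  have n: "norm (ccomb k e (\<psi> s)) < \<sigma>" using L sub s by blast
  have 2: "((\<lambda>s. \<Theta> (ccomb k e (\<psi> s))) has_derivative (\<lambda>t. E (ccomb k e (\<psi> s)) (\<Lambda> t))) (at s)"
   using has_derivative_compose[OF 1 \<Theta>(1)[OF n]] .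
  show ?thesis
  proof (rule complex_linear_imp_field_differentiable)
   show "((\<lambda>s. cfun c (\<Theta> (ccomb k e (\<psi> s)))) has_derivative (\<lambda>t. cfun c (E (ccomb k e (\<psi> s)) (\<Lambda> t)))) (at s)"
    by (rule bounded_linear.has_derivative[OF bounded_linear_cfun[OF c] 2])
   show "cfun c (E (ccomb k e (\<psi> s)) (\<Lambda> (\<i> * t))) = \<i> * cfun c (E (ccomb k e (\<psi> s)) (\<Lambda> t))" for t
    unfolding \<Lambda>i \<Theta>(2)[OF n] by (rule cfun_imult[OF c])
  qed
 qed
 then have "(\<lambda>s. cfun c (\<Theta> (ccomb k e (\<psi> s)))) holomorphic_on S"
  using S by (auto simp: holomorphic_on_def field_differentiable_at_within)
 then show "(\<lambda>s. cfun c (\<Theta> (ccomb k e (\<psi> s))) - \<psi> s j) holomorphic_on S" by (intro holomorphic_intros \<psi>)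
qed

text \<open>Lyapunov--Schmidt reduction: \<open>f\<close> plus the finite rank map is locally invertible, so that a zero
 of \<open>f\<close> is determined by the values of the functionals \<open>c i\<close>, which solve a finite system of analytic
 equations.\<close>

lemma finite_rank_defect_arcs:
 fixes m :: "nat \<Rightarrow> (nat \<Rightarrow> 'a::banach) \<Rightarrow> 'a" and k :: nat
 assumes m: "\<And>n. multilinear_bd n (C n) (m n)" and r: "0 < r" and K: "\<And>n. C n * r ^ n \<le> K"
  and f: "\<And>h. norm h < r ==> (\<lambda>n. m n (\<lambda>_. h)) sums f h" and f0: "f 0 = 0"
  and c: "\<And>i. i < k ==> bounded_linear (c i)"
  and m1: "\<And>h. m 1 (\<lambda>_. h) = h - (\<Sum>i<k. c i h *\<^sub>R e i)" and \<epsilon>: "0 < \<epsilon>"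
 shows "\<exists>\<delta>>0. \<forall>x. f x = 0 --> x \<noteq> 0 --> norm x < \<delta> --> (\<exists>p \<phi>. path p \<and> path_image p \<subseteq> {x. f x = 0} \<inter> ball 0 \<epsilon> - {0} \<and>
   pathstart p = x \<and> pathfinish p = \<phi> (1::real) \<and> continuous_on {-1..1} \<phi> \<and> inj_on \<phi> {-1..1} \<and> \<phi> 0 = 0 \<and>
   \<phi> ` {-1..1} \<subseteq> {x. f x = 0} \<inter> ball 0 \<epsilon>)"
proof -
 define N where "N h = (\<Sum>i<k. c i h *\<^sub>R e i)" for h
 have N0: "N 0 = 0" unfolding N_def using c by (intro sum.neutral) (simp add: linear_0 bounded_linear.linear)
 \<comment> \<open>The series of \<open>f + N\<close>: by \<open>m1\<close>, adding \<open>N\<close>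
   turns the linear term into the identity.\<close>
 define m' where "m' n = (if n = 1 then (\<lambda>v. v 0) else m n)" for n
 define C' where "C' n = (if n = 1 then 1 else C n)" for n
 have m'b: "multilinear_bd n (C' n) (m' n)" for n
 proof (cases "n = 1")
  case True then show ?thesis by (auto simp: m'_def C'_def multilinear_bd_def linear_iff)
 qed (simp add: m'_def C'_def m)
 have K': "C' n * r ^ n \<le> max K r" for n using K[of n] by (auto simp: C'_def)
 have f': "(\<lambda>n. m' n (\<lambda>_. h)) sums (f h + N h)" if "norm h < r" for h
 proof -
  have "(\<lambda>n. if n = 1 then N h else 0) sums N h" using sums_single[of 1 "\<lambda>_. N h"] by simp
  note s = sums_add[OF f[OF that] this]
  have "(\<lambda>n. m n (\<lambda>_. h) + (if n = 1 then N h else 0)) = (\<lambda>n. m' n (\<lambda>_. h))"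
   using m1[of h] by (auto simp: m'_def N_def fun_eq_iff)
  then show ?thesis using s by (simp only:)
 qed
 obtain \<rho>0 M and G :: "'a \<times> 'a \<Rightarrow> 'a \<times> 'a" and D where \<rho>0: "0 < \<rho>0" "\<rho>0 \<le> r"
  and G: "\<And>h. norm h < \<rho>0 ==> G (h, 0) = (f h + N h, 0)"
  "\<And>x. norm x < \<rho>0 ==> (G has_derivative D x) (at x)"
  "\<And>x h. norm x < \<rho>0 ==> D x (imult h) = imult (D x h)"
  "\<And>x h. norm x < \<rho>0 ==> norm (D x h - (m' 1 (\<lambda>_. fst h), m' 1 (\<lambda>_. snd h))) \<le> M * norm x * norm h"
 proof (rule complexified_series[OF m'b r K'])
  show "(\<lambda>n. m' n (\<lambda>_. h)) sums (f h + N h)" if "norm h < r" for h by (rule f'[OF that])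
  fix \<rho>0 M and G :: "'a \<times> 'a \<Rightarrow> 'a \<times> 'a" and D
  assume a: "0 < \<rho>0" "\<rho>0 \<le> r" "\<And>h. norm h < \<rho>0 ==> G (h, 0) = (f h + N h, 0)"
   "\<And>x. norm x < \<rho>0 ==> (G has_derivative D x) (at x)"
   "\<And>x h. norm x < \<rho>0 ==> D x (imult h) = imult (D x h)"
   "\<And>x h. norm x < \<rho>0 ==> norm (D x h - (m' 1 (\<lambda>_. fst h), m' 1 (\<lambda>_. snd h))) \<le> M * norm x * norm h"
  show thesis by (rule that) (assumption | rule a)+
 qed
 have G4: "norm (D x h - h) \<le> M * norm x * norm h" if "norm x < \<rho>0" for x h using G(4)[OF that, of h] by (simp add: m'_def)
 have G00: "G 0 = 0" using G(1)[of 0] \<rho>0 f0 N0 by (simp add: zero_prod_def)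
 obtain \<rho> \<Theta> where \<rho>: "0 < \<rho>" "\<rho> \<le> \<rho>0" "\<rho> \<le> \<epsilon>"
  and \<Theta>: "\<forall>y. norm y < \<rho> / 4 --> norm (\<Theta> y) < \<rho> \<and> G (\<Theta> y) = y"
  "\<forall>x. norm x < \<rho> --> norm (G x) < \<rho> / 4 --> \<Theta> (G x) = x"
  "\<forall>y. norm y < \<rho> / 4 --> bij (D (\<Theta> y)) \<and> (\<Theta> has_derivative inv_into UNIV (D (\<Theta> y))) (at y)"
  "\<forall>y S. norm y < \<rho> / 4 --> closed S --> 0 \<in> S --> (\<forall>w\<in>S. norm w < \<rho> --> y - (G w - w) \<in> S) --> \<Theta> y \<in> S"
  by (rule local_inverse[OF \<rho>0(1) G(2) G4 G00 \<epsilon>])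
 \<comment> \<open>\<open>G\<close> maps real points near 0 to real points, so the closed real
   subspace is preserved by the iteration behind \<open>\<Theta>\<close>.\<close>
 have real: "snd (\<Theta> (y, 0)) = 0" if y: "norm (y, 0::'a) < \<rho> / 4" for y
 proof -
  let ?S = "{w::'a \<times> 'a. snd w = 0}"
  have "\<Theta> (y, 0) \<in> ?S"
  proof (rule \<Theta>(4)[rule_format, OF y])
   show "closed ?S" by (intro closed_Collect_eq continuous_intros)
   show "0 \<in> ?S" by simp
   fix w assume that: "w \<in> ?S" "norm w < \<rho>"
   have w: "w = (fst w, 0)" using that by (simp add: prod_eq_iff)
   then have "norm (fst w) < \<rho>0" using that \<rho>(2) by (metis norm_Pair2 order_less_le_trans)
   from G(1)[OF this] w have "snd (G w) = 0" by (metis snd_conv)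
   then show "(y, 0) - (G w - w) \<in> ?S" using that by simp
  qed
  then show ?thesis by simp
 qed
 define \<delta>0 where "\<delta>0 = \<rho> / (8 * ((\<Sum>i<k. norm (e i)) + 1))"
 have sumpos: "0 < (\<Sum>i<k. norm (e i)) + 1" by (intro add_nonneg_pos sum_nonneg) auto
 have \<delta>0: "0 < \<delta>0" using \<rho>(1) sumpos by (simp add: \<delta>0_def)
 have Lsmall: "norm (ccomb k e x) < \<rho> / 4" if x: "x \<in> pdisc k \<delta>0" for x
 proof -
  have "norm (ccomb k e x) \<le> (\<Sum>i<k. 2 * \<delta>0 * norm (e i))" unfolding ccomb_def
  proof (rule sum_norm_le)
   fix i assume "i \<in> {..<k}"
   then have xi: "cmod (x i) < \<delta>0" using x by (simp add: pdisc_def)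
   have "norm (Re (x i) *\<^sub>R e i, Im (x i) *\<^sub>R e i) \<le> norm (Re (x i) *\<^sub>R e i) + norm (Im (x i) *\<^sub>R e i)"
    by (rule norm_Pair_le)
   also have "\<dots> \<le> \<delta>0 * norm (e i) + \<delta>0 * norm (e i)" unfolding norm_scaleR
    using xi abs_Re_le_cmod[of "x i"] abs_Im_le_cmod[of "x i"] by (intro add_mono mult_right_mono) auto
   finally show "norm (Re (x i) *\<^sub>R e i, Im (x i) *\<^sub>R e i) \<le> 2 * \<delta>0 * norm (e i)" by simp
  qed
  also have "\<dots> = 2 * \<delta>0 * (\<Sum>i<k. norm (e i))" by (simp add: sum_distrib_left)
  also have "\<dots> < 2 * \<delta>0 * ((\<Sum>i<k. norm (e i)) + 1)" using \<delta>0 by simp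
  also have "\<dots> = \<rho> / 4" using sumpos by (simp add: \<delta>0_def field_simps)
  finally show ?thesis .
 qed
 \<comment> \<open>A small zero \<open>\<xi>\<close> of \<open>f\<close> satisfies
   \<open>\<xi> = \<Theta> (N \<xi>)\<close>, and \<open>N \<xi>\<close> depends only on the numbers
   \<open>x i = c i \<xi>\<close>. Inserting one into the other gives these \<open>k\<close>
   equations for \<open>x\<close>.\<close>
 define q where "q i x = cfun (c i) (\<Theta> (ccomb k e x)) - x i" for i x
 have hol: "hol_germ k \<delta>0 h" if h: "h \<in> q ` {..<k}" for h
 proof -
  obtain j where j: "j < k" "h = q j" using h by auto
  show ?thesis unfolding j(2) q_def
  proof (rule hol_germ_chart[where \<sigma> = "\<rho> / 4" and E = "\<lambda>y. inv_into UNIV (D (\<Theta> y))"])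
   show "(\<Theta> has_derivative inv_into UNIV (D (\<Theta> y))) (at y)" if "norm y < \<rho> / 4" for y using \<Theta>(3) that by blast
   show "inv_into UNIV (D (\<Theta> y)) (imult h) = imult (inv_into UNIV (D (\<Theta> y)) h)" if y: "norm y < \<rho> / 4" for y h
   proof (rule inv_f_eq)
    have bij: "bij (D (\<Theta> y))" using \<Theta>(3) y by blast
    then show "inj (D (\<Theta> y))" by (rule bij_is_inj)
    have "norm (\<Theta> y) < \<rho>0" using \<Theta>(1)[rule_format, OF y] \<rho>(2) by simp
    then show "D (\<Theta> y) (imult (inv_into UNIV (D (\<Theta> y)) h)) = imult h"
     using G(3) bij by (simp add: bij_is_surj surj_f_inv_f)
   qed
  qed (use Lsmall c j in auto)
 qed
 define Z where "Z = {x \<in> pdisc k \<delta>0. real_pt x \<and> (\<forall>h\<in>q ` {..<k}. h x = 0)}"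
 have "\<exists>\<delta>1>0. \<forall>x\<in>Z. x \<in> pdisc k \<delta>1 --> x \<noteq> (\<lambda>_. 0) --> (\<exists>p \<phi>. path p \<and> path_image p \<subseteq> Z - {\<lambda>_. 0} \<and> pathstart p = x \<and> pathfinish p = \<phi> (1::real) \<and> continuous_on {-1..1} \<phi> \<and> inj_on \<phi> {-1..1} \<and> \<phi> 0 = (\<lambda>_. 0) \<and> \<phi> ` {-1..1} \<subseteq> Z)"
  unfolding Z_def by (rule zero_set_arcs[OF finite_imageI[OF finite_lessThan] \<delta>0]) (rule hol)
 then obtain \<delta>1 where \<delta>1: "0 < \<delta>1" "\<forall>x\<in>Z. x \<in> pdisc k \<delta>1 --> x \<noteq> (\<lambda>_. 0) --> (\<exists>p \<phi>. path p \<and> path_image p \<subseteq> Z - {\<lambda>_. 0} \<and> pathstart p = x \<and> pathfinish p = \<phi> (1::real) \<and> continuous_on {-1..1} \<phi> \<and> inj_on \<phi> {-1..1} \<and> \<phi> 0 = (\<lambda>_. 0) \<and> \<phi> ` {-1..1} \<subseteq> Z)"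
  by (elim exE conjE) (rule that; assumption)
 define \<Xi> where "\<Xi> x = fst (\<Theta> (ccomb k e x))" for x
 define \<kappa> where "\<kappa> \<xi> i = (if i < k then complex_of_real (c i \<xi>) else 0)" for \<xi> i
 have ccomb_real: "ccomb k e x = (\<Sum>i<k. Re (x i) *\<^sub>R e i, 0)" if "real_pt x" for x
 proof -
  have "Im (x i) = 0" for i using that by (simp add: real_pt_def complex_is_Real_iff)
  then show ?thesis unfolding ccomb_def by (simp add: prod_eq_iff fst_sum snd_sum)
 qed
 have \<Xi>Z: "f (\<Xi> x) = 0 \<and> norm (\<Xi> x) < \<rho> \<and> \<kappa> (\<Xi> x) = x" if x: "x \<in> Z" for x
 proof -
  have xp: "x \<in> pdisc k \<delta>0" "real_pt x" "\<And>i. i < k ==> q i x = 0" using x by (auto simp: Z_def)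
  let ?y = "\<Sum>i<k. Re (x i) *\<^sub>R e i"
  have n: "norm (?y, 0::'a) < \<rho> / 4" using Lsmall[OF xp(1)] ccomb_real[OF xp(2)] by simp
  have \<xi>: "\<Theta> (?y, 0) = (\<Xi> x, 0)" unfolding \<Xi>_def ccomb_real[OF xp(2)] using real[OF n] by (simp add: prod_eq_iff)
  have T: "norm (\<Xi> x, 0::'a) < \<rho>" "G (\<Xi> x, 0) = (?y, 0)" using \<Theta>(1)[rule_format, OF n] unfolding \<xi> by simp_all
  then have nx: "norm (\<Xi> x) < \<rho>" by (simp add: norm_Pair)
  have ci: "complex_of_real (c i (\<Xi> x)) = x i" if "i < k" for i
   using xp(3)[OF that] ccomb_real[OF xp(2)] \<xi> linear_0[OF bounded_linear.linear[OF c[OF that]]]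
   by (simp add: q_def cfun_def)
  have "Re (x i) = c i (\<Xi> x)" if "i < k" for i using arg_cong[OF ci[OF that], of Re] by simp
  then have "?y = N (\<Xi> x)" unfolding N_def by (intro sum.cong) simp_all
  moreover have "f (\<Xi> x) + N (\<Xi> x) = ?y" using G(1)[of "\<Xi> x"] T(2) nx \<rho>(2) by simp
  ultimately have "f (\<Xi> x) = 0" by simp
  moreover have "\<kappa> (\<Xi> x) = x"
  proof
   fix i show "\<kappa> (\<Xi> x) i = x i" using ci xp(1) by (auto simp: \<kappa>_def pdisc_def)
  qed
  ultimately show ?thesis using nx by blast
 qed
 have \<Xi>0: "\<Xi> (\<lambda>_. 0) = 0"
 proof -
  have "ccomb k e (\<lambda>_. 0) = 0" by (simp add: ccomb_def zero_prod_def[symmetric])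
  then show ?thesis using \<Theta>(2)[rule_format, of 0] G00 \<rho>(1) by (simp add: \<Xi>_def)
 qed
 have cont\<Xi>: "continuous_on Z \<Xi>"
 proof -
  have cL: "continuous_on Z (ccomb k e)"
   unfolding ccomb_def[abs_def]
   by (intro continuous_intros continuous_on_subset[OF continuous_on_product_coordinates]) auto
  have "continuous_on (ball 0 (\<rho> / 4)) \<Theta>"
  proof (rule continuous_at_imp_continuous_on, intro ballI)
   fix y :: "'a \<times> 'a" assume "y \<in> ball 0 (\<rho> / 4)"
   then have "norm y < \<rho> / 4" by simp
   then have "(\<Theta> has_derivative inv_into UNIV (D (\<Theta> y))) (at y)" using \<Theta>(3) by blast
   then show "isCont \<Theta> y" by (rule has_derivative_continuous)
  qed
  then have "continuous_on Z (\<lambda>x. \<Theta> (ccomb k e x))"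
   by (rule continuous_on_compose2[OF _ cL]) (use Lsmall in \<open>auto simp: Z_def\<close>)
  then show ?thesis unfolding \<Xi>_def by (rule continuous_on_fst)
 qed
 have inj\<Xi>: "inj_on \<Xi> Z" by (rule inj_on_inverseI[of _ \<kappa>]) (use \<Xi>Z in blast)
 have "\<forall>i. \<exists>b. i < k --> 0 < b \<and> (\<forall>x. norm (c i x) \<le> norm x * b)"
  using bounded_linear.pos_bounded[OF c] by blast
 from choice[OF this] obtain b where b: "\<And>i. i < k ==> 0 < b i" "\<And>i x. i < k ==> norm (c i x) \<le> norm x * b i" by blast
 define B where "B = (\<Sum>i<k. b i) + 1"
 have B: "1 \<le> B" "\<And>i. i < k ==> b i \<le> B"
 proof -
  have "0 \<le> sum b {..<k}" by (rule sum_nonneg) (use b(1) in \<open>force intro: less_imp_le\<close>)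
  then show "1 \<le> B" by (simp add: B_def)
  show "b i \<le> B" if "i < k" for i
   unfolding B_def using that b(1) member_le_sum[of i "{..<k}" b] by (fastforce simp: less_imp_le)
 qed
 define \<eta> where "\<eta> = min \<delta>0 \<delta>1"
 define \<delta> where "\<delta> = min \<rho> (\<eta> / B)"
 have \<eta>: "0 < \<eta>" using \<delta>0 \<delta>1 by (simp add: \<eta>_def)
 have \<delta>: "0 < \<delta>" using \<rho>(1) \<eta> B(1) by (simp add: \<delta>_def)
 show ?thesis
 proof (intro exI[of _ \<delta>] conjI \<delta> allI impI)
  fix \<xi> assume \<xi>: "f \<xi> = 0" "\<xi> \<noteq> 0" "norm \<xi> < \<delta>"
  have n\<xi>: "norm \<xi> < \<rho>" using \<xi>(3) by (simp add: \<delta>_def)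
  have small: "cmod (\<kappa> \<xi> i) < \<eta>" for i
  proof (cases "i < k")
   case True
   have "norm (c i \<xi>) \<le> norm \<xi> * B" using b(2)[OF True, of \<xi>] B(2)[OF True] mult_left_mono[OF B(2)[OF True] norm_ge_zero[of \<xi>]] by linarith
   also have "\<dots> < \<eta> / B * B" using \<xi>(3) B(1) by (intro mult_strict_right_mono) (auto simp: \<delta>_def)
   also have "\<dots> = \<eta>" using B(1) by simp
   finally show ?thesis using True by (simp add: \<kappa>_def)
  qed (simp add: \<kappa>_def \<eta>)
  have "cmod (\<kappa> \<xi> i) < \<delta>0" "cmod (\<kappa> \<xi> i) < \<delta>1" for i using small[of i] by (simp_all add: \<eta>_def)
  moreover have "\<kappa> \<xi> i = 0" if "k \<le> i" for i using that by (simp add: \<kappa>_def)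
  ultimately have \<kappa>p: "\<kappa> \<xi> \<in> pdisc k \<delta>0" "\<kappa> \<xi> \<in> pdisc k \<delta>1" by (simp_all add: pdisc_def)
  have rp: "real_pt (\<kappa> \<xi>)" by (simp add: real_pt_def \<kappa>_def)
  have L\<kappa>: "ccomb k e (\<kappa> \<xi>) = (N \<xi>, 0)" unfolding ccomb_real[OF rp] N_def by (simp add: \<kappa>_def)
  have "G (\<xi>, 0) = (N \<xi>, 0)" using G(1)[of \<xi>] n\<xi> \<rho>(2) \<xi>(1) by simp
  then have \<Theta>\<kappa>: "\<Theta> (ccomb k e (\<kappa> \<xi>)) = (\<xi>, 0)"
   using \<Theta>(2)[rule_format, of "(\<xi>, 0)"] n\<xi> Lsmall[OF \<kappa>p(1)] unfolding L\<kappa> by (simp add: norm_Pair)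
  have \<kappa>Z: "\<kappa> \<xi> \<in> Z" unfolding Z_def
   using \<kappa>p(1) rp c by (auto simp: q_def \<Theta>\<kappa> cfun_def \<kappa>_def linear_0 bounded_linear.linear)
  have \<Xi>\<kappa>: "\<Xi> (\<kappa> \<xi>) = \<xi>" by (simp add: \<Xi>_def \<Theta>\<kappa>)
  have \<kappa>nz: "\<kappa> \<xi> \<noteq> (\<lambda>_. 0)" using \<Xi>\<kappa> \<Xi>0 \<xi>(2) by auto
  obtain p \<phi> where p: "path p" "path_image p \<subseteq> Z - {\<lambda>_. 0}" "pathstart p = \<kappa> \<xi>" "pathfinish p = \<phi> (1::real)"
   and \<phi>: "continuous_on {-1..1} \<phi>" "inj_on \<phi> {-1..1}" "\<phi> 0 = (\<lambda>_. 0)" "\<phi> ` {-1..1} \<subseteq> Z"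
   using \<delta>1(2)[rule_format, OF \<kappa>Z \<kappa>p(2) \<kappa>nz] by (elim exE conjE) (rule that; assumption)
  have "\<phi> 0 \<in> Z" by (rule subsetD[OF \<phi>(4)], rule imageI) simp
  then have 0: "(\<lambda>_. 0) \<in> Z" unfolding \<phi>(3) .
  have mem: "\<Xi> x \<in> {x. f x = 0} \<inter> ball 0 \<epsilon>" if "x \<in> Z" for x using \<Xi>Z[OF that] \<rho>(3) by simp
  have nz: "\<Xi> x \<noteq> 0" if "x \<in> Z - {\<lambda>_. 0}" for x using inj_onD[OF inj\<Xi>, of x "\<lambda>_. 0"] \<Xi>0 0 that by auto
  show "\<exists>p \<phi>. path p \<and> path_image p \<subseteq> {x. f x = 0} \<inter> ball 0 \<epsilon> - {0} \<and>
   pathstart p = \<xi> \<and> pathfinish p = \<phi> (1::real) \<and> continuous_on {-1..1} \<phi> \<and> inj_on \<phi> {-1..1} \<and> \<phi> 0 = 0 \<and>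
   \<phi> ` {-1..1} \<subseteq> {x. f x = 0} \<inter> ball 0 \<epsilon>"
  proof (rule exI[of _ "\<Xi> \<circ> p"], rule exI[of _ "\<Xi> \<circ> \<phi>"], intro conjI)
   show "path (\<Xi> \<circ> p)" by (rule path_continuous_image[OF p(1) continuous_on_subset[OF cont\<Xi>]]) (use p(2) in blast)
   show "path_image (\<Xi> \<circ> p) \<subseteq> {x. f x = 0} \<inter> ball 0 \<epsilon> - {0}"
   proof
    fix z assume "z \<in> path_image (\<Xi> \<circ> p)"
    then obtain x where x: "x \<in> path_image p" "z = \<Xi> x" unfolding path_image_compose by blast
    have "x \<in> Z - {\<lambda>_. 0}" using p(2) x(1) by (rule subsetD)
    then show "z \<in> {x. f x = 0} \<inter> ball 0 \<epsilon> - {0}" using mem[of x] nz[of x] x(2) by simp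
   qed
   show "pathstart (\<Xi> \<circ> p) = \<xi>" using p(3) \<Xi>\<kappa> by (simp add: pathstart_compose)
   show "pathfinish (\<Xi> \<circ> p) = (\<Xi> \<circ> \<phi>) 1" using p(4) by (simp add: pathfinish_compose)
   show "continuous_on {-1..1} (\<Xi> \<circ> \<phi>)" by (rule continuous_on_compose[OF \<phi>(1) continuous_on_subset[OF cont\<Xi> \<phi>(4)]])
   show "inj_on (\<Xi> \<circ> \<phi>) {-1..1}" by (rule comp_inj_on[OF \<phi>(2) inj_on_subset[OF inj\<Xi> \<phi>(4)]])
   show "(\<Xi> \<circ> \<phi>) 0 = 0" using \<phi>(3) \<Xi>0 by simp
   show "(\<Xi> \<circ> \<phi>) ` {-1..1} \<subseteq> {x. f x = 0} \<inter> ball 0 \<epsilon>"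
   proof (rule image_subsetI)
    fix t :: real assume "t \<in> {-1..1}"
    then have "\<phi> t \<in> Z" by (intro subsetD[OF \<phi>(4)] imageI)
    then show "(\<Xi> \<circ> \<phi>) t \<in> {x. f x = 0} \<inter> ball 0 \<epsilon>" unfolding o_apply by (rule mem)
   qed
  qed
 qed
qed

section \<open>Global extension of curves of zeros\<close>

lemma analytic_map_at_series:
 fixes F :: "'a::real_normed_vector \<Rightarrow> 'b::banach"
 assumes "analytic_map_at F y"
 obtains m C r K where "\<And>n. multilinear_bd n (C n) (m n)" "0 < r" "\<And>n. C n * r ^ n \<le> K"
  "\<And>h. norm h < r ==> (\<lambda>n. m n (\<lambda>_. h)) sums F (y + h)"
proof -
 obtain m C r K where "\<forall>n. sym_multilinear n (C n) (m n)" "0 < r" "\<forall>n. C n * r ^ n \<le> K"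
  "\<forall>h. norm h < r --> (\<lambda>n. m n (\<lambda>_. h)) sums F (y + h)"
  using assms unfolding analytic_map_at_def by (elim exE conjE) (rule that; (assumption | blast))
 then show thesis by (intro that[of C m r K]) (auto intro: sym_multilinear_imp_bd)
qed

lemma series_derivative_bound:
 fixes F :: "'a::real_normed_vector \<Rightarrow> 'b::banach"
 assumes m: "\<And>n. multilinear_bd n (C n) (m n)" and r: "0 < r" and K: "\<And>n. C n * r ^ n \<le> K"
  and F: "\<And>h. norm h < r ==> (\<lambda>n. m n (\<lambda>_. h)) sums F (y + h)"
 obtains \<rho> D M where "0 < \<rho>" "\<forall>x. norm x < \<rho> --> ((\<lambda>x. F (y + x)) has_derivative D x) (at x)"
  "\<forall>x h. norm x < \<rho> --> norm (D x h - m 1 (\<lambda>_. h)) \<le> M * norm x * norm h"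
proof -
 obtain G D M where G: "\<And>x. norm x < r / 4 ==> (\<lambda>n. m n (\<lambda>_. x)) sums G x"
  "\<And>x. norm x < r / 4 ==> (G has_derivative D x) (at x)"
  "\<And>x h. norm x < r / 4 ==> norm (D x h - m 1 (\<lambda>_. h)) \<le> M * norm x * norm h"
  by (rule multilinear_series_derivative[OF m r K]) (rule that; (assumption | blast))
 have eq: "G x = F (y + x)" if "norm x < r / 4" for x
  using sums_unique2[OF G(1)[OF that] F[of x]] that r by simp
 show thesis
 proof (rule that[of "r / 4" D M])
  show "\<forall>x. norm x < r / 4 --> ((\<lambda>x. F (y + x)) has_derivative D x) (at x)"
  proof (intro allI impI)
   fix x :: 'a assume x: "norm x < r / 4"
   show "((\<lambda>x. F (y + x)) has_derivative D x) (at x)"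
    by (rule has_derivative_transform_within_open[OF G(2)[OF x] open_ball[of 0 "r / 4"]]) (use x eq in auto)
  qed
 qed (use r G(3) in auto)
qed

lemma series_derivative:
 fixes F :: "'a::real_normed_vector \<Rightarrow> 'b::banach"
 assumes m: "\<And>n. multilinear_bd n (C n) (m n)" and r: "0 < r" and K: "\<And>n. C n * r ^ n \<le> K"
  and F: "\<And>h. norm h < r ==> (\<lambda>n. m n (\<lambda>_. h)) sums F (y + h)"
 shows "(F has_derivative (\<lambda>h. m 1 (\<lambda>_. h))) (at y)"
proof -
 obtain \<rho> D M where D: "0 < \<rho>" "\<forall>x. norm x < \<rho> --> ((\<lambda>x. F (y + x)) has_derivative D x) (at x)"
  "\<forall>x h. norm x < \<rho> --> norm (D x h - m 1 (\<lambda>_. h)) \<le> M * norm x * norm h"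
  by (rule series_derivative_bound[OF m r K F])
 have "D 0 h = m 1 (\<lambda>_. h)" for h using D(1) D(3)[rule_format, of 0 h] by simp
 then have "D 0 = (\<lambda>h. m 1 (\<lambda>_. h))" by (rule ext)
 then have 1: "((\<lambda>x. F (y + x)) has_derivative (\<lambda>h. m 1 (\<lambda>_. h))) (at (y - y))" using D(1) D(2)[rule_format, of 0] by simp
 have 2: "((\<lambda>z. z - y) has_derivative (\<lambda>h. h)) (at y)" by (auto intro!: derivative_eq_intros)
 show ?thesis using has_derivative_compose[OF 2 1] by simp
qed

lemma analytic_map_at_continuous:
 fixes F :: "'a::real_normed_vector \<Rightarrow> 'b::banach"
 assumes "analytic_map_at F y"
 shows "isCont F y"
proof -
 obtain m C r K where m: "\<And>n. multilinear_bd n (C n) (m n)" and r: "0 < r" and K: "\<And>n. C n * r ^ n \<le> K"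
  and F: "\<And>h. norm h < r ==> (\<lambda>n. m n (\<lambda>_. h)) sums F (y + h)"
  by (rule analytic_map_at_series[OF assms]) (rule that; (assumption | blast))
 have "(F has_derivative (\<lambda>h. m 1 (\<lambda>_. h))) (at y)" by (rule series_derivative[OF m r K F])
 then show ?thesis by (rule has_derivative_continuous)
qed

lemma Du_eq:
 assumes "(F has_derivative T) (at (l, u))"
 shows "Du F l u = (\<lambda>w. T (0, w))"
proof -
 have "((\<lambda>w. (l, w)) has_derivative (\<lambda>w. (0, w))) (at u)"
  by (intro has_derivative_Pair has_derivative_const has_derivative_ident)
 from has_derivative_compose[OF this assms] have "((\<lambda>w. F (l, w)) has_derivative (\<lambda>w. T (0, w))) (at u)" .
 then show ?thesis unfolding Du_def by (rule frechet_derivative_at[symmetric])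
qed

text \<open>Applying \<open>Q\<close> and adding a zero in the parameter slot turns \<open>F\<close>
  into a self-map of the product space with the same zeros. Its linear part is the identity minus a
  map of finite rank, to which the parameter contributes one more dimension.\<close>

lemma fredholm_zero_set_arcs:
 fixes F :: "real \<times> 'u::banach \<Rightarrow> 'v::banach"
 assumes an: "analytic_map_at F y" and phi: "Du F (fst y) (snd y) \<in> Phi0" and Fy: "F y = 0" and \<epsilon>: "0 < \<epsilon>"
 shows "\<exists>\<delta>>0. \<forall>x\<in>zero_set F. x \<noteq> y --> dist x y < \<delta> -->
   (\<exists>p \<phi>. path p \<and> path_image p \<subseteq> zero_set F \<inter> ball y \<epsilon> - {y} \<and> pathstart p = x \<and> pathfinish p = \<phi> (1::real) \<and>
     continuous_on {-1..1} \<phi> \<and> inj_on \<phi> {-1..1} \<and> \<phi> 0 = y \<and> \<phi> ` {-1..1} \<subseteq> zero_set F \<inter> ball y \<epsilon>)"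
proof -
 obtain m C r K where m: "\<And>n. multilinear_bd n (C n) (m n)" and r: "0 < r" and K: "\<And>n. C n * r ^ n \<le> K"
  and F: "\<And>h. norm h < r ==> (\<lambda>n. m n (\<lambda>_. h)) sums F (y + h)"
  by (rule analytic_map_at_series[OF an]) (rule that; (assumption | blast))
 have der: "(F has_derivative (\<lambda>h. m 1 (\<lambda>_. h))) (at y)" by (rule series_derivative[OF m r K F])
 define T where "T h = m 1 (\<lambda>_. h)" for h
 have linT: "linear T" using has_derivative_linear[OF der] unfolding T_def .
 have Du: "Du F (fst y) (snd y) = (\<lambda>w. T (0, w))" unfolding T_def by (rule Du_eq) (use der in simp)
 obtain Q and n :: nat and l e where Q: "bounded_linear Q" "inj Q" and l: "\<And>i. i < n ==> bounded_linear (l i)"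
  and QT: "\<And>u. Q (T (0, u)) = u - (\<Sum>i<n. l i u *\<^sub>R e i)"
 proof (rule fredholm_index_zero_perturbation[OF phi[unfolded Du]])
  fix Q and n :: nat and l e
  assume a: "bounded_linear Q" "inj Q" "\<And>i. i < n ==> bounded_linear (l i)"
   "\<And>u. Q (T (0, u)) = u - (\<Sum>i<n. l i u *\<^sub>R e i)"
  show thesis by (rule that[of Q n l e]) (rule a(1), rule a(2), erule a(3), rule a(4))
 qed
 interpret Q: bounded_linear Q by (rule Q(1))
 obtain b where b: "0 < b" "\<And>v. norm (Q v) \<le> norm v * b" using Q.pos_bounded by blast
 define m' where "m' j v = (0::real, Q (m j v))" for j v
 have m': "multilinear_bd j (b * C j) (m' j)" for j
  unfolding multilinear_bd_def m'_def
 proof (intro conjI allI impI)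
  show "(0::real, Q (m j v)) = (0, Q (m j w))" if "\<forall>i<j. v i = w i" for v w
   using multilinear_bdD(1)[OF m, of j v w] that by simp
  show "linear (\<lambda>x. (0::real, Q (m j (v(i := x)))))" if "i < j" for v i
  proof -
   have "linear (\<lambda>x. m j (v(i := x)))" by (rule multilinear_bdD(2)[OF m that])
   from linear_compose[OF this Q.linear] have "linear (\<lambda>x. Q (m j (v(i := x))))" by (simp only: o_def)
   then show ?thesis by (simp add: linear_iff)
  qed
  fix v
  have "norm (Q (m j v)) \<le> norm (m j v) * b" by (rule b(2))
  also have "\<dots> \<le> (C j * (\<Prod>i<j. norm (v i))) * b" using b(1) multilinear_bdD(3)[OF m, of j v] by (intro mult_right_mono) auto
  finally show "norm (0::real, Q (m j v)) \<le> b * C j * (\<Prod>i<j. norm (v i))" by (simp add: norm_Pair mult_ac)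
 qed
 have K': "b * C j * r ^ j \<le> b * K" for j using mult_left_mono[OF K[of j], of b] b(1) by (simp add: mult_ac)
 define f where "f h = (0::real, Q (F (y + h)))" for h
 have f0: "f h = 0 \<longleftrightarrow> F (y + h) = 0" for h
  using Q(2) Q.zero by (auto simp: f_def zero_prod_def inj_def)
 have fs: "(\<lambda>j. m' j (\<lambda>_. h)) sums f h" if "norm h < r" for h
  unfolding m'_def f_def
  by (rule bounded_linear.sums[OF bounded_linear_Pair[OF bounded_linear_zero Q(1)] F[OF that]])
 define c where "c i h = (if i = 0 then fst h else l (i - 1) (snd h))" for i and h :: "real \<times> 'u"
 \<comment> \<open>The entry at index 0 cancels the parameter component of the identity and accounts
   for the derivative of \<open>F\<close> in the parameter.\<close>
 define e' where "e' i = (if i = 0 then (1::real, - Q (T (1, 0))) else (0, e (i - 1)))" for i :: nat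
 have c: "bounded_linear (c i)" if "i < Suc n" for i
 proof (cases i)
  case 0
  then have "c i = fst" by (simp add: c_def fun_eq_iff)
  then show ?thesis by (simp add: bounded_linear_fst)
 next
  case (Suc k)
  then have "c i = (\<lambda>h. l k (snd h))" by (simp add: c_def fun_eq_iff)
  then show ?thesis using bounded_linear_compose[OF l[of k] bounded_linear_snd] that Suc by simp
 qed
 have m1: "m' 1 (\<lambda>_. h) = h - (\<Sum>i<Suc n. c i h *\<^sub>R e' i)" for h
 proof (cases h)
  case (Pair a w)
  have "h = a *\<^sub>R (1, 0) + (0, w)" using Pair by simp
  then have "T h = T (a *\<^sub>R (1, 0) + (0, w))" by (rule arg_cong)
  also have "\<dots> = a *\<^sub>R T (1, 0) + T (0, w)" by (simp only: linear_add[OF linT] linear_scale[OF linT])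
  finally have "Q (T h) = a *\<^sub>R Q (T (1, 0)) + (w - (\<Sum>i<n. l i w *\<^sub>R e i))" by (simp add: Q.add Q.scaleR QT)
  moreover have "(\<Sum>i<Suc n. c i h *\<^sub>R e' i) = a *\<^sub>R (1, - Q (T (1, 0))) + (\<Sum>i<n. l i w *\<^sub>R (0, e i))"
   unfolding sum.lessThan_Suc_shift using Pair by (simp add: c_def e'_def)
  moreover have "(\<Sum>i<n. l i w *\<^sub>R (0::real, e i)) = (0, \<Sum>i<n. l i w *\<^sub>R e i)"
   by (simp add: prod_eq_iff fst_sum snd_sum)
  moreover have "m' 1 (\<lambda>_. h) = (0, Q (T h))" by (simp only: m'_def T_def)
  ultimately show ?thesis using Pair by (simp add: algebra_simps)
 qed
 have "\<exists>\<delta>>0. \<forall>x. f x = 0 --> x \<noteq> 0 --> norm x < \<delta> --> (\<exists>p \<phi>. path p \<and> path_image p \<subseteq> {x. f x = 0} \<inter> ball 0 \<epsilon> - {0} \<and>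
   pathstart p = x \<and> pathfinish p = \<phi> (1::real) \<and> continuous_on {-1..1} \<phi> \<and> inj_on \<phi> {-1..1} \<and> \<phi> 0 = 0 \<and>
   \<phi> ` {-1..1} \<subseteq> {x. f x = 0} \<inter> ball 0 \<epsilon>)"
  by (rule finite_rank_defect_arcs[where f = f and k = "Suc n" and c = c and e = e', OF m' r K'])
   (erule fs, simp add: f0 Fy, erule c, rule m1, rule \<epsilon>)
 then obtain \<delta> where \<delta>: "0 < \<delta>" "\<forall>x. f x = 0 --> x \<noteq> 0 --> norm x < \<delta> --> (\<exists>p \<phi>. path p \<and> path_image p \<subseteq> {x. f x = 0} \<inter> ball 0 \<epsilon> - {0} \<and>
   pathstart p = x \<and> pathfinish p = \<phi> (1::real) \<and> continuous_on {-1..1} \<phi> \<and> inj_on \<phi> {-1..1} \<and> \<phi> 0 = 0 \<and>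
   \<phi> ` {-1..1} \<subseteq> {x. f x = 0} \<inter> ball 0 \<epsilon>)"
  by (elim exE conjE) (rule that; assumption)
 show ?thesis
 proof (intro exI[of _ \<delta>] conjI \<delta>(1) ballI impI)
  fix x assume x: "x \<in> zero_set F" "x \<noteq> y" "dist x y < \<delta>"
  have d: "f (x - y) = 0" "x - y \<noteq> 0" "norm (x - y) < \<delta>" using x f0[of "x - y"] by (auto simp: zero_set_def dist_norm)
  obtain p \<phi> where p: "path p" "path_image p \<subseteq> {x. f x = 0} \<inter> ball 0 \<epsilon> - {0}" "pathstart p = x - y" "pathfinish p = \<phi> (1::real)"
   and \<phi>: "continuous_on {-1..1} \<phi>" "inj_on \<phi> {-1..1}" "\<phi> 0 = 0" "\<phi> ` {-1..1} \<subseteq> {x. f x = 0} \<inter> ball 0 \<epsilon>"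
   using \<delta>(2)[rule_format, OF d] by (elim exE conjE) (rule that; assumption)
  have shift: "y + z \<in> zero_set F \<inter> ball y \<epsilon>" if "z \<in> {x. f x = 0} \<inter> ball 0 \<epsilon>" for z
   using that f0[of z] by (simp add: zero_set_def dist_norm)
  show "\<exists>p \<phi>. path p \<and> path_image p \<subseteq> zero_set F \<inter> ball y \<epsilon> - {y} \<and> pathstart p = x \<and> pathfinish p = \<phi> (1::real) \<and>
     continuous_on {-1..1} \<phi> \<and> inj_on \<phi> {-1..1} \<and> \<phi> 0 = y \<and> \<phi> ` {-1..1} \<subseteq> zero_set F \<inter> ball y \<epsilon>"
  proof (rule exI[of _ "\<lambda>t. y + p t"], rule exI[of _ "\<lambda>t. y + \<phi> t"], intro conjI)
   show "path (\<lambda>t. y + p t)" using p(1) unfolding path_def by (intro continuous_intros)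
   show "path_image (\<lambda>t. y + p t) \<subseteq> zero_set F \<inter> ball y \<epsilon> - {y}"
   proof
    fix z assume "z \<in> path_image (\<lambda>t. y + p t)"
    then obtain t where t: "t \<in> {0..1}" "z = y + p t" by (auto simp: path_image_def)
    have "p t \<in> path_image p" using t(1) by (simp add: path_image_def)
    then have "p t \<in> {x. f x = 0} \<inter> ball 0 \<epsilon>" "p t \<noteq> 0" using p(2) by blast+
    then show "z \<in> zero_set F \<inter> ball y \<epsilon> - {y}" using shift[of "p t"] t(2) by simp
   qed
   show "pathstart (\<lambda>t. y + p t) = x" "pathfinish (\<lambda>t. y + p t) = y + \<phi> 1" using p(3,4) by (simp_all add: pathstart_def pathfinish_def)
   show "continuous_on {-1..1} (\<lambda>t. y + \<phi> t)" by (intro continuous_intros \<phi>(1))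
   show "inj_on (\<lambda>t. y + \<phi> t) {-1..1}" using \<phi>(2) by (simp add: inj_on_def)
   show "y + \<phi> 0 = y" using \<phi>(3) by simp
   show "(\<lambda>t. y + \<phi> t) ` {-1..1} \<subseteq> zero_set F \<inter> ball y \<epsilon>"
   proof
    fix z assume "z \<in> (\<lambda>t. y + \<phi> t) ` {-1..1}"
    then obtain t where t: "t \<in> {-1..1}" "z = y + \<phi> t" by auto
    then have "\<phi> t \<in> {x. f x = 0} \<inter> ball 0 \<epsilon>" using \<phi>(4) by blast
    then show "z \<in> zero_set F \<inter> ball y \<epsilon>" using shift t(2) by simp
   qed
  qed
 qed
qed

text \<open>By the mean value inequality the increment of \<open>F\<close> from
  \<open>(a, 0)\<close> to \<open>(a, w)\<close>, relative to the base point, differs from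
  \<open>S w\<close> by a small multiple of \<open>norm w\<close>. Between two zeros this bounds
  \<open>S w\<close>, and invertibility of \<open>S\<close> forces \<open>w = 0\<close>.\<close>

lemma regular_trivial_zero_isolated:
 fixes F :: "real \<times> 'u::banach \<Rightarrow> 'v::banach"
 assumes an: "analytic_map_at F (l0, 0)" and F1: "\<And>l. F (l, 0) = 0" and GL: "Du F l0 0 \<in> GL"
 shows "\<exists>\<delta>>0. \<forall>x. F x = 0 --> dist x (l0, 0) < \<delta> --> snd x = 0"
proof -
 let ?y = "(l0, 0) :: real \<times> 'u"
 obtain m C r K where m: "\<And>n. multilinear_bd n (C n) (m n)" and r: "0 < r" and K: "\<And>n. C n * r ^ n \<le> K"
  and F: "\<And>h. norm h < r ==> (\<lambda>n. m n (\<lambda>_. h)) sums F (?y + h)"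
  by (rule analytic_map_at_series[OF an]) (rule that; (assumption | blast))
 define T where "T h = m 1 (\<lambda>_. h)" for h
 have der: "(F has_derivative T) (at ?y)" unfolding T_def by (rule series_derivative[OF m r K F])
 have blT: "bounded_linear T" by (rule has_derivative_bounded_linear[OF der])
 define S where "S w = T (0, w)" for w
 have "Du F l0 0 = S" unfolding S_def by (rule Du_eq[OF der])
 then have S: "bij S" "bounded_linear (inv_into UNIV S)" using GL by (simp_all add: GL_def)
 obtain b where b: "0 < b" "\<And>v. norm (inv_into UNIV S v) \<le> norm v * b" using bounded_linear.pos_bounded[OF S(2)] by blast
 obtain \<rho> D M where D: "0 < \<rho>" "\<forall>x. norm x < \<rho> --> ((\<lambda>x. F (?y + x)) has_derivative D x) (at x)"
  "\<forall>x h. norm x < \<rho> --> norm (D x h - m 1 (\<lambda>_. h)) \<le> M * norm x * norm h"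
  by (rule series_derivative_bound[OF m r K F])
 define \<delta> where "\<delta> = min \<rho> (1 / (2 * b * (\<bar>M\<bar> + 1)))"
 have \<delta>: "0 < \<delta>" "\<delta> \<le> \<rho>" "(\<bar>M\<bar> + 1) * \<delta> * b \<le> 1 / 2"
 proof -
  show "0 < \<delta>" "\<delta> \<le> \<rho>" using D(1) b(1) by (auto simp: \<delta>_def)
  have "(\<bar>M\<bar> + 1) * \<delta> * b \<le> (\<bar>M\<bar> + 1) * (1 / (2 * b * (\<bar>M\<bar> + 1))) * b"
   using b(1) by (intro mult_right_mono mult_left_mono) (auto simp: \<delta>_def)
  also have "\<dots> = 1 / 2"
  proof -
   have k: "k * (1 / (2 * b * k)) * b = 1 / 2" if "0 < k" for k :: real using that b(1) by (simp add: field_simps)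
   show ?thesis by (rule k) (use abs_ge_zero[of M] in linarith)
  qed
  finally show "(\<bar>M\<bar> + 1) * \<delta> * b \<le> 1 / 2" .
 qed
 have "snd x = 0" if x: "F x = 0" "dist x ?y < \<delta>" for x
 proof -
  define a w where "a = fst x - l0" and "w = snd x"
  have xy: "x = ?y + (a, w)" by (simp add: a_def w_def prod_eq_iff)
  have n1: "norm (a, w) < \<delta>" using x(2) xy by (simp add: dist_norm)
  have "norm a < \<delta>" by (rule le_less_trans[OF norm_fst_le n1])
  then have n2: "norm (a, 0::'u) < \<delta>" by (simp add: norm_Pair)
  have "norm ((F (?y + (a, w)) - T (a, w)) - (F (?y + (a, 0)) - T (a, 0))) \<le> (\<bar>M\<bar> + 1) * \<delta> * norm ((a, w) - (a, 0))"
  proof (rule differentiable_bound[of "ball 0 \<delta>" "\<lambda>x. F (?y + x) - T x" "\<lambda>x h. D x h - T h"])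
   fix z :: "real \<times> 'u" assume "z \<in> ball 0 \<delta>"
   then have z: "norm z < \<delta>" "norm z < \<rho>" using \<delta>(2) by auto
   show "((\<lambda>x. F (?y + x) - T x) has_derivative (\<lambda>h. D z h - T h)) (at z within ball 0 \<delta>)"
    by (rule has_derivative_diff[OF has_derivative_at_withinI bounded_linear_imp_has_derivative[OF blT]])
     (use D(2) z(2) in blast)
   have "norm (D z h - T h) \<le> (\<bar>M\<bar> + 1) * \<delta> * norm h" for h
   proof -
    have "norm (D z h - T h) \<le> M * norm z * norm h" using D(3) z(2) unfolding T_def by blast
    also have "\<dots> \<le> (\<bar>M\<bar> + 1) * \<delta> * norm h" using z(1) by (intro mult_right_mono mult_mono) auto
    finally show ?thesis .
   qed
   then show "onorm (\<lambda>h. D z h - T h) \<le> (\<bar>M\<bar> + 1) * \<delta>" using \<delta>(1) by (intro onorm_bound) auto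
  qed (use n1 n2 in auto)
  moreover have "F (?y + (a, w)) = 0" using x(1) xy by simp
  moreover have "F (?y + (a, 0)) = 0" using F1 by simp
  moreover have "T (a, w) - T (a, 0) = S w"
   using linear_diff[OF bounded_linear.linear[OF blT], of "(a, w)" "(a, 0)"] by (simp add: S_def)
  ultimately have "norm (S w) \<le> (\<bar>M\<bar> + 1) * \<delta> * norm w"
   by (simp add: norm_Pair norm_minus_commute)
  then have "norm (S w) * b \<le> (\<bar>M\<bar> + 1) * \<delta> * norm w * b" using b(1) by (intro mult_right_mono) auto
  moreover have "(\<bar>M\<bar> + 1) * \<delta> * norm w * b = (\<bar>M\<bar> + 1) * \<delta> * b * norm w" by (simp only: mult_ac)
  moreover have "norm w \<le> norm (S w) * b" using b(2)[of "S w"] S(1) by (simp add: bij_is_inj)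
  moreover have "(\<bar>M\<bar> + 1) * \<delta> * b * norm w \<le> 1 / 2 * norm w" using \<delta>(3) by (intro mult_right_mono) auto
  ultimately have "norm w \<le> 1 / 2 * norm w" by linarith
  then have "w = 0" using norm_ge_zero[of w] by simp
  then show ?thesis by (simp only: w_def)
 qed
 then show ?thesis using \<delta>(1) by blast
qed

text \<open>Instantiates \<open>arc_extension\<close> with a half of the trivial line as second
  branch. Near the origin the curve avoids the trivial line or stays in it; in the latter case it
  keeps to one sign of the parameter, and the opposite half is free.\<close>

lemma analytic_curve_extension:
 fixes F :: "real \<times> 'u::banach \<Rightarrow> 'v::banach"
 assumes analytic: "analytic_map_on F UNIV" and F1: "\<And>l. F (l, 0) = 0" and F2: "\<And>l u. Du F l u \<in> Phi0"
  and iso: "0 isolated_in spectrum_family (linearization F)" and F4: "proper_on_closed_bounded F"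
  and curve: "analytic_curve_from_origin F \<gamma>"
 shows "\<exists>\<Gamma>. global_extension F \<gamma> \<Gamma>"
proof -
 have an: "analytic_map_at F y" for y using analytic unfolding analytic_map_on_def by blast
 have comp: "compact (zero_set F \<inter> cball 0 R)" for R
 proof -
  have "compact {x \<in> cball 0 R. F x \<in> {0}}"
   using F4 unfolding proper_on_closed_bounded_def by (elim allE[of _ "cball 0 R"] allE[of _ "{0}"]) auto
  moreover have "zero_set F \<inter> cball 0 R = {x \<in> cball 0 R. F x \<in> {0}}" by (auto simp: zero_set_def)
  ultimately show ?thesis by simp
 qed
 obtain \<epsilon> where \<epsilon>: "0 < \<epsilon>" "\<And>l. l \<noteq> 0 ==> \<bar>l\<bar> < \<epsilon> ==> Du F l 0 \<in> GL"
 proof -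
  obtain W where W: "open W" "W \<inter> spectrum_family (linearization F) = {0}" using iso unfolding isolated_in_def by blast
  then obtain e where e: "0 < e" "ball 0 e \<subseteq> W" using open_contains_ball by blast
  have gl: "Du F l 0 \<in> GL" if "l \<noteq> 0" "\<bar>l\<bar> < e" for l
  proof (rule ccontr)
   assume "Du F l 0 \<notin> GL"
   then have "l \<in> W \<inter> spectrum_family (linearization F)"
    using e(2) that(2) by (auto simp: spectrum_family_def linearization_def)
   then show False using W(2) that(1) by simp
  qed
  show thesis by (rule that[OF e(1)]) (rule gl)
 qed
 have \<gamma>: "\<And>t. 0 < t ==> t < 1 ==> isCont \<gamma> t" "inj_on \<gamma> {0<..<1}" "\<And>t. 0 < t ==> t < 1 ==> F (\<gamma> t) = 0"
  "(\<gamma> \<longlongrightarrow> (0, 0)) (at_right 0)"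
 proof -
  show "inj_on \<gamma> {0<..<1}" "(\<gamma> \<longlongrightarrow> (0, 0)) (at_right 0)" using curve unfolding analytic_curve_from_origin_def by blast+
  fix t :: real assume "0 < t" "t < 1"
  then have t: "t \<in> {0<..<1}" by simp
  have "analytic_map_at \<gamma> t" using curve t unfolding analytic_curve_from_origin_def analytic_map_on_def by blast
  then show "isCont \<gamma> t" by (rule analytic_map_at_continuous)
  have "\<gamma> t \<in> zero_set F" using curve t unfolding analytic_curve_from_origin_def by blast
  then show "F (\<gamma> t) = 0" by (simp add: zero_set_def)
 qed
 obtain d where d: "0 < d" "\<And>t. 0 < t ==> t < d ==> dist (\<gamma> t) (0, 0) < \<epsilon>"
  using tendstoD[OF \<gamma>(4) \<epsilon>(1)] unfolding eventually_at_right_field by blast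
 \<comment> \<open>By injectivity the curve passes through \<open>(0, 0)\<close> at most once, so it
   avoids that point on some initial interval.\<close>
 obtain t0 where t0: "0 < t0" "\<And>t. 0 < t ==> t < 1 ==> t < t0 ==> \<gamma> t \<noteq> (0, 0)"
 proof (cases "\<exists>s. 0 < s \<and> s < 1 \<and> \<gamma> s = (0, 0)")
  case True
  then obtain s where s: "0 < s" "s < 1" "\<gamma> s = (0, 0)" by blast
  have nz: "\<gamma> t \<noteq> (0, 0)" if t: "0 < t" "t < 1" "t < s" for t
  proof
   assume "\<gamma> t = (0, 0)"
   then have "t = s" using t s by (intro inj_onD[OF \<gamma>(2)]) auto
   then show False using t(3) by simp
  qed
  show ?thesis by (rule that[OF s(1)]) (rule nz)
 next
  case False
  show ?thesis by (rule that[of 1]) (use False in auto)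
 qed
 define c where "c = min (1 / 2) (min (d / 2) (t0 / 2))"
 have c: "0 < c" "c < 1" "c < d" "c < t0" using d(1) t0(1) by (auto simp: c_def)
 have \<gamma>c: "\<gamma> t \<noteq> (0, 0)" "dist (\<gamma> t) (0, 0) < \<epsilon>" if "0 < t" "t \<le> c" for t using d(2)[of t] t0(2)[of t] that c by auto
 have cont\<gamma>: "continuous_on {0<..c} \<gamma>" by (rule continuous_at_imp_continuous_on) (use \<gamma>(1) c in auto)
 \<comment> \<open>Closed in the interval by continuity, and open because zeros near
   \<open>(l, 0)\<close> with small \<open>l \<noteq> 0\<close> are trivial; so it is empty or
   everything.\<close>
 define J where "J = {t \<in> {0<..c}. snd (\<gamma> t) = 0}"
 have "J = {} \<or> J = {0<..c}"
 proof -
  have "closedin (top_of_set {0<..c}) J" unfolding J_def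
   by (rule continuous_closedin_preimage_constant) (intro continuous_intros cont\<gamma>)
  moreover have "openin (top_of_set {0<..c}) J" unfolding openin_euclidean_subtopology_iff
  proof (intro conjI ballI)
   show "J \<subseteq> {0<..c}" by (auto simp: J_def)
   fix t assume t: "t \<in> J"
   then have t': "0 < t" "t \<le> c" "\<gamma> t = (fst (\<gamma> t), 0)" by (auto simp: J_def prod_eq_iff)
   have "fst (\<gamma> t) \<noteq> 0" using \<gamma>c(1)[OF t'(1,2)] t'(3) by metis
   moreover have "\<bar>fst (\<gamma> t)\<bar> < \<epsilon>" using \<gamma>c(2)[OF t'(1,2)] dist_fst_le[of "\<gamma> t" "(0, 0)"] by (simp add: dist_real_def)
   ultimately have "Du F (fst (\<gamma> t)) 0 \<in> GL" by (rule \<epsilon>(2))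
   then obtain \<delta> where \<delta>: "0 < \<delta>" "\<forall>x. F x = 0 --> dist x (fst (\<gamma> t), 0) < \<delta> --> snd x = 0"
    using regular_trivial_zero_isolated[OF an F1] by blast
   obtain e where e: "0 < e" "\<forall>s. dist s t < e --> dist (\<gamma> s) (\<gamma> t) < \<delta>"
    using \<gamma>(1)[of t] t' c \<delta>(1) unfolding continuous_at_eps_delta by auto
   have "s \<in> J" if s: "s \<in> {0<..c}" "dist s t < e" for s
   proof -
    have "dist (\<gamma> s) (fst (\<gamma> t), 0) < \<delta>" using e(2)[rule_format, OF s(2)] by (subst t'(3)[symmetric])
    moreover have "F (\<gamma> s) = 0" using s(1) c by (intro \<gamma>(3)) auto
    ultimately have "snd (\<gamma> s) = 0" using \<delta>(2)[rule_format, of "\<gamma> s"] by blast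
    then show ?thesis using s(1) by (simp add: J_def)
   qed
   then show "\<exists>e>0. \<forall>x'\<in>{0<..c}. dist x' t < e --> x' \<in> J" using e(1) by blast
  qed
  ultimately show ?thesis using connected_clopen[of "{0<..c}"] by auto
 qed
 \<comment> \<open>Off the trivial line the positive half serves; on it the direction is opposite to
   the sign of the parameter along the curve.\<close>
 then obtain \<sigma> :: real where \<sigma>: "\<sigma> \<noteq> 0" "\<And>s t. 0 < s ==> 0 < t ==> t \<le> c ==> (\<sigma> * s, 0) \<noteq> \<gamma> t"
 proof
  assume J: "J = {}"
  have ne: "(1 * s, 0) \<noteq> \<gamma> t" if t: "0 < t" "t \<le> c" for s t
  proof
   assume "(1 * s, 0) = \<gamma> t"
   then have "snd (\<gamma> t) = 0" by (metis snd_conv)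
   then have "t \<in> J" using t by (simp add: J_def)
   then show False unfolding J by simp
  qed
  show ?thesis by (rule that[of 1], simp) (rule ne)
 next
  assume J: "J = {0<..c}"
  have nz: "fst (\<gamma> t) \<noteq> 0" if "0 < t" "t \<le> c" for t
  proof
   assume "fst (\<gamma> t) = 0"
   moreover have "t \<in> J" unfolding J using that by simp
   then have "snd (\<gamma> t) = 0" by (simp add: J_def)
   ultimately show False using \<gamma>c(1)[OF that] by (simp add: prod_eq_iff)
  qed
  have conn: "connected ((\<lambda>t. fst (\<gamma> t)) ` {0<..c})"
   by (rule connected_continuous_image) (auto intro!: continuous_intros cont\<gamma>)
  define u where "u = fst (\<gamma> c)"
  have same: "0 < u * fst (\<gamma> t)" if t: "0 < t" "t \<le> c" for t
  proof (rule ccontr)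
   assume "\<not> ?thesis"
   then have "u * fst (\<gamma> t) < 0" using nz[OF t] nz[of c] c by (simp add: u_def not_less order_le_less)
   then have "(u \<le> 0 \<and> 0 \<le> fst (\<gamma> t)) \<or> (fst (\<gamma> t) \<le> 0 \<and> 0 \<le> u)" by (auto simp: mult_less_0_iff)
   moreover have I: "fst (\<gamma> t) \<in> (\<lambda>t. fst (\<gamma> t)) ` {0<..c}" "u \<in> (\<lambda>t. fst (\<gamma> t)) ` {0<..c}"
    using t c by (auto simp: u_def)
   ultimately have "0 \<in> (\<lambda>t. fst (\<gamma> t)) ` {0<..c}"
    using connectedD_interval[OF conn I(1,2), of 0] connectedD_interval[OF conn I(2,1), of 0] by blast
   then show False using nz by auto
  qed
  have ne: "(- u * s, 0) \<noteq> \<gamma> t" if "0 < s" "0 < t" "t \<le> c" for s t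
  proof
   assume "(- u * s, 0) = \<gamma> t"
   then have "fst (\<gamma> t) = - u * s" by (metis fst_conv)
   then have "0 < u * (- u * s)" using same[OF that(2,3)] by simp
   moreover have "0 \<le> u * u * s" using that(1) by simp
   moreover have "u * (- u * s) = - (u * u * s)" by simp
   ultimately show False by linarith
  qed
  have "- u \<noteq> 0" using nz[of c] c by (simp add: u_def)
  then show ?thesis by (rule that[of "- u"]) (rule ne)
 qed
 \<comment> \<open>The value of \<open>\<gamma>\<close> at 0 is unspecified; it is replaced by the
   limit to obtain an arc on a closed interval.\<close>
 define g where "g t = (if t \<le> 0 then (0, 0) else \<gamma> t)" for t
 have g0: "g 0 = (0, 0)" and gp: "\<And>t. 0 < t ==> g t = \<gamma> t" by (simp_all add: g_def)
 interpret E: arc_extension "zero_set F" g "\<lambda>s. (\<sigma> * s, 0)" c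
 proof
  show "compact (zero_set F \<inter> cball 0 R)" for R by (rule comp)
  show "\<exists>\<delta>>0. \<forall>x\<in>zero_set F. x \<noteq> y --> dist x y < \<delta> -->
   (\<exists>p \<phi>. path p \<and> path_image p \<subseteq> zero_set F \<inter> ball y \<epsilon> - {y} \<and> pathstart p = x \<and> pathfinish p = \<phi> (1::real) \<and>
     continuous_on {-1..1} \<phi> \<and> inj_on \<phi> {-1..1} \<and> \<phi> 0 = y \<and> \<phi> ` {-1..1} \<subseteq> zero_set F \<inter> ball y \<epsilon>)"
   if "y \<in> zero_set F" "0 < \<epsilon>" for y \<epsilon>
   by (rule fredholm_zero_set_arcs[OF an F2 _ that(2)]) (use that(1) in \<open>simp add: zero_set_def\<close>)
  show "0 < c" by (rule c(1))
  show "continuous_on {0..c} g" unfolding continuous_on_eq_continuous_within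
  proof
   fix t assume t: "t \<in> {0..c}"
   show "continuous (at t within {0..c}) g"
   proof (cases "t = 0")
    case True
    have "(g \<longlongrightarrow> (0, 0)) (at_right 0)"
     by (rule Lim_transform_eventually[OF \<gamma>(4)]) (auto simp: eventually_at_filter g_def)
    moreover have "at 0 within {0..c} = at_right 0" by (rule at_within_Icc_at_right[OF c(1)])
    ultimately show ?thesis using True g0 by (simp add: continuous_within)
   next
    case False
    then have t': "0 < t" "t < 1" using t c by auto
    have "\<forall>\<^sub>F s in nhds t. g s = \<gamma> s"
     using eventually_nhds_in_open[of "{0<..}" t] t' by (auto elim!: eventually_mono simp: gp)
    then have "isCont g t" using isCont_cong \<gamma>(1)[OF t'] by blast
    then show ?thesis by (rule continuous_at_imp_continuous_at_within)
   qed
  qed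
  show "inj_on g {0..c}"
  proof (rule linorder_inj_onI)
   fix s t assume st: "s < t" "s \<in> {0..c}" "t \<in> {0..c}"
   show "g s \<noteq> g t"
   proof (cases "s = 0")
    case True then show ?thesis using g0 gp[of t] \<gamma>c(1)[of t] st by auto
   next
    case False
    then have "\<gamma> s \<noteq> \<gamma> t" using inj_onD[OF \<gamma>(2), of s t] st c by auto
    then show ?thesis using gp[of s] gp[of t] st False by auto
   qed
  qed auto
  show "g ` {0..c} \<subseteq> zero_set F"
  proof (rule image_subsetI)
   fix t assume "t \<in> {0..c}"
   then show "g t \<in> zero_set F" using \<gamma>(3)[of t] F1[of 0] c by (cases "t = 0") (auto simp: g_def zero_set_def)
  qed
  show "continuous_on {0..} (\<lambda>s. (\<sigma> * s, 0::'u))" by (intro continuous_intros)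
  show "inj_on (\<lambda>s. (\<sigma> * s, 0::'u)) {0..}" using \<sigma>(1) by (auto simp: inj_on_def)
  show "(\<lambda>s. (\<sigma> * s, 0::'u)) ` {0..} \<subseteq> zero_set F" using F1 by (auto simp: zero_set_def)
  show "(\<sigma> * 0, 0) = g 0" using g0 by simp
  show "(\<sigma> * s, 0) \<noteq> g t" if "0 < s" "0 < t" "t \<le> c" for s t using \<sigma>(2)[OF that] gp[OF that(2)] by simp
 qed
 obtain \<Gamma> \<delta> where \<Gamma>: "continuous_on {0..} \<Gamma>" "locally_injective_on \<Gamma> {0..}" "\<Gamma> ` {0..} \<subseteq> zero_set F"
  "0 < \<delta>" "\<delta> \<le> c" "\<forall>t\<in>{0<..<\<delta>}. \<Gamma> t = g t" "filterlim (\<lambda>t. norm (\<Gamma> t)) at_top at_top \<or> (\<exists>T>0. \<Gamma> T = g 0)"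
  using E.good unfolding E.good_def by (elim exE conjE) (rule that; (assumption | blast))
 have "global_extension F \<gamma> \<Gamma>" unfolding global_extension_def
  using \<Gamma> c(2) gp g0 by (intro conjI exI[of _ \<delta>]) auto
 then show ?thesis by blast
qed

theorem theorem7p2:
  fixes F :: "real \<times> 'u::banach \<Rightarrow> 'v::banach" and \<phi>0 :: 'u
  assumes analytic: "analytic_map_on F UNIV"
    and F1: "\<And>l. F (l, 0) = 0"
    and F2: "\<And>l u. Du F l u \<in> Phi0"
    and F3: "0 isolated_in spectrum_family (linearization F)"
      "\<phi>0 \<noteq> 0" "null_space (linearization F 0) = span {\<phi>0}"
    and F4: "proper_on_closed_bounded F"
  shows "(\<forall>\<gamma>. analytic_curve_from_origin F \<gamma> \<and> \<gamma> ` {0<..<1} \<subseteq> zero_set F - trivial_line \<and>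
              \<gamma> ` {0<..<1} \<subseteq> regular_points F \<longrightarrow>
            (\<exists>\<Gamma>. global_extension F \<gamma> \<Gamma>)) \<and>
         (\<forall>Uz d a. weierstrass_polynomial F \<phi>0 Uz d a \<and> weierstrass_irreducible Uz d a \<longrightarrow>
            (\<forall>\<gamma>. analytic_curve_from_origin F \<gamma> \<longrightarrow> (\<exists>\<Gamma>. global_extension F \<gamma> \<Gamma>)))"
proof -
  have "\<exists>\<Gamma>. global_extension F \<gamma> \<Gamma>" if "analytic_curve_from_origin F \<gamma>" for \<gamma>
    by (rule analytic_curve_extension[OF analytic F1 F2 F3(1) F4 that])
  then show ?thesis by blast
qed

end
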